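(* Let $Q$ be a finite acyclic quiver, let $X$ and $S$ be finite-dimensional representations of $Q$ over an algebraically closed field $K$, and let $0\neq\xi\in\mathrm{Ext}^1_Q(S,X)$ be a generating extension. Then for all dimension vectors $\mathbf{f},\mathbf{g}$ $$\mathrm{Im}(\Psi^\xi_{\mathbf{f},\mathbf{g}})=\bigl(\mathrm{Gr}_{\mathbf{f}}(X)\times\mathrm{Gr}_{\mathbf{g}}(S)\bigr)\setminus\bigl(\mathrm{Gr}_{\mathbf{f}}(X_S)\times\mathrm{Gr}_{\mathbf{g}-\mathbf{dim}\,S^X}(S/S^X)\bigr)$$ and $\Psi^\xi_{\mathbf{f},\mathbf{g}}:\mathcal{S}^\xi_{\mathbf{f},\mathbf{g}}\to\mathrm{Im}(\Psi^\xi_{\mathbf{f},\mathbf{g}})$ is a Zariski-locally trivial affine bundle of rank $\langle\mathbf{g},\mathbf{dim}\,X-\mathbf{f}\rangle$.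
   Context: $[A,B]^1:=\dim\mathrm{Ext}^1_Q(A,B)$ and $\langle\mathbf{a},\mathbf{b}\rangle=\sum_ia_ib_i-\sum_{\alpha:i\to j}a_ib_j$ is the Euler form. $\mathrm{Gr}_{\mathbf{e}}(M)$ is the projective variety of subrepresentations of $M$ of dimension vector $\mathbf{e}$. An extension $\xi\in\mathrm{Ext}^1_Q(S,X)$ is generating if it generates the vector space $\mathrm{Ext}^1_Q(S,X)$; a non-zero generating extension exists only if $[S,X]^1=1$. In that case $X_S$ denotes the largest subrepresentation $N\subseteq X$ with $[S,X/N]^1=1$ and $S^X$ the smallest subrepresentation $N\subseteq S$ with $[N,X]^1=1$; both are well defined. $\mathrm{Gr}_{\mathbf{g}-\mathbf{dim}S^X}(S/S^X)$ is identified with the closed subset of $\mathrm{Gr}_{\mathbf{g}}(S)$ of those $N''$ with $N''\supseteq S^X$ (empty if $\mathbf{g}-\mathbf{dim}\,S^X$ is not non-negative), and $\mathrm{Gr}_{\mathbf{f}}(X_S)$ with the closed subset of $\mathrm{Gr}_{\mathbf{f}}(X)$ of those $N'\subseteq X_S$. Represent $\xi$ by $0\to X\xrightarrow{\iota}Y\xrightarrow{\pi}S\to0$. With $\mathbf{e}=\mathbf{f}+\mathbf{g}$, $\mathcal{S}^\xi_{\mathbf{f},\mathbf{g}}\subseteq\mathrm{Gr}_{\mathbf{e}}(Y)$ is the locally closed subset of all $N$ with $\mathbf{dim}\,\iota^{-1}(N)=\mathbf{f}$ and $\mathbf{dim}\,\pi(N)=\mathbf{g}$, and $\Psi^\xi_{\mathbf{f},\mathbf{g}}:\mathcal{S}^\xi_{\mathbf{f},\mathbf{g}}\to\mathrm{Gr}_{\mathbf{f}}(X)\times\mathrm{Gr}_{\mathbf{g}}(S)$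 is the algebraic map $N\mapsto(\iota^{-1}(N),\pi(N))$. *)

theory Defs
  imports
    "HOL-Analysis.Function_Topology"
    "HOL-Library.Function_Algebras"
    "HOL-Computational_Algebra.Polynomial"
    "Graph_Theory.Digraph"
begin

section \<open>Representations of quivers\<close>

text \<open>
  A quiver is a \<^typ>\<open>('i, 'a) pre_digraph\<close>: loops and multiple arrows are possible, and the arrow
  \<open>\<alpha>\<close> goes from \<open>tail Q \<alpha>\<close> to \<open>head Q \<alpha>\<close>.  The vector spaces of a representation are subspaces
  \<open>spc M i\<close> of one ambient vector space \<^typ>\<open>'v\<close> of arbitrary dimension, with scalar multiplication
  \<open>scl M\<close>.  The values of \<open>act M \<alpha>\<close> outside \<open>spc M (tail Q \<alpha>)\<close>, and of \<open>spc M\<close> and \<open>act M\<close>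
  outside \<open>verts Q\<close> and \<open>arcs Q\<close>, are irrelevant.
\<close>

record ('i, 'a, 'k, 'v) qrep =
  scl :: "'k \<Rightarrow> 'v \<Rightarrow> 'v"
  spc :: "'i \<Rightarrow> 'v set"
  act :: "'a \<Rightarrow> 'v \<Rightarrow> 'v"

definition linear_btw ::
  "('k::field \<Rightarrow> 'v::ab_group_add \<Rightarrow> 'v) \<Rightarrow> ('k \<Rightarrow> 'w::ab_group_add \<Rightarrow> 'w) \<Rightarrow> 'v set \<Rightarrow> 'w set
    \<Rightarrow> ('v \<Rightarrow> 'w) \<Rightarrow> bool" where
  "linear_btw s t V W \<phi> \<longleftrightarrow> \<phi> \<in> V \<rightarrow> W \<and>
     (\<forall>x\<in>V. \<forall>y\<in>V. \<phi> (x + y) = \<phi> x + \<phi> y) \<and> (\<forall>c. \<forall>x\<in>V. \<phi> (s c x) = t c (\<phi> x))"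

definition fd_rep :: "('i, 'a) pre_digraph \<Rightarrow> ('i, 'a, 'k::field, 'v::ab_group_add) qrep \<Rightarrow> bool" where
  "fd_rep Q M \<longleftrightarrow> vector_space (scl M) \<and>
     (\<forall>i\<in>verts Q. \<exists>B. finite B \<and> spc M i = module.span (scl M) B) \<and>
     (\<forall>\<alpha>\<in>arcs Q. linear_btw (scl M) (scl M) (spc M (tail Q \<alpha>)) (spc M (head Q \<alpha>)) (act M \<alpha>))"

definition dimvec :: "('i, 'a, 'k::field, 'v::ab_group_add) qrep \<Rightarrow> ('i \<Rightarrow> 'v set) \<Rightarrow> 'i \<Rightarrow> nat" where
  "dimvec M N i = vector_space.dim (scl M) (N i)"

definition rep_hom :: "('i, 'a) pre_digraph \<Rightarrow> ('i, 'a, 'k::field, 'v::ab_group_add) qrep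
    \<Rightarrow> ('i, 'a, 'k, 'w::ab_group_add) qrep \<Rightarrow> ('i \<Rightarrow> 'v \<Rightarrow> 'w) \<Rightarrow> bool" where
  "rep_hom Q A B \<phi> \<longleftrightarrow>
     (\<forall>i\<in>verts Q. linear_btw (scl A) (scl B) (spc A i) (spc B i) (\<phi> i)) \<and>
     (\<forall>\<alpha>\<in>arcs Q. \<forall>v\<in>spc A (tail Q \<alpha>). \<phi> (head Q \<alpha>) (act A \<alpha> v) = act B \<alpha> (\<phi> (tail Q \<alpha>) v))"

text \<open>
  A subrepresentation is given by its family of subspaces, set to \<open>{}\<close> outside \<open>verts Q\<close> so that
  distinct families are distinct subrepresentations; inclusion is then the pointwise order \<open>\<le>\<close>.
  As a representation in its own right it is \<open>M\<lparr>spc := N\<rparr>\<close>.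
\<close>

definition subrep :: "('i, 'a) pre_digraph \<Rightarrow> ('i, 'a, 'k::field, 'v::ab_group_add) qrep
    \<Rightarrow> ('i \<Rightarrow> 'v set) \<Rightarrow> bool" where
  "subrep Q M N \<longleftrightarrow>
     (\<forall>i\<in>verts Q. N i \<subseteq> spc M i \<and> module.subspace (scl M) (N i)) \<and>
     (\<forall>i. i \<notin> verts Q \<longrightarrow> N i = {}) \<and>
     (\<forall>\<alpha>\<in>arcs Q. act M \<alpha> ` N (tail Q \<alpha>) \<subseteq> N (head Q \<alpha>))"

text \<open>
  The quotient \<open>M/N\<close> is taken up to isomorphism: it is a representation \<open>Z\<close> with an epimorphism
  from \<open>M\<close> with kernel \<open>N\<close>.  Such a \<open>Z\<close> exists over the type of \<open>M\<close> (lemma \<open>is_quot_quot_rep\<close>), for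
  instance on a vector space complement of \<open>N\<close>.
\<close>

definition is_quot :: "('i, 'a) pre_digraph \<Rightarrow> ('i, 'a, 'k::field, 'v::ab_group_add) qrep
    \<Rightarrow> ('i \<Rightarrow> 'v set) \<Rightarrow> ('i, 'a, 'k, 'v) qrep \<Rightarrow> ('i \<Rightarrow> 'v \<Rightarrow> 'v) \<Rightarrow> bool" where
  "is_quot Q M N Z p \<longleftrightarrow> fd_rep Q Z \<and> rep_hom Q M Z p \<and>
     (\<forall>i\<in>verts Q. p i ` spc M i = spc Z i \<and> {x \<in> spc M i. p i x = 0} = N i)"

definition quot_rep :: "('i, 'a) pre_digraph \<Rightarrow> ('i, 'a, 'k::field, 'v::ab_group_add) qrep
    \<Rightarrow> ('i \<Rightarrow> 'v set) \<Rightarrow> ('i, 'a, 'k, 'v) qrep" where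
  "quot_rep Q M N = (SOME Z. \<exists>p. is_quot Q M N Z p)"

definition euler_form :: "('i, 'a) pre_digraph \<Rightarrow> ('i \<Rightarrow> int) \<Rightarrow> ('i \<Rightarrow> int) \<Rightarrow> int" where
  "euler_form Q a b = (\<Sum>i\<in>verts Q. a i * b i) - (\<Sum>\<alpha>\<in>arcs Q. a (tail Q \<alpha>) * b (head Q \<alpha>))"


section \<open>First extension groups\<close>

text \<open>
  \<open>Ext\<^sup>1(A,B)\<close> is the cokernel of
  \<open>\<Oplus>\<^bsub>i\<^esub> Hom(A\<^sub>i,B\<^sub>i) \<longrightarrow> \<Oplus>\<^bsub>\<alpha>\<^esub> Hom(A\<^bsub>tail \<alpha>\<^esub>,B\<^bsub>head \<alpha>\<^esub>)\<close>,
  \<open>\<phi> \<mapsto> (\<phi>\<^bsub>head \<alpha>\<^esub> A\<^sub>\<alpha> - B\<^sub>\<alpha> \<phi>\<^bsub>tail \<alpha>\<^esub>)\<^sub>\<alpha>\<close>, that is, \<open>Hom(-,B)\<close> applied to the standard projective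
  resolution of \<open>A\<close>; its elements are cosets of the image.  Elements of the direct sums vanish outside
  the relevant arrows and vectors.  Lemmas \<open>ses_represents_ex1\<close>, \<open>ses_equiv_iff_represents\<close> and
  \<open>ext1_represented\<close> relate the cosets to equivalence classes of short exact sequences.
\<close>

definition ext_scale :: "('i, 'a, 'k, 'w) qrep \<Rightarrow> 'k \<Rightarrow> ('a \<Rightarrow> 'v \<Rightarrow> 'w) \<Rightarrow> 'a \<Rightarrow> 'v \<Rightarrow> 'w" where
  "ext_scale B c z = (\<lambda>\<alpha> v. scl B c (z \<alpha> v))"

definition ext_cocycles :: "('i, 'a) pre_digraph \<Rightarrow> ('i, 'a, 'k::field, 'v::ab_group_add) qrep
    \<Rightarrow> ('i, 'a, 'k, 'w::ab_group_add) qrep \<Rightarrow> ('a \<Rightarrow> 'v \<Rightarrow> 'w) set" where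
  "ext_cocycles Q A B = {z.
     (\<forall>\<alpha>\<in>arcs Q. linear_btw (scl A) (scl B) (spc A (tail Q \<alpha>)) (spc B (head Q \<alpha>)) (z \<alpha>)) \<and>
     (\<forall>\<alpha> v. \<alpha> \<notin> arcs Q \<or> v \<notin> spc A (tail Q \<alpha>) \<longrightarrow> z \<alpha> v = 0)}"

definition ext_diff :: "('i, 'a) pre_digraph \<Rightarrow> ('i, 'a, 'k::field, 'v::ab_group_add) qrep
    \<Rightarrow> ('i, 'a, 'k, 'w::ab_group_add) qrep \<Rightarrow> ('i \<Rightarrow> 'v \<Rightarrow> 'w) \<Rightarrow> 'a \<Rightarrow> 'v \<Rightarrow> 'w" where
  "ext_diff Q A B \<phi> = (\<lambda>\<alpha> v. if \<alpha> \<in> arcs Q \<and> v \<in> spc A (tail Q \<alpha>)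
     then \<phi> (head Q \<alpha>) (act A \<alpha> v) - act B \<alpha> (\<phi> (tail Q \<alpha>) v) else 0)"

definition ext_coboundaries :: "('i, 'a) pre_digraph \<Rightarrow> ('i, 'a, 'k::field, 'v::ab_group_add) qrep
    \<Rightarrow> ('i, 'a, 'k, 'w::ab_group_add) qrep \<Rightarrow> ('a \<Rightarrow> 'v \<Rightarrow> 'w) set" where
  "ext_coboundaries Q A B = ext_diff Q A B `
     {\<phi>. \<forall>i\<in>verts Q. linear_btw (scl A) (scl B) (spc A i) (spc B i) (\<phi> i)}"

definition ext1 :: "('i, 'a) pre_digraph \<Rightarrow> ('i, 'a, 'k::field, 'v::ab_group_add) qrep
    \<Rightarrow> ('i, 'a, 'k, 'w::ab_group_add) qrep \<Rightarrow> ('a \<Rightarrow> 'v \<Rightarrow> 'w) set set" where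
  "ext1 Q A B = (\<lambda>z. {z + b | b. b \<in> ext_coboundaries Q A B}) ` ext_cocycles Q A B"

definition ext1_scale :: "('i, 'a) pre_digraph \<Rightarrow> ('i, 'a, 'k::field, 'v::ab_group_add) qrep
    \<Rightarrow> ('i, 'a, 'k, 'w::ab_group_add) qrep \<Rightarrow> 'k \<Rightarrow> ('a \<Rightarrow> 'v \<Rightarrow> 'w) set \<Rightarrow> ('a \<Rightarrow> 'v \<Rightarrow> 'w) set" where
  "ext1_scale Q A B c \<xi> = {ext_scale B c z + b | z b. z \<in> \<xi> \<and> b \<in> ext_coboundaries Q A B}"

text \<open>The zero of \<open>Ext\<^sup>1(A,B)\<close> is the coset \<open>ext_coboundaries Q A B\<close>.\<close>

definition generating :: "('i, 'a) pre_digraph \<Rightarrow> ('i, 'a, 'k::field, 'v::ab_group_add) qrep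
    \<Rightarrow> ('i, 'a, 'k, 'w::ab_group_add) qrep \<Rightarrow> ('a \<Rightarrow> 'v \<Rightarrow> 'w) set \<Rightarrow> bool" where
  "generating Q A B \<xi> \<longleftrightarrow> \<xi> \<in> ext1 Q A B \<and> (\<forall>\<eta>\<in>ext1 Q A B. \<exists>c. \<eta> = ext1_scale Q A B c \<xi>)"

definition ext_dim :: "('i, 'a) pre_digraph \<Rightarrow> ('i, 'a, 'k::field, 'v::ab_group_add) qrep
    \<Rightarrow> ('i, 'a, 'k, 'w::ab_group_add) qrep \<Rightarrow> nat" where
  "ext_dim Q A B = vector_space.dim (ext_scale B) (ext_cocycles Q A B)
     - vector_space.dim (ext_scale B) (ext_coboundaries Q A B)"

definition short_exact :: "('i, 'a) pre_digraph \<Rightarrow> ('i, 'a, 'k::field, 'x::ab_group_add) qrep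
    \<Rightarrow> ('i, 'a, 'k, 'y::ab_group_add) qrep \<Rightarrow> ('i, 'a, 'k, 's::ab_group_add) qrep
    \<Rightarrow> ('i \<Rightarrow> 'x \<Rightarrow> 'y) \<Rightarrow> ('i \<Rightarrow> 'y \<Rightarrow> 's) \<Rightarrow> bool" where
  "short_exact Q X Y S \<iota> \<pi> \<longleftrightarrow> rep_hom Q X Y \<iota> \<and> rep_hom Q Y S \<pi> \<and>
     (\<forall>i\<in>verts Q. inj_on (\<iota> i) (spc X i) \<and> \<iota> i ` spc X i = {y \<in> spc Y i. \<pi> i y = 0} \<and>
        \<pi> i ` spc Y i = spc S i)"

text \<open>
  The class of a short exact sequence: for linear splittings \<open>\<sigma>\<^sub>i\<close> of \<open>\<pi>\<^sub>i\<close>, the cocycle \<open>z\<close> with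
  \<open>\<iota> z\<^sub>\<alpha> = Y\<^sub>\<alpha> \<sigma> - \<sigma> S\<^sub>\<alpha>\<close>; in the coordinates \<open>Y\<^sub>i = X\<^sub>i \<oplus> S\<^sub>i\<close> given by \<open>\<sigma>\<close>, this \<open>z\<^sub>\<alpha>\<close> is the
  off-diagonal block of \<open>Y\<^sub>\<alpha>\<close>.
\<close>

definition represents :: "('i, 'a) pre_digraph \<Rightarrow> ('i, 'a, 'k::field, 'x::ab_group_add) qrep
    \<Rightarrow> ('i, 'a, 'k, 'y::ab_group_add) qrep \<Rightarrow> ('i, 'a, 'k, 's::ab_group_add) qrep
    \<Rightarrow> ('i \<Rightarrow> 'x \<Rightarrow> 'y) \<Rightarrow> ('i \<Rightarrow> 'y \<Rightarrow> 's) \<Rightarrow> ('a \<Rightarrow> 's \<Rightarrow> 'x) set \<Rightarrow> bool" where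
  "represents Q X Y S \<iota> \<pi> \<xi> \<longleftrightarrow> short_exact Q X Y S \<iota> \<pi> \<and> \<xi> \<in> ext1 Q S X \<and>
     (\<exists>\<sigma> z. z \<in> \<xi> \<and>
       (\<forall>i\<in>verts Q. linear_btw (scl S) (scl Y) (spc S i) (spc Y i) (\<sigma> i) \<and>
          (\<forall>s\<in>spc S i. \<pi> i (\<sigma> i s) = s)) \<and>
       (\<forall>\<alpha>\<in>arcs Q. \<forall>s\<in>spc S (tail Q \<alpha>).
          \<iota> (head Q \<alpha>) (z \<alpha> s) = act Y \<alpha> (\<sigma> (tail Q \<alpha>) s) - \<sigma> (head Q \<alpha>) (act S \<alpha> s)))"

text \<open>
  \<open>upper_sub Q X S\<close> is \<open>X\<^sub>S\<close> and \<open>lower_sub Q X S\<close> is \<open>S\<^sup>X\<close>.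
\<close>

definition upper_sub :: "('i, 'a) pre_digraph \<Rightarrow> ('i, 'a, 'k::field, 'x::ab_group_add) qrep
    \<Rightarrow> ('i, 'a, 'k, 's::ab_group_add) qrep \<Rightarrow> 'i \<Rightarrow> 'x set" where
  "upper_sub Q X S = (GREATEST N. subrep Q X N \<and> ext_dim Q S (quot_rep Q X N) = 1)"

definition lower_sub :: "('i, 'a) pre_digraph \<Rightarrow> ('i, 'a, 'k::field, 'x::ab_group_add) qrep
    \<Rightarrow> ('i, 'a, 'k, 's::ab_group_add) qrep \<Rightarrow> 'i \<Rightarrow> 's set" where
  "lower_sub Q X S = (LEAST N. subrep Q S N \<and> ext_dim Q (S\<lparr>spc := N\<rparr>) X = 1)"


section \<open>Varieties as spaces with functions\<close>

text \<open>
  A variety over an algebraically closed field is treated as its set of closed points with the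
  Zariski topology and the sheaf of \<open>K\<close>-valued regular functions.  \<open>reg A U\<close> is the set of functions
  that are regular on the open set \<open>U\<close>; their values outside \<open>U\<close> are arbitrary.
\<close>

record ('p, 'k) fn_space =
  zar :: "'p topology"
  reg :: "'p set \<Rightarrow> ('p \<Rightarrow> 'k) set"

definition morphism :: "('p, 'k) fn_space \<Rightarrow> ('q, 'k) fn_space \<Rightarrow> ('p \<Rightarrow> 'q) \<Rightarrow> bool" where
  "morphism A B m \<longleftrightarrow> continuous_map (zar A) (zar B) m \<and>
     (\<forall>V. openin (zar B) V \<longrightarrow>
        (\<forall>\<phi>\<in>reg B V. \<phi> \<circ> m \<in> reg A {x \<in> topspace (zar A). m x \<in> V}))"

definition isomorphism :: "('p, 'k) fn_space \<Rightarrow> ('q, 'k) fn_space \<Rightarrow> ('p \<Rightarrow> 'q) \<Rightarrow> bool" where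
  "isomorphism A B m \<longleftrightarrow> morphism A B m \<and>
     (\<exists>m'. morphism B A m' \<and> homeomorphic_maps (zar A) (zar B) m m')"

text \<open>The structure induced on a subset; for a locally closed subset of a variety this is the
  reduced subvariety.\<close>

definition subspc :: "('p, 'k) fn_space \<Rightarrow> 'p set \<Rightarrow> ('p, 'k) fn_space" where
  "subspc A T = \<lparr>zar = subtopology (zar A) T,
     reg = (\<lambda>U. {\<phi>. \<forall>x\<in>U. \<exists>V \<psi>. openin (zar A) V \<and> x \<in> V \<and> \<psi> \<in> reg A V \<and>
                      (\<forall>y\<in>U \<inter> V. \<phi> y = \<psi> y)})\<rparr>"

inductive_set poly_funs :: "('p \<Rightarrow> 'k::comm_ring_1) set \<Rightarrow> ('p \<Rightarrow> 'k) set"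
  for C :: "('p \<Rightarrow> 'k) set" where
  const: "(\<lambda>_. c) \<in> poly_funs C"
| coord: "\<gamma> \<in> C \<Longrightarrow> \<gamma> \<in> poly_funs C"
| add: "p \<in> poly_funs C \<Longrightarrow> q \<in> poly_funs C \<Longrightarrow> (\<lambda>x. p x + q x) \<in> poly_funs C"
| mult: "p \<in> poly_funs C \<Longrightarrow> q \<in> poly_funs C \<Longrightarrow> (\<lambda>x. p x * q x) \<in> poly_funs C"

text \<open>
  \<open>zar_space P C\<close> is a subset \<open>P\<close> of an affine space with linear coordinates \<open>C\<close>, with the Zariski
  topology and with the functions that are locally quotients of polynomials.
\<close>

definition zar_space :: "'p set \<Rightarrow> ('p \<Rightarrow> 'k::field) set \<Rightarrow> ('p, 'k) fn_space" where
  "zar_space P C = \<lparr>zar = topology_generated_by {{x \<in> P. p x \<noteq> 0} | p. p \<in> poly_funs C},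
     reg = (\<lambda>U. {\<phi>. \<forall>x\<in>U. \<exists>p\<in>poly_funs C. \<exists>q\<in>poly_funs C. q x \<noteq> 0 \<and>
                      (\<forall>y\<in>U. q y \<noteq> 0 \<longrightarrow> \<phi> y = p y / q y)})\<rparr>"

definition affine_spc :: "nat \<Rightarrow> (nat \<Rightarrow> 'k::field, 'k) fn_space" where
  "affine_spc n = zar_space ({..<n} \<rightarrow>\<^sub>E UNIV) {(\<lambda>x. x k) | k. k < n}"

text \<open>
  The product of varieties (not the product topology): with \<open>tensor_funs A B U V\<close> the functions
  \<open>(x,y) \<mapsto> \<Sum>\<^sub>k a\<^sub>k x * b\<^sub>k y\<close> with \<open>a\<^sub>k\<close>, \<open>b\<^sub>k\<close> regular on \<open>U\<close>, \<open>V\<close>, the open sets are the unions of sets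
  \<open>{(x,y) \<in> U \<times> V. h (x,y) \<noteq> 0}\<close> and the regular functions are locally quotients \<open>g/h\<close>.
\<close>

definition tensor_funs :: "('p, 'k::field) fn_space \<Rightarrow> ('q, 'k) fn_space \<Rightarrow> 'p set \<Rightarrow> 'q set
    \<Rightarrow> ('p \<times> 'q \<Rightarrow> 'k) set" where
  "tensor_funs A B U V = {(\<lambda>(x, y). \<Sum>k<n. a k x * b k y) | (n::nat) a b.
     \<forall>k<n. a k \<in> reg A U \<and> b k \<in> reg B V}"

definition prod_spc :: "('p, 'k::field) fn_space \<Rightarrow> ('q, 'k) fn_space \<Rightarrow> ('p \<times> 'q, 'k) fn_space" where
  "prod_spc A B = \<lparr>zar = topology_generated_by
       {{w \<in> U \<times> V. h w \<noteq> 0} | U V h.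
          openin (zar A) U \<and> openin (zar B) V \<and> h \<in> tensor_funs A B U V},
     reg = (\<lambda>W. {\<phi>. \<forall>w\<in>W. \<exists>U V. openin (zar A) U \<and> openin (zar B) V \<and> w \<in> U \<times> V \<and>
        (\<exists>g\<in>tensor_funs A B U V. \<exists>h\<in>tensor_funs A B U V. h w \<noteq> 0 \<and>
          (\<forall>w'\<in>W \<inter> (U \<times> V). h w' \<noteq> 0 \<longrightarrow> \<phi> w' = g w' / h w'))})\<rparr>"

definition quot_spc :: "('p, 'k) fn_space \<Rightarrow> ('p \<Rightarrow> 'q) \<Rightarrow> ('q, 'k) fn_space" where
  "quot_spc A q = \<lparr>zar = topology (\<lambda>U. U \<subseteq> q ` topspace (zar A) \<and>
        openin (zar A) {x \<in> topspace (zar A). q x \<in> U}),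
     reg = (\<lambda>U. {\<phi>. \<phi> \<circ> q \<in> reg A {x \<in> topspace (zar A). q x \<in> U}})\<rparr>"

text \<open>
  Zariski-locally trivial affine bundles of rank \<open>r\<close>: the base is covered by open sets \<open>U\<close> over
  which the map is isomorphic to the projection from \<open>U \<times> \<^bold>A\<^sup>r\<close>.  The rank is an integer because the
  Euler form can take negative values on dimension vectors for which the base is empty.
\<close>

definition affine_bundle ::
  "('p, 'k::field) fn_space \<Rightarrow> ('q, 'k) fn_space \<Rightarrow> ('p \<Rightarrow> 'q) \<Rightarrow> int \<Rightarrow> bool" where
  "affine_bundle E B p r \<longleftrightarrow> morphism E B p \<and>
     (\<forall>b\<in>topspace (zar B). \<exists>U n t. openin (zar B) U \<and> b \<in> U \<and> int n = r \<and>
        isomorphism (subspc E {x \<in> topspace (zar E). p x \<in> U})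
          (prod_spc (subspc B U) (affine_spc n)) t \<and>
        (\<forall>x\<in>topspace (zar E). p x \<in> U \<longrightarrow> fst (t x) = p x))"


section \<open>Quiver Grassmannians\<close>

text \<open>
  The product over \<open>i\<close> of the Grassmannians of \<open>e i\<close>-dimensional subspaces of \<open>spc M i\<close> is the
  geometric quotient of the variety of frames (\<open>e i\<close> linearly independent vectors in \<open>spc M i\<close> for
  each \<open>i\<close>, an open subset of an affine space) by the product of the general linear groups, the
  quotient map sending a frame to its span.  The quiver Grassmannian is the closed subset of
  subrepresentations.
\<close>

definition frames :: "('i, 'a) pre_digraph \<Rightarrow> ('i, 'a, 'k::field, 'v::ab_group_add) qrep
    \<Rightarrow> ('i \<Rightarrow> nat) \<Rightarrow> ('i \<times> nat \<Rightarrow> 'v) set" where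
  "frames Q M e = {b \<in> (\<Pi>\<^sub>E (i, k)\<in>(SIGMA i:verts Q. {..<e i}). spc M i).
     \<forall>i\<in>verts Q. inj_on (\<lambda>k. b (i, k)) {..<e i} \<and>
       \<not> module.dependent (scl M) ((\<lambda>k. b (i, k)) ` {..<e i})}"

definition frame_coords :: "('i, 'a) pre_digraph \<Rightarrow> ('i, 'a, 'k::field, 'v::ab_group_add) qrep
    \<Rightarrow> ('i \<Rightarrow> nat) \<Rightarrow> (('i \<times> nat \<Rightarrow> 'v) \<Rightarrow> 'k) set" where
  "frame_coords Q M e = {(\<lambda>b. l (b (i, k))) | l i k.
     i \<in> verts Q \<and> k < e i \<and> linear_btw (scl M) (*) (spc M i) UNIV l}"

definition frame_span :: "('i, 'a) pre_digraph \<Rightarrow> ('i, 'a, 'k::field, 'v::ab_group_add) qrep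
    \<Rightarrow> ('i \<Rightarrow> nat) \<Rightarrow> ('i \<times> nat \<Rightarrow> 'v) \<Rightarrow> 'i \<Rightarrow> 'v set" where
  "frame_span Q M e b =
     (\<lambda>i. if i \<in> verts Q then module.span (scl M) ((\<lambda>k. b (i, k)) ` {..<e i}) else {})"

definition grass_spc :: "('i, 'a) pre_digraph \<Rightarrow> ('i, 'a, 'k::field, 'v::ab_group_add) qrep
    \<Rightarrow> ('i \<Rightarrow> nat) \<Rightarrow> ('i \<Rightarrow> 'v set, 'k) fn_space" where
  "grass_spc Q M e = quot_spc (zar_space (frames Q M e) (frame_coords Q M e)) (frame_span Q M e)"

definition Gr :: "('i, 'a) pre_digraph \<Rightarrow> ('i, 'a, 'k::field, 'v::ab_group_add) qrep
    \<Rightarrow> ('i \<Rightarrow> nat) \<Rightarrow> ('i \<Rightarrow> 'v set) set" where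
  "Gr Q M e = {N. subrep Q M N \<and> (\<forall>i\<in>verts Q. dimvec M N i = e i)}"

definition Gr_spc :: "('i, 'a) pre_digraph \<Rightarrow> ('i, 'a, 'k::field, 'v::ab_group_add) qrep
    \<Rightarrow> ('i \<Rightarrow> nat) \<Rightarrow> ('i \<Rightarrow> 'v set, 'k) fn_space" where
  "Gr_spc Q M e = subspc (grass_spc Q M e) (Gr Q M e)"

definition Psi :: "('i, 'a, 'k, 'x) qrep \<Rightarrow> ('i \<Rightarrow> 'x \<Rightarrow> 'y) \<Rightarrow> ('i \<Rightarrow> 'y \<Rightarrow> 's)
    \<Rightarrow> ('i \<Rightarrow> 'y set) \<Rightarrow> ('i \<Rightarrow> 'x set) \<times> ('i \<Rightarrow> 's set)" where
  "Psi X \<iota> \<pi> N = (\<lambda>i. {x \<in> spc X i. \<iota> i x \<in> N i}, \<lambda>i. \<pi> i ` N i)"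

definition stratum :: "('i, 'a) pre_digraph \<Rightarrow> ('i, 'a, 'k::field, 'x::ab_group_add) qrep
    \<Rightarrow> ('i, 'a, 'k, 'y::ab_group_add) qrep \<Rightarrow> ('i, 'a, 'k, 's::ab_group_add) qrep
    \<Rightarrow> ('i \<Rightarrow> 'x \<Rightarrow> 'y) \<Rightarrow> ('i \<Rightarrow> 'y \<Rightarrow> 's) \<Rightarrow> ('i \<Rightarrow> nat) \<Rightarrow> ('i \<Rightarrow> nat) \<Rightarrow> ('i \<Rightarrow> 'y set) set" where
  "stratum Q X Y S \<iota> \<pi> f g = {N \<in> Gr Q Y (\<lambda>i. f i + g i).
     \<forall>i\<in>verts Q. dimvec X (fst (Psi X \<iota> \<pi> N)) i = f i \<and> dimvec S (snd (Psi X \<iota> \<pi> N)) i = g i}"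


section \<open>Short exact sequences, quotients and points\<close>

lemma linear_btwD:
  assumes "linear_btw s t V W \<phi>"
  shows "x \<in> V \<Longrightarrow> \<phi> x \<in> W" and "x \<in> V \<Longrightarrow> y \<in> V \<Longrightarrow> \<phi> (x + y) = \<phi> x + \<phi> y"
    and "x \<in> V \<Longrightarrow> \<phi> (s c x) = t c (\<phi> x)"
  using assms by (auto simp: linear_btw_def)

lemma linear_btw_diff:
  assumes "linear_btw s t V W \<phi>" "module s" "module.subspace s V" "x \<in> V" "y \<in> V"
  shows "\<phi> (x - y) = \<phi> x - \<phi> y"
proof -
  have "x - y \<in> V" using assms by (auto intro: module.subspace_diff)
  then have "\<phi> ((x - y) + y) = \<phi> (x - y) + \<phi> y" using assms by (intro linear_btwD(2)) auto
  then show ?thesis by (simp add: algebra_simps)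
qed

lemma linear_btw_0:
  assumes "linear_btw s t V W \<phi>" "module s" "module.subspace s V"
  shows "\<phi> 0 = 0"
  using linear_btw_diff[OF assms, of 0 0] assms by (simp add: module.subspace_0)

lemma fd_repD:
  assumes "fd_rep Q M"
  shows "vector_space (scl M)" "module (scl M)"
    "i \<in> verts Q \<Longrightarrow> module.subspace (scl M) (spc M i)"
    "\<alpha> \<in> arcs Q \<Longrightarrow> linear_btw (scl M) (scl M) (spc M (tail Q \<alpha>)) (spc M (head Q \<alpha>)) (act M \<alpha>)"
proof -
  show v: "vector_space (scl M)" using assms by (simp add: fd_rep_def)
  then show m: "module (scl M)" by (simp add: module_iff_vector_space)
  show "i \<in> verts Q \<Longrightarrow> module.subspace (scl M) (spc M i)"
    using assms m by (auto simp: fd_rep_def module.subspace_span)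
  show "\<alpha> \<in> arcs Q \<Longrightarrow> linear_btw (scl M) (scl M) (spc M (tail Q \<alpha>)) (spc M (head Q \<alpha>)) (act M \<alpha>)"
    using assms by (simp add: fd_rep_def)
qed

lemma complement_projection:
  assumes "vector_space s" "module.subspace s V" "module.subspace s N" "N \<subseteq> V"
  obtains r where "Vector_Spaces.linear s s r" "\<And>x. x \<in> V \<Longrightarrow> r x \<in> V" "\<And>x. x \<in> V \<Longrightarrow> x - r x \<in> N"
    "\<And>x. x \<in> N \<Longrightarrow> r x = 0"
proof -
  interpret vector_space s by fact
  interpret vector_space_pair s s ..
  obtain B1 where B1: "B1 \<subseteq> N" "independent B1" "N \<subseteq> span B1"
    by (rule maximal_independent_subset)
  have spB1: "span B1 = N" using B1 assms by (simp add: span_subspace)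
  obtain B where B: "B1 \<subseteq> B" "B \<subseteq> V" "independent B" "V \<subseteq> span B"
    using maximal_independent_subset_extend[of B1 V] B1 assms by (metis order_trans)
  have spB: "span B = V" using B assms by (simp add: span_subspace)
  obtain r where r: "Vector_Spaces.linear s s r" "\<forall>x\<in>B. r x = (if x \<in> B1 then 0 else x)"
    using linear_independent_extend[OF B(3), of "\<lambda>x. if x \<in> B1 then 0 else x"] by auto
  interpret r: Vector_Spaces.linear s s r by fact
  have r0: "r b = 0" if "b \<in> B1" for b using r(2) B(1) that by auto
  have 0: "r x = 0" if "x \<in> N" for x
    using r.eq_0_on_span[of B1 x, OF r0] that spB1 by auto
  have 1: "x - r x \<in> N" if "x \<in> V" for x
  proof -
    have "x \<in> span B" using that spB by simp
    then show ?thesis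
    proof (induction rule: span_induct_alt)
      case base show ?case using assms by (simp add: r.zero subspace_0)
    next
      case (step c x y)
      have "x - r x \<in> N" using step r B1 assms(3) by (auto simp: subspace_0)
      then have "s c (x - r x) + (y - r y) \<in> N"
        using step assms(3) by (blast intro: subspace_add subspace_scale)
      moreover have "s c x + y - r (s c x + y) = s c (x - r x) + (y - r y)"
        by (simp add: r.add r.scale scale_right_diff_distrib)
      ultimately show ?case by (simp only:)
    qed
  qed
  have "r x \<in> V" if "x \<in> V" for x
    using subspace_diff[OF assms(2) that, of "x - r x"] 1[OF that] assms(4) by auto
  then show ?thesis using that r(1) 0 1 by blast
qed

lemma is_quot_quot_rep:
  assumes "wf_digraph Q" "fd_rep Q M" "subrep Q M N"
  shows "\<exists>p. is_quot Q M N (quot_rep Q M N) p"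
proof -
  interpret wf_digraph Q by fact
  note M = fd_repD[OF assms(2)]
  interpret vector_space "scl M" by (rule M)
  define P where "P i r \<longleftrightarrow> Vector_Spaces.linear (scl M) (scl M) r \<and> (\<forall>x\<in>spc M i. r x \<in> spc M i \<and> x - r x \<in> N i) \<and>
    (\<forall>x\<in>N i. r x = 0)" for i r
  have "\<exists>r. P i r" if "i \<in> verts Q" for i
    using complement_projection[of "scl M" "spc M i" "N i"] M that assms(3)
    unfolding P_def subrep_def by metis
  then obtain r where "\<forall>i\<in>verts Q. P i (r i)" by metis
  then have r: "\<And>i. i \<in> verts Q \<Longrightarrow> Vector_Spaces.linear (scl M) (scl M) (r i)"
    "\<And>i x. i \<in> verts Q \<Longrightarrow> x \<in> spc M i \<Longrightarrow> r i x \<in> spc M i"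
    "\<And>i x. i \<in> verts Q \<Longrightarrow> x \<in> spc M i \<Longrightarrow> x - r i x \<in> N i"
    "\<And>i x. i \<in> verts Q \<Longrightarrow> x \<in> N i \<Longrightarrow> r i x = 0"
    by (auto simp: P_def)
  note rh = r(1)[THEN Vector_Spaces.linear.axioms(3)]
  have N: "\<And>i. i \<in> verts Q \<Longrightarrow> N i \<subseteq> spc M i"
    "\<And>\<alpha> x. \<alpha> \<in> arcs Q \<Longrightarrow> x \<in> N (tail Q \<alpha>) \<Longrightarrow> act M \<alpha> x \<in> N (head Q \<alpha>)"
    using assms(3) unfolding subrep_def by blast+
  define Z where "Z = M\<lparr>spc := \<lambda>i. r i ` spc M i, act := \<lambda>\<alpha> x. r (head Q \<alpha>) (act M \<alpha> x)\<rparr>"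
  have lin: "linear_btw (scl M) (scl M) (spc M i) (r i ` spc M i) (r i)" if "i \<in> verts Q" for i
    using rh[OF that] by (auto simp: linear_btw_def module_hom.add module_hom.scale)
  have "fd_rep Q Z"
    unfolding fd_rep_def Z_def
  proof (simp, intro conjI ballI)
    show "vector_space (scl M)" by (rule M)
    fix i assume i: "i \<in> verts Q"
    obtain B where "finite B" "spc M i = span B" using assms(2) i by (auto simp: fd_rep_def)
    then show "\<exists>B. finite B \<and> r i ` spc M i = span B"
      using module_hom.span_image[OF rh[OF i], of B] by (metis finite_imageI)
  next
    fix \<alpha> assume a: "\<alpha> \<in> arcs Q"
    then have h: "head Q \<alpha> \<in> verts Q" and t: "tail Q \<alpha> \<in> verts Q" by auto
    have "linear_btw (scl M) (scl M) (spc M (tail Q \<alpha>)) (r (head Q \<alpha>) ` spc M (head Q \<alpha>))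
       (\<lambda>x. r (head Q \<alpha>) (act M \<alpha> x))"
      using M(4)[OF a] rh[OF h] by (auto simp: linear_btw_def module_hom.add module_hom.scale)
    then show "linear_btw (scl M) (scl M) (r (tail Q \<alpha>) ` spc M (tail Q \<alpha>))
       (r (head Q \<alpha>) ` spc M (head Q \<alpha>)) (\<lambda>x. r (head Q \<alpha>) (act M \<alpha> x))"
      using r(2)[OF t] unfolding linear_btw_def by auto
  qed
  moreover have "rep_hom Q M Z r"
    unfolding rep_hom_def
  proof (intro conjI ballI)
    fix i assume "i \<in> verts Q" then show "linear_btw (scl M) (scl Z) (spc M i) (spc Z i) (r i)"
      using lin by (simp add: Z_def)
  next
    fix \<alpha> v assume a: "\<alpha> \<in> arcs Q" and v: "v \<in> spc M (tail Q \<alpha>)"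
    then have h: "head Q \<alpha> \<in> verts Q" and t: "tail Q \<alpha> \<in> verts Q" by auto
    have "act M \<alpha> (v - r (tail Q \<alpha>) v) \<in> N (head Q \<alpha>)"
      using N(2)[OF a] r(3)[OF t v] by simp
    then have "r (head Q \<alpha>) (act M \<alpha> (v - r (tail Q \<alpha>) v)) = 0" using r(4)[OF h] by simp
    moreover have "act M \<alpha> (v - r (tail Q \<alpha>) v) = act M \<alpha> v - act M \<alpha> (r (tail Q \<alpha>) v)"
      using M a t v r(2) by (intro linear_btw_diff[of "scl M"]) auto
    ultimately show "r (head Q \<alpha>) (act M \<alpha> v) = act Z \<alpha> (r (tail Q \<alpha>) v)"
      by (simp add: Z_def module_hom.diff[OF rh[OF h]])
  qed
  moreover have "{x \<in> spc M i. r i x = 0} = N i" if "i \<in> verts Q" for i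
    using r(3,4)[OF that] N(1)[OF that] by force
  ultimately have "is_quot Q M N Z r" by (auto simp: is_quot_def Z_def)
  then show ?thesis unfolding quot_rep_def by (intro someI_ex[of "\<lambda>Z. \<exists>p. is_quot Q M N Z p"]) blast
qed


lemma linear_btw_minus:
  assumes "linear_btw s t V W \<phi>" "linear_btw s t V W \<psi>" "module t" "module.subspace t W"
  shows "linear_btw s t V W (\<lambda>x. \<phi> x - \<psi> x)"
  using assms unfolding linear_btw_def
  by (auto simp: Pi_iff module.subspace_diff module.scale_right_diff_distrib)

lemma linear_btw_plus:
  assumes "linear_btw s t V W \<phi>" "linear_btw s t V W \<psi>" "module t" "module.subspace t W"
  shows "linear_btw s t V W (\<lambda>x. \<phi> x + \<psi> x)"
  using assms unfolding linear_btw_def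
  by (auto simp: Pi_iff module.subspace_add module.scale_right_distrib)

lemma linear_btw_comp:
  assumes "linear_btw s t V W \<phi>" "linear_btw t u W W' \<psi>"
  shows "linear_btw s u V W' (\<lambda>x. \<psi> (\<phi> x))"
  using assms unfolding linear_btw_def by (auto simp: Pi_iff)

lemma ext_coboundaries_diff:
  assumes "wf_digraph Q" "fd_rep Q A" "fd_rep Q B"
    "b \<in> ext_coboundaries Q A B" "b' \<in> ext_coboundaries Q A B"
  shows "b - b' \<in> ext_coboundaries Q A B"
proof -
  interpret wf_digraph Q by fact
  obtain \<phi> \<psi> where \<phi>: "b = ext_diff Q A B \<phi>" "\<And>i. i \<in> verts Q \<Longrightarrow> linear_btw (scl A) (scl B) (spc A i) (spc B i) (\<phi> i)"
    and \<psi>: "b' = ext_diff Q A B \<psi>" "\<And>i. i \<in> verts Q \<Longrightarrow> linear_btw (scl A) (scl B) (spc A i) (spc B i) (\<psi> i)"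
    using assms by (auto simp: ext_coboundaries_def)
  have "act B \<alpha> (\<phi> (tail Q \<alpha>) v - \<psi> (tail Q \<alpha>) v) = act B \<alpha> (\<phi> (tail Q \<alpha>) v) - act B \<alpha> (\<psi> (tail Q \<alpha>) v)"
    if "\<alpha> \<in> arcs Q" "v \<in> spc A (tail Q \<alpha>)" for \<alpha> v
    using that fd_repD[OF assms(3)] linear_btwD(1)[OF \<phi>(2)] linear_btwD(1)[OF \<psi>(2)]
    by (intro linear_btw_diff[of "scl B"]) auto
  then have "b - b' = ext_diff Q A B (\<lambda>i x. \<phi> i x - \<psi> i x)"
    by (auto simp: \<phi>(1) \<psi>(1) ext_diff_def fun_eq_iff)
  then show ?thesis
    unfolding ext_coboundaries_def using \<phi>(2) \<psi>(2) fd_repD[OF assms(3)]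
    by (blast intro: linear_btw_minus)
qed

lemma ext_coboundaries_0:
  assumes "wf_digraph Q" "fd_rep Q A" "fd_rep Q B"
  shows "0 \<in> ext_coboundaries Q A B"
proof -
  have "\<forall>i\<in>verts Q. linear_btw (scl A) (scl B) (spc A i) (spc B i) (\<lambda>_. 0)"
    using fd_repD[OF assms(3)]
    by (auto simp: linear_btw_def module.subspace_0 module.scale_zero_right)
  then have "ext_diff Q A B (\<lambda>_ _. 0) \<in> ext_coboundaries Q A B"
    by (simp add: ext_coboundaries_def)
  from ext_coboundaries_diff[OF assms this this] show ?thesis by simp
qed

lemma ext1_mem_iff:
  assumes "wf_digraph Q" "fd_rep Q A" "fd_rep Q B" "\<xi> \<in> ext1 Q A B" "z \<in> \<xi>"
  shows "w \<in> \<xi> \<longleftrightarrow> w - z \<in> ext_coboundaries Q A B"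
proof -
  let ?C = "ext_coboundaries Q A B"
  note d = ext_coboundaries_diff[OF assms(1-3)] and 0 = ext_coboundaries_0[OF assms(1-3)]
  have a: "b + b' \<in> ?C" if "b \<in> ?C" "b' \<in> ?C" for b b'
    using d[OF that(1) d[OF 0 that(2)]] by simp
  obtain z0 b0 where z0: "\<xi> = {z0 + b | b. b \<in> ?C}" "z = z0 + b0" "b0 \<in> ?C"
    using assms(4,5) by (auto simp: ext1_def)
  show ?thesis
  proof
    assume "w \<in> \<xi>"
    then show "w - z \<in> ?C" using z0 d by auto
  next
    assume w: "w - z \<in> ?C"
    have "w = z0 + ((w - z) + b0)" using z0 by simp
    then show "w \<in> \<xi>" using a[OF w z0(3)] z0(1) by blast
  qed
qed

lemma ext1_cocycle_in:
  assumes "wf_digraph Q" "fd_rep Q A" "fd_rep Q B" "\<xi> \<in> ext1 Q A B"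
  obtains z where "z \<in> \<xi>" "z \<in> ext_cocycles Q A B"
proof -
  obtain z where "\<xi> = {z + b | b. b \<in> ext_coboundaries Q A B}" "z \<in> ext_cocycles Q A B"
    using assms(4) by (auto simp: ext1_def)
  moreover from this have "z + 0 \<in> \<xi>" using ext_coboundaries_0[OF assms(1-3)] by blast
  then have "z \<in> \<xi>" by simp
  ultimately show ?thesis using that by blast
qed

lemma ext1_vanish:
  assumes "\<xi> \<in> ext1 Q A B" "z \<in> \<xi>" "\<alpha> \<notin> arcs Q \<or> v \<notin> spc A (tail Q \<alpha>)"
  shows "z \<alpha> v = 0"
  using assms by (auto simp: ext1_def ext_cocycles_def ext_coboundaries_def ext_diff_def)

lemma ext1_mem_space:
  assumes "wf_digraph Q" "fd_rep Q A" "fd_rep Q B" "\<xi> \<in> ext1 Q A B" "w \<in> \<xi>"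
    and a: "\<alpha> \<in> arcs Q" and s: "s \<in> spc A (tail Q \<alpha>)"
  shows "w \<alpha> s \<in> spc B (head Q \<alpha>)"
proof -
  interpret wf_digraph Q by fact
  have h: "head Q \<alpha> \<in> verts Q" and t: "tail Q \<alpha> \<in> verts Q" using a by auto
  note A = fd_repD[OF assms(2)] and B = fd_repD[OF assms(3)]
  obtain w0 where w0: "w0 \<in> \<xi>" "w0 \<in> ext_cocycles Q A B" using ext1_cocycle_in[OF assms(1-4)] .
  obtain \<phi> where \<phi>: "w - w0 = ext_diff Q A B \<phi>"
      "\<And>i. i \<in> verts Q \<Longrightarrow> linear_btw (scl A) (scl B) (spc A i) (spc B i) (\<phi> i)"
    using ext1_mem_iff[OF assms(1-4) w0(1), of w] assms(5) by (auto simp: ext_coboundaries_def)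
  have "w \<alpha> s = w0 \<alpha> s + (\<phi> (head Q \<alpha>) (act A \<alpha> s) - act B \<alpha> (\<phi> (tail Q \<alpha>) s))"
    using fun_cong[OF fun_cong[OF \<phi>(1)], of \<alpha> s] a s by (simp add: ext_diff_def algebra_simps)
  moreover have "w0 \<alpha> s \<in> spc B (head Q \<alpha>)"
    using w0(2) a s by (auto simp: ext_cocycles_def linear_btw_def)
  moreover have "\<phi> (head Q \<alpha>) (act A \<alpha> s) - act B \<alpha> (\<phi> (tail Q \<alpha>) s) \<in> spc B (head Q \<alpha>)"
    by (intro module.subspace_diff[OF B(2) B(3)[OF h]] linear_btwD(1)[OF \<phi>(2)[OF h]]
        linear_btwD(1)[OF A(4)[OF a] s] linear_btwD(1)[OF B(4)[OF a]] linear_btwD(1)[OF \<phi>(2)[OF t] s])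
  ultimately show ?thesis using module.subspace_add[OF B(2) B(3)[OF h]] by simp
qed

lemma linear_section:
  assumes "fd_rep Q Y" "fd_rep Q S" "short_exact Q X Y S \<iota> \<pi>" "i \<in> verts Q"
  shows "\<exists>\<sigma>. linear_btw (scl S) (scl Y) (spc S i) (spc Y i) \<sigma> \<and> (\<forall>s\<in>spc S i. \<pi> i (\<sigma> s) = s)"
proof -
  note Y = fd_repD[OF assms(1)] and S = fd_repD[OF assms(2)]
  interpret V: vector_space "scl S" by (rule S)
  interpret W: vector_space "scl Y" by (rule Y)
  interpret vector_space_pair "scl S" "scl Y" ..
  have sY: "W.subspace (spc Y i)" and sS: "V.subspace (spc S i)" using Y S assms by auto
  have \<pi>: "linear_btw (scl Y) (scl S) (spc Y i) (spc S i) (\<pi> i)" "\<pi> i ` spc Y i = spc S i"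
    using assms by (auto simp: short_exact_def rep_hom_def)
  obtain B where B: "B \<subseteq> spc S i" "V.independent B" "spc S i \<subseteq> V.span B"
    by (rule V.maximal_independent_subset)
  have "\<forall>b\<in>B. \<exists>y. y \<in> spc Y i \<and> \<pi> i y = b" using B(1) \<pi>(2) by (force simp: image_iff)
  then obtain h where h: "\<And>b. b \<in> B \<Longrightarrow> h b \<in> spc Y i \<and> \<pi> i (h b) = b" by metis
  obtain \<sigma> where \<sigma>: "Vector_Spaces.linear (scl S) (scl Y) \<sigma>" "\<forall>b\<in>B. \<sigma> b = h b"
    using linear_independent_extend[OF B(2)] by blast
  interpret \<sigma>: Vector_Spaces.linear "scl S" "scl Y" \<sigma> by fact
  have "\<sigma> s \<in> spc Y i \<and> \<pi> i (\<sigma> s) = s" if "s \<in> spc S i" for s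
  proof -
    from that B have "s \<in> V.span B" by blast
    then show ?thesis
    proof (induction rule: V.span_induct_alt)
      case base
      then show ?case using linear_btw_0[OF \<pi>(1) Y(2) sY] sY by (simp add: W.subspace_0)
    next
      case (step c x y)
      then have x: "\<sigma> x \<in> spc Y i" "\<pi> i (\<sigma> x) = x" using h \<sigma>(2) by auto
      then have "scl Y c (\<sigma> x) \<in> spc Y i" using sY W.subspace_scale by blast
      then show ?case
        using step x \<pi>(1) sY by (simp add: \<sigma>.add \<sigma>.scale W.subspace_add linear_btwD(2,3))
    qed
  qed
  then show ?thesis by (intro exI[of _ \<sigma>]) (auto simp: linear_btw_def \<sigma>.add \<sigma>.scale)
qed

lemma representsE:
  assumes "represents Q X Y S \<iota> \<pi> \<xi>"
  obtains \<sigma> z where "\<xi> \<in> ext1 Q S X" "z \<in> \<xi>"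
    "\<And>i. i \<in> verts Q \<Longrightarrow> linear_btw (scl S) (scl Y) (spc S i) (spc Y i) (\<sigma> i)"
    "\<And>i s. i \<in> verts Q \<Longrightarrow> s \<in> spc S i \<Longrightarrow> \<pi> i (\<sigma> i s) = s"
    "\<And>\<alpha> s. \<alpha> \<in> arcs Q \<Longrightarrow> s \<in> spc S (tail Q \<alpha>) \<Longrightarrow>
       \<iota> (head Q \<alpha>) (z \<alpha> s) = act Y \<alpha> (\<sigma> (tail Q \<alpha>) s) - \<sigma> (head Q \<alpha>) (act S \<alpha> s)"
proof -
  from assms have "\<xi> \<in> ext1 Q S X" and "\<exists>\<sigma> z. z \<in> \<xi> \<and>
       (\<forall>i\<in>verts Q. linear_btw (scl S) (scl Y) (spc S i) (spc Y i) (\<sigma> i) \<and>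
          (\<forall>s\<in>spc S i. \<pi> i (\<sigma> i s) = s)) \<and>
       (\<forall>\<alpha>\<in>arcs Q. \<forall>s\<in>spc S (tail Q \<alpha>).
          \<iota> (head Q \<alpha>) (z \<alpha> s) = act Y \<alpha> (\<sigma> (tail Q \<alpha>) s) - \<sigma> (head Q \<alpha>) (act S \<alpha> s))"
    by (simp_all add: represents_def)
  then obtain \<sigma> z where x: "z \<in> \<xi>" and w: "\<forall>i\<in>verts Q. linear_btw (scl S) (scl Y) (spc S i) (spc Y i) (\<sigma> i) \<and>
          (\<forall>s\<in>spc S i. \<pi> i (\<sigma> i s) = s)" "\<forall>\<alpha>\<in>arcs Q. \<forall>s\<in>spc S (tail Q \<alpha>).
          \<iota> (head Q \<alpha>) (z \<alpha> s) = act Y \<alpha> (\<sigma> (tail Q \<alpha>) s) - \<sigma> (head Q \<alpha>) (act S \<alpha> s)"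
    by (elim exE conjE) (rule that)
  show ?thesis
    by (rule that[OF \<open>\<xi> \<in> ext1 Q S X\<close> x]) (use w in simp_all)
qed

lemma ses_represents_ex1:
  assumes "wf_digraph Q" "fd_rep Q X" "fd_rep Q Y" "fd_rep Q S" "short_exact Q X Y S \<iota> \<pi>"
  shows "\<exists>!\<xi>. represents Q X Y S \<iota> \<pi> \<xi>"
proof -
  interpret wf_digraph Q by fact
  note X = fd_repD[OF assms(2)] and Y = fd_repD[OF assms(3)] and S = fd_repD[OF assms(4)]
  have \<iota>: "\<And>i. i \<in> verts Q \<Longrightarrow> linear_btw (scl X) (scl Y) (spc X i) (spc Y i) (\<iota> i)"
    and \<pi>: "\<And>i. i \<in> verts Q \<Longrightarrow> linear_btw (scl Y) (scl S) (spc Y i) (spc S i) (\<pi> i)"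
    and \<iota>h: "\<And>\<alpha> v. \<alpha> \<in> arcs Q \<Longrightarrow> v \<in> spc X (tail Q \<alpha>) \<Longrightarrow> \<iota> (head Q \<alpha>) (act X \<alpha> v) = act Y \<alpha> (\<iota> (tail Q \<alpha>) v)"
    and \<pi>h: "\<And>\<alpha> v. \<alpha> \<in> arcs Q \<Longrightarrow> v \<in> spc Y (tail Q \<alpha>) \<Longrightarrow> \<pi> (head Q \<alpha>) (act Y \<alpha> v) = act S \<alpha> (\<pi> (tail Q \<alpha>) v)"
    and inj: "\<And>i. i \<in> verts Q \<Longrightarrow> inj_on (\<iota> i) (spc X i)"
    and ker: "\<And>i. i \<in> verts Q \<Longrightarrow> \<iota> i ` spc X i = {y \<in> spc Y i. \<pi> i y = 0}"
    using assms(5) by (simp_all add: short_exact_def rep_hom_def)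
  have pull: "\<exists>g. linear_btw s (scl X) V (spc X i) g \<and> (\<forall>x\<in>V. \<iota> i (g x) = f x)"
    if "i \<in> verts Q" "linear_btw s (scl Y) V (spc Y i) f" "\<And>x. x \<in> V \<Longrightarrow> \<pi> i (f x) = 0" 
      "module s" "module.subspace s V"
    for i s V f
  proof -
    have "\<forall>x\<in>V. \<exists>w. w \<in> spc X i \<and> \<iota> i w = f x"
    proof
      fix x assume x: "x \<in> V"
      then have "f x \<in> \<iota> i ` spc X i"
        unfolding ker[OF that(1)] using that(3) linear_btwD(1)[OF that(2)] by simp
      then show "\<exists>w. w \<in> spc X i \<and> \<iota> i w = f x" by (metis imageE)
    qed
    then obtain g where g: "\<And>x. x \<in> V \<Longrightarrow> g x \<in> spc X i" "\<And>x. x \<in> V \<Longrightarrow> \<iota> i (g x) = f x"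
      by metis
    note i = inj_onD[OF inj[OF that(1)]] and sub = X(3)[OF that(1)] and li = linear_btwD[OF \<iota>[OF that(1)]]
      and lf = linear_btwD[OF that(2)]
    have "g (x + y) = g x + g y" if x: "x \<in> V" and y: "y \<in> V" for x y
    proof (rule i)
      have xy: "x + y \<in> V" using module.subspace_add[OF \<open>module s\<close> \<open>module.subspace s V\<close> x y] .
      then show "g (x + y) \<in> spc X i" by (rule g)
      show "g x + g y \<in> spc X i" using module.subspace_add[OF X(2) sub] g(1) x y by blast
      show "\<iota> i (g (x + y)) = \<iota> i (g x + g y)"
        by (simp only: g(2)[OF xy] lf(2)[OF x y] li(2)[OF g(1)[OF x] g(1)[OF y]] g(2)[OF x] g(2)[OF y])
    qed
    moreover have "g (s c x) = scl X c (g x)" if x: "x \<in> V" for x c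
    proof (rule i)
      have cx: "s c x \<in> V" using module.subspace_scale[OF \<open>module s\<close> \<open>module.subspace s V\<close> x] .
      then show "g (s c x) \<in> spc X i" by (rule g)
      show "scl X c (g x) \<in> spc X i" using module.subspace_scale[OF X(2) sub] g(1) x by blast
      show "\<iota> i (g (s c x)) = \<iota> i (scl X c (g x))"
        by (simp only: g(2)[OF cx] lf(3)[OF x] li(3)[OF g(1)[OF x]] g(2)[OF x])
    qed
    ultimately show ?thesis using g by (intro exI[of _ g]) (auto simp: linear_btw_def)
  qed
  show ?thesis
  proof (rule ex_ex1I)
    have "\<forall>i. \<exists>\<sigma>. i \<in> verts Q \<longrightarrow> linear_btw (scl S) (scl Y) (spc S i) (spc Y i) \<sigma> \<and> (\<forall>s\<in>spc S i. \<pi> i (\<sigma> s) = s)"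
      using linear_section[OF assms(3,4,5)] by blast
    then obtain \<sigma> where \<sigma>: "\<And>i. i \<in> verts Q \<Longrightarrow> linear_btw (scl S) (scl Y) (spc S i) (spc Y i) (\<sigma> i)"
      "\<And>i s. i \<in> verts Q \<Longrightarrow> s \<in> spc S i \<Longrightarrow> \<pi> i (\<sigma> i s) = s" by metis
    have "\<exists>g. linear_btw (scl S) (scl X) (spc S (tail Q \<alpha>)) (spc X (head Q \<alpha>)) g \<and>
       (\<forall>s\<in>spc S (tail Q \<alpha>). \<iota> (head Q \<alpha>) (g s) = act Y \<alpha> (\<sigma> (tail Q \<alpha>) s) - \<sigma> (head Q \<alpha>) (act S \<alpha> s))"
      if a: "\<alpha> \<in> arcs Q" for \<alpha>
    proof (rule pull)
      show h: "head Q \<alpha> \<in> verts Q" using a by simp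
      have t: "tail Q \<alpha> \<in> verts Q" using a by simp
      have l1: "linear_btw (scl S) (scl Y) (spc S (tail Q \<alpha>)) (spc Y (head Q \<alpha>)) (\<lambda>s. act Y \<alpha> (\<sigma> (tail Q \<alpha>) s))"
        and l2: "linear_btw (scl S) (scl Y) (spc S (tail Q \<alpha>)) (spc Y (head Q \<alpha>)) (\<lambda>s. \<sigma> (head Q \<alpha>) (act S \<alpha> s))"
        using \<sigma>(1)[OF t] \<sigma>(1)[OF h] Y(4)[OF a] S(4)[OF a] by (auto intro: linear_btw_comp)
      then show "linear_btw (scl S) (scl Y) (spc S (tail Q \<alpha>)) (spc Y (head Q \<alpha>))
         (\<lambda>s. act Y \<alpha> (\<sigma> (tail Q \<alpha>) s) - \<sigma> (head Q \<alpha>) (act S \<alpha> s))"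
        using Y h by (intro linear_btw_minus) auto
      fix s assume s: "s \<in> spc S (tail Q \<alpha>)"
      have "\<pi> (head Q \<alpha>) (act Y \<alpha> (\<sigma> (tail Q \<alpha>) s) - \<sigma> (head Q \<alpha>) (act S \<alpha> s))
        = \<pi> (head Q \<alpha>) (act Y \<alpha> (\<sigma> (tail Q \<alpha>) s)) - \<pi> (head Q \<alpha>) (\<sigma> (head Q \<alpha>) (act S \<alpha> s))"
        using Y h s linear_btwD(1)[OF l1] linear_btwD(1)[OF l2]
        by (intro linear_btw_diff[OF \<pi>[OF h]]) auto
      then show "\<pi> (head Q \<alpha>) (act Y \<alpha> (\<sigma> (tail Q \<alpha>) s) - \<sigma> (head Q \<alpha>) (act S \<alpha> s)) = 0"
        using \<pi>h[OF a] linear_btwD(1)[OF \<sigma>(1)[OF t] s] \<sigma>(2)[OF t s] \<sigma>(2)[OF h linear_btwD(1)[OF S(4)[OF a] s]]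
        by simp
    qed (use S a in auto)
    then obtain g where g: "\<And>\<alpha>. \<alpha> \<in> arcs Q \<Longrightarrow> linear_btw (scl S) (scl X) (spc S (tail Q \<alpha>)) (spc X (head Q \<alpha>)) (g \<alpha>)"
       "\<And>\<alpha> s. \<alpha> \<in> arcs Q \<Longrightarrow> s \<in> spc S (tail Q \<alpha>) \<Longrightarrow>
          \<iota> (head Q \<alpha>) (g \<alpha> s) = act Y \<alpha> (\<sigma> (tail Q \<alpha>) s) - \<sigma> (head Q \<alpha>) (act S \<alpha> s)"
      by metis
    define z where "z \<alpha> v = (if \<alpha> \<in> arcs Q \<and> v \<in> spc S (tail Q \<alpha>) then g \<alpha> v else 0)" for \<alpha> v
    have "linear_btw (scl S) (scl X) (spc S (tail Q \<alpha>)) (spc X (head Q \<alpha>)) (z \<alpha>)" if a: "\<alpha> \<in> arcs Q" for \<alpha>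
      using g(1)[OF a] S(2) S(3)[of "tail Q \<alpha>"] a
      unfolding linear_btw_def by (auto simp: z_def module.subspace_add module.subspace_scale)
    then have "z \<in> ext_cocycles Q S X" unfolding ext_cocycles_def by (auto simp: z_def)
    then have "{z + b | b. b \<in> ext_coboundaries Q S X} \<in> ext1 Q S X" by (auto simp: ext1_def)
    moreover have "z \<in> {z + b | b. b \<in> ext_coboundaries Q S X}"
      using ext_coboundaries_0[OF assms(1,4,2)] by force
    ultimately show "\<exists>\<xi>. represents Q X Y S \<iota> \<pi> \<xi>"
      unfolding represents_def using assms(5) \<sigma> g(2)
      by (intro exI[of _ "{z + b | b. b \<in> ext_coboundaries Q S X}"] conjI exI[of _ \<sigma>] exI[of _ z])
         (auto simp: z_def)
  next
    fix \<xi> \<xi>' assume r: "represents Q X Y S \<iota> \<pi> \<xi>" "represents Q X Y S \<iota> \<pi> \<xi>'"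
    from r(1) obtain \<sigma> z where x: "\<xi> \<in> ext1 Q S X" "z \<in> \<xi>"
      and \<sigma>: "\<And>i. i \<in> verts Q \<Longrightarrow> linear_btw (scl S) (scl Y) (spc S i) (spc Y i) (\<sigma> i)"
       "\<And>i s. i \<in> verts Q \<Longrightarrow> s \<in> spc S i \<Longrightarrow> \<pi> i (\<sigma> i s) = s"
      and z: "\<And>\<alpha> s. \<alpha> \<in> arcs Q \<Longrightarrow> s \<in> spc S (tail Q \<alpha>) \<Longrightarrow>
          \<iota> (head Q \<alpha>) (z \<alpha> s) = act Y \<alpha> (\<sigma> (tail Q \<alpha>) s) - \<sigma> (head Q \<alpha>) (act S \<alpha> s)"
      by (rule representsE) blast
    from r(2) obtain \<sigma>' z' where x': "\<xi>' \<in> ext1 Q S X" "z' \<in> \<xi>'"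
      and \<sigma>': "\<And>i. i \<in> verts Q \<Longrightarrow> linear_btw (scl S) (scl Y) (spc S i) (spc Y i) (\<sigma>' i)"
       "\<And>i s. i \<in> verts Q \<Longrightarrow> s \<in> spc S i \<Longrightarrow> \<pi> i (\<sigma>' i s) = s"
      and z': "\<And>\<alpha> s. \<alpha> \<in> arcs Q \<Longrightarrow> s \<in> spc S (tail Q \<alpha>) \<Longrightarrow>
          \<iota> (head Q \<alpha>) (z' \<alpha> s) = act Y \<alpha> (\<sigma>' (tail Q \<alpha>) s) - \<sigma>' (head Q \<alpha>) (act S \<alpha> s)"
      by (rule representsE) blast
    have "\<exists>g. linear_btw (scl S) (scl X) (spc S i) (spc X i) g \<and> (\<forall>s\<in>spc S i. \<iota> i (g s) = \<sigma>' i s - \<sigma> i s)"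
      if i: "i \<in> verts Q" for i
    proof (rule pull[OF i])
      show "linear_btw (scl S) (scl Y) (spc S i) (spc Y i) (\<lambda>s. \<sigma>' i s - \<sigma> i s)"
        using i \<sigma> \<sigma>' Y by (intro linear_btw_minus) auto
      fix s assume s: "s \<in> spc S i"
      show "\<pi> i (\<sigma>' i s - \<sigma> i s) = 0"
        using linear_btw_diff[OF \<pi>[OF i] Y(2) Y(3)[OF i], of "\<sigma>' i s" "\<sigma> i s"]
          linear_btwD(1)[OF \<sigma>(1)[OF i] s] linear_btwD(1)[OF \<sigma>'(1)[OF i] s] \<sigma>(2)[OF i s] \<sigma>'(2)[OF i s]
        by simp
    qed (use S i in auto)
    then obtain g where g: "\<And>i. i \<in> verts Q \<Longrightarrow> linear_btw (scl S) (scl X) (spc S i) (spc X i) (g i)"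
       "\<And>i s. i \<in> verts Q \<Longrightarrow> s \<in> spc S i \<Longrightarrow> \<iota> i (g i s) = \<sigma>' i s - \<sigma> i s" by metis
    have "z \<alpha> s - z' \<alpha> s = ext_diff Q S X g \<alpha> s" for \<alpha> s
    proof (cases "\<alpha> \<in> arcs Q \<and> s \<in> spc S (tail Q \<alpha>)")
      case True
      then have a: "\<alpha> \<in> arcs Q" and s: "s \<in> spc S (tail Q \<alpha>)" and h: "head Q \<alpha> \<in> verts Q" and t: "tail Q \<alpha> \<in> verts Q" by auto
      have gs: "g (tail Q \<alpha>) s \<in> spc X (tail Q \<alpha>)" and Ss: "act S \<alpha> s \<in> spc S (head Q \<alpha>)"
        using linear_btwD(1)[OF g(1)[OF t] s] linear_btwD(1)[OF S(4)[OF a] s] .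
      have m: "act X \<alpha> (g (tail Q \<alpha>) s) \<in> spc X (head Q \<alpha>)" "g (head Q \<alpha>) (act S \<alpha> s) \<in> spc X (head Q \<alpha>)"
        using linear_btwD(1)[OF X(4)[OF a] gs] linear_btwD(1)[OF g(1)[OF h] Ss] .
      have mz: "z \<alpha> s \<in> spc X (head Q \<alpha>)" "z' \<alpha> s \<in> spc X (head Q \<alpha>)" using ext1_mem_space[OF assms(1,4,2) x a s] ext1_mem_space[OF assms(1,4,2) x' a s] .
      note sub = X(3)[OF h] and li = linear_btw_diff[OF \<iota>[OF h] X(2) X(3)[OF h]]
      have m': "g (head Q \<alpha>) (act S \<alpha> s) - act X \<alpha> (g (tail Q \<alpha>) s) \<in> spc X (head Q \<alpha>)" "z \<alpha> s - z' \<alpha> s \<in> spc X (head Q \<alpha>)"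
        using module.subspace_diff[OF X(2) sub] m mz by auto
      have "\<iota> (head Q \<alpha>) (z \<alpha> s - z' \<alpha> s) = \<iota> (head Q \<alpha>) (g (head Q \<alpha>) (act S \<alpha> s) - act X \<alpha> (g (tail Q \<alpha>) s))"
        using linear_btw_diff[OF Y(4)[OF a] Y(2) Y(3)[OF t], of "\<sigma>' (tail Q \<alpha>) s" "\<sigma> (tail Q \<alpha>) s"]
          linear_btwD(1)[OF \<sigma>(1)[OF t] s] linear_btwD(1)[OF \<sigma>'(1)[OF t] s]
        by (simp add: li m mz z[OF a s] z'[OF a s] \<iota>h[OF a gs] g(2)[OF t s] g(2)[OF h Ss])
      then show ?thesis using inj_onD[OF inj[OF h]] m' True by (auto simp: ext_diff_def)
    next
      case False
      then show ?thesis using ext1_vanish[OF x] ext1_vanish[OF x'] by (auto simp: ext_diff_def)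
    qed
    then have "z - z' = ext_diff Q S X g" by (simp add: fun_eq_iff)
    then have "z - z' \<in> ext_coboundaries Q S X" using g(1) by (auto simp: ext_coboundaries_def)
    then have "z \<in> \<xi>'" using ext1_mem_iff[OF assms(1,4,2) x'] by simp
    then show "\<xi> = \<xi>'"
      using ext1_mem_iff[OF assms(1,4,2) x] ext1_mem_iff[OF assms(1,4,2) x'(1)] by blast
  qed
qed


lemma short_exactD:
  assumes "short_exact Q X Y S \<iota> \<pi>"
  shows "\<And>i. i \<in> verts Q \<Longrightarrow> linear_btw (scl X) (scl Y) (spc X i) (spc Y i) (\<iota> i)"
    and "\<And>i. i \<in> verts Q \<Longrightarrow> linear_btw (scl Y) (scl S) (spc Y i) (spc S i) (\<pi> i)"
    and "\<And>\<alpha> v. \<alpha> \<in> arcs Q \<Longrightarrow> v \<in> spc X (tail Q \<alpha>) \<Longrightarrow> \<iota> (head Q \<alpha>) (act X \<alpha> v) = act Y \<alpha> (\<iota> (tail Q \<alpha>) v)"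
    and "\<And>\<alpha> v. \<alpha> \<in> arcs Q \<Longrightarrow> v \<in> spc Y (tail Q \<alpha>) \<Longrightarrow> \<pi> (head Q \<alpha>) (act Y \<alpha> v) = act S \<alpha> (\<pi> (tail Q \<alpha>) v)"
    and "\<And>i. i \<in> verts Q \<Longrightarrow> inj_on (\<iota> i) (spc X i)"
    and "\<And>i. i \<in> verts Q \<Longrightarrow> \<iota> i ` spc X i = {y \<in> spc Y i. \<pi> i y = 0}"
  using assms by (simp_all add: short_exact_def rep_hom_def)

lemma rep_homD:
  assumes "rep_hom Q A B \<phi>"
  shows "\<And>i. i \<in> verts Q \<Longrightarrow> linear_btw (scl A) (scl B) (spc A i) (spc B i) (\<phi> i)"
    and "\<And>\<alpha> v. \<alpha> \<in> arcs Q \<Longrightarrow> v \<in> spc A (tail Q \<alpha>) \<Longrightarrow> \<phi> (head Q \<alpha>) (act A \<alpha> v) = act B \<alpha> (\<phi> (tail Q \<alpha>) v)"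
  using assms by (simp_all add: rep_hom_def)

lemma representsI:
  assumes "short_exact Q X Y S \<iota> \<pi>" "\<xi> \<in> ext1 Q S X" "z \<in> \<xi>"
    "\<And>i. i \<in> verts Q \<Longrightarrow> linear_btw (scl S) (scl Y) (spc S i) (spc Y i) (\<sigma> i)"
    "\<And>i s. i \<in> verts Q \<Longrightarrow> s \<in> spc S i \<Longrightarrow> \<pi> i (\<sigma> i s) = s"
    "\<And>\<alpha> s. \<alpha> \<in> arcs Q \<Longrightarrow> s \<in> spc S (tail Q \<alpha>) \<Longrightarrow>
       \<iota> (head Q \<alpha>) (z \<alpha> s) = act Y \<alpha> (\<sigma> (tail Q \<alpha>) s) - \<sigma> (head Q \<alpha>) (act S \<alpha> s)"
  shows "represents Q X Y S \<iota> \<pi> \<xi>"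
  unfolding represents_def using assms by (intro conjI exI[of _ \<sigma>] exI[of _ z]) simp_all

lemma ses_equiv_iff_represents:
  assumes "wf_digraph Q" "fd_rep Q X" "fd_rep Q Y" "fd_rep Q Y'" "fd_rep Q S"
    and "represents Q X Y S \<iota> \<pi> \<xi>" "short_exact Q X Y' S \<iota>' \<pi>'"
  shows "represents Q X Y' S \<iota>' \<pi>' \<xi> \<longleftrightarrow> (\<exists>\<theta>. rep_hom Q Y Y' \<theta> \<and>
     (\<forall>i\<in>verts Q. (\<forall>x\<in>spc X i. \<theta> i (\<iota> i x) = \<iota>' i x) \<and> (\<forall>y\<in>spc Y i. \<pi>' i (\<theta> i y) = \<pi> i y)))"
proof -
  interpret wf_digraph Q by fact
  note X = fd_repD[OF assms(2)] and Y = fd_repD[OF assms(3)] and Y' = fd_repD[OF assms(4)]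
    and S = fd_repD[OF assms(5)]
  from assms(6) have ex: "short_exact Q X Y S \<iota> \<pi>" by (simp add: represents_def)
  note E = short_exactD[OF ex] and E' = short_exactD[OF assms(7)]
  from assms(6) obtain \<sigma> z where \<xi>: "\<xi> \<in> ext1 Q S X" "z \<in> \<xi>"
      and \<sigma>: "\<And>i. i \<in> verts Q \<Longrightarrow> linear_btw (scl S) (scl Y) (spc S i) (spc Y i) (\<sigma> i)"
       "\<And>i s. i \<in> verts Q \<Longrightarrow> s \<in> spc S i \<Longrightarrow> \<pi> i (\<sigma> i s) = s"
      and z: "\<And>\<alpha> s. \<alpha> \<in> arcs Q \<Longrightarrow> s \<in> spc S (tail Q \<alpha>) \<Longrightarrow>
          \<iota> (head Q \<alpha>) (z \<alpha> s) = act Y \<alpha> (\<sigma> (tail Q \<alpha>) s) - \<sigma> (head Q \<alpha>) (act S \<alpha> s)"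
      by (rule representsE) blast
  note zX = ext1_mem_space[OF assms(1,5,2) \<xi>]
  show ?thesis
  proof
    assume "\<exists>\<theta>. rep_hom Q Y Y' \<theta> \<and>
     (\<forall>i\<in>verts Q. (\<forall>x\<in>spc X i. \<theta> i (\<iota> i x) = \<iota>' i x) \<and> (\<forall>y\<in>spc Y i. \<pi>' i (\<theta> i y) = \<pi> i y))"
    then obtain \<theta> where \<theta>0: "rep_hom Q Y Y' \<theta>"
      and \<theta>1: "\<And>i x. i \<in> verts Q \<Longrightarrow> x \<in> spc X i \<Longrightarrow> \<theta> i (\<iota> i x) = \<iota>' i x"
      and \<theta>2: "\<And>i y. i \<in> verts Q \<Longrightarrow> y \<in> spc Y i \<Longrightarrow> \<pi>' i (\<theta> i y) = \<pi> i y" by blast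
    note \<theta> = rep_homD[OF \<theta>0]
    show "represents Q X Y' S \<iota>' \<pi>' \<xi>"
    proof (rule representsI[OF assms(7) \<xi>, where \<sigma> = "\<lambda>i s. \<theta> i (\<sigma> i s)"])
      fix i assume i: "i \<in> verts Q"
      show "linear_btw (scl S) (scl Y') (spc S i) (spc Y' i) (\<lambda>s. \<theta> i (\<sigma> i s))"
        by (rule linear_btw_comp[OF \<sigma>(1)[OF i] \<theta>(1)[OF i]])
      fix s assume s: "s \<in> spc S i"
      show "\<pi>' i (\<theta> i (\<sigma> i s)) = s"
        using \<theta>2[OF i linear_btwD(1)[OF \<sigma>(1)[OF i] s]] \<sigma>(2)[OF i s] by simp
    next
      fix \<alpha> s assume a: "\<alpha> \<in> arcs Q" and s: "s \<in> spc S (tail Q \<alpha>)"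
      have h: "head Q \<alpha> \<in> verts Q" and t: "tail Q \<alpha> \<in> verts Q" using a by auto
      have \<sigma>s: "\<sigma> (tail Q \<alpha>) s \<in> spc Y (tail Q \<alpha>)" by (rule linear_btwD(1)[OF \<sigma>(1)[OF t] s])
      have "\<iota>' (head Q \<alpha>) (z \<alpha> s) = \<theta> (head Q \<alpha>) (act Y \<alpha> (\<sigma> (tail Q \<alpha>) s) - \<sigma> (head Q \<alpha>) (act S \<alpha> s))"
        using \<theta>1[OF h zX[OF a s]] z[OF a s] by simp
      also have "\<dots> = \<theta> (head Q \<alpha>) (act Y \<alpha> (\<sigma> (tail Q \<alpha>) s)) - \<theta> (head Q \<alpha>) (\<sigma> (head Q \<alpha>) (act S \<alpha> s))"
        by (intro linear_btw_diff[OF \<theta>(1)[OF h] Y(2) Y(3)[OF h]] linear_btwD(1)[OF Y(4)[OF a] \<sigma>s]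
            linear_btwD(1)[OF \<sigma>(1)[OF h]] linear_btwD(1)[OF S(4)[OF a] s])
      finally show "\<iota>' (head Q \<alpha>) (z \<alpha> s) =
          act Y' \<alpha> (\<theta> (tail Q \<alpha>) (\<sigma> (tail Q \<alpha>) s)) - \<theta> (head Q \<alpha>) (\<sigma> (head Q \<alpha>) (act S \<alpha> s))"
        using \<theta>(2)[OF a \<sigma>s] by simp
    qed
  next
    assume "represents Q X Y' S \<iota>' \<pi>' \<xi>"
    then obtain \<sigma>' z' where \<xi>': "\<xi> \<in> ext1 Q S X" "z' \<in> \<xi>"
      and \<sigma>': "\<And>i. i \<in> verts Q \<Longrightarrow> linear_btw (scl S) (scl Y') (spc S i) (spc Y' i) (\<sigma>' i)"
       "\<And>i s. i \<in> verts Q \<Longrightarrow> s \<in> spc S i \<Longrightarrow> \<pi>' i (\<sigma>' i s) = s"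
      and z': "\<And>\<alpha> s. \<alpha> \<in> arcs Q \<Longrightarrow> s \<in> spc S (tail Q \<alpha>) \<Longrightarrow>
          \<iota>' (head Q \<alpha>) (z' \<alpha> s) = act Y' \<alpha> (\<sigma>' (tail Q \<alpha>) s) - \<sigma>' (head Q \<alpha>) (act S \<alpha> s)"
      by (rule representsE) blast
    obtain \<phi> where \<phi>0: "z' - z = ext_diff Q S X \<phi>"
      and \<phi>: "\<And>i. i \<in> verts Q \<Longrightarrow> linear_btw (scl S) (scl X) (spc S i) (spc X i) (\<phi> i)"
      using ext1_mem_iff[OF assms(1,5,2) \<xi>, of z'] \<xi>'(2) by (auto simp: ext_coboundaries_def)
    define \<tau> where "\<tau> i s = \<sigma>' i s + \<iota>' i (\<phi> i s)" for i s
    have \<tau>: "linear_btw (scl S) (scl Y') (spc S i) (spc Y' i) (\<tau> i)" if i: "i \<in> verts Q" for i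
      unfolding \<tau>_def
      by (rule linear_btw_plus[OF \<sigma>'(1)[OF i] linear_btw_comp[OF \<phi>[OF i] E'(1)[OF i]] Y'(2) Y'(3)[OF i]])
    have \<pi>\<iota>': "\<iota>' i x \<in> spc Y' i" "\<pi>' i (\<iota>' i x) = 0" if "i \<in> verts Q" "x \<in> spc X i" for i x
      using E'(6)[OF that(1)] that(2) by blast+
    have \<pi>\<tau>: "\<pi>' i (\<tau> i s) = s" if i: "i \<in> verts Q" and s: "s \<in> spc S i" for i s
      unfolding \<tau>_def
      using linear_btwD(2)[OF E'(2)[OF i] linear_btwD(1)[OF \<sigma>'(1)[OF i] s] \<pi>\<iota>'(1)[OF i linear_btwD(1)[OF \<phi>[OF i] s]]]
        \<sigma>'(2)[OF i s] \<pi>\<iota>'(2)[OF i linear_btwD(1)[OF \<phi>[OF i] s]] by simp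
    have z\<tau>: "\<iota>' (head Q \<alpha>) (z \<alpha> s) = act Y' \<alpha> (\<tau> (tail Q \<alpha>) s) - \<tau> (head Q \<alpha>) (act S \<alpha> s)"
      if a: "\<alpha> \<in> arcs Q" and s: "s \<in> spc S (tail Q \<alpha>)" for \<alpha> s
    proof -
      have h: "head Q \<alpha> \<in> verts Q" and t: "tail Q \<alpha> \<in> verts Q" using a by auto
      have Ss: "act S \<alpha> s \<in> spc S (head Q \<alpha>)" by (rule linear_btwD(1)[OF S(4)[OF a] s])
      have \<phi>s: "\<phi> (tail Q \<alpha>) s \<in> spc X (tail Q \<alpha>)" by (rule linear_btwD(1)[OF \<phi>[OF t] s])
      have m: "\<phi> (head Q \<alpha>) (act S \<alpha> s) \<in> spc X (head Q \<alpha>)" "act X \<alpha> (\<phi> (tail Q \<alpha>) s) \<in> spc X (head Q \<alpha>)"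
        using linear_btwD(1)[OF \<phi>[OF h] Ss] linear_btwD(1)[OF X(4)[OF a] \<phi>s] .
      have e: "z' \<alpha> s - z \<alpha> s = \<phi> (head Q \<alpha>) (act S \<alpha> s) - act X \<alpha> (\<phi> (tail Q \<alpha>) s)"
        using fun_cong[OF fun_cong[OF \<phi>0], of \<alpha> s] a s by (simp add: ext_diff_def)
      note li = linear_btw_diff[OF E'(1)[OF h] X(2) X(3)[OF h]]
      have "\<iota>' (head Q \<alpha>) (z' \<alpha> s) - \<iota>' (head Q \<alpha>) (z \<alpha> s) =
          \<iota>' (head Q \<alpha>) (\<phi> (head Q \<alpha>) (act S \<alpha> s)) - \<iota>' (head Q \<alpha>) (act X \<alpha> (\<phi> (tail Q \<alpha>) s))"
        by (simp only: li[OF m, symmetric] e[symmetric]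
            li[OF ext1_mem_space[OF assms(1,5,2) \<xi>' a s] zX[OF a s]])
      moreover have "act Y' \<alpha> (\<tau> (tail Q \<alpha>) s) = act Y' \<alpha> (\<sigma>' (tail Q \<alpha>) s) + act Y' \<alpha> (\<iota>' (tail Q \<alpha>) (\<phi> (tail Q \<alpha>) s))"
        unfolding \<tau>_def
        by (rule linear_btwD(2)[OF Y'(4)[OF a] linear_btwD(1)[OF \<sigma>'(1)[OF t] s] \<pi>\<iota>'(1)[OF t \<phi>s]])
      ultimately show ?thesis
        by (simp add: \<tau>_def E'(3)[OF a \<phi>s] z'[OF a s] algebra_simps)
    qed
    have "\<exists>w. w \<in> spc X i \<and> \<iota> i w = y - \<sigma> i (\<pi> i y)" if i: "i \<in> verts Q" and y: "y \<in> spc Y i" for i y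
    proof -
      have \<pi>y: "\<pi> i y \<in> spc S i" by (rule linear_btwD(1)[OF E(2)[OF i] y])
      have \<sigma>y: "\<sigma> i (\<pi> i y) \<in> spc Y i" by (rule linear_btwD(1)[OF \<sigma>(1)[OF i] \<pi>y])
      have "\<pi> i (y - \<sigma> i (\<pi> i y)) = 0"
        using linear_btw_diff[OF E(2)[OF i] Y(2) Y(3)[OF i] y \<sigma>y] \<sigma>(2)[OF i \<pi>y] by simp
      then have "y - \<sigma> i (\<pi> i y) \<in> \<iota> i ` spc X i"
        unfolding E(6)[OF i] using module.subspace_diff[OF Y(2) Y(3)[OF i] y \<sigma>y] by simp
      then show ?thesis by (metis imageE)
    qed
    then obtain \<rho> where \<rho>: "\<And>i y. i \<in> verts Q \<Longrightarrow> y \<in> spc Y i \<Longrightarrow> \<rho> i y \<in> spc X i"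
      "\<And>i y. i \<in> verts Q \<Longrightarrow> y \<in> spc Y i \<Longrightarrow> \<iota> i (\<rho> i y) = y - \<sigma> i (\<pi> i y)" by metis
    have \<rho>_eq: "\<rho> i y = x" if "i \<in> verts Q" "y \<in> spc Y i" "x \<in> spc X i" "\<iota> i x + \<sigma> i (\<pi> i y) = y" for i x y
    proof (rule inj_onD[OF E(5)[OF that(1)]])
      have "\<iota> i x = y - \<sigma> i (\<pi> i y)" using that(4) by (simp add: eq_diff_eq)
      then show "\<iota> i (\<rho> i y) = \<iota> i x" using \<rho>(2)[OF that(1,2)] by simp
    qed (use that \<rho> in auto)
    have \<rho>l: "linear_btw (scl Y) (scl X) (spc Y i) (spc X i) (\<rho> i)" if i: "i \<in> verts Q" for i
      unfolding linear_btw_def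
    proof (intro conjI ballI allI funcsetI)
      note \<sigma>\<pi> = linear_btw_comp[OF E(2)[OF i] \<sigma>(1)[OF i]]
      fix y assume y: "y \<in> spc Y i"
      then show "\<rho> i y \<in> spc X i" by (rule \<rho>(1)[OF i])
      show "\<rho> i (scl Y c y) = scl X c (\<rho> i y)" for c
        by (rule \<rho>_eq[OF i module.subspace_scale[OF Y(2) Y(3)[OF i] y] module.subspace_scale[OF X(2) X(3)[OF i] \<rho>(1)[OF i y]]])
          (simp add: linear_btwD(3)[OF E(1)[OF i] \<rho>(1)[OF i y]] linear_btwD(3)[OF \<sigma>\<pi> y] \<rho>(2)[OF i y]
            module.scale_right_diff_distrib[OF Y(2)])
      fix y' assume y': "y' \<in> spc Y i"
      show "\<rho> i (y + y') = \<rho> i y + \<rho> i y'"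
        by (rule \<rho>_eq[OF i module.subspace_add[OF Y(2) Y(3)[OF i] y y']
              module.subspace_add[OF X(2) X(3)[OF i] \<rho>(1)[OF i y] \<rho>(1)[OF i y']]])
          (simp add: linear_btwD(2)[OF E(1)[OF i] \<rho>(1)[OF i y] \<rho>(1)[OF i y']] linear_btwD(2)[OF \<sigma>\<pi> y y']
            \<rho>(2)[OF i y] \<rho>(2)[OF i y'])
    qed
    define \<theta> where "\<theta> i y = \<iota>' i (\<rho> i y) + \<tau> i (\<pi> i y)" for i y
    have "rep_hom Q Y Y' \<theta>"
      unfolding rep_hom_def
    proof (intro conjI ballI)
      fix i assume i: "i \<in> verts Q"
      show "linear_btw (scl Y) (scl Y') (spc Y i) (spc Y' i) (\<theta> i)"
        unfolding \<theta>_def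
        by (rule linear_btw_plus[OF linear_btw_comp[OF \<rho>l[OF i] E'(1)[OF i]] linear_btw_comp[OF E(2)[OF i] \<tau>[OF i]] Y'(2) Y'(3)[OF i]])
    next
      fix \<alpha> y assume a: "\<alpha> \<in> arcs Q" and y: "y \<in> spc Y (tail Q \<alpha>)"
      have h: "head Q \<alpha> \<in> verts Q" and t: "tail Q \<alpha> \<in> verts Q" using a by auto
      define s where "s = \<pi> (tail Q \<alpha>) y"
      have s: "s \<in> spc S (tail Q \<alpha>)" unfolding s_def by (rule linear_btwD(1)[OF E(2)[OF t] y])
      have Ay: "act Y \<alpha> y \<in> spc Y (head Q \<alpha>)" by (rule linear_btwD(1)[OF Y(4)[OF a] y])
      have \<rho>y: "\<rho> (tail Q \<alpha>) y \<in> spc X (tail Q \<alpha>)" by (rule \<rho>(1)[OF t y])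
      have A\<rho>: "act X \<alpha> (\<rho> (tail Q \<alpha>) y) \<in> spc X (head Q \<alpha>)" by (rule linear_btwD(1)[OF X(4)[OF a] \<rho>y])
      have \<sigma>s: "\<sigma> (tail Q \<alpha>) s \<in> spc Y (tail Q \<alpha>)" by (rule linear_btwD(1)[OF \<sigma>(1)[OF t] s])
      have \<tau>s: "\<tau> (tail Q \<alpha>) s \<in> spc Y' (tail Q \<alpha>)" by (rule linear_btwD(1)[OF \<tau>[OF t] s])
      have \<rho>A: "\<rho> (head Q \<alpha>) (act Y \<alpha> y) = act X \<alpha> (\<rho> (tail Q \<alpha>) y) + z \<alpha> s"
      proof (rule \<rho>_eq[OF h Ay module.subspace_add[OF X(2) X(3)[OF h] A\<rho> zX[OF a s]]])
        have "act Y \<alpha> (\<iota> (tail Q \<alpha>) (\<rho> (tail Q \<alpha>) y)) = act Y \<alpha> y - act Y \<alpha> (\<sigma> (tail Q \<alpha>) s)"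
          unfolding \<rho>(2)[OF t y] s_def[symmetric]
          by (rule linear_btw_diff[OF Y(4)[OF a] Y(2) Y(3)[OF t] y \<sigma>s])
        then show "\<iota> (head Q \<alpha>) (act X \<alpha> (\<rho> (tail Q \<alpha>) y) + z \<alpha> s) + \<sigma> (head Q \<alpha>) (\<pi> (head Q \<alpha>) (act Y \<alpha> y)) = act Y \<alpha> y"
          by (simp add: linear_btwD(2)[OF E(1)[OF h] A\<rho> zX[OF a s]] E(3)[OF a \<rho>y] z[OF a s] E(4)[OF a y] s_def[symmetric])
      qed
      have "act Y' \<alpha> (\<theta> (tail Q \<alpha>) y) = act Y' \<alpha> (\<iota>' (tail Q \<alpha>) (\<rho> (tail Q \<alpha>) y)) + act Y' \<alpha> (\<tau> (tail Q \<alpha>) s)"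
        unfolding \<theta>_def s_def[symmetric] by (rule linear_btwD(2)[OF Y'(4)[OF a] \<pi>\<iota>'(1)[OF t \<rho>y] \<tau>s])
      then show "\<theta> (head Q \<alpha>) (act Y \<alpha> y) = act Y' \<alpha> (\<theta> (tail Q \<alpha>) y)"
        by (simp add: \<theta>_def \<rho>A linear_btwD(2)[OF E'(1)[OF h] A\<rho> zX[OF a s]] E'(3)[OF a \<rho>y] z\<tau>[OF a s]
            E(4)[OF a y] s_def[symmetric])
    qed
    moreover have "\<theta> i (\<iota> i x) = \<iota>' i x" if i: "i \<in> verts Q" and x: "x \<in> spc X i" for i x
    proof -
      have \<iota>x: "\<iota> i x \<in> spc Y i" "\<pi> i (\<iota> i x) = 0" using E(6)[OF i] x by blast+
      have "\<sigma> i 0 = 0" "\<tau> i 0 = 0"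
        using linear_btw_0[OF \<sigma>(1)[OF i] S(2) S(3)[OF i]] linear_btw_0[OF \<tau>[OF i] S(2) S(3)[OF i]] .
      then show ?thesis using \<rho>_eq[OF i \<iota>x(1) x] \<iota>x by (simp add: \<theta>_def)
    qed
    moreover have "\<pi>' i (\<theta> i y) = \<pi> i y" if i: "i \<in> verts Q" and y: "y \<in> spc Y i" for i y
    proof -
      have s: "\<pi> i y \<in> spc S i" by (rule linear_btwD(1)[OF E(2)[OF i] y])
      show ?thesis
        unfolding \<theta>_def
        using linear_btwD(2)[OF E'(2)[OF i] \<pi>\<iota>'(1)[OF i \<rho>(1)[OF i y]] linear_btwD(1)[OF \<tau>[OF i] s]]
          \<pi>\<iota>'(2)[OF i \<rho>(1)[OF i y]] \<pi>\<tau>[OF i s] by simp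
    qed
    ultimately show "\<exists>\<theta>. rep_hom Q Y Y' \<theta> \<and>
     (\<forall>i\<in>verts Q. (\<forall>x\<in>spc X i. \<theta> i (\<iota> i x) = \<iota>' i x) \<and> (\<forall>y\<in>spc Y i. \<pi>' i (\<theta> i y) = \<pi> i y))"
      by blast
  qed
qed

lemma ext1_represented:
  fixes X :: "('i, 'a, 'k::field, 'x::ab_group_add) qrep" and S :: "('i, 'a, 'k, 's::ab_group_add) qrep"
  assumes "wf_digraph Q" "fd_rep Q X" "fd_rep Q S" "\<xi> \<in> ext1 Q S X"
  shows "\<exists>(Y :: ('i, 'a, 'k, 'x \<times> 's) qrep) \<iota> \<pi>. fd_rep Q Y \<and> represents Q X Y S \<iota> \<pi> \<xi>"
proof -
  interpret wf_digraph Q by fact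
  note X = fd_repD[OF assms(2)] and S = fd_repD[OF assms(3)]
  interpret X: vector_space "scl X" by (rule X)
  interpret S: vector_space "scl S" by (rule S)
  obtain z where z: "z \<in> \<xi>" "z \<in> ext_cocycles Q S X" using ext1_cocycle_in[OF assms(1,3,2,4)] .
  then have zl: "\<And>\<alpha>. \<alpha> \<in> arcs Q \<Longrightarrow> linear_btw (scl S) (scl X) (spc S (tail Q \<alpha>)) (spc X (head Q \<alpha>)) (z \<alpha>)"
    by (simp add: ext_cocycles_def)
  define sc where "sc c w = (scl X c (fst w), scl S c (snd w))" for c and w :: "'x \<times> 's"
  define Y :: "('i, 'a, 'k, 'x \<times> 's) qrep" where
    "Y = \<lparr>scl = sc, spc = \<lambda>i. spc X i \<times> spc S i,
          act = \<lambda>\<alpha> w. (act X \<alpha> (fst w) + z \<alpha> (snd w), act S \<alpha> (snd w))\<rparr>"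
  have vs: "vector_space sc"
    by unfold_locales (auto simp: sc_def X.scale_right_distrib S.scale_right_distrib
        X.scale_left_distrib S.scale_left_distrib)
  interpret Y: vector_space sc by (rule vs)
  have l1: "module_hom (scl X) sc (\<lambda>x. (x, 0))" and l2: "module_hom (scl S) sc (\<lambda>s. (0, s))"
    by unfold_locales (auto simp: sc_def)
  have "fd_rep Q Y"
    unfolding fd_rep_def
  proof (intro conjI ballI)
    show "vector_space (scl Y)" using vs by (simp add: Y_def)
    fix i assume i: "i \<in> verts Q"
    obtain B C where B: "finite B" "spc X i = X.span B" and C: "finite C" "spc S i = S.span C"
      using assms(2,3) i unfolding fd_rep_def by metis
    have "Y.span ((\<lambda>x. (x, 0)) ` B \<union> (\<lambda>s. (0, s)) ` C) = spc X i \<times> spc S i"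
      unfolding Y.span_Un module_hom.span_image[OF l1] module_hom.span_image[OF l2] B(2) C(2)
      by force
    then show "\<exists>B. finite B \<and> spc Y i = module.span (scl Y) B"
      using B C by (intro exI[of _ "(\<lambda>x. (x, 0)) ` B \<union> (\<lambda>s. (0, s)) ` C"]) (simp add: Y_def)
  next
    fix \<alpha> assume a: "\<alpha> \<in> arcs Q"
    have h: "head Q \<alpha> \<in> verts Q" and t: "tail Q \<alpha> \<in> verts Q" using a by auto
    note f = linear_btwD[OF zl[OF a]] linear_btwD[OF X(4)[OF a]] linear_btwD[OF S(4)[OF a]]
    show "linear_btw (scl Y) (scl Y) (spc Y (tail Q \<alpha>)) (spc Y (head Q \<alpha>)) (act Y \<alpha>)"
      unfolding linear_btw_def Y_def
      using X.subspace_add[OF X(3)[OF h]]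
      by (auto simp: sc_def f X.scale_right_distrib)
  qed
  moreover have "represents Q X Y S (\<lambda>_ x. (x, 0)) (\<lambda>_. snd) \<xi>"
  proof (rule representsI[OF _ assms(4) z(1), where \<sigma> = "\<lambda>_ s. (0, s)"])
    have act0: "act S \<alpha> 0 = 0" "z \<alpha> 0 = 0" if a: "\<alpha> \<in> arcs Q" for \<alpha>
      using linear_btw_0[OF S(4)[OF a] S(2) S(3)[OF tail_in_verts[OF a]]]
        linear_btw_0[OF zl[OF a] S(2) S(3)[OF tail_in_verts[OF a]]] .
    have 0: "0 \<in> spc X i" "0 \<in> spc S i" if "i \<in> verts Q" for i
      using X.subspace_0[OF X(3)[OF that]] S.subspace_0[OF S(3)[OF that]] .
    show "short_exact Q X Y S (\<lambda>_ x. (x, 0)) (\<lambda>_. snd)"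
      unfolding short_exact_def rep_hom_def linear_btw_def Y_def
      using 0 by (auto simp: sc_def act0 inj_on_def image_iff)
    show "linear_btw (scl S) (scl Y) (spc S i) (spc Y i) (\<lambda>s. (0, s))" if "i \<in> verts Q" for i
      using 0[OF that] by (auto simp: linear_btw_def Y_def sc_def)
    have "act X \<alpha> 0 = 0" if a: "\<alpha> \<in> arcs Q" for \<alpha>
      using linear_btw_0[OF X(4)[OF a] X(2) X(3)[OF tail_in_verts[OF a]]] .
    then show "(z \<alpha> s, 0) = act Y \<alpha> (0, s) - (0, act S \<alpha> s)"
      if "\<alpha> \<in> arcs Q" "s \<in> spc S (tail Q \<alpha>)" for \<alpha> s
      using that by (simp add: Y_def)
  qed auto
  ultimately show ?thesis by blast
qed

lemma istopology_quot:
  "istopology (\<lambda>U. U \<subseteq> q ` topspace T \<and> openin T {x \<in> topspace T. q x \<in> U})"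
proof -
  have "{x \<in> topspace T. q x \<in> U \<inter> V} = {x \<in> topspace T. q x \<in> U} \<inter> {x \<in> topspace T. q x \<in> V}"
    for U V by auto
  moreover have "{x \<in> topspace T. q x \<in> \<Union>\<K>} = \<Union> ((\<lambda>U. {x \<in> topspace T. q x \<in> U}) ` \<K>)" for \<K>
    by auto
  ultimately show ?thesis
    unfolding istopology_def by (auto simp del: Union_iff intro: openin_Union)
qed

lemma openin_quot_spc:
  "openin (zar (quot_spc A q)) U \<longleftrightarrow>
     U \<subseteq> q ` topspace (zar A) \<and> openin (zar A) {x \<in> topspace (zar A). q x \<in> U}"
  by (simp add: quot_spc_def istopology_quot)

lemma topspace_zar_space: "topspace (zar (zar_space P C)) = P"
proof -
  let ?D = "{{x \<in> P. p x \<noteq> 0} | p. p \<in> poly_funs C}"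
  have "P = {x \<in> P. (\<lambda>_. 1) x \<noteq> (0 :: 'b)}" by simp
  then have "P \<in> ?D" by (intro CollectI exI[of _ "\<lambda>_. 1 :: 'b"] conjI poly_funs.const)
  then have "P \<subseteq> \<Union>?D" by (rule Union_upper)
  moreover have "\<Union>?D \<subseteq> P" by (rule Union_least) auto
  ultimately have "\<Union>?D = P" by (rule antisym[rotated])
  then show ?thesis by (simp add: zar_space_def topology_generated_by_topspace)
qed

lemma topspace_quot_spc: "topspace (zar (quot_spc A q)) = q ` topspace (zar A)"
proof
  show "topspace (zar (quot_spc A q)) \<subseteq> q ` topspace (zar A)"
    using openin_topspace[of "zar (quot_spc A q)"] by (simp only: openin_quot_spc)
  have "{x \<in> topspace (zar A). q x \<in> q ` topspace (zar A)} = topspace (zar A)" by auto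
  then have "openin (zar (quot_spc A q)) (q ` topspace (zar A))"
    unfolding openin_quot_spc by (simp only: openin_topspace subset_refl simp_thms)
  then show "q ` topspace (zar A) \<subseteq> topspace (zar (quot_spc A q))" by (rule openin_subset)
qed

lemma topspace_Gr_spc:
  assumes "fd_rep Q M"
  shows "topspace (zar (Gr_spc Q M e)) = Gr Q M e"
proof -
  interpret vector_space "scl M" using assms by (simp add: fd_rep_def)
  have "N \<in> frame_span Q M e ` frames Q M e" if N: "N \<in> Gr Q M e" for N
  proof -
    have "\<exists>c. bij_betw c {..<e i} (c ` {..<e i}) \<and> c ` {..<e i} \<subseteq> N i \<and> independent (c ` {..<e i}) \<and>
        span (c ` {..<e i}) = N i" if i: "i \<in> verts Q" for i
    proof -
      have sub: "subspace (N i)" "N i \<subseteq> spc M i" "dim (N i) = e i"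
        using N i by (auto simp: Gr_def subrep_def dimvec_def)
      obtain B where B: "B \<subseteq> N i" "independent B" "N i \<subseteq> span B" "card B = dim (N i)"
        by (rule basis_exists)
      obtain F where "finite F" "spc M i = span F" using assms i by (auto simp: fd_rep_def)
      then have "finite B" using independent_span_bound[of F B] B sub by auto
      then obtain c where "bij_betw c {..<e i} B"
        using ex_bij_betw_nat_finite[of B] B(4) sub(3) by (auto simp: atLeast0LessThan)
      then show ?thesis
        using B sub(1) by (intro exI[of _ c]) (auto simp: bij_betw_imp_surj_on span_subspace)
    qed
    then obtain c where c: "\<And>i. i \<in> verts Q \<Longrightarrow> inj_on (c i) {..<e i}"
      "\<And>i. i \<in> verts Q \<Longrightarrow> c i ` {..<e i} \<subseteq> N i"
      "\<And>i. i \<in> verts Q \<Longrightarrow> independent (c i ` {..<e i})"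
      "\<And>i. i \<in> verts Q \<Longrightarrow> span (c i ` {..<e i}) = N i"
      unfolding bij_betw_def by metis
    define b where "b = (\<lambda>(i, k)\<in>(SIGMA i:verts Q. {..<e i}). c i k)"
    have b: "b (i, k) = c i k" if "i \<in> verts Q" "k < e i" for i k using that by (simp add: b_def)
    have img: "(\<lambda>k. b (i, k)) ` {..<e i} = c i ` {..<e i}" if "i \<in> verts Q" for i
      using b that by (auto simp: image_iff)
    have "N i \<subseteq> spc M i" if "i \<in> verts Q" for i using N that by (auto simp: Gr_def subrep_def)
    then have "b \<in> (\<Pi>\<^sub>E (i, k)\<in>(SIGMA i:verts Q. {..<e i}). spc M i)"
      using c(2) unfolding b_def by (intro PiE_I) (auto simp: subset_iff)
    moreover have "inj_on (\<lambda>k. b (i, k)) {..<e i}" if "i \<in> verts Q" for i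
      using c(1)[OF that] b that by (simp add: inj_on_def)
    ultimately have "b \<in> frames Q M e" using c(3) by (simp add: frames_def img)
    moreover have "frame_span Q M e b = N"
      unfolding frame_span_def using c(4) N by (intro ext) (auto simp: img Gr_def subrep_def)
    ultimately show ?thesis by blast
  qed
  then have "Gr Q M e \<subseteq> frame_span Q M e ` frames Q M e" by blast
  then show ?thesis
    by (auto simp: Gr_spc_def subspc_def grass_spc_def topspace_quot_spc topspace_zar_space)
qed

lemma topspace_prod_spc:
  fixes A :: "('p, 'k::field) fn_space" and B :: "('q, 'k) fn_space"
  assumes "(\<lambda>_. 1) \<in> reg A (topspace (zar A))" "(\<lambda>_. 1) \<in> reg B (topspace (zar B))"
  shows "topspace (zar (prod_spc A B)) = topspace (zar A) \<times> topspace (zar B)"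
proof
  let ?D = "{{w \<in> U \<times> V. h w \<noteq> 0} | U V h.
          openin (zar A) U \<and> openin (zar B) V \<and> h \<in> tensor_funs A B U V}"
  have top: "topspace (zar (prod_spc A B)) = \<Union>?D"
    by (simp add: prod_spc_def topology_generated_by_topspace)
  show "topspace (zar (prod_spc A B)) \<subseteq> topspace (zar A) \<times> topspace (zar B)"
    unfolding top
  proof (rule Union_least)
    fix W assume "W \<in> ?D"
    then obtain U V where "openin (zar A) U" "openin (zar B) V" "W \<subseteq> U \<times> V"
      by (elim CollectE exE conjE) (rule that, assumption, assumption, erule ssubst, rule Collect_restrict)
    then show "W \<subseteq> topspace (zar A) \<times> topspace (zar B)"
      by (meson Sigma_mono openin_subset order_trans)
  qed
  define h :: "'p \<times> 'q \<Rightarrow> 'k" where "h = (\<lambda>(x, y). \<Sum>k<(1::nat). 1 * 1)"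
  have hT: "h \<in> tensor_funs A B (topspace (zar A)) (topspace (zar B))"
    unfolding tensor_funs_def h_def
    by (rule CollectI, rule exI[of _ "1::nat"], rule exI[of _ "\<lambda>_ _. 1"], rule exI[of _ "\<lambda>_ _. 1"])
      (simp add: assms)
  have "{w \<in> topspace (zar A) \<times> topspace (zar B). h w \<noteq> 0} \<in> ?D"
    by (rule CollectI, intro exI)
      (rule conjI[OF refl conjI[OF openin_topspace conjI[OF openin_topspace hT]]])
  moreover have "{w \<in> topspace (zar A) \<times> topspace (zar B). h w \<noteq> 0} = topspace (zar A) \<times> topspace (zar B)"
    by (auto simp: h_def)
  ultimately have "topspace (zar A) \<times> topspace (zar B) \<in> ?D" by (simp only:)
  then show "topspace (zar A) \<times> topspace (zar B) \<subseteq> topspace (zar (prod_spc A B))"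
    unfolding top by (rule Union_upper)
qed

lemma const_reg_Gr_spc:
  fixes M :: "('i, 'a, 'k::field, 'v::ab_group_add) qrep"
  shows "(\<lambda>_. c) \<in> reg (Gr_spc Q M e) (topspace (zar (Gr_spc Q M e)))"
proof -
  have "(\<lambda>_. c) \<in> reg (zar_space P C) U" for P U and C :: "('p \<Rightarrow> 'k) set" and c
    unfolding zar_space_def fn_space.simps
    by (intro CollectI ballI bexI[of _ "\<lambda>_. c"] bexI[of _ "\<lambda>_. 1"] poly_funs.const) simp
  then have g: "(\<lambda>_. c) \<in> reg (grass_spc Q M e) V" for V
    by (simp add: grass_spc_def quot_spc_def comp_def)
  show ?thesis
  proof -
    let ?T = "topspace (zar (grass_spc Q M e))"
    have "\<forall>x\<in>topspace (zar (Gr_spc Q M e)). openin (zar (grass_spc Q M e)) ?T \<and> x \<in> ?T \<and>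
        (\<lambda>_. c) \<in> reg (grass_spc Q M e) ?T \<and> (\<forall>y\<in>topspace (zar (Gr_spc Q M e)) \<inter> ?T. c = c)"
      using g by (simp add: Gr_spc_def subspc_def)
    then show ?thesis unfolding Gr_spc_def subspc_def fn_space.simps by blast
  qed
qed

end

theory Submission
  imports Defs "Jordan_Normal_Form.Determinant"
begin

text \<open>
  Write the extension as a cocycle: a family \<open>z\<close> of linear maps \<open>S\<^bsub>tail \<alpha>\<^esub> \<rightarrow> X\<^bsub>head \<alpha>\<^esub>\<close>, so that
  \<open>Y\<close> is \<open>X \<oplus> S\<close> with the action of \<open>\<alpha>\<close> twisted by \<open>z \<alpha>\<close>. A pair \<open>(N', N'')\<close> of
  subrepresentations of \<open>X\<close> and \<open>S\<close> is in the image of \<open>\<Psi>\<close> exactly if the class of \<open>z\<close> becomes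
  zero in \<open>Ext\<^sup>1(N'', X/N')\<close> (predicate \<open>split\<close>): a subrepresentation of \<open>Y\<close> over the pair is
  the graph of a linear map \<open>N'' \<rightarrow> X/N'\<close>, and it is stable under the action exactly if this map
  bounds \<open>z\<close>.

  For the image, linear maps extend from \<open>N''\<close> to \<open>S\<close> and lift from \<open>X/N'\<close> to \<open>X\<close>, and a cochain
  on arrows need not satisfy any condition; hence \<open>Ext\<^sup>1(S, X) \<rightarrow> Ext\<^sup>1(N'', X/N')\<close> is onto. As
  \<open>z\<close> generates the source, this map is zero if the pair splits and is injective if it does not.
  From this, \<open>z\<close> survives in \<open>Ext\<^sup>1(N'', X/N')\<close> if and only if it survives in \<open>Ext\<^sup>1(S, X/N')\<close>
  and in \<open>Ext\<^sup>1(N'', X)\<close> (\<open>not_split_iff\<close>). The first condition depends only on \<open>N'\<close> and is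
  stable under sums, the second depends only on \<open>N''\<close> and is stable under intersections, so they
  say \<open>N' \<subseteq> X\<^sub>S\<close> and \<open>S\<^sup>X \<subseteq> N''\<close> (\<open>upper_sub\<close>, \<open>lower_sub\<close>).

  For the bundle, fix a point \<open>(N\<^sub>0', N\<^sub>0'')\<close> of the image and complements \<open>C'\<close>, \<open>C''\<close> of its
  members. On the open set of pairs that still have these complements, the subrepresentations
  over \<open>x = (N', N'')\<close> correspond to the solutions \<open>\<psi> \<in> \<Oplus>\<^bsub>i\<^esub> Hom(N\<^sub>0''\<^sub>i, C'\<^sub>i)\<close> of a linear
  system \<open>L\<^sub>x \<psi> = R\<^sub>x\<close> with values in \<open>\<Oplus>\<^bsub>\<alpha>\<^esub> Hom(N\<^sub>0''\<^bsub>tail \<alpha>\<^esub>, C'\<^bsub>head \<alpha>\<^esub>)\<close> (\<open>psi_equation\<close>,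
  \<open>NN_subrep\<close>), whose coefficients are polynomials in the coordinates of the two Grassmannians
  (\<open>L_poly\<close>, \<open>Rh_poly\<close>). At the chosen point \<open>L\<close> is onto, because splitting kills all of
  \<open>Ext\<^sup>1(N\<^sub>0'', X/N\<^sub>0')\<close> (\<open>L_base_surj\<close>). Where a maximal minor stays nonzero, Cramer's rule
  solves the system with the remaining unknowns as free parameters, and this is an algebraic
  trivialisation with fibre the affine space of dimension
  \<open>dim \<Oplus>\<^bsub>i\<^esub> Hom(N\<^sub>0''\<^sub>i, C'\<^sub>i) - dim \<Oplus>\<^bsub>\<alpha>\<^esub> Hom(N\<^sub>0''\<^bsub>tail \<alpha>\<^esub>, C'\<^bsub>head \<alpha>\<^esub>) = \<langle>g, dim X - f\<rangle>\<close>.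

  Quiver Grassmannians are built as subspaces of quotients of subsets of affine spaces. Two
  notions make them computable: \<open>geometric\<close> collects the closure properties of a sheaf of
  regular functions, and \<open>chart A U C\<close> says that on \<open>U\<close> everything is locally a fraction of
  polynomials in the functions \<open>C\<close>. For charts, a map is a morphism as soon as it pulls the
  coordinates back to regular functions (\<open>morphism_chartI\<close>, \<open>isomorphism_chartI\<close>); the charts of
  a Grassmannian are the sets of subspaces with a given complement (\<open>chart_Gr_spc\<close>).
\<close>

section \<open>Finite-dimensional subspaces and coordinate systems\<close>

definition fd_sub :: "('k::field \<Rightarrow> 'v::ab_group_add \<Rightarrow> 'v) \<Rightarrow> 'v set \<Rightarrow> bool" where
  "fd_sub s V \<longleftrightarrow> module.subspace s V \<and> (\<exists>B. finite B \<and> V \<subseteq> module.span s B)"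

text \<open>
  A finite basis \<open>E\<close> of the subspace \<open>V\<close> together with its dual basis \<open>\<kappa>\<close>. The scalar
  multiplication is an argument because the spaces of a representation are subspaces of a type
  that carries no vector space class.
\<close>

definition coords :: "('k::field \<Rightarrow> 'v::ab_group_add \<Rightarrow> 'v) \<Rightarrow> 'v set \<Rightarrow> 'j set \<Rightarrow> ('j \<Rightarrow> 'v)
    \<Rightarrow> ('j \<Rightarrow> 'v \<Rightarrow> 'k) \<Rightarrow> bool" where
  "coords s V I E \<kappa> \<longleftrightarrow> finite I \<and> (\<forall>i\<in>I. E i \<in> V \<and> linear_btw s (*) V UNIV (\<kappa> i)) \<and>
     (\<forall>v\<in>V. v = (\<Sum>i\<in>I. s (\<kappa> i v) (E i))) \<and> (\<forall>i\<in>I. \<forall>j\<in>I. \<kappa> i (E j) = (if i = j then 1 else 0))"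

lemma vector_space_times: "vector_space ((*) :: 'k::field \<Rightarrow> 'k \<Rightarrow> 'k)"
  by unfold_locales (auto simp: algebra_simps)

lemma linear_imp_btw:
  assumes "Vector_Spaces.linear s t f" "f ` V \<subseteq> W"
  shows "linear_btw s t V W f"
  using assms by (auto simp: linear_btw_def Vector_Spaces.linear_iff)

lemma linear_btw_mono:
  assumes "linear_btw s t V W f" "V' \<subseteq> V" "f ` V' \<subseteq> W'"
  shows "linear_btw s t V' W' f"
  using assms unfolding linear_btw_def by blast

lemma linear_btw_sum:
  assumes f: "linear_btw s t V W f" and s: "Modules.module s" and V: "module.subspace s V"
    and x: "\<And>i. i \<in> I \<Longrightarrow> x i \<in> V"
  shows "f (\<Sum>i\<in>I. x i) = (\<Sum>i\<in>I. f (x i))"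
proof (cases "finite I")
  case True
  have "f (\<Sum>i\<in>I. x i) = (\<Sum>i\<in>I. f (x i)) \<and> (\<Sum>i\<in>I. x i) \<in> V"
    using True x
  proof (induction I)
    case empty
    then show ?case using linear_btw_0[OF f s V] module.subspace_0[OF s V] by simp
  next
    case (insert i I)
    then show ?case using linear_btwD(2)[OF f] module.subspace_add[OF s V] by simp
  qed
  then show ?thesis ..
qed (simp add: linear_btw_0[OF f s V])

lemma linear_btw_lincomb:
  assumes f: "linear_btw s t V W f" and s: "Modules.module s" and V: "module.subspace s V"
    and x: "\<And>i. i \<in> I \<Longrightarrow> x i \<in> V"
  shows "f (\<Sum>i\<in>I. s (c i) (x i)) = (\<Sum>i\<in>I. t (c i) (f (x i)))"
proof -
  have "f (\<Sum>i\<in>I. s (c i) (x i)) = (\<Sum>i\<in>I. f (s (c i) (x i)))"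
    using x by (intro linear_btw_sum[OF f s V] module.subspace_scale[OF s V])
  also have "\<dots> = (\<Sum>i\<in>I. t (c i) (f (x i)))"
    using x by (intro sum.cong refl linear_btwD(3)[OF f])
  finally show ?thesis .
qed

lemma linear_btw_extend:
  assumes "vector_space s" "vector_space t" "module.subspace s V" "linear_btw s t V W f"
    "module.subspace t W"
  obtains F where "Vector_Spaces.linear s t F" "\<And>v. v \<in> V \<Longrightarrow> F v = f v" "\<And>v. F v \<in> W"
proof -
  interpret vector_space_pair s t using assms by (simp add: vector_space_pair_def)
  obtain B where B: "B \<subseteq> V" "vs1.independent B" "V \<subseteq> vs1.span B"
    by (rule vs1.maximal_independent_subset)
  obtain F where F: "Vector_Spaces.linear s t F" "\<forall>x\<in>B. F x = f x" "range F = vs2.span (f ` B)"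
    using linear_independent_extend_subspace[OF B(2), of f] by blast
  interpret F: Vector_Spaces.linear s t F by fact
  have "F v = f v" if "v \<in> V" for v
  proof -
    have "v \<in> vs1.span B" using B that by blast
    then have "F v = f v \<and> v \<in> V"
    proof (induction rule: vs1.span_induct_alt)
      case base
      then show ?case using assms by (simp add: linear_btw_0 vs1.module_axioms vs1.subspace_0 F.zero)
    next
      case (step c x y)
      then have "s c x \<in> V" using assms B by (auto intro: vs1.subspace_scale)
      then show ?case
        using step linear_btwD(2,3)[OF assms(4)] B F(2) assms(3)
        by (auto simp: F.add F.scale intro: vs1.subspace_add)
    qed
    then show ?thesis ..
  qed
  moreover have "F v \<in> W" for v
  proof -
    have "f ` B \<subseteq> W" using linear_btwD(1)[OF assms(4)] B by auto
    then have "vs2.span (f ` B) \<subseteq> W" using assms by (simp add: vs2.span_minimal)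
    then show ?thesis using F(3) by blast
  qed
  ultimately show ?thesis using that F(1) by blast
qed

text \<open>
  The sum of \<open>V1\<close> and \<open>V2\<close> need not be direct: project along \<open>V2\<close> and choose preimages in \<open>V1\<close>
  linearly.
\<close>

lemma (in vector_space) projection_onto_summand:
  assumes "subspace V1" "subspace V2"
  shows "\<exists>p. Vector_Spaces.linear scale scale p \<and> (\<forall>x. p x \<in> V1) \<and> (\<forall>x\<in>{a + b | a b. a \<in> V1 \<and> b \<in> V2}. x - p x \<in> V2)"
proof -
  interpret vector_space_pair scale scale ..
  let ?V = "{a + b | a b. a \<in> V1 \<and> b \<in> V2}"
  have V: "subspace ?V" by (rule subspace_sums[OF assms])
  have V2: "V2 \<subseteq> ?V" using subspace_0[OF assms(1)] by force
  have V1: "V1 \<subseteq> ?V" using subspace_0[OF assms(2)] by force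
  obtain W where W: "W = ?V" by simp
  obtain r where "Vector_Spaces.linear scale scale r" "\<And>x. x \<in> W \<Longrightarrow> r x \<in> W" "\<And>x. x \<in> W \<Longrightarrow> x - r x \<in> V2" "\<And>x. x \<in> V2 \<Longrightarrow> r x = 0"
    using complement_projection[OF vector_space_axioms V[folded W] assms(2) V2[folded W]] by metis
  note r = this[unfolded W]
  interpret r: Vector_Spaces.linear scale scale r by fact
  obtain g where g: "range g \<subseteq> V1" "Vector_Spaces.linear scale scale g" "\<forall>v\<in>r ` V1. r (g v) = v"
    using linear_exists_right_inverse_on[OF r(1) assms(1)] by blast
  interpret g: Vector_Spaces.linear scale scale g by fact
  have "x - g (r x) \<in> V2" if "x \<in> ?V" for x
  proof -
    obtain a b where ab: "x = a + b" "a \<in> V1" "b \<in> V2" using \<open>x \<in> ?V\<close> by blast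
    have rx: "r x = r a" using ab r(4) by (simp add: r.add)
    then have "r (g (r x)) = r x" using g(3) ab by auto
    moreover have "x - g (r x) \<in> ?V" using g(1) subsetD[OF V1] by (intro subspace_diff[OF V \<open>x \<in> ?V\<close>]) blast
    ultimately show ?thesis using r(3)[of "x - g (r x)"] by (simp add: r.diff)
  qed
  moreover have "Vector_Spaces.linear scale scale (\<lambda>x. g (r x))"
    by unfold_locales (simp_all add: r.add g.add r.scale g.scale)
  ultimately show ?thesis using g(1) by (intro exI[of _ "\<lambda>x. g (r x)"]) blast
qed

text \<open>
  Zero on \<open>V1\<close> and \<open>h\<close> on \<open>V2\<close> agree on the intersection, hence glue to a linear map on the sum,
  which extends to the whole space without enlarging the range.
\<close>

lemma (in vector_space_pair) linear_common_extension:
  assumes V1: "vs1.subspace V1" and V2: "vs1.subspace V2" and h: "linear_btw s1 s2 V2 UNIV h"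
    and 0: "\<And>s. s \<in> V1 \<Longrightarrow> s \<in> V2 \<Longrightarrow> h s = 0"
  shows "\<exists>g. Vector_Spaces.linear s1 s2 g \<and> (\<forall>s\<in>V1. g s = 0) \<and> (\<forall>s\<in>V2. g s = h s) \<and> range g \<subseteq> vs2.span (h ` V2)"
proof -
  interpret SS: vector_space_pair s1 s1 ..
  have "linear_btw s1 s2 V2 (vs2.span (h ` V2)) h"
    by (rule linear_btw_mono[OF h]) (auto intro: vs2.span_base)
  from linear_btw_extend[OF vs1.vector_space_axioms vs2.vector_space_axioms V2 this vs2.subspace_span]
  obtain H where H: "Vector_Spaces.linear s1 s2 H" "\<And>v. v \<in> V2 \<Longrightarrow> H v = h v" "\<And>v. H v \<in> vs2.span (h ` V2)" by blast
  interpret H: Vector_Spaces.linear s1 s2 H by fact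
  obtain r where r: "Vector_Spaces.linear s1 s1 r" "\<And>x. x - r x \<in> V1" "\<And>x. x \<in> V1 \<Longrightarrow> r x = 0"
    using complement_projection[OF vs1.vector_space_axioms vs1.subspace_UNIV V1] by auto
  interpret r: Vector_Spaces.linear s1 s1 r by fact
  obtain g where g: "range g \<subseteq> V2" "Vector_Spaces.linear s1 s1 g" "\<forall>v\<in>r ` V2. r (g v) = v"
    using SS.linear_exists_right_inverse_on[OF r(1) V2] by blast
  interpret g: Vector_Spaces.linear s1 s1 g by fact
  have "H (g (r s)) = h s" if s: "s \<in> V2" for s
  proof -
    have gs: "g (r s) \<in> V2" using g(1) by auto
    have "r (g (r s) - s) = 0" using g(3) s by (simp add: r.diff)
    then have "g (r s) - s \<in> V1" using r(2)[of "g (r s) - s"] by simp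
    moreover have "g (r s) - s \<in> V2" using vs1.subspace_diff[OF V2 gs s] .
    ultimately have "H (g (r s) - s) = 0" using 0 H(2) by simp
    then show ?thesis using H(2)[OF s] by (simp add: H.diff)
  qed
  moreover have "H (g (r s)) = 0" if "s \<in> V1" for s using r(3)[OF that] by (simp add: g.zero H.zero)
  moreover have "Vector_Spaces.linear s1 s2 (\<lambda>s. H (g (r s)))"
    by unfold_locales (simp_all add: r.add g.add H.add r.scale g.scale H.scale)
  ultimately show ?thesis using H(3) by (intro exI[of _ "\<lambda>s. H (g (r s))"]) auto
qed

lemma coordsD:
  assumes "coords s V I E \<kappa>"
  shows "finite I" "\<And>i. i \<in> I \<Longrightarrow> E i \<in> V" "\<And>i. i \<in> I \<Longrightarrow> linear_btw s (*) V UNIV (\<kappa> i)"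
    "\<And>v. v \<in> V \<Longrightarrow> (\<Sum>i\<in>I. s (\<kappa> i v) (E i)) = v"
    "\<And>i j. i \<in> I \<Longrightarrow> j \<in> I \<Longrightarrow> \<kappa> i (E j) = (if i = j then 1 else 0)"
  using assms unfolding coords_def by metis+

lemma coords_comb:
  assumes "coords s V I E \<kappa>" "Modules.module s" "module.subspace s V" "j \<in> I"
  shows "\<kappa> j (\<Sum>i\<in>I. s (a i) (E i)) = a j"
proof -
  note c = coordsD[OF assms(1)]
  have "\<kappa> j (\<Sum>i\<in>I. s (a i) (E i)) = (\<Sum>i\<in>I. a i * \<kappa> j (E i))"
    using c(2) by (rule linear_btw_lincomb[OF c(3)[OF assms(4)] assms(2,3)])
  also have "\<dots> = (\<Sum>i\<in>I. if i = j then a i else 0)"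
    using c(5)[OF assms(4)] by (intro sum.cong) auto
  also have "\<dots> = a j" using c(1) assms(4) by simp
  finally show ?thesis .
qed

lemma coords_eqI:
  assumes "coords s V I E \<kappa>" "v \<in> V" "w \<in> V" "\<And>i. i \<in> I \<Longrightarrow> \<kappa> i v = \<kappa> i w"
  shows "v = w"
proof -
  have "v = (\<Sum>i\<in>I. s (\<kappa> i v) (E i))" using coordsD(4)[OF assms(1,2)] by simp
  also have "\<dots> = (\<Sum>i\<in>I. s (\<kappa> i w) (E i))" using assms(4) by simp
  finally show ?thesis using coordsD(4)[OF assms(1,3)] by simp
qed

lemma linear_btw_expand:
  assumes "coords s V I E \<kappa>" "Modules.module s" "module.subspace s V" "linear_btw s t V W f" "v \<in> V"
  shows "f v = (\<Sum>i\<in>I. t (\<kappa> i v) (f (E i)))"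
proof -
  note c = coordsD[OF assms(1)]
  have "f v = f (\<Sum>i\<in>I. s (\<kappa> i v) (E i))" using c(4)[OF assms(5)] by simp
  also have "\<dots> = (\<Sum>i\<in>I. t (\<kappa> i v) (f (E i)))"
    using c(2) by (rule linear_btw_lincomb[OF assms(4,2,3)])
  finally show ?thesis .
qed

lemma coords_span:
  assumes "vector_space s" "module.subspace s V" "coords s V I E \<kappa>"
  shows "module.span s (E ` I) = V" "inj_on E I" "\<not> module.dependent s (E ` I)"
proof -
  interpret vector_space s by fact
  note c = coordsD[OF assms(3)]
  show "span (E ` I) = V"
  proof
    show "span (E ` I) \<subseteq> V" using c(2) assms(2) by (intro span_minimal) auto
    show "V \<subseteq> span (E ` I)"
    proof
      fix v assume v: "v \<in> V"
      have "(\<Sum>i\<in>I. s (\<kappa> i v) (E i)) \<in> span (E ` I)"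
        by (intro span_sum span_scale span_base) auto
      then show "v \<in> span (E ` I)" using c(4)[OF v] by simp
    qed
  qed
  show inj: "inj_on E I"
    by (rule inj_onI) (metis c(5) zero_neq_one)
  show "independent (E ` I)"
  proof (rule independent_if_scalars_zero)
    show "finite (E ` I)" using c(1) by simp
    fix f x assume s0: "(\<Sum>x\<in>E ` I. s (f x) x) = 0" and x: "x \<in> E ` I"
    then obtain j where j: "j \<in> I" "x = E j" by auto
    have "f (E j) = \<kappa> j (\<Sum>i\<in>I. s (f (E i)) (E i))"
      using coords_comb[OF assms(3) module_axioms assms(2) j(1), of "\<lambda>i. f (E i)"] by simp
    also have "(\<Sum>i\<in>I. s (f (E i)) (E i)) = 0" using s0 by (simp add: sum.reindex[OF inj])
    also have "\<kappa> j 0 = 0" by (rule linear_btw_0[OF c(3)[OF j(1)] module_axioms assms(2)])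
    finally show "f x = 0" using j by simp
  qed
qed

lemma coords_dim:
  assumes "vector_space s" "module.subspace s V" "coords s V I E \<kappa>"
  shows "vector_space.dim s V = card I" "fd_sub s V"
proof -
  interpret vector_space s by fact
  note c = coordsD[OF assms(3)] and sp = coords_span[OF assms]
  show "dim V = card I"
    using dim_span_eq_card_independent[OF sp(3)] sp card_image[OF sp(2)] by simp
  show "fd_sub s V" unfolding fd_sub_def using c(1) sp(1) assms(2) by blast
qed

lemma coords_of_independent:
  assumes "vector_space s" "finite I" "inj_on E I" "\<not> module.dependent s (E ` I)"
  shows "\<exists>\<kappa>. coords s (module.span s (E ` I)) I E \<kappa>"
proof -
  interpret vector_space s by fact
  let ?\<kappa> = "\<lambda>i v. representation (E ` I) v (E i)"
  have "coords s (span (E ` I)) I E ?\<kappa>"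
    unfolding coords_def
  proof (intro conjI ballI)
    fix i assume i: "i \<in> I"
    show "linear_btw s (*) (span (E ` I)) UNIV (?\<kappa> i)"
      using assms by (auto simp: linear_btw_def representation_add representation_scale)
    show "E i \<in> span (E ` I)" using i by (intro span_base) auto
    fix j assume j: "j \<in> I"
    show "?\<kappa> i (E j) = (if i = j then 1 else 0)"
      using representation_basis[OF assms(4), of "E j"] i j assms(3) by (auto simp: inj_on_eq_iff)
  next
    fix v assume v: "v \<in> span (E ` I)"
    have "(\<Sum>b\<in>E ` I. s (representation (E ` I) v b) b) = v"
      by (rule sum_representation_eq[OF assms(4) v]) (use assms in auto)
    then show "v = (\<Sum>i\<in>I. s (?\<kappa> i v) (E i))" by (simp add: sum.reindex[OF assms(3)])
  qed fact
  then show ?thesis by blast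
qed

lemma coords_exist:
  assumes "vector_space s" "fd_sub s V"
  obtains E \<kappa> where "coords s V {..<vector_space.dim s V} E \<kappa>"
proof -
  interpret vector_space s by fact
  obtain B0 where B0: "finite B0" "V \<subseteq> span B0" "subspace V" using assms by (auto simp: fd_sub_def)
  obtain B where B: "B \<subseteq> V" "independent B" "V \<subseteq> span B" "card B = dim V" by (rule basis_exists)
  have "finite B" using independent_span_bound[OF B0(1) B(2)] B0 B by auto
  then obtain E where E: "bij_betw E {..<dim V} B"
    using ex_bij_betw_nat_finite[of B] B(4) by (auto simp: atLeast0LessThan)
  then have img: "E ` {..<dim V} = B" by (simp add: bij_betw_def)
  have "span B = V" using B B0 by (simp add: span_subspace)
  then show ?thesis
    using coords_of_independent[OF assms(1), of "{..<dim V}" E] E B(2) that img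
    by (auto simp: bij_betw_def)
qed

lemma fd_sub_subset:
  assumes "vector_space s" "fd_sub s V" "module.subspace s W" "W \<subseteq> V"
  shows "fd_sub s W"
  using assms unfolding fd_sub_def by blast

lemma fd_subD:
  assumes "fd_sub s V"
  shows "module.subspace s V"
  using assms by (simp add: fd_sub_def)

lemma subspace_linear_btw:
  assumes "Modules.module s" "Modules.module t" "module.subspace s V" "linear_btw s t V W f"
  shows "module.subspace s {v \<in> V. f v = 0}" "module.subspace t (f ` V)"
proof -
  note f = linear_btwD[OF assms(4)] and f0 = linear_btw_0[OF assms(4,1,3)]
  show "module.subspace s {v \<in> V. f v = 0}"
    using assms f f0 by (auto simp: module.subspace_def module.scale_zero_right)
  have "0 \<in> f ` V" using f0 assms by (metis imageI module.subspace_0)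
  moreover have "f x + f y \<in> f ` V" if "x \<in> V" "y \<in> V" for x y
    using that assms f(2)[OF that] by (metis imageI module.subspace_add)
  moreover have "t c (f x) \<in> f ` V" if "x \<in> V" for x c
    using that assms f(3)[OF that, of c] by (metis imageI module.subspace_scale)
  ultimately show "module.subspace t (f ` V)"
    by (auto simp: module.subspace_def[OF assms(2)])
qed

lemma sum_lessThan_add_split:
  fixes f :: "nat \<Rightarrow> 'b::comm_monoid_add"
  shows "(\<Sum>k<n + r. f k) = (\<Sum>k<n. f k) + (\<Sum>j<r. f (n + j))"
  by (induction r) (simp_all add: add.assoc)

text \<open>
  Rank-nullity with bases: a basis of the kernel followed by preimages of a basis of the image.
\<close>

lemma coords_exact:
  fixes n r :: nat
  assumes s: "vector_space s" and t: "vector_space t" and V: "module.subspace s V"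
    and f: "linear_btw s t V W f" and K: "coords s {v \<in> V. f v = 0} {..<n} E \<kappa>"
    and R: "coords t (f ` V) {..<r} G \<mu>"
    and H: "\<And>j. j < r \<Longrightarrow> H j \<in> V \<and> f (H j) = G j"
  shows "coords s V {..<n + r} (\<lambda>k. if k < n then E k else H (k - n))
      (\<lambda>k v. if k < n then \<kappa> k (v - (\<Sum>j<r. s (\<mu> j (f v)) (H j))) else \<mu> (k - n) (f v))"
proof -
  interpret vector_space s by fact
  interpret t: vector_space t by fact
  note k = coordsD[OF K] and g = coordsD[OF R] and fl = linear_btwD[OF f]
  define p where "p v = v - (\<Sum>j<r. s (\<mu> j (f v)) (H j))" for v
  have HV: "(\<Sum>j<r. s (a j) (H j)) \<in> V" for a using V H by (intro subspace_sum subspace_scale) auto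
  have fH: "f (\<Sum>j<r. s (\<mu> j (f v)) (H j)) = f v" if "v \<in> V" for v
  proof -
    have "f (\<Sum>j<r. s (\<mu> j (f v)) (H j)) = (\<Sum>j<r. t (\<mu> j (f v)) (f (H j)))"
      using H by (intro linear_btw_lincomb[OF f module_axioms V]) auto
    also have "\<dots> = (\<Sum>j<r. t (\<mu> j (f v)) (G j))" using H by simp
    finally show ?thesis using g(4) that by simp
  qed
  have pK: "p v \<in> {v \<in> V. f v = 0}" if "v \<in> V" for v
    using that V HV[of "\<lambda>j. \<mu> j (f v)"] linear_btw_diff[OF f module_axioms V that HV[of "\<lambda>j. \<mu> j (f v)"]] fH[OF that]
    by (simp add: p_def subspace_diff)
  have \<mu>lin: "\<mu> j (f (x + y)) = \<mu> j (f x) + \<mu> j (f y)" "\<mu> j (f (s c x)) = c * \<mu> j (f x)"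
    if "j < r" "x \<in> V" "y \<in> V" for j x y c
    using that linear_btwD[OF g(3)[of j]] fl by auto
  have plin: "p (x + y) = p x + p y" "p (s c x) = s c (p x)" if "x \<in> V" "y \<in> V" for x y c
    using that \<mu>lin by (simp_all add: p_def scale_left_distrib sum.distrib scale_right_diff_distrib scale_sum_right)
  have pE: "p v = v" if "v \<in> V" "f v = 0" for v
  proof -
    have "\<mu> j 0 = 0" if "j < r" for j
      using linear_btw_0[OF g(3)[of j] t.module_axioms subspace_linear_btw(2)[OF module_axioms t.module_axioms V f]] that by simp
    then show ?thesis using that by (simp add: p_def)
  qed
  show ?thesis
    unfolding coords_def p_def[symmetric]
  proof (intro conjI ballI)
    show "finite {..<n + r}" by simp
    fix i assume i: "i \<in> {..<n + r}"
    show "(if i < n then E i else H (i - n)) \<in> V" using k(2)[of i] H[of "i - n"] i by auto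
    show "linear_btw s (*) V UNIV (\<lambda>v. if i < n then \<kappa> i (p v) else \<mu> (i - n) (f v))"
      using i \<mu>lin[of "i - n"] plin linear_btwD[OF k(3)[of i]] pK
      by (auto simp: linear_btw_def)
    fix j assume j: "j \<in> {..<n + r}"
    show "(if i < n then \<kappa> i (p (if j < n then E j else H (j - n)))
             else \<mu> (i - n) (f (if j < n then E j else H (j - n)))) = (if i = j then 1 else 0)"
    proof (cases "j < n")
      case True
      then have "p (E j) = E j" "f (E j) = 0" using pE k(2)[of j] by auto
      moreover have "\<mu> (i - n) 0 = 0" if "\<not> i < n"
        using linear_btw_0[OF g(3)[of "i - n"] t.module_axioms subspace_linear_btw(2)[OF module_axioms t.module_axioms V f]] that i by simp
      ultimately show ?thesis using True k(5)[of i j] by auto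
    next
      case False
      then have fj: "f (H (j - n)) = G (j - n)" "H (j - n) \<in> V" "j - n < r" using H[of "j - n"] j by auto
      have "(\<Sum>l<r. s (\<mu> l (G (j - n))) (H l)) = (\<Sum>l<r. if l = j - n then H l else 0)"
        using g(5) fj(3) by (intro sum.cong) auto
      also have "\<dots> = H (j - n)" using fj by simp
      finally have "p (H (j - n)) = 0" using fj by (simp add: p_def)
      moreover have "\<kappa> i 0 = 0" if "i < n"
        using linear_btw_0[OF k(3)[of i] module_axioms subspace_linear_btw(1)[OF module_axioms t.module_axioms V f]] that by simp
      ultimately show ?thesis using False fj g(5)[of "i - n" "j - n"] i by auto
    qed
  next
    fix v assume v: "v \<in> V"
    have "(\<Sum>i<n + r. s (if i < n then \<kappa> i (p v) else \<mu> (i - n) (f v)) (if i < n then E i else H (i - n)))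
      = (\<Sum>i<n. s (\<kappa> i (p v)) (E i)) + (\<Sum>j<r. s (\<mu> j (f v)) (H j))"
      by (simp add: sum_lessThan_add_split)
    also have "(\<Sum>i<n. s (\<kappa> i (p v)) (E i)) = p v" using k(4) pK[OF v] by blast
    finally show "v = (\<Sum>i<n + r. s (if i < n then \<kappa> i (p v) else \<mu> (i - n) (f v)) (if i < n then E i else H (i - n)))"
      by (simp add: p_def)
  qed
qed

lemma fd_sub_image:
  assumes "vector_space s" "vector_space t" "fd_sub s V" "linear_btw s t V W f"
  shows "fd_sub t (f ` V)"
proof -
  interpret vector_space s by fact
  interpret t: vector_space t by fact
  note V = fd_subD[OF assms(3)]
  obtain E \<kappa> where c: "coords s V {..<dim V} E \<kappa>" using coords_exist[OF assms(1,3)] .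
  have "f v \<in> t.span (f ` E ` {..<dim V})" if "v \<in> V" for v
    unfolding linear_btw_expand[OF c module_axioms V assms(4) that]
    by (intro t.span_sum t.span_scale t.span_base) auto
  then show ?thesis
    unfolding fd_sub_def using subspace_linear_btw(2)[OF module_axioms t.module_axioms V assms(4)]
    by (intro conjI exI[of _ "f ` E ` {..<dim V}"]) auto
qed

lemma dim_exact:
  assumes "vector_space s" "vector_space t" "fd_sub s V" "linear_btw s t V W f"
  shows "vector_space.dim s V = vector_space.dim s {v \<in> V. f v = 0} + vector_space.dim t (f ` V)"
proof -
  interpret vector_space s by fact
  interpret t: vector_space t by fact
  note V = fd_subD[OF assms(3)]
  note sub = subspace_linear_btw[OF module_axioms t.module_axioms V assms(4)]
  have "fd_sub s {v \<in> V. f v = 0}" by (rule fd_sub_subset[OF assms(1,3) sub(1)]) auto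
  then obtain E \<kappa> where E: "coords s {v \<in> V. f v = 0} {..<dim {v \<in> V. f v = 0}} E \<kappa>"
    using coords_exist assms(1) by blast
  obtain G \<mu> where G: "coords t (f ` V) {..<t.dim (f ` V)} G \<mu>"
    using coords_exist[OF assms(2) fd_sub_image[OF assms]] by blast
  have "\<exists>h. h \<in> V \<and> f h = G j" if "j < t.dim (f ` V)" for j
    using coordsD(2)[OF G, of j] that by (auto simp: image_iff)
  then obtain H where "\<And>j. j < t.dim (f ` V) \<Longrightarrow> H j \<in> V \<and> f (H j) = G j" by metis
  from coords_dim(1)[OF assms(1) V coords_exact[OF assms(1,2) V assms(4) E G this]]
  show ?thesis by simp
qed

lemma dim_image_inj:
  assumes "vector_space s" "vector_space t" "fd_sub s V" "linear_btw s t V W f" "inj_on f V"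
  shows "vector_space.dim t (f ` V) = vector_space.dim s V"
proof -
  interpret vector_space s by fact
  interpret t: vector_space t by fact
  have "f 0 = 0" "0 \<in> V"
    using linear_btw_0[OF assms(4) module_axioms fd_subD[OF assms(3)]] subspace_0[OF fd_subD[OF assms(3)]] .
  then have "{v \<in> V. f v = 0} = {0}" using inj_onD[OF assms(5), of _ 0] by auto
  moreover have "dim {0} = 0" using dim_span_eq_card_independent[OF independent_empty] by simp
  ultimately show ?thesis using dim_exact[OF assms(1-4)] by simp
qed

lemma subspace_eq_dim:
  assumes "vector_space s" "fd_sub s V" "module.subspace s W" "W \<subseteq> V"
  shows "vector_space.dim s W \<le> vector_space.dim s V"
    "vector_space.dim s W = vector_space.dim s V \<Longrightarrow> W = V"
proof -
  interpret vector_space s by fact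
  note V = fd_subD[OF assms(2)]
  obtain r where r: "Vector_Spaces.linear s s r" "\<And>x. x \<in> V \<Longrightarrow> r x \<in> V" "\<And>x. x \<in> V \<Longrightarrow> x - r x \<in> W"
    "\<And>x. x \<in> W \<Longrightarrow> r x = 0" using complement_projection[OF assms(1) V assms(3,4)] by blast
  have l: "linear_btw s s V V r" by (rule linear_imp_btw[OF r(1)]) (use r in auto)
  have ker: "{v \<in> V. r v = 0} = W" using r assms(4) by force
  have d: "dim V = dim W + dim (r ` V)" using dim_exact[OF assms(1,1,2) l] ker by simp
  then show "dim W \<le> dim V" by simp
  assume "dim W = dim V"
  then have d0: "dim (r ` V) = 0" using d by simp
  obtain E \<kappa> where "coords s (r ` V) {..<dim (r ` V)} E \<kappa>"
    using coords_exist[OF assms(1) fd_sub_image[OF assms(1,1,2) l]] .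
  from coordsD(4)[OF this] have "\<forall>v\<in>V. r v = 0" by (simp add: d0)
  then show "W = V" using ker by auto
qed

section \<open>Families of linear maps\<close>

definition fam_scale :: "('k \<Rightarrow> 'w \<Rightarrow> 'w) \<Rightarrow> 'k \<Rightarrow> ('j \<Rightarrow> 'v \<Rightarrow> 'w) \<Rightarrow> 'j \<Rightarrow> 'v \<Rightarrow> 'w" where
  "fam_scale t c \<psi> = (\<lambda>j v. t c (\<psi> j v))"

text \<open>
  The direct sum of the spaces of linear maps \<open>V j \<rightarrow> W j\<close>. Members vanish off the index set and
  off the sources, so that equality of families is equality of functions.
\<close>

definition hom_fam :: "'j set \<Rightarrow> ('k::field \<Rightarrow> 'v::ab_group_add \<Rightarrow> 'v) \<Rightarrow> ('k \<Rightarrow> 'w::ab_group_add \<Rightarrow> 'w)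
    \<Rightarrow> ('j \<Rightarrow> 'v set) \<Rightarrow> ('j \<Rightarrow> 'w set) \<Rightarrow> ('j \<Rightarrow> 'v \<Rightarrow> 'w) set" where
  "hom_fam J s t V W = {\<psi>. (\<forall>j\<in>J. linear_btw s t (V j) (W j) (\<psi> j)) \<and>
     (\<forall>j v. j \<notin> J \<or> v \<notin> V j \<longrightarrow> \<psi> j v = 0)}"

lemma vector_space_fam_scale:
  assumes "vector_space t"
  shows "vector_space (fam_scale t :: 'k::field \<Rightarrow> ('j \<Rightarrow> 'v \<Rightarrow> 'w::ab_group_add) \<Rightarrow> _)"
proof -
  interpret vector_space t by fact
  show ?thesis
    by unfold_locales (auto simp: fam_scale_def fun_eq_iff scale_left_distrib scale_right_distrib)
qed

lemma subspace_hom_fam: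
  assumes "vector_space s" "vector_space t" "\<And>j. j \<in> J \<Longrightarrow> module.subspace s (V j)"
    "\<And>j. j \<in> J \<Longrightarrow> module.subspace t (W j)"
  shows "module.subspace (fam_scale t) (hom_fam J s t V W)"
proof -
  interpret s: vector_space s by fact
  interpret t: vector_space t by fact
  interpret f: vector_space "fam_scale t :: 'a \<Rightarrow> ('j \<Rightarrow> 'b \<Rightarrow> 'c) \<Rightarrow> _"
    by (rule vector_space_fam_scale[OF assms(2)])
  show ?thesis
    unfolding f.subspace_def
  proof (intro conjI ballI allI)
    show "0 \<in> hom_fam J s t V W"
      using t.subspace_0[OF assms(4)] by (auto simp: hom_fam_def linear_btw_def)
  next
    fix x y assume "x \<in> hom_fam J s t V W" "y \<in> hom_fam J s t V W"
    then have "linear_btw s t (V j) (W j) (\<lambda>v. x j v + y j v)" if "j \<in> J" for j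
      using that by (intro linear_btw_plus[OF _ _ t.module_axioms assms(4)]) (auto simp: hom_fam_def)
    then show "x + y \<in> hom_fam J s t V W" using \<open>x \<in> _\<close> \<open>y \<in> _\<close> by (auto simp: hom_fam_def plus_fun_def)
  next
    fix c x assume "x \<in> hom_fam J s t V W"
    then show "fam_scale t c x \<in> hom_fam J s t V W"
      using t.subspace_scale[OF assms(4)]
      by (auto simp: hom_fam_def fam_scale_def linear_btw_def t.scale_right_distrib mult.commute Pi_iff)
  qed
qed

lemma sum_fam_apply: "(\<Sum>i\<in>I. F i) j v = (\<Sum>i\<in>I. F i j v)"
  by (induction I rule: infinite_finite_induct) (auto simp: plus_fun_def zero_fun_def)

text \<open>
  Elementary matrices. The last conjunct records that each coordinate of a family is a linear
  functional of one of its values: this turns regularity of a family of maps into regularity of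
  its values.
\<close>

lemma coords_hom_fam:
  fixes J :: "'j set"
  assumes s: "vector_space s" and t: "vector_space t" and J: "finite J"
    and V: "\<And>j. j \<in> J \<Longrightarrow> fd_sub s (V j)" and W: "\<And>j. j \<in> J \<Longrightarrow> fd_sub t (W j)"
  shows "\<exists>I E \<kappa>. coords (fam_scale t) (hom_fam J s t V W) (I :: ('j \<times> nat \<times> nat) set) E \<kappa> \<and>
     card I = (\<Sum>j\<in>J. vector_space.dim s (V j) * vector_space.dim t (W j)) \<and>
     (\<forall>i\<in>I. \<exists>j\<in>J. \<exists>v\<in>V j. \<exists>l. linear_btw t (*) (W j) UNIV l \<and> (\<forall>\<psi>. \<kappa> i \<psi> = l (\<psi> j v)))"
proof -
  interpret s: vector_space s by fact
  interpret t: vector_space t by fact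
  have "\<exists>b a. coords s (V j) {..<s.dim (V j)} b a" if "j \<in> J" for j
    using coords_exist[OF s V[OF that]] by metis
  then obtain b a where ba: "\<And>j. j \<in> J \<Longrightarrow> coords s (V j) {..<s.dim (V j)} (b j) (a j)" by metis
  have "\<exists>c l. coords t (W j) {..<t.dim (W j)} c l" if "j \<in> J" for j
    using coords_exist[OF t W[OF that]] by metis
  then obtain c l where cl: "\<And>j. j \<in> J \<Longrightarrow> coords t (W j) {..<t.dim (W j)} (c j) (l j)" by metis
  note b = coordsD[OF ba] and c = coordsD[OF cl]
  define I where "I = (SIGMA j:J. {..<s.dim (V j)} \<times> {..<t.dim (W j)})"
  define E where "E = (\<lambda>(j, k, m) j' v. if j' = j \<and> v \<in> V j then t (a j k v) (c j m) else 0)"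
  define \<kappa> where "\<kappa> = (\<lambda>(j, k, m) \<psi>. l j m (\<psi> j (b j k)))"
  have fin: "finite I" using J by (simp add: I_def)
  have "coords (fam_scale t) (hom_fam J s t V W) I E \<kappa>"
    unfolding coords_def
  proof (intro conjI ballI)
    fix i assume "i \<in> I"
    then obtain j k m where i: "i = (j, k, m)" "j \<in> J" "k < s.dim (V j)" "m < t.dim (W j)"
      by (auto simp: I_def)
    have ak: "linear_btw s (*) (V j) UNIV (a j k)" and cm: "c j m \<in> W j" using b(3) c(2) i by auto
    note Wj = fd_subD[OF W[OF i(2)]] and Vj = fd_subD[OF V[OF i(2)]]
    show "E i \<in> hom_fam J s t V W"
      unfolding hom_fam_def
    proof (intro CollectI conjI ballI allI impI)
      fix j' assume j': "j' \<in> J"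
      show "linear_btw s t (V j') (W j') (E i j')"
      proof (cases "j' = j")
        case True
        then show ?thesis using i linear_btwD(2,3)[OF ak] t.subspace_scale[OF Wj cm] s.subspace_add[OF Vj] s.subspace_scale[OF Vj]
          by (auto simp: E_def linear_btw_def t.scale_left_distrib)
      next
        case False
        then show ?thesis using t.subspace_0[OF fd_subD[OF W[OF j']]] i by (auto simp: E_def linear_btw_def)
      qed
    next
      fix j' v assume "j' \<notin> J \<or> v \<notin> V j'"
      then show "E i j' v = 0" using i by (auto simp: E_def)
    qed
    have evW: "x j (b j k) \<in> W j" if "x \<in> hom_fam J s t V W" for x
    proof (rule linear_btwD(1)[of s t "V j" "W j" "x j"])
      show "linear_btw s t (V j) (W j) (x j)" using that i(2) by (simp add: hom_fam_def)
      show "b j k \<in> V j" using b(2)[OF i(2)] i(3) by simp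
    qed
    show "linear_btw (fam_scale t) (*) (hom_fam J s t V W) UNIV (\<kappa> i)"
      unfolding linear_btw_def
    proof (intro conjI ballI allI)
      fix x y assume xy: "x \<in> hom_fam J s t V W" "y \<in> hom_fam J s t V W"
      have "x j (b j k) \<in> W j" "y j (b j k) \<in> W j"
        using evW xy by auto
      then show "\<kappa> i (x + y) = \<kappa> i x + \<kappa> i y"
        using linear_btwD(2)[OF c(3)[OF i(2)]] i by (auto simp: \<kappa>_def)
    next
      fix d x assume x: "x \<in> hom_fam J s t V W"
      have "x j (b j k) \<in> W j" using evW x by auto
      then show "\<kappa> i (fam_scale t d x) = d * \<kappa> i x"
        using linear_btwD(3)[OF c(3)[OF i(2)]] i by (auto simp: \<kappa>_def fam_scale_def)
    qed auto
    fix i' assume "i' \<in> I"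
    then obtain j' k' m' where i': "i' = (j', k', m')" "j' \<in> J" "k' < s.dim (V j')" "m' < t.dim (W j')"
      by (auto simp: I_def)
    have l0: "l j m 0 = 0" using linear_btw_0[OF c(3)[OF i(2)] t.module_axioms Wj] i by auto
    show "\<kappa> i (E i') = (if i = i' then 1 else 0)"
    proof (cases "j' = j")
      case True
      have "\<kappa> i (E i') = l j m (t (a j k' (b j k)) (c j m'))"
        using True i i' b(2)[OF i(2)] by (auto simp: \<kappa>_def E_def)
      also have "\<dots> = a j k' (b j k) * l j m (c j m')"
        using linear_btwD(3)[OF c(3)[OF i(2)]] c(2)[OF i(2)] i i' True by auto
      also have "\<dots> = (if i = i' then 1 else 0)"
        using b(5)[OF i(2)] c(5)[OF i(2)] i i' True by auto
      finally show ?thesis .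
    next
      case False
      then show ?thesis using i i' l0 by (auto simp: \<kappa>_def E_def)
    qed
  next
    fix \<psi> assume \<psi>: "\<psi> \<in> hom_fam J s t V W"
    show "\<psi> = (\<Sum>i\<in>I. fam_scale t (\<kappa> i \<psi>) (E i))"
    proof (intro ext)
      fix j v
      have "(\<Sum>i\<in>I. fam_scale t (\<kappa> i \<psi>) (E i)) j v = (\<Sum>i\<in>I. t (\<kappa> i \<psi>) (E i j v))"
        by (simp add: sum_fam_apply fam_scale_def)
      also have "\<dots> = (\<Sum>j'\<in>J. \<Sum>(k, m)\<in>{..<s.dim (V j')} \<times> {..<t.dim (W j')}. t (\<kappa> (j', k, m) \<psi>) (E (j', k, m) j v))"
        unfolding I_def using J by (subst sum.Sigma) (auto simp: case_prod_unfold)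
      also have "\<dots> = (\<Sum>j'\<in>J. if j' = j then (if v \<in> V j then \<psi> j v else 0) else 0)"
      proof (intro sum.cong refl)
        fix j' assume j': "j' \<in> J"
        show "(\<Sum>(k, m)\<in>{..<s.dim (V j')} \<times> {..<t.dim (W j')}. t (\<kappa> (j', k, m) \<psi>) (E (j', k, m) j v)) =
          (if j' = j then (if v \<in> V j then \<psi> j v else 0) else 0)"
        proof (cases "j' = j \<and> v \<in> V j")
          case True
          then have v: "v \<in> V j" and j: "j \<in> J" using j' by auto
          have \<psi>j: "linear_btw s t (V j) (W j) (\<psi> j)" using \<psi> j by (auto simp: hom_fam_def)
          have "(\<Sum>(k, m)\<in>{..<s.dim (V j)} \<times> {..<t.dim (W j)}. t (\<kappa> (j, k, m) \<psi>) (E (j, k, m) j v))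
            = (\<Sum>k<s.dim (V j). \<Sum>m<t.dim (W j). t (l j m (\<psi> j (b j k))) (t (a j k v) (c j m)))"
            using v by (simp add: sum.cartesian_product E_def \<kappa>_def)
          also have "\<dots> = (\<Sum>k<s.dim (V j). t (a j k v) (\<Sum>m<t.dim (W j). t (l j m (\<psi> j (b j k))) (c j m)))"
            by (simp add: t.scale_sum_right mult.commute)
          also have "\<dots> = (\<Sum>k<s.dim (V j). t (a j k v) (\<psi> j (b j k)))"
            using c(4)[OF j] linear_btwD(1)[OF \<psi>j] b(2)[OF j] by (intro sum.cong) auto
          also have "\<dots> = \<psi> j v"
            using linear_btw_expand[OF ba[OF j] s.module_axioms fd_subD[OF V[OF j]] \<psi>j v] by simp
          finally show ?thesis using True by simp
        next
          case False
          then show ?thesis by (auto simp: E_def intro!: sum.neutral)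
        qed
      qed
      also have "\<dots> = \<psi> j v" using J \<psi> by (auto simp: hom_fam_def)
      finally show "\<psi> j v = (\<Sum>i\<in>I. fam_scale t (\<kappa> i \<psi>) (E i)) j v" by simp
    qed
  qed (rule fin)
  moreover have "card I = (\<Sum>j\<in>J. s.dim (V j) * t.dim (W j))" using J by (simp add: I_def)
  moreover have "\<exists>j\<in>J. \<exists>v\<in>V j. \<exists>l. linear_btw t (*) (W j) UNIV l \<and> (\<forall>\<psi>. \<kappa> i \<psi> = l (\<psi> j v))"
    if iI: "i \<in> I" for i
  proof -
    obtain j k m where i: "i = (j, k, m)" "j \<in> J" "k < s.dim (V j)" "m < t.dim (W j)"
      using iI by (auto simp: I_def)
    show ?thesis
      using i b(2)[OF i(2)] c(3)[OF i(2)]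
      by (intro bexI[of _ j] bexI[of _ "b j k"] exI[of _ "l j m"]) (auto simp: \<kappa>_def)
  qed
  ultimately show ?thesis by (intro exI[of _ I] exI[of _ E] exI[of _ \<kappa>] conjI ballI)
qed

section \<open>Spaces of local fractions\<close>

text \<open>
  Regularity at \<open>x\<close> in terms of coordinates: the part of \<open>X\<close> where \<open>q\<close> does not vanish serves as
  the neighbourhood of \<open>x\<close>.
\<close>

definition frac_at :: "('p \<Rightarrow> 'k::field) set \<Rightarrow> 'p set \<Rightarrow> 'p \<Rightarrow> ('p \<Rightarrow> 'k) \<Rightarrow> bool" where
  "frac_at C X x \<phi> \<longleftrightarrow> (\<exists>p\<in>poly_funs C. \<exists>q\<in>poly_funs C. q x \<noteq> 0 \<and> (\<forall>y\<in>X. q y \<noteq> 0 \<longrightarrow> \<phi> y = p y / q y))"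

lemma poly_funs_mono: "p \<in> poly_funs C \<Longrightarrow> C \<subseteq> D \<Longrightarrow> p \<in> poly_funs D"
  by (induction rule: poly_funs.induct) (auto intro: poly_funs.intros)

lemma poly_funs_sum:
  assumes "\<And>i. i \<in> I \<Longrightarrow> p i \<in> poly_funs C"
  shows "(\<lambda>x. \<Sum>i\<in>I. p i x) \<in> poly_funs C"
  using assms by (induction I rule: infinite_finite_induct) (auto intro: poly_funs.intros)

lemma poly_funs_prod:
  assumes "\<And>i. i \<in> I \<Longrightarrow> p i \<in> poly_funs C"
  shows "(\<lambda>x. \<Prod>i\<in>I. p i x) \<in> poly_funs C"
  using assms by (induction I rule: infinite_finite_induct) (auto intro: poly_funs.intros)

lemma poly_funs_cmult: "p \<in> poly_funs C \<Longrightarrow> (\<lambda>x. c * p x) \<in> poly_funs C"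
  by (intro poly_funs.mult poly_funs.const)

lemma poly_funs_minus:
  fixes p :: "'p \<Rightarrow> 'k::comm_ring_1"
  assumes "p \<in> poly_funs C" "q \<in> poly_funs C"
  shows "(\<lambda>x. p x - q x) \<in> poly_funs C"
proof -
  have "(\<lambda>x. p x + (-1) * q x) \<in> poly_funs C"
    using assms by (intro poly_funs.add poly_funs_cmult)
  then show ?thesis by simp
qed

lemma poly_funs_comp:
  assumes "p \<in> poly_funs C" "\<And>\<gamma>. \<gamma> \<in> C \<Longrightarrow> (\<lambda>x. \<gamma> (m x)) \<in> poly_funs D"
  shows "(\<lambda>x. p (m x)) \<in> poly_funs D"
  using assms by (induction rule: poly_funs.induct) (auto intro: poly_funs.intros)

lemma frac_at_poly:
  assumes "p \<in> poly_funs C" "\<And>y. y \<in> X \<Longrightarrow> \<phi> y = p y"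
  shows "frac_at C X x \<phi>"
  unfolding frac_at_def using assms
  by (intro bexI[of _ p] bexI[of _ "\<lambda>_. 1"]) (auto intro: poly_funs.const)

lemma frac_at_mono: "frac_at C X x \<phi> \<Longrightarrow> X' \<subseteq> X \<Longrightarrow> frac_at C X' x \<phi>"
  unfolding frac_at_def by blast

lemma frac_at_cong: "frac_at C X x \<phi> \<Longrightarrow> (\<And>y. y \<in> X \<Longrightarrow> \<psi> y = \<phi> y) \<Longrightarrow> frac_at C X x \<psi>"
  unfolding frac_at_def by metis

text \<open>
  A fraction on a smaller neighbourhood that is cut out by \<open>r \<noteq> 0\<close> is a fraction on the larger
  one: multiply numerator and denominator by \<open>r\<close>.
\<close>

lemma frac_at_local:
  assumes "frac_at C X' x \<phi>" "r \<in> poly_funs C" "r x \<noteq> 0" "{y \<in> X. r y \<noteq> 0} \<subseteq> X'"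
  shows "frac_at C X x \<phi>"
proof -
  obtain p q where pq: "p \<in> poly_funs C" "q \<in> poly_funs C" "q x \<noteq> 0" "\<And>y. y \<in> X' \<Longrightarrow> q y \<noteq> 0 \<Longrightarrow> \<phi> y = p y / q y"
    using assms(1) by (auto simp: frac_at_def)
  show ?thesis
    unfolding frac_at_def using pq assms
    by (intro bexI[of _ "\<lambda>y. p y * r y"] bexI[of _ "\<lambda>y. q y * r y"] conjI ballI impI)
      (auto intro: poly_funs.mult)
qed

lemma frac_at_add:
  assumes "frac_at C X x \<phi>" "frac_at C X x \<psi>"
  shows "frac_at C X x (\<lambda>y. \<phi> y + \<psi> y)"
proof -
  obtain p q where pq: "p \<in> poly_funs C" "q \<in> poly_funs C" "q x \<noteq> 0" "\<And>y. y \<in> X \<Longrightarrow> q y \<noteq> 0 \<Longrightarrow> \<phi> y = p y / q y"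
    using assms(1) by (auto simp: frac_at_def)
  obtain p' q' where pq': "p' \<in> poly_funs C" "q' \<in> poly_funs C" "q' x \<noteq> 0" "\<And>y. y \<in> X \<Longrightarrow> q' y \<noteq> 0 \<Longrightarrow> \<psi> y = p' y / q' y"
    using assms(2) by (auto simp: frac_at_def)
  show ?thesis
    unfolding frac_at_def using pq pq'
    by (intro bexI[of _ "\<lambda>y. p y * q' y + p' y * q y"] bexI[of _ "\<lambda>y. q y * q' y"] conjI ballI impI)
      (auto simp: add_frac_eq intro: poly_funs.mult poly_funs.add)
qed

lemma frac_at_mult:
  assumes "frac_at C X x \<phi>" "frac_at C X x \<psi>"
  shows "frac_at C X x (\<lambda>y. \<phi> y * \<psi> y)"
proof -
  obtain p q where pq: "p \<in> poly_funs C" "q \<in> poly_funs C" "q x \<noteq> 0" "\<And>y. y \<in> X \<Longrightarrow> q y \<noteq> 0 \<Longrightarrow> \<phi> y = p y / q y"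
    using assms(1) by (auto simp: frac_at_def)
  obtain p' q' where pq': "p' \<in> poly_funs C" "q' \<in> poly_funs C" "q' x \<noteq> 0" "\<And>y. y \<in> X \<Longrightarrow> q' y \<noteq> 0 \<Longrightarrow> \<psi> y = p' y / q' y"
    using assms(2) by (auto simp: frac_at_def)
  show ?thesis
    unfolding frac_at_def using pq pq'
    by (intro bexI[of _ "\<lambda>y. p y * p' y"] bexI[of _ "\<lambda>y. q y * q' y"] conjI ballI impI)
      (auto intro: poly_funs.mult)
qed

lemma frac_at_inverse:
  assumes "frac_at C X x \<phi>" "\<phi> x \<noteq> 0" "x \<in> X"
  shows "frac_at C X x (\<lambda>y. inverse (\<phi> y))"
proof -
  obtain p q where pq: "p \<in> poly_funs C" "q \<in> poly_funs C" "q x \<noteq> 0" "\<And>y. y \<in> X \<Longrightarrow> q y \<noteq> 0 \<Longrightarrow> \<phi> y = p y / q y"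
    using assms(1) by (auto simp: frac_at_def)
  have "p x \<noteq> 0" using pq(3) pq(4)[of x] assms by auto
  then show ?thesis
    unfolding frac_at_def using pq
    by (intro bexI[of _ "\<lambda>y. q y * q y"] bexI[of _ "\<lambda>y. p y * q y"] conjI ballI impI)
      (auto intro: poly_funs.mult)
qed

lemma frac_at_nonzero:
  assumes "frac_at C X x \<phi>" "\<phi> x \<noteq> 0" "x \<in> X"
  shows "\<exists>r\<in>poly_funs C. r x \<noteq> 0 \<and> (\<forall>y\<in>X. r y \<noteq> 0 \<longrightarrow> \<phi> y \<noteq> 0)"
proof -
  obtain p q where pq: "p \<in> poly_funs C" "q \<in> poly_funs C" "q x \<noteq> 0" "\<And>y. y \<in> X \<Longrightarrow> q y \<noteq> 0 \<Longrightarrow> \<phi> y = p y / q y"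
    using assms(1) by (auto simp: frac_at_def)
  have "p x \<noteq> 0" using pq(3) pq(4)[of x] assms by auto
  then show ?thesis using pq by (intro bexI[of _ "\<lambda>y. p y * q y"]) (auto intro: poly_funs.mult)
qed

text \<open>
  The properties of a sheaf of field-valued functions that arguments with regular functions rely
  on: regularity on an open set depends only on the values there, restricts, is local, is closed
  under the field operations, and nonvanishing loci are open.
\<close>

definition geometric :: "('p, 'k::field) fn_space \<Rightarrow> bool" where
  "geometric A \<longleftrightarrow>
    (\<forall>U \<phi> \<psi>. openin (zar A) U \<longrightarrow> \<phi> \<in> reg A U \<longrightarrow> (\<forall>x\<in>U. \<psi> x = \<phi> x) \<longrightarrow> \<psi> \<in> reg A U) \<and>
    (\<forall>U V \<phi>. openin (zar A) U \<longrightarrow> openin (zar A) V \<longrightarrow> V \<subseteq> U \<longrightarrow> \<phi> \<in> reg A U \<longrightarrow> \<phi> \<in> reg A V) \<and>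
    (\<forall>U \<phi>. openin (zar A) U \<longrightarrow> (\<forall>x\<in>U. \<exists>V. openin (zar A) V \<and> x \<in> V \<and> V \<subseteq> U \<and> \<phi> \<in> reg A V) \<longrightarrow> \<phi> \<in> reg A U) \<and>
    (\<forall>U c. openin (zar A) U \<longrightarrow> (\<lambda>_. c) \<in> reg A U) \<and>
    (\<forall>U \<phi> \<psi>. openin (zar A) U \<longrightarrow> \<phi> \<in> reg A U \<longrightarrow> \<psi> \<in> reg A U \<longrightarrow>
       (\<lambda>x. \<phi> x + \<psi> x) \<in> reg A U \<and> (\<lambda>x. \<phi> x * \<psi> x) \<in> reg A U) \<and>
    (\<forall>U \<phi>. openin (zar A) U \<longrightarrow> \<phi> \<in> reg A U \<longrightarrow>
       openin (zar A) {x \<in> U. \<phi> x \<noteq> 0} \<and> (\<lambda>x. inverse (\<phi> x)) \<in> reg A {x \<in> U. \<phi> x \<noteq> 0})"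

lemma geometricD:
  assumes "geometric A" "openin (zar A) U"
  shows "\<phi> \<in> reg A U \<Longrightarrow> (\<And>x. x \<in> U \<Longrightarrow> \<psi> x = \<phi> x) \<Longrightarrow> \<psi> \<in> reg A U"
    and "openin (zar A) V \<Longrightarrow> V \<subseteq> U \<Longrightarrow> \<phi> \<in> reg A U \<Longrightarrow> \<phi> \<in> reg A V"
    and "(\<And>x. x \<in> U \<Longrightarrow> \<exists>V. openin (zar A) V \<and> x \<in> V \<and> V \<subseteq> U \<and> \<phi> \<in> reg A V) \<Longrightarrow> \<phi> \<in> reg A U"
    and "(\<lambda>_. c) \<in> reg A U"
    and "\<phi> \<in> reg A U \<Longrightarrow> \<psi> \<in> reg A U \<Longrightarrow> (\<lambda>x. \<phi> x + \<psi> x) \<in> reg A U"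
    and "\<phi> \<in> reg A U \<Longrightarrow> \<psi> \<in> reg A U \<Longrightarrow> (\<lambda>x. \<phi> x * \<psi> x) \<in> reg A U"
    and "\<phi> \<in> reg A U \<Longrightarrow> openin (zar A) {x \<in> U. \<phi> x \<noteq> 0}"
    and "\<phi> \<in> reg A U \<Longrightarrow> (\<lambda>x. inverse (\<phi> x)) \<in> reg A {x \<in> U. \<phi> x \<noteq> 0}"
proof -
  note g = assms(1)[unfolded geometric_def] and o = assms(2)
  note g1 = g[THEN conjunct1] and g2 = g[THEN conjunct2, THEN conjunct1]
    and g3 = g[THEN conjunct2, THEN conjunct2, THEN conjunct1]
    and g4 = g[THEN conjunct2, THEN conjunct2, THEN conjunct2, THEN conjunct1]
    and g5 = g[THEN conjunct2, THEN conjunct2, THEN conjunct2, THEN conjunct2, THEN conjunct1]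
    and g6 = g[THEN conjunct2, THEN conjunct2, THEN conjunct2, THEN conjunct2, THEN conjunct2]
  show "\<phi> \<in> reg A U \<Longrightarrow> (\<And>x. x \<in> U \<Longrightarrow> \<psi> x = \<phi> x) \<Longrightarrow> \<psi> \<in> reg A U"
    using g1 o by blast
  show "openin (zar A) V \<Longrightarrow> V \<subseteq> U \<Longrightarrow> \<phi> \<in> reg A U \<Longrightarrow> \<phi> \<in> reg A V" using g2 o by blast
  show "(\<And>x. x \<in> U \<Longrightarrow> \<exists>V. openin (zar A) V \<and> x \<in> V \<and> V \<subseteq> U \<and> \<phi> \<in> reg A V) \<Longrightarrow> \<phi> \<in> reg A U"
    using g3 o by blast
  show "(\<lambda>_. c) \<in> reg A U" using g4 o by blast
  show "\<phi> \<in> reg A U \<Longrightarrow> \<psi> \<in> reg A U \<Longrightarrow> (\<lambda>x. \<phi> x + \<psi> x) \<in> reg A U"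
    "\<phi> \<in> reg A U \<Longrightarrow> \<psi> \<in> reg A U \<Longrightarrow> (\<lambda>x. \<phi> x * \<psi> x) \<in> reg A U" using g5 o by blast+
  show "\<phi> \<in> reg A U \<Longrightarrow> openin (zar A) {x \<in> U. \<phi> x \<noteq> 0}"
    "\<phi> \<in> reg A U \<Longrightarrow> (\<lambda>x. inverse (\<phi> x)) \<in> reg A {x \<in> U. \<phi> x \<noteq> 0}" using g6 o by blast+
qed

text \<open>
  Subsets of affine spaces and products are defined by the same recipe: rings \<open>R d\<close> of functions
  on pieces \<open>D d\<close>, nonvanishing loci as basic open sets, local quotients as regular functions. A
  subset of an affine space has a single piece; the pieces of a product are the boxes \<open>U \<times> V\<close>.
  The recipe gives a geometric space once any two pieces have a common refinement.
\<close>

locale fraction_space =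
  fixes A :: "('p, 'k::field) fn_space" and I :: "'d set" and D :: "'d \<Rightarrow> 'p set"
    and R :: "'d \<Rightarrow> ('p \<Rightarrow> 'k) set"
  assumes zar_eq: "zar A = topology_generated_by {{x \<in> D d. h x \<noteq> 0} | d h. d \<in> I \<and> h \<in> R d}"
    and reg_eq: "openin (zar A) W \<Longrightarrow> reg A W = {\<phi>. \<forall>x\<in>W. \<exists>d\<in>I. x \<in> D d \<and>
        (\<exists>g\<in>R d. \<exists>h\<in>R d. h x \<noteq> 0 \<and> (\<forall>y\<in>W \<inter> D d. h y \<noteq> 0 \<longrightarrow> \<phi> y = g y / h y))}"
    and meet: "d \<in> I \<Longrightarrow> e \<in> I \<Longrightarrow> \<exists>m\<in>I. D m = D d \<inter> D e \<and> R d \<subseteq> R m \<and> R e \<subseteq> R m"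
    and R_const: "d \<in> I \<Longrightarrow> (\<lambda>_. c) \<in> R d"
    and R_add: "d \<in> I \<Longrightarrow> g \<in> R d \<Longrightarrow> h \<in> R d \<Longrightarrow> (\<lambda>x. g x + h x) \<in> R d"
    and R_mult: "d \<in> I \<Longrightarrow> g \<in> R d \<Longrightarrow> h \<in> R d \<Longrightarrow> (\<lambda>x. g x * h x) \<in> R d"
begin

lemma openin_basic: "d \<in> I \<Longrightarrow> h \<in> R d \<Longrightarrow> openin (zar A) {x \<in> D d. h x \<noteq> 0}"
  unfolding zar_eq by (rule topology_generated_by_Basis) auto

lemma openin_iff:
  "openin (zar A) U \<longleftrightarrow> (\<forall>x\<in>U. \<exists>d\<in>I. \<exists>h\<in>R d. x \<in> D d \<and> h x \<noteq> 0 \<and> {y \<in> D d. h y \<noteq> 0} \<subseteq> U)"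
    (is "_ \<longleftrightarrow> ?P U")
proof
  assume "openin (zar A) U"
  then have "generate_topology_on {{x \<in> D d. h x \<noteq> 0} | d h. d \<in> I \<and> h \<in> R d} U"
    unfolding zar_eq by (rule openin_topology_generated_by)
  then show "?P U"
  proof induction
    case (Int U V)
    show ?case
    proof
      fix x assume x: "x \<in> U \<inter> V"
      obtain d h where d: "d \<in> I" "h \<in> R d" "x \<in> D d" "h x \<noteq> 0" "{y \<in> D d. h y \<noteq> 0} \<subseteq> U"
        using Int x by blast
      obtain e k where e: "e \<in> I" "k \<in> R e" "x \<in> D e" "k x \<noteq> 0" "{y \<in> D e. k y \<noteq> 0} \<subseteq> V"
        using Int x by blast
      obtain m where m: "m \<in> I" "D m = D d \<inter> D e" "R d \<subseteq> R m" "R e \<subseteq> R m"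
        using meet d(1) e(1) by blast
      have "(\<lambda>x. h x * k x) \<in> R m" using m d e by (intro R_mult) auto
      then show "\<exists>d\<in>I. \<exists>h\<in>R d. x \<in> D d \<and> h x \<noteq> 0 \<and> {y \<in> D d. h y \<noteq> 0} \<subseteq> U \<inter> V"
        using m d e by (intro bexI[of _ m] bexI[of _ "\<lambda>x. h x * k x"]) auto
    qed
  next
    case (UN K)
    then show ?case by (meson Union_iff Union_upper subset_trans)
  next
    case (Basis s)
    then show ?case by blast
  qed auto
next
  assume P: "?P U"
  show "openin (zar A) U"
  proof (subst openin_subopen, rule ballI)
    fix x assume "x \<in> U"
    then obtain d h where "d \<in> I" "h \<in> R d" "x \<in> D d" "h x \<noteq> 0" "{y \<in> D d. h y \<noteq> 0} \<subseteq> U"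
      using P by blast
    then show "\<exists>T. openin (zar A) T \<and> x \<in> T \<and> T \<subseteq> U"
      using openin_basic by (intro exI[of _ "{y \<in> D d. h y \<noteq> 0}"]) auto
  qed
qed

text \<open>
  The definition of regularity refers to \<open>W \<inter> D d\<close>; shrinking the piece makes the quotient valid
  on all of the basic open set.
\<close>

lemma reg_local:
  assumes U: "openin (zar A) U" and r: "\<phi> \<in> reg A U" and x: "x \<in> U"
  shows "\<exists>d g h. d \<in> I \<and> g \<in> R d \<and> h \<in> R d \<and> x \<in> D d \<and> h x \<noteq> 0 \<and> {y \<in> D d. h y \<noteq> 0} \<subseteq> U \<and>
    (\<forall>y\<in>D d. h y \<noteq> 0 \<longrightarrow> \<phi> y = g y / h y)"
proof -
  have "\<forall>x\<in>U. \<exists>d\<in>I. x \<in> D d \<and> (\<exists>g\<in>R d. \<exists>h\<in>R d. h x \<noteq> 0 \<and> (\<forall>y\<in>U \<inter> D d. h y \<noteq> 0 \<longrightarrow> \<phi> y = g y / h y))"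
    using r unfolding reg_eq[OF U] by (rule CollectD)
  from bspec[OF this x] obtain d g h where d: "d \<in> I" "x \<in> D d" "g \<in> R d" "h \<in> R d" "h x \<noteq> 0"
    "\<forall>y\<in>U \<inter> D d. h y \<noteq> 0 \<longrightarrow> \<phi> y = g y / h y"
    by (elim bexE conjE) (rule that)
  from U have "\<forall>x\<in>U. \<exists>d\<in>I. \<exists>h\<in>R d. x \<in> D d \<and> h x \<noteq> 0 \<and> {y \<in> D d. h y \<noteq> 0} \<subseteq> U"
    by (rule openin_iff[THEN iffD1])
  from bspec[OF this x] obtain e k where e: "e \<in> I" "k \<in> R e" "x \<in> D e" "k x \<noteq> 0" "{y \<in> D e. k y \<noteq> 0} \<subseteq> U"
    by (elim bexE conjE) (rule that)
  from meet[OF d(1) e(1)] obtain m where m: "m \<in> I" "D m = D d \<inter> D e" "R d \<subseteq> R m" "R e \<subseteq> R m"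
    by (elim bexE conjE) (rule that)
  have "(\<lambda>x. g x * k x) \<in> R m" "(\<lambda>x. h x * k x) \<in> R m" using m d e by (auto intro!: R_mult)
  moreover have "\<phi> y = g y * k y / (h y * k y)" if "y \<in> D m" "h y * k y \<noteq> 0" for y
    using d(6) e(5) m(2) that by auto
  ultimately show ?thesis
    using m d e by (intro exI[of _ m] conjI exI[of _ "\<lambda>x. g x * k x"] exI[of _ "\<lambda>x. h x * k x"]) auto
qed

lemma regI:
  assumes U: "openin (zar A) U"
    and P: "\<And>x. x \<in> U \<Longrightarrow> \<exists>d\<in>I. \<exists>g\<in>R d. \<exists>h\<in>R d. x \<in> D d \<and> h x \<noteq> 0 \<and> (\<forall>y\<in>U \<inter> D d. h y \<noteq> 0 \<longrightarrow> \<phi> y = g y / h y)"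
  shows "\<phi> \<in> reg A U"
  unfolding reg_eq[OF U] using P by blast

lemma regE:
  assumes "openin (zar A) U" "\<phi> \<in> reg A U" "x \<in> U"
  obtains d g h where "d \<in> I" "g \<in> R d" "h \<in> R d" "x \<in> D d" "h x \<noteq> 0" "{y \<in> D d. h y \<noteq> 0} \<subseteq> U"
    "\<And>y. y \<in> D d \<Longrightarrow> h y \<noteq> 0 \<Longrightarrow> \<phi> y = g y / h y"
proof -
  from reg_local[OF assms] obtain d g h where "d \<in> I" "g \<in> R d" "h \<in> R d" "x \<in> D d" "h x \<noteq> 0"
    "{y \<in> D d. h y \<noteq> 0} \<subseteq> U" and e: "\<forall>y\<in>D d. h y \<noteq> 0 \<longrightarrow> \<phi> y = g y / h y"
    by (elim exE conjE) (rule that)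
  then show thesis by (intro that[of d g h]) simp_all
qed

lemma regE2:
  assumes "openin (zar A) U" "\<phi> \<in> reg A U" "\<psi> \<in> reg A U" "x \<in> U"
  obtains d g h g' h' where "d \<in> I" "g \<in> R d" "h \<in> R d" "x \<in> D d" "h x \<noteq> 0"
    "g' \<in> R d" "h' \<in> R d" "h' x \<noteq> 0" "\<And>y. y \<in> D d \<Longrightarrow> h y \<noteq> 0 \<Longrightarrow> \<phi> y = g y / h y"
    "\<And>y. y \<in> D d \<Longrightarrow> h' y \<noteq> 0 \<Longrightarrow> \<psi> y = g' y / h' y"
proof -
  obtain d g h where d: "d \<in> I" "g \<in> R d" "h \<in> R d" "x \<in> D d" "h x \<noteq> 0" "{y \<in> D d. h y \<noteq> 0} \<subseteq> U"
    "\<And>y. y \<in> D d \<Longrightarrow> h y \<noteq> 0 \<Longrightarrow> \<phi> y = g y / h y"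
    by (rule regE[OF assms(1,2,4)]) (rule that)
  obtain e g' h' where e: "e \<in> I" "g' \<in> R e" "h' \<in> R e" "x \<in> D e" "h' x \<noteq> 0" "{y \<in> D e. h' y \<noteq> 0} \<subseteq> U"
    "\<And>y. y \<in> D e \<Longrightarrow> h' y \<noteq> 0 \<Longrightarrow> \<psi> y = g' y / h' y"
    by (rule regE[OF assms(1,3,4)]) (rule that)
  obtain m where m: "m \<in> I" "D m = D d \<inter> D e" "R d \<subseteq> R m" "R e \<subseteq> R m"
    using meet d(1) e(1) by blast
  then show thesis using d e by (intro that[of m g h g' h']) auto
qed

lemma geometric: "geometric A"
  unfolding geometric_def
proof (intro conjI allI impI)
  fix U \<phi> \<psi> assume U: "openin (zar A) U" and \<phi>: "\<phi> \<in> reg A U"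
  show "\<psi> \<in> reg A U" if e: "\<forall>x\<in>U. \<psi> x = \<phi> x"
  proof (rule regI[OF U])
    fix x assume x: "x \<in> U"
    obtain d g h where d: "d \<in> I" "g \<in> R d" "h \<in> R d" "x \<in> D d" "h x \<noteq> 0" "{y \<in> D d. h y \<noteq> 0} \<subseteq> U"
      "\<And>y. y \<in> D d \<Longrightarrow> h y \<noteq> 0 \<Longrightarrow> \<phi> y = g y / h y"
      by (rule regE[OF U \<phi> x]) (rule that)
    then show "\<exists>d\<in>I. \<exists>g\<in>R d. \<exists>h\<in>R d. x \<in> D d \<and> h x \<noteq> 0 \<and> (\<forall>y\<in>U \<inter> D d. h y \<noteq> 0 \<longrightarrow> \<psi> y = g y / h y)"
      using e by (intro bexI[of _ d] bexI[of _ g] bexI[of _ h]) auto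
  qed
  assume \<psi>: "\<psi> \<in> reg A U"
  show "(\<lambda>x. \<phi> x + \<psi> x) \<in> reg A U"
  proof (rule regI[OF U])
    fix x assume x: "x \<in> U"
    obtain d g h g' h' where d: "d \<in> I" "g \<in> R d" "h \<in> R d" "x \<in> D d" "h x \<noteq> 0"
      "g' \<in> R d" "h' \<in> R d" "h' x \<noteq> 0" "\<And>y. y \<in> D d \<Longrightarrow> h y \<noteq> 0 \<Longrightarrow> \<phi> y = g y / h y"
      "\<And>y. y \<in> D d \<Longrightarrow> h' y \<noteq> 0 \<Longrightarrow> \<psi> y = g' y / h' y" by (rule regE2[OF U \<phi> \<psi> x]) (rule that)
    then show "\<exists>d\<in>I. \<exists>g\<in>R d. \<exists>h\<in>R d. x \<in> D d \<and> h x \<noteq> 0 \<and> (\<forall>y\<in>U \<inter> D d. h y \<noteq> 0 \<longrightarrow> \<phi> y + \<psi> y = g y / h y)"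
      by (intro bexI[of _ d] bexI[of _ "\<lambda>y. g y * h' y + g' y * h y"] bexI[of _ "\<lambda>y. h y * h' y"])
        (auto simp: add_frac_eq intro: R_add R_mult)
  qed
  show "(\<lambda>x. \<phi> x * \<psi> x) \<in> reg A U"
  proof (rule regI[OF U])
    fix x assume x: "x \<in> U"
    obtain d g h g' h' where d: "d \<in> I" "g \<in> R d" "h \<in> R d" "x \<in> D d" "h x \<noteq> 0"
      "g' \<in> R d" "h' \<in> R d" "h' x \<noteq> 0" "\<And>y. y \<in> D d \<Longrightarrow> h y \<noteq> 0 \<Longrightarrow> \<phi> y = g y / h y"
      "\<And>y. y \<in> D d \<Longrightarrow> h' y \<noteq> 0 \<Longrightarrow> \<psi> y = g' y / h' y" by (rule regE2[OF U \<phi> \<psi> x]) (rule that)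
    then show "\<exists>d\<in>I. \<exists>g\<in>R d. \<exists>h\<in>R d. x \<in> D d \<and> h x \<noteq> 0 \<and> (\<forall>y\<in>U \<inter> D d. h y \<noteq> 0 \<longrightarrow> \<phi> y * \<psi> y = g y / h y)"
      by (intro bexI[of _ d] bexI[of _ "\<lambda>y. g y * g' y"] bexI[of _ "\<lambda>y. h y * h' y"])
        (auto intro: R_mult)
  qed
next
  fix U V \<phi> assume U: "openin (zar A) U" "openin (zar A) V" "V \<subseteq> U" "\<phi> \<in> reg A U"
  show "\<phi> \<in> reg A V"
  proof (rule regI[OF U(2)])
    fix x assume "x \<in> V"
    then have x: "x \<in> U" using U by blast
    obtain d g h where "d \<in> I" "g \<in> R d" "h \<in> R d" "x \<in> D d" "h x \<noteq> 0" "{y \<in> D d. h y \<noteq> 0} \<subseteq> U"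
      "\<And>y. y \<in> D d \<Longrightarrow> h y \<noteq> 0 \<Longrightarrow> \<phi> y = g y / h y"
      by (rule regE[OF U(1,4) x]) (rule that)
    then show "\<exists>d\<in>I. \<exists>g\<in>R d. \<exists>h\<in>R d. x \<in> D d \<and> h x \<noteq> 0 \<and> (\<forall>y\<in>V \<inter> D d. h y \<noteq> 0 \<longrightarrow> \<phi> y = g y / h y)"
      by (intro bexI[of _ d] bexI[of _ g] bexI[of _ h]) auto
  qed
next
  fix U \<phi> assume U: "openin (zar A) U" and l: "\<forall>x\<in>U. \<exists>V. openin (zar A) V \<and> x \<in> V \<and> V \<subseteq> U \<and> \<phi> \<in> reg A V"
  show "\<phi> \<in> reg A U"
  proof (rule regI[OF U])
    fix x assume "x \<in> U"
    then obtain V where V: "openin (zar A) V" "x \<in> V" "V \<subseteq> U" "\<phi> \<in> reg A V" using l by blast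
    obtain d g h where "d \<in> I" "g \<in> R d" "h \<in> R d" "x \<in> D d" "h x \<noteq> 0" "{y \<in> D d. h y \<noteq> 0} \<subseteq> V"
      "\<And>y. y \<in> D d \<Longrightarrow> h y \<noteq> 0 \<Longrightarrow> \<phi> y = g y / h y"
      by (rule regE[OF V(1,4,2)]) (rule that)
    then show "\<exists>d\<in>I. \<exists>g\<in>R d. \<exists>h\<in>R d. x \<in> D d \<and> h x \<noteq> 0 \<and> (\<forall>y\<in>U \<inter> D d. h y \<noteq> 0 \<longrightarrow> \<phi> y = g y / h y)"
      by (intro bexI[of _ d] bexI[of _ g] bexI[of _ h]) auto
  qed
next
  fix U c assume U: "openin (zar A) U"
  show "(\<lambda>_. c) \<in> reg A U"
  proof (rule regI[OF U])
    fix x assume "x \<in> U"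
    then obtain d where "d \<in> I" "x \<in> D d" using U unfolding openin_iff by blast
    then show "\<exists>d\<in>I. \<exists>g\<in>R d. \<exists>h\<in>R d. x \<in> D d \<and> h x \<noteq> 0 \<and> (\<forall>y\<in>U \<inter> D d. h y \<noteq> 0 \<longrightarrow> c = g y / h y)"
      by (intro bexI[of _ d] bexI[of _ "\<lambda>_. c"] bexI[of _ "\<lambda>_. 1"]) (auto intro: R_const)
  qed
next
  fix U \<phi> assume U: "openin (zar A) U" and \<phi>: "\<phi> \<in> reg A U"
  have *: "\<exists>d\<in>I. \<exists>g\<in>R d. \<exists>h\<in>R d. x \<in> D d \<and> g x \<noteq> 0 \<and> h x \<noteq> 0 \<and> {y \<in> D d. h y \<noteq> 0} \<subseteq> U \<and>
      (\<forall>y\<in>D d. h y \<noteq> 0 \<longrightarrow> \<phi> y = g y / h y)" if x: "x \<in> U" "\<phi> x \<noteq> 0" for x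
  proof -
    obtain d g h where d: "d \<in> I" "g \<in> R d" "h \<in> R d" "x \<in> D d" "h x \<noteq> 0" "{y \<in> D d. h y \<noteq> 0} \<subseteq> U"
      "\<And>y. y \<in> D d \<Longrightarrow> h y \<noteq> 0 \<Longrightarrow> \<phi> y = g y / h y"
      by (rule regE[OF U \<phi> x(1)]) (rule that)
    moreover have "g x \<noteq> 0" using d(7)[OF d(4,5)] x by auto
    ultimately show ?thesis by (intro bexI[of _ d] bexI[of _ g] bexI[of _ h]) auto
  qed
  show o: "openin (zar A) {x \<in> U. \<phi> x \<noteq> 0}"
    unfolding openin_iff
  proof
    fix x assume "x \<in> {x \<in> U. \<phi> x \<noteq> 0}"
    then obtain d g h where d: "d \<in> I" "g \<in> R d" "h \<in> R d" "x \<in> D d" "g x \<noteq> 0" "h x \<noteq> 0" "{y \<in> D d. h y \<noteq> 0} \<subseteq> U"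
      "\<forall>y\<in>D d. h y \<noteq> 0 \<longrightarrow> \<phi> y = g y / h y" using * by blast
    have "{y \<in> D d. g y * h y \<noteq> 0} \<subseteq> {x \<in> U. \<phi> x \<noteq> 0}" using d(7,8) by force
    then show "\<exists>d\<in>I. \<exists>h\<in>R d. x \<in> D d \<and> h x \<noteq> 0 \<and> {y \<in> D d. h y \<noteq> 0} \<subseteq> {x \<in> U. \<phi> x \<noteq> 0}"
      using d R_mult by (intro bexI[of _ d] bexI[of _ "\<lambda>y. g y * h y"]) auto
  qed
  show "(\<lambda>x. inverse (\<phi> x)) \<in> reg A {x \<in> U. \<phi> x \<noteq> 0}"
  proof (rule regI[OF o])
    fix x assume "x \<in> {x \<in> U. \<phi> x \<noteq> 0}"
    then obtain d g h where d: "d \<in> I" "g \<in> R d" "h \<in> R d" "x \<in> D d" "g x \<noteq> 0" "h x \<noteq> 0" "{y \<in> D d. h y \<noteq> 0} \<subseteq> U"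
      "\<forall>y\<in>D d. h y \<noteq> 0 \<longrightarrow> \<phi> y = g y / h y" using * by blast
    then show "\<exists>d\<in>I. \<exists>g\<in>R d. \<exists>h\<in>R d. x \<in> D d \<and> h x \<noteq> 0 \<and>
        (\<forall>y\<in>{x \<in> U. \<phi> x \<noteq> 0} \<inter> D d. h y \<noteq> 0 \<longrightarrow> inverse (\<phi> y) = g y / h y)"
      using R_mult by (intro bexI[of _ d] bexI[of _ "\<lambda>y. h y * h y"] bexI[of _ "\<lambda>y. g y * h y"]) auto
  qed
qed

end

lemma openin_zar_space_subset: "openin (zar (zar_space P C)) W \<Longrightarrow> W \<subseteq> P"
  using openin_subset[of "zar (zar_space P C)" W] by (simp add: topspace_zar_space)

lemma fraction_space_zar_space:
  "fraction_space (zar_space P C) {()} (\<lambda>_. P) (\<lambda>_. poly_funs C)"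
proof
  show "zar (zar_space P C) = topology_generated_by {{x \<in> P. h x \<noteq> 0} | d h. d \<in> {()} \<and> h \<in> poly_funs C}"
    by (simp add: zar_space_def)
  fix W assume "openin (zar (zar_space P C)) W"
  then have W: "W \<subseteq> P" by (rule openin_zar_space_subset)
  then have WP: "W \<inter> P = W" by blast
  show "reg (zar_space P C) W = {\<phi>. \<forall>x\<in>W. \<exists>d\<in>{()}. x \<in> P \<and> (\<exists>g\<in>poly_funs C. \<exists>h\<in>poly_funs C. h x \<noteq> 0 \<and>
       (\<forall>y\<in>W \<inter> P. h y \<noteq> 0 \<longrightarrow> \<phi> y = g y / h y))}"
    unfolding WP using W by (simp add: zar_space_def) blast
qed (auto intro: poly_funs.intros)

lemma geometric_zar_space: "geometric (zar_space P C)"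
  by (rule fraction_space.geometric[OF fraction_space_zar_space])

lemma openin_zar_space:
  "openin (zar (zar_space P C)) U \<longleftrightarrow> U \<subseteq> P \<and> (\<forall>x\<in>U. \<exists>p\<in>poly_funs C. p x \<noteq> 0 \<and> {y \<in> P. p y \<noteq> 0} \<subseteq> U)"
  using openin_zar_space_subset[of P C U]
  unfolding fraction_space.openin_iff[OF fraction_space_zar_space] by blast

lemma reg_zar_space: "\<phi> \<in> reg (zar_space P C) U \<longleftrightarrow> (\<forall>x\<in>U. frac_at C U x \<phi>)"
  by (simp add: zar_space_def frac_at_def)

lemma geometric_quot_spc:
  assumes A: "geometric A"
  shows "geometric (quot_spc A q)"
proof -
  define P where "P U = {x \<in> topspace (zar A). q x \<in> U}" for U
  have o: "openin (zar (quot_spc A q)) U \<longleftrightarrow> U \<subseteq> q ` topspace (zar A) \<and> openin (zar A) (P U)" for U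
    unfolding P_def by (rule openin_quot_spc)
  have r: "\<phi> \<in> reg (quot_spc A q) U \<longleftrightarrow> (\<lambda>x. \<phi> (q x)) \<in> reg A (P U)" for \<phi> U
    by (simp add: quot_spc_def P_def comp_def)
  have PI: "x \<in> P U \<Longrightarrow> q x \<in> U" "U \<subseteq> V \<Longrightarrow> P U \<subseteq> P V" for x U V by (auto simp: P_def)
  have PC: "P {x \<in> U. \<phi> x \<noteq> 0} = {x \<in> P U. \<phi> (q x) \<noteq> 0}" for U and \<phi> :: "_ \<Rightarrow> 'b" by (auto simp: P_def)
  note g = geometricD[OF A]
  show ?thesis
    unfolding geometric_def o r PC
  proof (intro conjI allI impI; (elim conjE)?)
    fix U \<phi> \<psi> assume U: "openin (zar A) (P U)" "(\<lambda>x. \<phi> (q x)) \<in> reg A (P U)"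
    show "(\<lambda>x. \<psi> (q x)) \<in> reg A (P U)" if "\<forall>x\<in>U. \<psi> x = \<phi> x"
      by (rule g(1)[OF U]) (use that PI(1) in blast)
    show "(\<lambda>x. \<phi> (q x) + \<psi> (q x)) \<in> reg A (P U)" if "(\<lambda>x. \<psi> (q x)) \<in> reg A (P U)"
      using g(5)[OF U that] .
    show "(\<lambda>x. \<phi> (q x) * \<psi> (q x)) \<in> reg A (P U)" if "(\<lambda>x. \<psi> (q x)) \<in> reg A (P U)"
      using g(6)[OF U that] .
    show "{x \<in> U. \<phi> x \<noteq> 0} \<subseteq> q ` topspace (zar A)" if "U \<subseteq> q ` topspace (zar A)" using that by auto
    show "openin (zar A) {x \<in> P U. \<phi> (q x) \<noteq> 0}" using g(7)[OF U] .
    show "(\<lambda>x. inverse (\<phi> (q x))) \<in> reg A {x \<in> P U. \<phi> (q x) \<noteq> 0}" using g(8)[OF U] .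
  next
    fix U V \<phi> assume "openin (zar A) (P U)" "openin (zar A) (P V)" "V \<subseteq> U" "(\<lambda>x. \<phi> (q x)) \<in> reg A (P U)"
    then show "(\<lambda>x. \<phi> (q x)) \<in> reg A (P V)" by (intro g(2)[of "P U" "P V" "\<lambda>x. \<phi> (q x)"] PI(2))
  next
    fix U \<phi> assume U: "openin (zar A) (P U)"
      and l: "\<forall>x\<in>U. \<exists>V. (V \<subseteq> q ` topspace (zar A) \<and> openin (zar A) (P V)) \<and> x \<in> V \<and> V \<subseteq> U \<and> (\<lambda>x. \<phi> (q x)) \<in> reg A (P V)"
    show "(\<lambda>x. \<phi> (q x)) \<in> reg A (P U)"
    proof (rule g(3)[OF U])
      fix x assume x: "x \<in> P U"
      then obtain V where V: "openin (zar A) (P V)" "q x \<in> V" "V \<subseteq> U" "(\<lambda>x. \<phi> (q x)) \<in> reg A (P V)"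
        using bspec[OF l PI(1)[OF x]] by blast
      moreover have "x \<in> P V" using x V by (simp add: P_def)
      moreover have "P V \<subseteq> P U" by (rule PI(2)[OF V(3)])
      ultimately show "\<exists>V. openin (zar A) V \<and> x \<in> V \<and> V \<subseteq> P U \<and> (\<lambda>x. \<phi> (q x)) \<in> reg A V" by blast
    qed
  next
    show "(\<lambda>x. c) \<in> reg A (P U)" if "openin (zar A) (P U)" for U c using g(4)[OF that] .
  qed
qed

lemma reg_subspc_iff:
  "\<phi> \<in> reg (subspc A T) U \<longleftrightarrow> (\<forall>x\<in>U. \<exists>V \<psi>. openin (zar A) V \<and> x \<in> V \<and> \<psi> \<in> reg A V \<and> (\<forall>y\<in>U \<inter> V. \<phi> y = \<psi> y))"
  by (simp add: subspc_def)

lemma zar_subspc: "zar (subspc A T) = subtopology (zar A) T"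
  by (simp add: subspc_def)

lemma geometric_subspc:
  assumes A: "geometric A"
  shows "geometric (subspc A T)"
proof -
  note g = geometricD[OF A] and r = reg_subspc_iff
  note o = openin_subtopology[of "zar A" T]
  have pair: "\<exists>V \<psi> \<psi>'. openin (zar A) V \<and> x \<in> V \<and> \<psi> \<in> reg A V \<and> \<psi>' \<in> reg A V \<and>
      (\<forall>y\<in>U \<inter> V. \<phi> y = \<psi> y \<and> \<phi>' y = \<psi>' y)"
    if pr: "\<phi> \<in> reg (subspc A T) U" "\<phi>' \<in> reg (subspc A T) U" "x \<in> U" for \<phi> \<phi>' U x
  proof -
    obtain V \<psi> where V: "openin (zar A) V" "x \<in> V" "\<psi> \<in> reg A V" "\<forall>y\<in>U \<inter> V. \<phi> y = \<psi> y"
      using bspec[OF pr(1)[unfolded r] pr(3)] by blast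
    obtain V' \<psi>' where V': "openin (zar A) V'" "x \<in> V'" "\<psi>' \<in> reg A V'" "\<forall>y\<in>U \<inter> V'. \<phi>' y = \<psi>' y"
      using bspec[OF pr(2)[unfolded r] pr(3)] by blast
    have o: "openin (zar A) (V \<inter> V')" using V V' by blast
    then have "\<psi> \<in> reg A (V \<inter> V')" "\<psi>' \<in> reg A (V \<inter> V')"
      using g(2)[OF V(1) o _ V(3)] g(2)[OF V'(1) o _ V'(3)] by auto
    then show ?thesis using V V' o by (intro exI[of _ "V \<inter> V'"] exI[of _ \<psi>] exI[of _ \<psi>']) auto
  qed
  show ?thesis
    unfolding geometric_def zar_subspc
  proof (intro conjI allI impI)
    fix U \<phi> \<psi> assume U: "openin (subtopology (zar A) T) U" and \<phi>: "\<phi> \<in> reg (subspc A T) U"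
    show "\<psi> \<in> reg (subspc A T) U" if "\<forall>x\<in>U. \<psi> x = \<phi> x"
      unfolding r
    proof
      fix x assume "x \<in> U"
      from bspec[OF \<phi>[unfolded r] this] obtain V \<phi>1 where "openin (zar A) V" "x \<in> V" "\<phi>1 \<in> reg A V" "\<forall>y\<in>U \<inter> V. \<phi> y = \<phi>1 y"
        by (elim exE conjE) (rule that)
      then show "\<exists>V \<psi>'. openin (zar A) V \<and> x \<in> V \<and> \<psi>' \<in> reg A V \<and> (\<forall>y\<in>U \<inter> V. \<psi> y = \<psi>' y)"
        using that by (intro exI[of _ V] exI[of _ \<phi>1]) auto
    qed
    assume \<psi>: "\<psi> \<in> reg (subspc A T) U"
    show "(\<lambda>x. \<phi> x + \<psi> x) \<in> reg (subspc A T) U"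
      unfolding r
    proof
      fix x assume x: "x \<in> U"
      from pair[OF \<phi> \<psi> x] obtain V \<phi>1 \<psi>1 where V: "openin (zar A) V" "x \<in> V" "\<phi>1 \<in> reg A V" "\<psi>1 \<in> reg A V"
        "\<forall>y\<in>U \<inter> V. \<phi> y = \<phi>1 y \<and> \<psi> y = \<psi>1 y"
        by (elim exE conjE) (rule that)
      then show "\<exists>V \<psi>'. openin (zar A) V \<and> x \<in> V \<and> \<psi>' \<in> reg A V \<and> (\<forall>y\<in>U \<inter> V. \<phi> y + \<psi> y = \<psi>' y)"
        using g(5)[OF V(1,3,4)] by (intro exI[of _ V] exI[of _ "\<lambda>x. \<phi>1 x + \<psi>1 x"]) auto
    qed
    show "(\<lambda>x. \<phi> x * \<psi> x) \<in> reg (subspc A T) U"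
      unfolding r
    proof
      fix x assume x: "x \<in> U"
      from pair[OF \<phi> \<psi> x] obtain V \<phi>1 \<psi>1 where V: "openin (zar A) V" "x \<in> V" "\<phi>1 \<in> reg A V" "\<psi>1 \<in> reg A V"
        "\<forall>y\<in>U \<inter> V. \<phi> y = \<phi>1 y \<and> \<psi> y = \<psi>1 y"
        by (elim exE conjE) (rule that)
      then show "\<exists>V \<psi>'. openin (zar A) V \<and> x \<in> V \<and> \<psi>' \<in> reg A V \<and> (\<forall>y\<in>U \<inter> V. \<phi> y * \<psi> y = \<psi>' y)"
        using g(6)[OF V(1,3,4)] by (intro exI[of _ V] exI[of _ "\<lambda>x. \<phi>1 x * \<psi>1 x"]) auto
    qed
  next
    fix U V \<phi> assume VU: "V \<subseteq> U" and \<phi>: "\<phi> \<in> reg (subspc A T) U"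
    show "\<phi> \<in> reg (subspc A T) V"
      unfolding r
    proof
      fix x assume "x \<in> V"
      then have "x \<in> U" using VU by blast
      from bspec[OF \<phi>[unfolded r] this] obtain V' \<phi>1 where "openin (zar A) V'" "x \<in> V'" "\<phi>1 \<in> reg A V'" "\<forall>y\<in>U \<inter> V'. \<phi> y = \<phi>1 y"
        by (elim exE conjE) (rule that)
      then show "\<exists>V' \<psi>'. openin (zar A) V' \<and> x \<in> V' \<and> \<psi>' \<in> reg A V' \<and> (\<forall>y\<in>V \<inter> V'. \<phi> y = \<psi>' y)"
        using VU by (intro exI[of _ V'] exI[of _ \<phi>1]) auto
    qed
  next
    fix U \<phi> assume l: "\<forall>x\<in>U. \<exists>V. openin (subtopology (zar A) T) V \<and> x \<in> V \<and> V \<subseteq> U \<and> \<phi> \<in> reg (subspc A T) V"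
      and U: "openin (subtopology (zar A) T) U"
    show "\<phi> \<in> reg (subspc A T) U"
      unfolding r
    proof
      fix x assume "x \<in> U"
      then obtain V where V: "openin (subtopology (zar A) T) V" "x \<in> V" "\<phi> \<in> reg (subspc A T) V" using l by blast
      then obtain S where S: "openin (zar A) S" "V = S \<inter> T" unfolding o by blast
      obtain V1 \<psi> where V1: "openin (zar A) V1" "x \<in> V1" "\<psi> \<in> reg A V1" "\<forall>y\<in>V \<inter> V1. \<phi> y = \<psi> y"
        using bspec[OF V(3)[unfolded r] V(2)] by blast
      have o1: "openin (zar A) (S \<inter> V1)" using S V1 by blast
      have "U \<subseteq> T" using openin_subset[OF U] by simp
      then have "\<forall>y\<in>U \<inter> (S \<inter> V1). \<phi> y = \<psi> y" using V1 S by auto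
      moreover have "\<psi> \<in> reg A (S \<inter> V1)" using g(2)[OF V1(1) o1 _ V1(3)] by simp
      ultimately show "\<exists>V \<psi>. openin (zar A) V \<and> x \<in> V \<and> \<psi> \<in> reg A V \<and> (\<forall>y\<in>U \<inter> V. \<phi> y = \<psi> y)"
        using o1 V V1 S by (intro exI[of _ "S \<inter> V1"] exI[of _ \<psi>]) auto
    qed
  next
    fix U c assume U: "openin (subtopology (zar A) T) U"
    then have "U \<subseteq> topspace (zar A)" using openin_subset[OF U] by simp
    then show "(\<lambda>_. c) \<in> reg (subspc A T) U"
      unfolding r using g(4)[OF openin_topspace]
      by (intro ballI exI[of _ "topspace (zar A)"] exI[of _ "\<lambda>_. c"]) auto
  next
    fix U \<phi> assume U: "openin (subtopology (zar A) T) U" and \<phi>: "\<phi> \<in> reg (subspc A T) U"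
    have *: "\<exists>V \<psi>. openin (zar A) V \<and> x \<in> V \<and> \<psi> \<in> reg A V \<and> (\<forall>y\<in>U \<inter> V. \<phi> y = \<psi> y)" if "x \<in> U" for x
      by (rule bspec[OF \<phi>[unfolded r] that])
    show "openin (subtopology (zar A) T) {x \<in> U. \<phi> x \<noteq> 0}"
    proof (subst openin_subopen, rule ballI)
      fix x assume x: "x \<in> {x \<in> U. \<phi> x \<noteq> 0}"
      then obtain V \<psi> where V: "openin (zar A) V" "x \<in> V" "\<psi> \<in> reg A V" "\<forall>y\<in>U \<inter> V. \<phi> y = \<psi> y" using *[of x] by blast
      have "openin (subtopology (zar A) T) (T \<inter> {y \<in> V. \<psi> y \<noteq> 0})"
        using g(7)[OF V(1,3)] by (simp add: openin_subtopology_Int2)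
      then have "openin (subtopology (zar A) T) (U \<inter> (T \<inter> {y \<in> V. \<psi> y \<noteq> 0}))" using U by (rule openin_Int[rotated])
      then show "\<exists>S. openin (subtopology (zar A) T) S \<and> x \<in> S \<and> S \<subseteq> {x \<in> U. \<phi> x \<noteq> 0}"
        using V x openin_subset[OF U] by (intro exI[of _ "U \<inter> (T \<inter> {y \<in> V. \<psi> y \<noteq> 0})"]) auto
    qed
    show "(\<lambda>x. inverse (\<phi> x)) \<in> reg (subspc A T) {x \<in> U. \<phi> x \<noteq> 0}"
      unfolding r
    proof
      fix x assume x: "x \<in> {x \<in> U. \<phi> x \<noteq> 0}"
      then obtain V \<psi> where V: "openin (zar A) V" "x \<in> V" "\<psi> \<in> reg A V" "\<forall>y\<in>U \<inter> V. \<phi> y = \<psi> y" using *[of x] by blast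
      show "\<exists>V \<psi>. openin (zar A) V \<and> x \<in> V \<and> \<psi> \<in> reg A V \<and> (\<forall>y\<in>{x \<in> U. \<phi> x \<noteq> 0} \<inter> V. inverse (\<phi> y) = \<psi> y)"
        using V x g(7,8)[OF V(1,3)]
        by (intro exI[of _ "{x \<in> V. \<psi> x \<noteq> 0}"] exI[of _ "\<lambda>x. inverse (\<psi> x)"]) auto
    qed
  qed
qed

text \<open>
  Reindexes a double sum by a single index, as the product of two tensors has to be a single
  sum.
\<close>

lemma sum_div_mod:
  fixes f :: "nat \<Rightarrow> nat \<Rightarrow> 'b::comm_monoid_add"
  shows "(\<Sum>j<n * m. f (j div m) (j mod m)) = (\<Sum>k<n. \<Sum>l<m. f k l)"
proof (induction n)
  case (Suc n)
  note sp = sum_lessThan_add_split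
  have "(\<Sum>j<Suc n * m. f (j div m) (j mod m)) = (\<Sum>j<n * m + m. f (j div m) (j mod m))" by (simp add: add.commute)
  also have "\<dots> = (\<Sum>k<n. \<Sum>l<m. f k l) + (\<Sum>l<m. f ((n * m + l) div m) ((n * m + l) mod m))"
    unfolding sp Suc.IH ..
  also have "(\<Sum>l<m. f ((n * m + l) div m) ((n * m + l) mod m)) = (\<Sum>l<m. f n l)"
    by (intro sum.cong) auto
  finally show ?case by simp
qed simp

lemma tensor_funs_one:
  assumes "a \<in> reg A U" "b \<in> reg B V"
  shows "(\<lambda>(x, y). a x * b y) \<in> tensor_funs A B U V"
  unfolding tensor_funs_def using assms
  by (intro CollectI exI[of _ "1::nat"] exI[of _ "\<lambda>_. a"] exI[of _ "\<lambda>_. b"]) auto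

lemma tensor_funs_add:
  fixes A :: "('p, 'k::field) fn_space" and B :: "('q, 'k) fn_space"
  assumes "g \<in> tensor_funs A B U V" "h \<in> tensor_funs A B U V"
  shows "(\<lambda>w. g w + h w) \<in> tensor_funs A B U V"
proof -
  obtain n :: nat and a b where g: "g = (\<lambda>(x, y). \<Sum>k<n. a k x * b k y)" "\<And>k. k < n \<Longrightarrow> a k \<in> reg A U \<and> b k \<in> reg B V"
    using assms(1) by (auto simp: tensor_funs_def)
  obtain m :: nat and c d where h: "h = (\<lambda>(x, y). \<Sum>k<m. c k x * d k y)" "\<And>k. k < m \<Longrightarrow> c k \<in> reg A U \<and> d k \<in> reg B V"
    using assms(2) by (auto simp: tensor_funs_def)
  note sp = sum_lessThan_add_split
  define a' where "a' k = (if k < n then a k else c (k - n))" for k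
  define b' where "b' k = (if k < n then b k else d (k - n))" for k
  have "(\<lambda>w. g w + h w) = (\<lambda>(x, y). \<Sum>k<n + m. a' k x * b' k y)"
    unfolding g(1) h(1) sp by (auto simp: a'_def b'_def intro!: sum.cong)
  moreover have "a' k \<in> reg A U \<and> b' k \<in> reg B V" if "k < n + m" for k
    using g(2)[of k] h(2)[of "k - n"] that by (auto simp: a'_def b'_def)
  ultimately show ?thesis unfolding tensor_funs_def by blast
qed

lemma tensor_funs_mult:
  fixes A :: "('p, 'k::field) fn_space" and B :: "('q, 'k) fn_space"
  assumes "geometric A" "geometric B" "openin (zar A) U" "openin (zar B) V"
    and "g \<in> tensor_funs A B U V" "h \<in> tensor_funs A B U V"
  shows "(\<lambda>w. g w * h w) \<in> tensor_funs A B U V"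
proof -
  obtain n :: nat and a b where g: "g = (\<lambda>(x, y). \<Sum>k<n. a k x * b k y)" "\<And>k. k < n \<Longrightarrow> a k \<in> reg A U \<and> b k \<in> reg B V"
    using assms(5) by (auto simp: tensor_funs_def)
  obtain m :: nat and c d where h: "h = (\<lambda>(x, y). \<Sum>k<m. c k x * d k y)" "\<And>k. k < m \<Longrightarrow> c k \<in> reg A U \<and> d k \<in> reg B V"
    using assms(6) by (auto simp: tensor_funs_def)
  define a' where "a' j = (\<lambda>x. a (j div m) x * c (j mod m) x)" for j
  define b' where "b' j = (\<lambda>x. b (j div m) x * d (j mod m) x)" for j
  have "(\<lambda>w. g w * h w) = (\<lambda>(x, y). \<Sum>k<n * m. a' k x * b' k y)"
  proof
    fix w :: "'p \<times> 'q"
    obtain x y where w: "w = (x, y)" by force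
    have "g w * h w = (\<Sum>i<n. \<Sum>j<m. (a i x * b i y) * (c j x * d j y))"
      by (simp add: g(1) h(1) w sum_product)
    also have "\<dots> = (\<Sum>k<n * m. (a (k div m) x * b (k div m) y) * (c (k mod m) x * d (k mod m) y))"
      by (rule sum_div_mod[symmetric])
    also have "\<dots> = (\<Sum>k<n * m. a' k x * b' k y)"
      unfolding a'_def b'_def by (simp add: mult.assoc mult.left_commute)
    finally show "g w * h w = (case w of (x, y) \<Rightarrow> \<Sum>k<n * m. a' k x * b' k y)" by (simp add: w)
  qed
  moreover have "a' k \<in> reg A U \<and> b' k \<in> reg B V" if "k < n * m" for k
  proof -
    have "k div m < n" "k mod m < m"
      using less_mult_imp_div_less[OF that] mod_less_divisor[of m k] that by (cases "m = 0"; simp)+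
    then show ?thesis
      using g(2)[of "k div m"] h(2)[of "k mod m"] geometricD(6)[OF assms(1,3)] geometricD(6)[OF assms(2,4)]
      by (simp add: a'_def b'_def)
  qed
  ultimately show ?thesis unfolding tensor_funs_def by blast
qed

lemma tensor_funs_mono:
  assumes "geometric A" "geometric B" "openin (zar A) U" "openin (zar B) V" "openin (zar A) U'" "openin (zar B) V'"
    "U' \<subseteq> U" "V' \<subseteq> V"
  shows "tensor_funs A B U V \<subseteq> tensor_funs A B U' V'"
  unfolding tensor_funs_def
  using geometricD(2)[OF assms(1,3,5,7)] geometricD(2)[OF assms(2,4,6,8)] by blast

lemma fraction_space_prod_spc:
  assumes A: "geometric A" and B: "geometric B"
  shows "fraction_space (prod_spc A B) {(U, V). openin (zar A) U \<and> openin (zar B) V} (\<lambda>(U, V). U \<times> V)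
     (\<lambda>(U, V). tensor_funs A B U V)"
proof
  show "zar (prod_spc A B) = topology_generated_by {{x \<in> case d of (U, V) \<Rightarrow> U \<times> V. h x \<noteq> 0} | d h.
      d \<in> {(U, V). openin (zar A) U \<and> openin (zar B) V} \<and> h \<in> (case d of (U, V) \<Rightarrow> tensor_funs A B U V)}"
    unfolding prod_spc_def fn_space.select_convs
    by (simp only: split_paired_Ex mem_Collect_eq case_prod_conv conj_assoc)
  fix W
  show "reg (prod_spc A B) W = {\<phi>. \<forall>x\<in>W. \<exists>d\<in>{(U, V). openin (zar A) U \<and> openin (zar B) V}. x \<in> (case d of (U, V) \<Rightarrow> U \<times> V) \<and>
     (\<exists>g\<in>case d of (U, V) \<Rightarrow> tensor_funs A B U V. \<exists>h\<in>case d of (U, V) \<Rightarrow> tensor_funs A B U V. h x \<noteq> 0 \<and>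
       (\<forall>y\<in>W \<inter> (case d of (U, V) \<Rightarrow> U \<times> V). h y \<noteq> 0 \<longrightarrow> \<phi> y = g y / h y))}"
    unfolding prod_spc_def by (simp add: Bex_def conj_assoc)
next
  fix d e
  assume d: "d \<in> {(U, V). openin (zar A) U \<and> openin (zar B) V}" and e: "e \<in> {(U, V). openin (zar A) U \<and> openin (zar B) V}"
  obtain U V where UV: "d = (U, V)" by force
  obtain U' V' where UV': "e = (U', V')" by force
  have o: "openin (zar A) U" "openin (zar B) V" "openin (zar A) U'" "openin (zar B) V'" using d e UV UV' by auto
  have o': "openin (zar A) (U \<inter> U')" "openin (zar B) (V \<inter> V')" using o by auto
  have "tensor_funs A B U V \<subseteq> tensor_funs A B (U \<inter> U') (V \<inter> V')" "tensor_funs A B U' V' \<subseteq> tensor_funs A B (U \<inter> U') (V \<inter> V')"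
    using tensor_funs_mono[OF A B o(1,2) o'] tensor_funs_mono[OF A B o(3,4) o'] by auto
  then show "\<exists>m\<in>{(U, V). openin (zar A) U \<and> openin (zar B) V}.
       (case m of (U, V) \<Rightarrow> U \<times> V) = (case d of (U, V) \<Rightarrow> U \<times> V) \<inter> (case e of (U, V) \<Rightarrow> U \<times> V) \<and>
       (case d of (U, V) \<Rightarrow> tensor_funs A B U V) \<subseteq> (case m of (U, V) \<Rightarrow> tensor_funs A B U V) \<and>
       (case e of (U, V) \<Rightarrow> tensor_funs A B U V) \<subseteq> (case m of (U, V) \<Rightarrow> tensor_funs A B U V)"
    using o' UV UV' by (intro bexI[of _ "(U \<inter> U', V \<inter> V')"]) auto
next
  fix d c assume d: "d \<in> {(U, V). openin (zar A) U \<and> openin (zar B) V}"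
  obtain U V where UV: "d = (U, V)" by force
  have "(\<lambda>(x, y). c * 1) \<in> tensor_funs A B U V"
    using d UV geometricD(4)[OF A] geometricD(4)[OF B] by (intro tensor_funs_one) auto
  then show "(\<lambda>_. c) \<in> (case d of (U, V) \<Rightarrow> tensor_funs A B U V)" using UV by (simp add: case_prod_unfold)
next
  fix d g h assume d: "d \<in> {(U, V). openin (zar A) U \<and> openin (zar B) V}"
    and gh: "g \<in> (case d of (U, V) \<Rightarrow> tensor_funs A B U V)" "h \<in> (case d of (U, V) \<Rightarrow> tensor_funs A B U V)"
  obtain U V where UV: "d = (U, V)" by force
  show "(\<lambda>x. g x + h x) \<in> (case d of (U, V) \<Rightarrow> tensor_funs A B U V)"
    using UV gh by (auto intro: tensor_funs_add)
  show "(\<lambda>x. g x * h x) \<in> (case d of (U, V) \<Rightarrow> tensor_funs A B U V)"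
    using UV gh d by (auto intro: tensor_funs_mult[OF A B])
qed

lemma geometric_prod_spc: "geometric A \<Longrightarrow> geometric B \<Longrightarrow> geometric (prod_spc A B)"
  by (rule fraction_space.geometric[OF fraction_space_prod_spc])

section \<open>Affine charts\<close>

text \<open>
  On \<open>U\<close> the space looks like a subset of an affine space with coordinate functions \<open>C\<close>: open
  subsets of \<open>U\<close> are unions of nonvanishing loci of polynomials in \<open>C\<close>, regular functions are
  locally fractions of such polynomials.
\<close>

definition chart :: "('p, 'k::field) fn_space \<Rightarrow> 'p set \<Rightarrow> ('p \<Rightarrow> 'k) set \<Rightarrow> bool" where
  "chart A U C \<longleftrightarrow> openin (zar A) U \<and> C \<subseteq> reg A U \<and>
     (\<forall>W. W \<subseteq> U \<longrightarrow> openin (zar A) W \<longrightarrow> (\<forall>x\<in>W. \<exists>p\<in>poly_funs C. p x \<noteq> 0 \<and> {y \<in> U. p y \<noteq> 0} \<subseteq> W)) \<and>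
     (\<forall>W \<phi>. W \<subseteq> U \<longrightarrow> openin (zar A) W \<longrightarrow> \<phi> \<in> reg A W \<longrightarrow> (\<forall>x\<in>W. frac_at C W x \<phi>))"

lemma chartD:
  assumes "chart A U C"
  shows "openin (zar A) U" "\<gamma> \<in> C \<Longrightarrow> \<gamma> \<in> reg A U"
    "W \<subseteq> U \<Longrightarrow> openin (zar A) W \<Longrightarrow> x \<in> W \<Longrightarrow> \<exists>p\<in>poly_funs C. p x \<noteq> 0 \<and> {y \<in> U. p y \<noteq> 0} \<subseteq> W"
    "W \<subseteq> U \<Longrightarrow> openin (zar A) W \<Longrightarrow> \<phi> \<in> reg A W \<Longrightarrow> x \<in> W \<Longrightarrow> frac_at C W x \<phi>"
  using assms by (auto simp: chart_def)

lemma poly_funs_reg: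
  assumes A: "geometric A" and U: "openin (zar A) U" and C: "\<And>\<gamma>. \<gamma> \<in> C \<Longrightarrow> (\<lambda>x. \<gamma> (m x)) \<in> reg A U"
    and p: "p \<in> poly_funs C"
  shows "(\<lambda>x. p (m x)) \<in> reg A U"
  using p
proof induction
  case (const c)
  then show ?case using geometricD(4)[OF A U] by simp
next
  case (coord \<gamma>)
  then show ?case using C by simp
next
  case (add p q)
  then show ?case using geometricD(5)[OF A U] by simp
next
  case (mult p q)
  then show ?case using geometricD(6)[OF A U] by simp
qed

lemma chart_zar_space: "chart (zar_space P C) P C"
  unfolding chart_def
proof (intro conjI allI impI ballI subsetI)
  show "openin (zar (zar_space P C)) P" by (metis openin_topspace topspace_zar_space)
  show "\<gamma> \<in> reg (zar_space P C) P" if "\<gamma> \<in> C" for \<gamma>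
    using that by (auto simp: reg_zar_space intro: frac_at_poly poly_funs.coord)
qed (auto simp: openin_zar_space reg_zar_space)

lemma chart_subspc:
  assumes A: "geometric A" and c: "chart A U C"
  shows "chart (subspc A T) (U \<inter> T) C"
  unfolding chart_def zar_subspc
proof (intro conjI allI impI ballI subsetI)
  note c = chartD[OF c]
  show "openin (subtopology (zar A) T) (U \<inter> T)" using c(1) by (rule openin_subtopology_Int)
  show "\<gamma> \<in> reg (subspc A T) (U \<inter> T)" if "\<gamma> \<in> C" for \<gamma>
    unfolding reg_subspc_iff using c(1) c(2)[OF that] by auto
  fix W assume W: "W \<subseteq> U \<inter> T" "openin (subtopology (zar A) T) W"
  obtain S where S: "openin (zar A) S" "W = S \<inter> T" using W by (auto simp: openin_subtopology)
  have SU: "S \<inter> U \<subseteq> U" "openin (zar A) (S \<inter> U)" using S c(1) by auto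
  show "\<exists>p\<in>poly_funs C. p x \<noteq> 0 \<and> {y \<in> U \<inter> T. p y \<noteq> 0} \<subseteq> W" if "x \<in> W" for x
  proof -
    have "x \<in> S \<inter> U" using that W S by auto
    then obtain p where p: "p \<in> poly_funs C" "p x \<noteq> 0" "{y \<in> U. p y \<noteq> 0} \<subseteq> S \<inter> U" using c(3)[OF SU] by blast
    then show ?thesis using S by (intro bexI[of _ p]) auto
  qed
  fix \<phi> x assume \<phi>: "\<phi> \<in> reg (subspc A T) W" and x: "x \<in> W"
  obtain V \<psi> where V: "openin (zar A) V" "x \<in> V" "\<psi> \<in> reg A V" "\<forall>y\<in>W \<inter> V. \<phi> y = \<psi> y"
    using bspec[OF \<phi>[unfolded reg_subspc_iff] x] by blast
  have VU: "V \<inter> U \<subseteq> U" "openin (zar A) (V \<inter> U)" "x \<in> V \<inter> U" using V c(1) W x by auto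
  have "\<psi> \<in> reg A (V \<inter> U)" using geometricD(2)[OF A V(1) VU(2) _ V(3)] by auto
  from c(4)[OF VU(1,2) this VU(3)] have "frac_at C (V \<inter> U) x \<psi>" .
  moreover obtain r where r: "r \<in> poly_funs C" "r x \<noteq> 0" "{y \<in> U. r y \<noteq> 0} \<subseteq> V \<inter> U" using c(3)[OF VU] by blast
  ultimately have "frac_at C (W \<inter> V) x \<phi>" using V(4) W
    by (auto intro: frac_at_cong[OF frac_at_mono[where X = "V \<inter> U"]])
  then show "frac_at C W x \<phi>" by (rule frac_at_local[OF _ r(1,2)]) (use r W in auto)
qed

text \<open>
  On a box, each summand of a tensor is a product of local fractions in the two sets of
  coordinates; a quotient of tensors is then again a local fraction.
\<close>

lemma chart_prod:
  fixes A :: "('p, 'k::field) fn_space" and B :: "('q, 'k) fn_space"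
  assumes A: "geometric A" and B: "geometric B" and cA: "chart A U C" and cB: "chart B V C'"
  shows "chart (prod_spc A B) (U \<times> V) ((\<lambda>\<gamma> w. \<gamma> (fst w)) ` C \<union> (\<lambda>\<gamma> w. \<gamma> (snd w)) ` C')"
    (is "chart _ _ ?C")
proof -
  interpret fs: fraction_space "prod_spc A B" "{(U, V). openin (zar A) U \<and> openin (zar B) V}" "\<lambda>(U, V). U \<times> V"
    "\<lambda>(U, V). tensor_funs A B U V" by (rule fraction_space_prod_spc[OF A B])
  note a = chartD[OF cA] and b = chartD[OF cB]
  have pA: "(\<lambda>w. p (fst w)) \<in> poly_funs ?C" if "p \<in> poly_funs C" for p
    using that by (rule poly_funs_comp) (auto intro: poly_funs.coord)
  have pB: "(\<lambda>w. p (snd w)) \<in> poly_funs ?C" if "p \<in> poly_funs C'" for p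
    using that by (rule poly_funs_comp) (auto intro: poly_funs.coord)
  have fA: "frac_at ?C (U1 \<times> Z) w (\<lambda>w. \<phi> (fst w))" if fr: "frac_at C U1 (fst w) \<phi>" for U1 w \<phi> and Z :: "'q set"
  proof -
    obtain p q where "p \<in> poly_funs C" "q \<in> poly_funs C" "q (fst w) \<noteq> 0" "\<And>y. y \<in> U1 \<Longrightarrow> q y \<noteq> 0 \<Longrightarrow> \<phi> y = p y / q y"
      using fr by (auto simp: frac_at_def)
    then show ?thesis unfolding frac_at_def using pA
      by (intro bexI[of _ "\<lambda>w. p (fst w)"] bexI[of _ "\<lambda>w. q (fst w)"]) auto
  qed
  have fB: "frac_at ?C (Z \<times> V1) w (\<lambda>w. \<phi> (snd w))" if fr: "frac_at C' V1 (snd w) \<phi>" for V1 w \<phi> and Z :: "'p set"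
  proof -
    obtain p q where "p \<in> poly_funs C'" "q \<in> poly_funs C'" "q (snd w) \<noteq> 0" "\<And>y. y \<in> V1 \<Longrightarrow> q y \<noteq> 0 \<Longrightarrow> \<phi> y = p y / q y"
      using fr by (auto simp: frac_at_def)
    then show ?thesis unfolding frac_at_def using pB
      by (intro bexI[of _ "\<lambda>w. p (snd w)"] bexI[of _ "\<lambda>w. q (snd w)"]) auto
  qed
  have tens: "frac_at ?C ((U1 \<inter> U) \<times> (V1 \<inter> V)) w h"
    if o: "openin (zar A) U1" "openin (zar B) V1" and w: "w \<in> (U1 \<inter> U) \<times> (V1 \<inter> V)" and h: "h \<in> tensor_funs A B U1 V1"
    for U1 V1 w h
  proof -
    obtain n :: nat and f g where h: "h = (\<lambda>(x, y). \<Sum>k<n. f k x * g k y)" and fg: "\<And>k. k < n \<Longrightarrow> f k \<in> reg A U1 \<and> g k \<in> reg B V1"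
      using h by (auto simp: tensor_funs_def)
    have o': "openin (zar A) (U1 \<inter> U)" "openin (zar B) (V1 \<inter> V)" using o a(1) b(1) by auto
    have "frac_at ?C ((U1 \<inter> U) \<times> (V1 \<inter> V)) w (\<lambda>w. \<Sum>k<m. f k (fst w) * g k (snd w))" if "m \<le> n" for m
      using that
    proof (induction m)
      case 0
      then show ?case by (auto intro!: frac_at_poly[OF poly_funs.const[of 0]])
    next
      case (Suc m)
      have "f m \<in> reg A (U1 \<inter> U)" "g m \<in> reg B (V1 \<inter> V)"
        using fg[of m] Suc geometricD(2)[OF A o(1) o'(1)] geometricD(2)[OF B o(2) o'(2)] by auto
      then have "frac_at C (U1 \<inter> U) (fst w) (f m)" "frac_at C' (V1 \<inter> V) (snd w) (g m)"
        using a(4)[OF _ o'(1)] b(4)[OF _ o'(2)] w by auto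
      then show ?case using Suc by (auto intro!: frac_at_add frac_at_mult fA fB)
    qed
    from this[of n] show ?thesis unfolding h case_prod_unfold by simp
  qed
  have nbh: "\<exists>r\<in>poly_funs ?C. r w \<noteq> 0 \<and> {y \<in> U \<times> V. r y \<noteq> 0} \<subseteq> (U1 \<inter> U) \<times> (V1 \<inter> V)"
    if o: "openin (zar A) U1" "openin (zar B) V1" and w: "w \<in> (U1 \<inter> U) \<times> (V1 \<inter> V)" for U1 V1 w
  proof -
    have o': "openin (zar A) (U1 \<inter> U)" "openin (zar B) (V1 \<inter> V)" using o a(1) b(1) by auto
    obtain p where p: "p \<in> poly_funs C" "p (fst w) \<noteq> 0" "{y \<in> U. p y \<noteq> 0} \<subseteq> U1 \<inter> U"
      using a(3)[OF _ o'(1), of "fst w"] w by auto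
    obtain q where q: "q \<in> poly_funs C'" "q (snd w) \<noteq> 0" "{y \<in> V. q y \<noteq> 0} \<subseteq> V1 \<inter> V"
      using b(3)[OF _ o'(2), of "snd w"] w by auto
    show ?thesis using p q pA pB by (intro bexI[of _ "\<lambda>w. p (fst w) * q (snd w)"]) (auto intro: poly_funs.mult)
  qed
  show ?thesis
    unfolding chart_def
  proof (intro conjI allI impI ballI subsetI)
    have "openin (zar (prod_spc A B)) {x \<in> case (U, V) of (U, V) \<Rightarrow> U \<times> V. (1::'k) \<noteq> 0}"
      by (rule fs.openin_basic[of "(U, V)" "\<lambda>_. 1"]) (use a b fs.R_const[of "(U, V)"] in auto)
    then show o: "openin (zar (prod_spc A B)) (U \<times> V)" by simp
    fix \<gamma> assume \<gamma>: "\<gamma> \<in> ?C"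
    have "\<gamma> \<in> tensor_funs A B U V"
      using \<gamma>
    proof
      assume "\<gamma> \<in> (\<lambda>\<gamma> w. \<gamma> (fst w)) ` C"
      then obtain \<delta> where d: "\<delta> \<in> C" "\<gamma> = (\<lambda>w. \<delta> (fst w))" by auto
      have "(\<lambda>(x, y). \<delta> x * 1) \<in> tensor_funs A B U V"
        using a(2)[OF d(1)] geometricD(4)[OF B b(1)] by (intro tensor_funs_one) auto
      then show ?thesis unfolding d case_prod_unfold by simp
    next
      assume "\<gamma> \<in> (\<lambda>\<gamma> w. \<gamma> (snd w)) ` C'"
      then obtain \<delta> where d: "\<delta> \<in> C'" "\<gamma> = (\<lambda>w. \<delta> (snd w))" by auto
      have "(\<lambda>(x, y). 1 * \<delta> y) \<in> tensor_funs A B U V"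
        using b(2)[OF d(1)] geometricD(4)[OF A a(1)] by (intro tensor_funs_one) auto
      then show ?thesis unfolding d case_prod_unfold by simp
    qed
    then show "\<gamma> \<in> reg (prod_spc A B) (U \<times> V)"
      using a(1) b(1) fs.R_const[of "(U, V)" 1]
      by (intro fs.regI[OF o] bexI[of _ "(U, V)"] bexI[of _ \<gamma>] bexI[of _ "\<lambda>_. 1"]) auto
  next
    fix W x assume W: "W \<subseteq> U \<times> V" "openin (zar (prod_spc A B)) W" "x \<in> W"
    then obtain d h where "d \<in> {(U, V). openin (zar A) U \<and> openin (zar B) V}" "h \<in> (case d of (U, V) \<Rightarrow> tensor_funs A B U V)"
       "x \<in> (case d of (U, V) \<Rightarrow> U \<times> V)" "h x \<noteq> 0" "{y \<in> (case d of (U, V) \<Rightarrow> U \<times> V). h y \<noteq> 0} \<subseteq> W"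
      using fs.openin_iff[of W] by meson
    then obtain U1 V1 where d: "openin (zar A) U1" "openin (zar B) V1" "h \<in> tensor_funs A B U1 V1" "x \<in> U1 \<times> V1"
       "h x \<noteq> 0" "{y \<in> U1 \<times> V1. h y \<noteq> 0} \<subseteq> W" by auto
    have x: "x \<in> (U1 \<inter> U) \<times> (V1 \<inter> V)" using d W by auto
    obtain r where r: "r \<in> poly_funs ?C" "r x \<noteq> 0" "{y \<in> U \<times> V. r y \<noteq> 0} \<subseteq> (U1 \<inter> U) \<times> (V1 \<inter> V)"
      using nbh[OF d(1,2) x] by blast
    obtain r' where r': "r' \<in> poly_funs ?C" "r' x \<noteq> 0" "\<forall>y\<in>(U1 \<inter> U) \<times> (V1 \<inter> V). r' y \<noteq> 0 \<longrightarrow> h y \<noteq> 0"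
      using frac_at_nonzero[OF tens[OF d(1,2) x d(3)] d(5) x] by blast
    show "\<exists>p\<in>poly_funs ?C. p x \<noteq> 0 \<and> {y \<in> U \<times> V. p y \<noteq> 0} \<subseteq> W"
    proof (intro bexI[of _ "\<lambda>w. r w * r' w"] conjI)
      show "(\<lambda>w. r w * r' w) \<in> poly_funs ?C" using r r' by (intro poly_funs.mult)
      show "r x * r' x \<noteq> 0" using r r' by simp
      show "{y \<in> U \<times> V. r y * r' y \<noteq> 0} \<subseteq> W"
      proof
        fix y assume y: "y \<in> {y \<in> U \<times> V. r y * r' y \<noteq> 0}"
        then have y1: "y \<in> (U1 \<inter> U) \<times> (V1 \<inter> V)" using r(3) by auto
        then have "h y \<noteq> 0" using r'(3) y by auto
        then show "y \<in> W" using d(6) y1 by auto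
      qed
    qed
  next
    fix W \<phi> x assume W: "W \<subseteq> U \<times> V" "openin (zar (prod_spc A B)) W" "\<phi> \<in> reg (prod_spc A B) W" "x \<in> W"
    obtain d g h where "d \<in> {(U, V). openin (zar A) U \<and> openin (zar B) V}"
       "g \<in> (case d of (U, V) \<Rightarrow> tensor_funs A B U V)" "h \<in> (case d of (U, V) \<Rightarrow> tensor_funs A B U V)"
       "x \<in> (case d of (U, V) \<Rightarrow> U \<times> V)" "h x \<noteq> 0" "{y \<in> (case d of (U, V) \<Rightarrow> U \<times> V). h y \<noteq> 0} \<subseteq> W"
       "\<And>y. y \<in> (case d of (U, V) \<Rightarrow> U \<times> V) \<Longrightarrow> h y \<noteq> 0 \<Longrightarrow> \<phi> y = g y / h y"
      by (rule fs.regE[OF W(2,3,4)]) blast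
    then obtain U1 V1 where d: "openin (zar A) U1" "openin (zar B) V1" "h \<in> tensor_funs A B U1 V1" "x \<in> U1 \<times> V1"
       "h x \<noteq> 0" "{y \<in> U1 \<times> V1. h y \<noteq> 0} \<subseteq> W" "g \<in> tensor_funs A B U1 V1"
       and \<phi>: "\<And>y. y \<in> U1 \<times> V1 \<Longrightarrow> h y \<noteq> 0 \<Longrightarrow> \<phi> y = g y / h y" by auto
    let ?X = "(U1 \<inter> U) \<times> (V1 \<inter> V)"
    have x: "x \<in> ?X" using d W by auto
    obtain r where r: "r \<in> poly_funs ?C" "r x \<noteq> 0" "{y \<in> U \<times> V. r y \<noteq> 0} \<subseteq> ?X"
      using nbh[OF d(1,2) x] by blast
    note hf = tens[OF d(1,2) x d(3)]
    obtain r' where r': "r' \<in> poly_funs ?C" "r' x \<noteq> 0" "\<forall>y\<in>?X. r' y \<noteq> 0 \<longrightarrow> h y \<noteq> 0"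
      using frac_at_nonzero[OF hf d(5) x] by blast
    have "frac_at ?C ?X x (\<lambda>y. g y * inverse (h y))"
      by (intro frac_at_mult tens[OF d(1,2) x d(7)] frac_at_inverse hf d(5) x)
    then have "frac_at ?C {y \<in> ?X. r' y \<noteq> 0} x (\<lambda>y. g y * inverse (h y))" by (rule frac_at_mono) auto
    then have "frac_at ?C {y \<in> ?X. r' y \<noteq> 0} x \<phi>"
      by (rule frac_at_cong) (use \<phi> r' in \<open>auto simp: divide_inverse\<close>)
    then have "frac_at ?C ?X x \<phi>" by (rule frac_at_local[OF _ r'(1,2)]) auto
    then show "frac_at ?C W x \<phi>" by (rule frac_at_local[OF _ r(1,2)]) (use r W in auto)
  qed
qed

text \<open>
  A morphism can be recognised on coordinates: near a point of the target, open sets and regular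
  functions are given by polynomials in the coordinates, and these pull back to regular
  functions.
\<close>

lemma morphism_chartI:
  assumes A: "geometric A" and B: "geometric B"
    and m: "\<And>x. x \<in> topspace (zar A) \<Longrightarrow> m x \<in> topspace (zar B)"
    and loc: "\<And>b. b \<in> topspace (zar B) \<Longrightarrow> \<exists>V C. chart B V C \<and> b \<in> V \<and>
       openin (zar A) {x \<in> topspace (zar A). m x \<in> V} \<and>
       (\<forall>\<gamma>\<in>C. (\<lambda>x. \<gamma> (m x)) \<in> reg A {x \<in> topspace (zar A). m x \<in> V})"
  shows "morphism A B m"
proof -
  define P where "P V = {x \<in> topspace (zar A). m x \<in> V}" for V
  have cont: "openin (zar A) (P W)" if W: "openin (zar B) W" for W
  proof (subst openin_subopen, rule ballI)
    fix x assume x: "x \<in> P W"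
    then have "m x \<in> topspace (zar B)" using m by (simp add: P_def)
    then obtain V C where V: "chart B V C" "m x \<in> V" "openin (zar A) (P V)" "\<And>\<gamma>. \<gamma> \<in> C \<Longrightarrow> (\<lambda>x. \<gamma> (m x)) \<in> reg A (P V)"
      using loc unfolding P_def by blast
    have "W \<inter> V \<subseteq> V" "openin (zar B) (W \<inter> V)" "m x \<in> W \<inter> V" using W chartD(1)[OF V(1)] V x by (auto simp: P_def)
    from chartD(3)[OF V(1) this] obtain p where p: "p \<in> poly_funs C" "p (m x) \<noteq> 0" "{y \<in> V. p y \<noteq> 0} \<subseteq> W \<inter> V" by blast
    have "(\<lambda>x. p (m x)) \<in> reg A (P V)" using poly_funs_reg[OF A V(3,4) p(1)] .
    then have "openin (zar A) {x \<in> P V. p (m x) \<noteq> 0}" using geometricD(7)[OF A V(3)] by blast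
    then show "\<exists>T. openin (zar A) T \<and> x \<in> T \<and> T \<subseteq> P W"
      using p V x by (intro exI[of _ "{x \<in> P V. p (m x) \<noteq> 0}"]) (auto simp: P_def)
  qed
  have "(\<lambda>x. \<phi> (m x)) \<in> reg A (P W)" if W: "openin (zar B) W" and \<phi>: "\<phi> \<in> reg B W" for W \<phi>
  proof (rule geometricD(3)[OF A cont[OF W]])
    fix x assume x: "x \<in> P W"
    then have "m x \<in> topspace (zar B)" using m by (simp add: P_def)
    then obtain V C where V: "chart B V C" "m x \<in> V" "openin (zar A) (P V)" "\<And>\<gamma>. \<gamma> \<in> C \<Longrightarrow> (\<lambda>x. \<gamma> (m x)) \<in> reg A (P V)"
      using loc unfolding P_def by blast
    have WV: "W \<inter> V \<subseteq> V" "openin (zar B) (W \<inter> V)" "m x \<in> W \<inter> V" using W chartD(1)[OF V(1)] V x by (auto simp: P_def)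
    have "\<phi> \<in> reg B (W \<inter> V)" using geometricD(2)[OF B W WV(2) _ \<phi>] by auto
    from chartD(4)[OF V(1) WV(1,2) this WV(3)] obtain p q where pq: "p \<in> poly_funs C" "q \<in> poly_funs C" "q (m x) \<noteq> 0"
      "\<And>y. y \<in> W \<inter> V \<Longrightarrow> q y \<noteq> 0 \<Longrightarrow> \<phi> y = p y / q y" by (auto simp: frac_at_def)
    have pr: "(\<lambda>x. p (m x)) \<in> reg A (P V)" "(\<lambda>x. q (m x)) \<in> reg A (P V)"
      using poly_funs_reg[OF A V(3,4)] pq by auto
    have PWV: "openin (zar A) (P (W \<inter> V))" by (rule cont[OF WV(2)])
    have sub: "P (W \<inter> V) \<subseteq> P V" by (auto simp: P_def)
    have pr': "(\<lambda>x. p (m x)) \<in> reg A (P (W \<inter> V))" "(\<lambda>x. q (m x)) \<in> reg A (P (W \<inter> V))"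
      using geometricD(2)[OF A V(3) PWV sub] pr by auto
    define O' where "O' = {x \<in> P (W \<inter> V). q (m x) \<noteq> 0}"
    have O': "openin (zar A) O'" "(\<lambda>x. inverse (q (m x))) \<in> reg A O'"
      unfolding O'_def using geometricD(7,8)[OF A PWV pr'(2)] by auto
    have "(\<lambda>x. p (m x)) \<in> reg A O'" using geometricD(2)[OF A PWV O'(1) _ pr'(1)] by (auto simp: O'_def)
    from geometricD(6)[OF A O'(1) this O'(2)] have "(\<lambda>x. p (m x) * inverse (q (m x))) \<in> reg A O'" .
    then have "(\<lambda>x. \<phi> (m x)) \<in> reg A O'"
      by (rule geometricD(1)[OF A O'(1)]) (use pq(4) in \<open>auto simp: O'_def P_def divide_inverse\<close>)
    then show "\<exists>V. openin (zar A) V \<and> x \<in> V \<and> V \<subseteq> P W \<and> (\<lambda>x. \<phi> (m x)) \<in> reg A V"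
      using O' x V pq(3) by (intro exI[of _ O']) (auto simp: O'_def P_def)
  qed
  then show ?thesis
    unfolding morphism_def continuous_map using cont m by (auto simp: P_def comp_def)
qed

lemma isomorphism_chartI:
  assumes A: "geometric A" and B: "geometric B"
    and cA: "chart A (topspace (zar A)) C" and cB: "chart B (topspace (zar B)) D"
    and m: "\<And>x. x \<in> topspace (zar A) \<Longrightarrow> m x \<in> topspace (zar B) \<and> m' (m x) = x"
    and m': "\<And>y. y \<in> topspace (zar B) \<Longrightarrow> m' y \<in> topspace (zar A) \<and> m (m' y) = y"
    and D: "\<And>\<delta>. \<delta> \<in> D \<Longrightarrow> (\<lambda>x. \<delta> (m x)) \<in> reg A (topspace (zar A))"
    and C: "\<And>\<gamma>. \<gamma> \<in> C \<Longrightarrow> (\<lambda>y. \<gamma> (m' y)) \<in> reg B (topspace (zar B))"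
  shows "isomorphism A B m"
proof -
  have e: "{x \<in> topspace (zar A). m x \<in> topspace (zar B)} = topspace (zar A)"
    "{x \<in> topspace (zar B). m' x \<in> topspace (zar A)} = topspace (zar B)" using m m' by auto
  have 1: "morphism A B m"
    by (rule morphism_chartI[OF A B])
      (use m D cB e in \<open>auto intro!: exI[of _ "topspace (zar B)"] exI[of _ D]\<close>)
  have 2: "morphism B A m'"
    by (rule morphism_chartI[OF B A])
      (use m' C cA e in \<open>auto intro!: exI[of _ "topspace (zar A)"] exI[of _ C]\<close>)
  have "homeomorphic_maps (zar A) (zar B) m m'"
    unfolding homeomorphic_maps_def using 1 2 m m' by (auto simp: morphism_def)
  then show ?thesis using 1 2 by (auto simp: isomorphism_def)
qed

section \<open>Systems of linear equations with polynomial coefficients\<close>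

lemma det_poly_funs:
  fixes A :: "'p \<Rightarrow> 'k::field mat"
  assumes "\<And>x. A x \<in> carrier_mat n n" "\<And>i j. i < n \<Longrightarrow> j < n \<Longrightarrow> (\<lambda>x. A x $$ (i, j)) \<in> poly_funs C"
  shows "(\<lambda>x. det (A x)) \<in> poly_funs C"
proof -
  have "(\<lambda>x. det (A x)) = (\<lambda>x. \<Sum>p | p permutes {0..<n}. of_int (sign p) * (\<Prod>i = 0..<n. A x $$ (i, p i)))"
    using assms(1) by (auto simp: det_def')
  also have "\<dots> \<in> poly_funs C"
    using assms(2) by (intro poly_funs_sum poly_funs_cmult poly_funs_prod) (auto dest: permutes_in_image)
  finally show ?thesis .
qed

text \<open>
  Determinant and adjugate of a square matrix of polynomial functions, as the form of Cramer's
  rule in which no inverse has to be taken.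
\<close>

lemma poly_adjugate:
  fixes A :: "nat \<Rightarrow> nat \<Rightarrow> 'p \<Rightarrow> 'k::field"
  assumes A: "\<And>i j. i < n \<Longrightarrow> j < n \<Longrightarrow> A i j \<in> poly_funs C"
  obtains d a where "d \<in> poly_funs C" "\<And>i j. i < n \<Longrightarrow> j < n \<Longrightarrow> a i j \<in> poly_funs C"
    "\<And>i j x. i < n \<Longrightarrow> j < n \<Longrightarrow> (\<Sum>k<n. A i k x * a k j x) = (if i = j then d x else 0)"
    "\<And>i j x. i < n \<Longrightarrow> j < n \<Longrightarrow> (\<Sum>k<n. a i k x * A k j x) = (if i = j then d x else 0)"
    "\<And>x. (\<And>i j. i < n \<Longrightarrow> j < n \<Longrightarrow> A i j x = (if i = j then 1 else 0)) \<Longrightarrow> d x = 1"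
proof -
  define M where "M x = mat n n (\<lambda>(i, j). A i j x)" for x
  have M: "M x \<in> carrier_mat n n" for x by (simp add: M_def)
  have Mij: "M x $$ (i, j) = A i j x" if "i < n" "j < n" for i j x using that by (simp add: M_def)
  have adj: "adj_mat (M x) \<in> carrier_mat n n" "M x * adj_mat (M x) = det (M x) \<cdot>\<^sub>m 1\<^sub>m n" "adj_mat (M x) * M x = det (M x) \<cdot>\<^sub>m 1\<^sub>m n" for x
    using adj_mat[OF M[of x]] by auto
  define a where "a i j x = adj_mat (M x) $$ (i, j)" for i j x
  show thesis
  proof (rule that[of "\<lambda>x. det (M x)" a])
    show "(\<lambda>x. det (M x)) \<in> poly_funs C" using M A by (intro det_poly_funs) (auto simp: Mij)
    fix i j assume ij: "i < n" "j < n"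
    have "a i j = (\<lambda>x. (-1) ^ (j + i) * det (mat_delete (M x) j i))"
      using ij M by (auto simp: a_def adj_mat_def cofactor_def M_def)
    also have "\<dots> \<in> poly_funs C"
    proof (intro poly_funs_cmult det_poly_funs)
      show "mat_delete (M x) j i \<in> carrier_mat (n - 1) (n - 1)" for x by (simp add: mat_delete_def M_def)
      fix i' j' assume i'j': "i' < n - 1" "j' < n - 1"
      then show "(\<lambda>x. mat_delete (M x) j i $$ (i', j')) \<in> poly_funs C"
        using ij A by (auto simp: mat_delete_def M_def)
    qed
    finally show "a i j \<in> poly_funs C" .
    fix x
    have dims: "dim_row (M x) = n" "dim_col (M x) = n" "dim_row (adj_mat (M x)) = n" "dim_col (adj_mat (M x)) = n"
      using M[of x] adj(1)[of x] by auto
    have "(\<Sum>k<n. A i k x * a k j x) = (M x * adj_mat (M x)) $$ (i, j)"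
      using ij by (simp add: scalar_prod_def dims Mij a_def atLeast0LessThan)
    then show "(\<Sum>k<n. A i k x * a k j x) = (if i = j then det (M x) else 0)" using ij adj by simp
    have "(\<Sum>k<n. a i k x * A k j x) = (adj_mat (M x) * M x) $$ (i, j)"
      using ij by (simp add: scalar_prod_def dims Mij a_def atLeast0LessThan)
    then show "(\<Sum>k<n. a i k x * A k j x) = (if i = j then det (M x) else 0)" using ij adj by simp
  next
    fix x assume "\<And>i j. i < n \<Longrightarrow> j < n \<Longrightarrow> A i j x = (if i = j then 1 else 0)"
    then have "M x = 1\<^sub>m n" by (intro eq_matI) (auto simp: M_def)
    then show "det (M x) = 1" by simp
  qed
qed

section \<open>Where a generating extension splits\<close>

lemma ext_cocycles_eq_hom_fam:
  "ext_cocycles Q A B = hom_fam (arcs Q) (scl A) (scl B) (\<lambda>\<alpha>. spc A (tail Q \<alpha>)) (\<lambda>\<alpha>. spc B (head Q \<alpha>))"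
  by (simp add: ext_cocycles_def hom_fam_def)

lemma ext_scale_eq_fam_scale: "ext_scale B = fam_scale (scl B)"
  by (simp add: ext_scale_def fam_scale_def fun_eq_iff)

lemma fd_rep_fd_sub: "fd_rep Q M \<Longrightarrow> i \<in> verts Q \<Longrightarrow> fd_sub (scl M) (spc M i)"
  unfolding fd_sub_def by (metis fd_repD(3) fd_rep_def order_refl)

lemma ext_diff_mem_cocycles:
  assumes "wf_digraph Q" and A: "fd_rep Q A" and B: "fd_rep Q B"
    and \<phi>: "\<And>i. i \<in> verts Q \<Longrightarrow> linear_btw (scl A) (scl B) (spc A i) (spc B i) (\<phi> i)"
  shows "ext_diff Q A B \<phi> \<in> ext_cocycles Q A B"
proof -
  interpret wf_digraph Q by fact
  note A = fd_repD[OF A] and B = fd_repD[OF B]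
  have "linear_btw (scl A) (scl B) (spc A (tail Q \<alpha>)) (spc B (head Q \<alpha>)) (ext_diff Q A B \<phi> \<alpha>)" if a: "\<alpha> \<in> arcs Q" for \<alpha>
  proof -
    have h: "head Q \<alpha> \<in> verts Q" and t: "tail Q \<alpha> \<in> verts Q" using a by auto
    have "linear_btw (scl A) (scl B) (spc A (tail Q \<alpha>)) (spc B (head Q \<alpha>))
        (\<lambda>v. \<phi> (head Q \<alpha>) (act A \<alpha> v) - act B \<alpha> (\<phi> (tail Q \<alpha>) v))"
      using linear_btw_comp[OF A(4)[OF a] \<phi>[OF h]] linear_btw_comp[OF \<phi>[OF t] B(4)[OF a]] B(2) B(3)[OF h]
      by (rule linear_btw_minus)
    then show ?thesis
      using A(2) A(3)[OF t] a unfolding linear_btw_def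
      by (auto simp: ext_diff_def module.subspace_add module.subspace_scale)
  qed
  then show ?thesis by (auto simp: ext_cocycles_def ext_diff_def)
qed

lemma subspace_ext_coboundaries:
  assumes "wf_digraph Q" and A: "fd_rep Q A" and B: "fd_rep Q B"
  shows "module.subspace (ext_scale B) (ext_coboundaries Q A B)"
proof -
  interpret wf_digraph Q by fact
  note A' = fd_repD[OF A] and B' = fd_repD[OF B]
  interpret B: vector_space "scl B" by (rule B')
  interpret f: vector_space "ext_scale B :: 'c \<Rightarrow> ('b \<Rightarrow> 'd \<Rightarrow> 'e) \<Rightarrow> _"
    unfolding ext_scale_eq_fam_scale by (rule vector_space_fam_scale[OF B'(1)])
  note 0 = ext_coboundaries_0[OF assms] and d = ext_coboundaries_diff[OF assms]
  show ?thesis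
    unfolding f.subspace_def
  proof (intro conjI ballI allI)
    show "x + y \<in> ext_coboundaries Q A B" if x: "x \<in> ext_coboundaries Q A B" and y: "y \<in> ext_coboundaries Q A B" for x y
      using d[OF x d[OF 0 y]] by simp
  next
    fix c x assume "x \<in> ext_coboundaries Q A B"
    then obtain \<phi> where \<phi>: "x = ext_diff Q A B \<phi>" "\<And>i. i \<in> verts Q \<Longrightarrow> linear_btw (scl A) (scl B) (spc A i) (spc B i) (\<phi> i)"
      by (auto simp: ext_coboundaries_def)
    have "ext_scale B c x = ext_diff Q A B (\<lambda>i v. scl B c (\<phi> i v))"
    proof (intro ext)
      fix \<alpha> v
      show "ext_scale B c x \<alpha> v = ext_diff Q A B (\<lambda>i v. scl B c (\<phi> i v)) \<alpha> v"
      proof (cases "\<alpha> \<in> arcs Q \<and> v \<in> spc A (tail Q \<alpha>)")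
        case True
        then have "\<phi> (tail Q \<alpha>) v \<in> spc B (tail Q \<alpha>)" using linear_btwD(1)[OF \<phi>(2)] by auto
        then show ?thesis
          using True linear_btwD(3)[OF B'(4)] by (simp add: ext_scale_def ext_diff_def \<phi>(1) B.scale_right_diff_distrib)
      qed (auto simp: ext_scale_def ext_diff_def \<phi>(1))
    qed
    moreover have "linear_btw (scl A) (scl B) (spc A i) (spc B i) (\<lambda>v. scl B c (\<phi> i v))" if "i \<in> verts Q" for i
      using \<phi>(2)[OF that] B.subspace_scale[OF B'(3)[OF that]]
      by (auto simp: linear_btw_def B.scale_right_distrib mult.commute Pi_iff)
    ultimately show "ext_scale B c x \<in> ext_coboundaries Q A B" by (auto simp: ext_coboundaries_def)
  qed (rule 0)
qed

text \<open>
  If every cocycle is a multiple of \<open>z\<close> up to a coboundary, cocycles exceed coboundaries by at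
  most one dimension.
\<close>

lemma ext_dim_of_generator:
  assumes "fin_digraph Q" and A: "fd_rep Q A" and B: "fd_rep Q B" and z: "z \<in> ext_cocycles Q A B"
    and gen: "\<And>w. w \<in> ext_cocycles Q A B \<Longrightarrow> \<exists>c. \<exists>b\<in>ext_coboundaries Q A B. w = ext_scale B c z + b"
  shows "ext_dim Q A B = (if z \<in> ext_coboundaries Q A B then 0 else 1)"
proof -
  interpret fin_digraph Q by fact
  have wf: "wf_digraph Q" by unfold_locales
  note A' = fd_repD[OF A] and B' = fd_repD[OF B]
  interpret f: vector_space "ext_scale B :: 'c \<Rightarrow> ('b \<Rightarrow> 'd \<Rightarrow> 'e) \<Rightarrow> _"
    unfolding ext_scale_eq_fam_scale by (rule vector_space_fam_scale[OF B'(1)])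
  let ?Z = "ext_cocycles Q A B" and ?C = "ext_coboundaries Q A B"
  have sZ: "f.subspace ?Z"
    unfolding ext_cocycles_eq_hom_fam ext_scale_eq_fam_scale
    using A'(1,3) B'(1,3) by (intro subspace_hom_fam) auto
  have "\<exists>I E \<kappa>. coords (fam_scale (scl B)) ?Z (I :: ('b \<times> nat \<times> nat) set) E \<kappa>"
    unfolding ext_cocycles_eq_hom_fam
    using coords_hom_fam[OF A'(1) B'(1) finite_arcs, where V = "\<lambda>\<alpha>. spc A (tail Q \<alpha>)" and W = "\<lambda>\<alpha>. spc B (head Q \<alpha>)"]
      fd_rep_fd_sub[OF A] fd_rep_fd_sub[OF B] by (meson head_in_verts tail_in_verts)
  then have fdZ: "fd_sub (ext_scale B) ?Z"
    using coords_dim(2) f.vector_space_axioms sZ unfolding ext_scale_eq_fam_scale by blast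
  note sC = subspace_ext_coboundaries[OF wf A B]
  have CZ: "?C \<subseteq> ?Z" using ext_diff_mem_cocycles[OF wf A B] by (auto simp: ext_coboundaries_def)
  show ?thesis
  proof (cases "z \<in> ?C")
    case True
    have "w \<in> ?C" if w: "w \<in> ?Z" for w
    proof -
      obtain c b where "b \<in> ?C" "w = ext_scale B c z + b" using gen[OF w] by blast
      then show ?thesis using f.subspace_add[OF sC f.subspace_scale[OF sC True]] by simp
    qed
    then have "?Z = ?C" using CZ by blast
    then show ?thesis using True by (simp add: ext_dim_def)
  next
    case False
    obtain D where D: "D \<subseteq> ?C" "f.independent D" "?C \<subseteq> f.span D" "card D = f.dim ?C" by (rule f.basis_exists)
    obtain D0 where "finite D0" "?Z \<subseteq> f.span D0" using fdZ by (auto simp: fd_sub_def)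
    then have fin: "finite D" using f.independent_span_bound[of D0 D] D CZ by blast
    have spD: "f.span D = ?C" using D sC by (simp add: f.span_subspace)
    have "f.independent (insert z D)" using False D(2) spD by (intro f.independent_insertI) auto
    moreover have "insert z D \<subseteq> ?Z" using D CZ z by auto
    moreover have "?Z \<subseteq> f.span (insert z D)"
    proof
      fix w assume "w \<in> ?Z"
      then obtain c b where b: "b \<in> ?C" "w = ext_scale B c z + b" using gen by blast
      have "b \<in> f.span (insert z D)" using b spD f.span_mono[of D "insert z D"] by auto
      then show "w \<in> f.span (insert z D)" unfolding b(2)
        by (intro f.span_add f.span_scale) (auto intro: f.span_base)
    qed
    moreover have "z \<notin> D" using D(1) False by blast
    then have "card (insert z D) = Suc (f.dim ?C)" using fin D(4) by simp
    ultimately have "f.dim ?Z = Suc (f.dim ?C)" by (intro f.dim_unique) auto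
    then show ?thesis using False by (simp add: ext_dim_def)
  qed
qed

lemma subrep_subspace:
  assumes "subrep Q M N" "i \<in> verts Q"
  shows "N i \<subseteq> spc M i" "module.subspace (scl M) (N i)"
  using assms by (auto simp: subrep_def)

lemma subrep_act:
  assumes "subrep Q M N" "\<alpha> \<in> arcs Q" "x \<in> N (tail Q \<alpha>)"
  shows "act M \<alpha> x \<in> N (head Q \<alpha>)"
  using assms unfolding subrep_def by blast

lemma fd_rep_subrep:
  assumes "fd_rep Q M" "subrep Q M N"
  shows "fd_rep Q (M\<lparr>spc := N\<rparr>)"
proof -
  note M = fd_repD[OF assms(1)]
  interpret M: vector_space "scl M" by (rule M)
  have "\<exists>B. finite B \<and> N i = M.span B" if i: "i \<in> verts Q" for i
  proof -
    note sub = subrep_subspace[OF assms(2) i]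
    have "fd_sub (scl M) (N i)" using fd_sub_subset[OF M(1) fd_rep_fd_sub[OF assms(1) i] sub(2,1)] .
    then obtain E \<kappa> where c: "coords (scl M) (N i) {..<M.dim (N i)} E \<kappa>" using coords_exist[OF M(1)] by blast
    show ?thesis using coords_span(1)[OF M(1) sub(2) c] by (intro exI[of _ "E ` {..<M.dim (N i)}"]) auto
  qed
  moreover have "linear_btw (scl M) (scl M) (N (tail Q \<alpha>)) (N (head Q \<alpha>)) (act M \<alpha>)" if a: "\<alpha> \<in> arcs Q" for \<alpha>
    by (rule linear_btw_mono[OF M(4)[OF a]]) (use assms(2) a in \<open>auto simp: subrep_def\<close>)
  ultimately show ?thesis using M(1) by (simp add: fd_rep_def)
qed

text \<open>
  Here \<open>Ext\<^sup>1(S, X)\<close> is a line spanned by the class of \<open>z\<close>. The dichotomy below comes from the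
  fact that a linear map out of a line is zero or injective.
\<close>

locale one_generated_ext =
  fixes Q :: "('i, 'a) pre_digraph"
    and X :: "('i, 'a, 'k::field, 'x::ab_group_add) qrep"
    and S :: "('i, 'a, 'k, 's::ab_group_add) qrep"
    and z :: "'a \<Rightarrow> 's \<Rightarrow> 'x"
  assumes Q: "fin_digraph Q" and X: "fd_rep Q X" and S: "fd_rep Q S"
    and z: "z \<in> ext_cocycles Q S X" and z_nz: "z \<notin> ext_coboundaries Q S X"
    and gen: "\<And>w. w \<in> ext_cocycles Q S X \<Longrightarrow> \<exists>c. \<exists>b\<in>ext_coboundaries Q S X. w = ext_scale X c z + b"
begin

sublocale fin_digraph Q by (rule Q)
sublocale X: vector_space "scl X" by (rule fd_repD(1)[OF X])
sublocale S: vector_space "scl S" by (rule fd_repD(1)[OF S])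

lemma wf: "wf_digraph Q" by unfold_locales

lemmas XD = fd_repD(3,4)[OF X] and SD = fd_repD(3,4)[OF S]

text \<open>
  Cochains without the convention that they vanish outside the relevant arrows and vectors;
  \<open>cob\<close> is the differential on them.
\<close>

definition lin :: "('i \<Rightarrow> 's \<Rightarrow> 'x) \<Rightarrow> bool" where
  "lin \<phi> \<longleftrightarrow> (\<forall>i\<in>verts Q. linear_btw (scl S) (scl X) (spc S i) (spc X i) (\<phi> i))"

definition arr :: "('a \<Rightarrow> 's \<Rightarrow> 'x) \<Rightarrow> bool" where
  "arr w \<longleftrightarrow> (\<forall>\<alpha>\<in>arcs Q. linear_btw (scl S) (scl X) (spc S (tail Q \<alpha>)) (spc X (head Q \<alpha>)) (w \<alpha>))"

definition cob :: "('i \<Rightarrow> 's \<Rightarrow> 'x) \<Rightarrow> 'a \<Rightarrow> 's \<Rightarrow> 'x" where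
  "cob \<phi> \<alpha> s = \<phi> (head Q \<alpha>) (act S \<alpha> s) - act X \<alpha> (\<phi> (tail Q \<alpha>) s)"

text \<open>
  The class of \<open>z\<close> becomes zero in \<open>Ext\<^sup>1(N'', X/N')\<close>. The bounding cochain is taken from \<open>S\<close> to
  \<open>X\<close> rather than from \<open>N''\<close> to \<open>X/N'\<close>; this is the same, since linear maps extend and lift.
\<close>

definition split :: "('i \<Rightarrow> 'x set) \<Rightarrow> ('i \<Rightarrow> 's set) \<Rightarrow> bool" where
  "split N' N'' \<longleftrightarrow> (\<exists>\<phi>. lin \<phi> \<and> (\<forall>\<alpha>\<in>arcs Q. \<forall>s\<in>N'' (tail Q \<alpha>). z \<alpha> s - cob \<phi> \<alpha> s \<in> N' (head Q \<alpha>)))"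

lemma linD: "lin \<phi> \<Longrightarrow> i \<in> verts Q \<Longrightarrow> linear_btw (scl S) (scl X) (spc S i) (spc X i) (\<phi> i)"
  by (simp add: lin_def)

lemma arrD: "arr w \<Longrightarrow> \<alpha> \<in> arcs Q \<Longrightarrow> linear_btw (scl S) (scl X) (spc S (tail Q \<alpha>)) (spc X (head Q \<alpha>)) (w \<alpha>)"
  by (simp add: arr_def)

lemma arr_z: "arr z" using z by (simp add: arr_def ext_cocycles_def)

lemma lin_add: "lin \<phi> \<Longrightarrow> lin \<psi> \<Longrightarrow> lin (\<lambda>i s. \<phi> i s + \<psi> i s)"
  unfolding lin_def using linear_btw_plus[OF _ _ X.module_axioms XD(1)] by blast

lemma linear_btw_scale:
  "linear_btw (scl S) (scl X) V W f \<Longrightarrow> X.subspace W \<Longrightarrow> linear_btw (scl S) (scl X) V W (\<lambda>s. scl X c (f s))"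
  using X.subspace_scale by (auto simp: linear_btw_def X.scale_right_distrib mult.commute Pi_iff)

lemma lin_scale: "lin \<phi> \<Longrightarrow> lin (\<lambda>i s. scl X c (\<phi> i s))"
  unfolding lin_def using linear_btw_scale XD(1) by blast

lemma arr_diff: "arr v \<Longrightarrow> arr w \<Longrightarrow> arr (\<lambda>\<alpha> s. v \<alpha> s - w \<alpha> s)"
  unfolding arr_def by (intro ballI linear_btw_minus[OF _ _ X.module_axioms XD(1)]) auto

lemma arr_cob:
  assumes "lin \<phi>"
  shows "arr (cob \<phi>)"
  unfolding arr_def cob_def
proof
  fix \<alpha> assume a: "\<alpha> \<in> arcs Q"
  have h: "head Q \<alpha> \<in> verts Q" and t: "tail Q \<alpha> \<in> verts Q" using a by auto
  show "linear_btw (scl S) (scl X) (spc S (tail Q \<alpha>)) (spc X (head Q \<alpha>))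
        (\<lambda>v. \<phi> (head Q \<alpha>) (act S \<alpha> v) - act X \<alpha> (\<phi> (tail Q \<alpha>) v))"
    using linear_btw_comp[OF SD(2)[OF a] linD[OF assms h]] linear_btw_comp[OF linD[OF assms t] XD(2)[OF a]]
      X.module_axioms XD(1)[OF h] by (rule linear_btw_minus)
qed

lemma cob_add:
  assumes "lin \<phi>" "lin \<psi>" "\<alpha> \<in> arcs Q" "s \<in> spc S (tail Q \<alpha>)"
  shows "cob (\<lambda>i s. \<phi> i s + \<psi> i s) \<alpha> s = cob \<phi> \<alpha> s + cob \<psi> \<alpha> s"
proof -
  have t: "tail Q \<alpha> \<in> verts Q" using assms by auto
  have "\<phi> (tail Q \<alpha>) s \<in> spc X (tail Q \<alpha>)" "\<psi> (tail Q \<alpha>) s \<in> spc X (tail Q \<alpha>)"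
    using linear_btwD(1)[OF linD[OF assms(1) t] assms(4)] linear_btwD(1)[OF linD[OF assms(2) t] assms(4)] .
  then show ?thesis using linear_btwD(2)[OF XD(2)[OF assms(3)]] by (simp add: cob_def)
qed

lemma cob_scale:
  assumes "lin \<phi>" "\<alpha> \<in> arcs Q" "s \<in> spc S (tail Q \<alpha>)"
  shows "cob (\<lambda>i s. scl X c (\<phi> i s)) \<alpha> s = scl X c (cob \<phi> \<alpha> s)"
proof -
  have t: "tail Q \<alpha> \<in> verts Q" using assms by auto
  have "\<phi> (tail Q \<alpha>) s \<in> spc X (tail Q \<alpha>)" using linear_btwD(1)[OF linD[OF assms(1) t] assms(3)] .
  then show ?thesis using linear_btwD(3)[OF XD(2)[OF assms(2)]]
    by (simp add: cob_def X.scale_right_diff_distrib)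
qed

lemma arr_generated:
  assumes "arr w"
  shows "\<exists>c \<phi>. lin \<phi> \<and> (\<forall>\<alpha>\<in>arcs Q. \<forall>s\<in>spc S (tail Q \<alpha>). w \<alpha> s = scl X c (z \<alpha> s) + cob \<phi> \<alpha> s)"
proof -
  define w' where "w' \<alpha> s = (if \<alpha> \<in> arcs Q \<and> s \<in> spc S (tail Q \<alpha>) then w \<alpha> s else 0)" for \<alpha> s
  have "linear_btw (scl S) (scl X) (spc S (tail Q \<alpha>)) (spc X (head Q \<alpha>)) (w' \<alpha>)" if a: "\<alpha> \<in> arcs Q" for \<alpha>
    using arrD[OF assms a] S.subspace_add[OF SD(1)] S.subspace_scale[OF SD(1)] a
    unfolding linear_btw_def by (auto simp: w'_def)
  then have "w' \<in> ext_cocycles Q S X" by (auto simp: ext_cocycles_def w'_def)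
  then obtain c b where b: "b \<in> ext_coboundaries Q S X" "w' = ext_scale X c z + b" using gen by blast
  then obtain \<phi> where \<phi>: "b = ext_diff Q S X \<phi>" "lin \<phi>" unfolding ext_coboundaries_def lin_def by blast
  have "w \<alpha> s = scl X c (z \<alpha> s) + cob \<phi> \<alpha> s" if "\<alpha> \<in> arcs Q" "s \<in> spc S (tail Q \<alpha>)" for \<alpha> s
  proof -
    have "w' \<alpha> s = (ext_scale X c z + ext_diff Q S X \<phi>) \<alpha> s" using b \<phi> by simp
    then show ?thesis using that by (simp add: w'_def ext_scale_def ext_diff_def cob_def)
  qed
  then show ?thesis using \<phi>(2) by blast
qed

lemma split_mono:
  assumes "split N' N''" "\<And>i. i \<in> verts Q \<Longrightarrow> N' i \<subseteq> M' i" "\<And>i. i \<in> verts Q \<Longrightarrow> M'' i \<subseteq> N'' i"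
  shows "split M' M''"
  using assms unfolding split_def by (meson head_in_verts subsetD tail_in_verts)

text \<open>
  If \<open>z\<close> survives in \<open>Ext\<^sup>1(N'', X/N')\<close>, then so does every nonzero class, all classes being
  multiples of \<open>z\<close>. The class of \<open>w\<close> does not survive, hence it is zero.
\<close>

lemma coboundary_if_not_split:
  assumes "\<not> split N' N''" "subrep Q X N'" "subrep Q S N''" "arr w"
    and w: "\<And>\<alpha> s. \<alpha> \<in> arcs Q \<Longrightarrow> s \<in> N'' (tail Q \<alpha>) \<Longrightarrow> w \<alpha> s \<in> N' (head Q \<alpha>)"
  shows "\<exists>\<phi>. lin \<phi> \<and> (\<forall>\<alpha>\<in>arcs Q. \<forall>s\<in>spc S (tail Q \<alpha>). w \<alpha> s = cob \<phi> \<alpha> s)"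
proof -
  obtain c \<phi> where \<phi>: "lin \<phi>" "\<And>\<alpha> s. \<alpha> \<in> arcs Q \<Longrightarrow> s \<in> spc S (tail Q \<alpha>) \<Longrightarrow> w \<alpha> s = scl X c (z \<alpha> s) + cob \<phi> \<alpha> s"
    using arr_generated[OF assms(4)] by blast
  have "c = 0"
  proof (rule ccontr)
    assume c: "c \<noteq> 0"
    \<comment> \<open>If \<open>w = c z + cob \<phi>\<close> with \<open>c \<noteq> 0\<close>, solve for \<open>z\<close>; as \<open>w\<close> maps \<open>N''\<close> into \<open>N'\<close>, the pair would split.\<close>
    let ?\<psi> = "\<lambda>i s. scl X (- inverse c) (\<phi> i s)"
    have "z \<alpha> s - cob ?\<psi> \<alpha> s \<in> N' (head Q \<alpha>)" if a: "\<alpha> \<in> arcs Q" and s: "s \<in> N'' (tail Q \<alpha>)" for \<alpha> s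
    proof -
      have t: "tail Q \<alpha> \<in> verts Q" and h: "head Q \<alpha> \<in> verts Q" using a by auto
      have sS: "s \<in> spc S (tail Q \<alpha>)" using subrep_subspace(1)[OF assms(3) t] s by blast
      have "z \<alpha> s - cob ?\<psi> \<alpha> s = scl X (inverse c) (w \<alpha> s)"
        unfolding cob_scale[OF \<phi>(1) a sS] \<phi>(2)[OF a sS] using c by (simp add: X.scale_right_distrib)
      then show ?thesis using X.subspace_scale[OF subrep_subspace(2)[OF assms(2) h] w[OF a s]] by simp
    qed
    then have "split N' N''" unfolding split_def using lin_scale[OF \<phi>(1)] by blast
    then show False using assms(1) by simp
  qed
  then show ?thesis using \<phi> by auto
qed

text \<open>
  If \<open>z\<close> dies in \<open>Ext\<^sup>1(N'', X/N')\<close>, then so do all its multiples.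
\<close>

lemma split_reduces_all:
  assumes "split N' N''" "subrep Q X N'" "subrep Q S N''" "arr w"
  shows "\<exists>\<phi>. lin \<phi> \<and> (\<forall>\<alpha>\<in>arcs Q. \<forall>s\<in>N'' (tail Q \<alpha>). w \<alpha> s - cob \<phi> \<alpha> s \<in> N' (head Q \<alpha>))"
proof -
  obtain c \<phi> where \<phi>: "lin \<phi>" "\<And>\<alpha> s. \<alpha> \<in> arcs Q \<Longrightarrow> s \<in> spc S (tail Q \<alpha>) \<Longrightarrow> w \<alpha> s = scl X c (z \<alpha> s) + cob \<phi> \<alpha> s"
    using arr_generated[OF assms(4)] by blast
  obtain \<psi> where \<psi>: "lin \<psi>" "\<And>\<alpha> s. \<alpha> \<in> arcs Q \<Longrightarrow> s \<in> N'' (tail Q \<alpha>) \<Longrightarrow> z \<alpha> s - cob \<psi> \<alpha> s \<in> N' (head Q \<alpha>)"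
    using assms(1) unfolding split_def by blast
  let ?\<chi> = "\<lambda>i s. scl X c (\<psi> i s) + \<phi> i s"
  have "w \<alpha> s - cob ?\<chi> \<alpha> s \<in> N' (head Q \<alpha>)" if a: "\<alpha> \<in> arcs Q" and s: "s \<in> N'' (tail Q \<alpha>)" for \<alpha> s
  proof -
    have t: "tail Q \<alpha> \<in> verts Q" and h: "head Q \<alpha> \<in> verts Q" using a by auto
    have sS: "s \<in> spc S (tail Q \<alpha>)" using subrep_subspace(1)[OF assms(3) t] s by blast
    have "w \<alpha> s - cob ?\<chi> \<alpha> s = scl X c (z \<alpha> s - cob \<psi> \<alpha> s)"
      by (simp add: cob_add[OF lin_scale[OF \<psi>(1)] \<phi>(1) a sS] cob_scale[OF \<psi>(1) a sS] \<phi>(2)[OF a sS] X.scale_right_diff_distrib)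
    then show ?thesis using X.subspace_scale[OF subrep_subspace(2)[OF assms(2) h] \<psi>(2)[OF a s]] by simp
  qed
  then show ?thesis using lin_add[OF lin_scale[OF \<psi>(1)] \<phi>(1)] by blast
qed

text \<open>
  The smallest subrepresentation of \<open>X\<close> and the largest one of \<open>S\<close>, empty outside the vertices
  as subrepresentations have to be.
\<close>

definition zero_sub :: "'i \<Rightarrow> 'x set" where "zero_sub i = (if i \<in> verts Q then {0} else {})"

definition whole :: "'i \<Rightarrow> 's set" where "whole i = (if i \<in> verts Q then spc S i else {})"

lemma subrep_zero_sub: "subrep Q X zero_sub"
proof -
  have "act X \<alpha> 0 = 0" if "\<alpha> \<in> arcs Q" for \<alpha>
    using linear_btw_0[OF XD(2)[OF that] X.module_axioms XD(1)] that by auto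
  then show ?thesis using X.subspace_0[OF XD(1)] by (auto simp: subrep_def zero_sub_def)
qed

lemma subrep_whole: "subrep Q S whole"
  using SD linear_btwD(1)[OF SD(2)] by (auto simp: subrep_def whole_def)

lemma not_split_zero_whole: "\<not> split zero_sub whole"
proof
  assume "split zero_sub whole"
  then obtain \<phi> where \<phi>: "lin \<phi>" "\<forall>\<alpha>\<in>arcs Q. \<forall>s\<in>whole (tail Q \<alpha>). z \<alpha> s - cob \<phi> \<alpha> s \<in> zero_sub (head Q \<alpha>)"
    by (auto simp: split_def)
  have "z \<alpha> s = ext_diff Q S X \<phi> \<alpha> s" for \<alpha> s
    using \<phi>(2) z by (auto simp: whole_def zero_sub_def ext_diff_def cob_def ext_cocycles_def)
  then have "z = ext_diff Q S X \<phi>" by blast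
  then show False using z_nz \<phi>(1) by (auto simp: ext_coboundaries_def lin_def)
qed

text \<open>
  For the converse let \<open>z - cob \<phi>\<close> map \<open>N''\<close> into \<open>N'\<close>, and extend its restriction to \<open>N''\<close> to a
  cochain \<open>w\<close> from \<open>S\<close> to \<open>N'\<close>. The class of \<open>w\<close> dies in \<open>Ext\<^sup>1(S, X/N')\<close>, where \<open>z\<close> survives,
  so \<open>w = cob \<psi>\<close>; hence \<open>z = cob (\<phi> + \<psi>)\<close> on \<open>N''\<close>, although \<open>z\<close> survives in \<open>Ext\<^sup>1(N'', X)\<close>.
\<close>

lemma not_split_iff:
  assumes N': "subrep Q X N'" and N'': "subrep Q S N''"
  shows "\<not> split N' N'' \<longleftrightarrow> \<not> split N' whole \<and> \<not> split zero_sub N''"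
proof
  assume n: "\<not> split N' N''"
  have "split N' whole \<Longrightarrow> split N' N''"
    by (erule split_mono) (use subrep_subspace(1)[OF N''] in \<open>auto simp: whole_def\<close>)
  moreover have "split zero_sub N'' \<Longrightarrow> split N' N''"
    by (erule split_mono) (use X.subspace_0[OF subrep_subspace(2)[OF N']] in \<open>auto simp: zero_sub_def\<close>)
  ultimately show "\<not> split N' whole \<and> \<not> split zero_sub N''" using n by blast
next
  assume n: "\<not> split N' whole \<and> \<not> split zero_sub N''"
  show "\<not> split N' N''"
  proof
    assume "split N' N''"
    then obtain \<phi> where \<phi>: "lin \<phi>" "\<And>\<alpha> s. \<alpha> \<in> arcs Q \<Longrightarrow> s \<in> N'' (tail Q \<alpha>) \<Longrightarrow> z \<alpha> s - cob \<phi> \<alpha> s \<in> N' (head Q \<alpha>)"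
      unfolding split_def by blast
    have arr: "arr (\<lambda>\<alpha> s. z \<alpha> s - cob \<phi> \<alpha> s)" using arr_diff[OF arr_z arr_cob[OF \<phi>(1)]] .
    have "\<exists>w. Vector_Spaces.linear (scl S) (scl X) w \<and> (\<forall>s\<in>N'' (tail Q \<alpha>). w s = z \<alpha> s - cob \<phi> \<alpha> s) \<and> (\<forall>s. w s \<in> N' (head Q \<alpha>))"
      if a: "\<alpha> \<in> arcs Q" for \<alpha>
    proof -
      have t: "tail Q \<alpha> \<in> verts Q" and h: "head Q \<alpha> \<in> verts Q" using a by auto
      have "linear_btw (scl S) (scl X) (N'' (tail Q \<alpha>)) (N' (head Q \<alpha>)) (\<lambda>s. z \<alpha> s - cob \<phi> \<alpha> s)"
        by (rule linear_btw_mono[OF arrD[OF arr a]]) (use subrep_subspace(1)[OF N'' t] \<phi>(2)[OF a] in auto)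
      from linear_btw_extend[OF S.vector_space_axioms X.vector_space_axioms subrep_subspace(2)[OF N'' t] this subrep_subspace(2)[OF N' h]]
      obtain w where "Vector_Spaces.linear (scl S) (scl X) w" "\<And>s. s \<in> N'' (tail Q \<alpha>) \<Longrightarrow> w s = z \<alpha> s - cob \<phi> \<alpha> s"
        "\<And>s. w s \<in> N' (head Q \<alpha>)" by metis
      then show ?thesis by (intro exI[of _ w]) simp
    qed
    then obtain w where w: "\<And>\<alpha>. \<alpha> \<in> arcs Q \<Longrightarrow> Vector_Spaces.linear (scl S) (scl X) (w \<alpha>)"
      "\<And>\<alpha> s. \<alpha> \<in> arcs Q \<Longrightarrow> s \<in> N'' (tail Q \<alpha>) \<Longrightarrow> w \<alpha> s = z \<alpha> s - cob \<phi> \<alpha> s"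
      "\<And>\<alpha> s. \<alpha> \<in> arcs Q \<Longrightarrow> w \<alpha> s \<in> N' (head Q \<alpha>)" by metis
    have "arr w"
      unfolding arr_def
    proof (intro ballI linear_imp_btw[OF w(1)] image_subsetI)
      fix \<alpha> s assume a: "\<alpha> \<in> arcs Q"
      show "w \<alpha> s \<in> spc X (head Q \<alpha>)"
        using w(3)[OF a] subrep_subspace(1)[OF N' head_in_verts[OF a]] by blast
    qed
    then obtain \<psi> where \<psi>: "lin \<psi>" "\<And>\<alpha> s. \<alpha> \<in> arcs Q \<Longrightarrow> s \<in> spc S (tail Q \<alpha>) \<Longrightarrow> w \<alpha> s = cob \<psi> \<alpha> s"
      using coboundary_if_not_split[of N' whole w] N' subrep_whole w(3) n by blast
    have "z \<alpha> s - cob (\<lambda>i s. \<phi> i s + \<psi> i s) \<alpha> s \<in> zero_sub (head Q \<alpha>)" if a: "\<alpha> \<in> arcs Q" and s: "s \<in> N'' (tail Q \<alpha>)" for \<alpha> s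
    proof -
      have sS: "s \<in> spc S (tail Q \<alpha>)" using subrep_subspace(1)[OF N'' tail_in_verts[OF a]] s by blast
      show ?thesis using w(2)[OF a s] \<psi>(2)[OF a sS] a
        by (simp add: cob_add[OF \<phi>(1) \<psi>(1) a sS] zero_sub_def algebra_simps)
    qed
    then have "split zero_sub N''" unfolding split_def using lin_add[OF \<phi>(1) \<psi>(1)] by blast
    then show False using n by simp
  qed
qed

text \<open>
  Otherwise \<open>z\<close> is cohomologous to a cochain with values in \<open>N1 + N2\<close>. Its parts with values in
  \<open>N1\<close> and in \<open>N2\<close> are coboundaries by \<open>coboundary_if_not_split\<close>, and so would be \<open>z\<close>.
\<close>

lemma not_split_sum:
  assumes N1: "subrep Q X N1" and N2: "subrep Q X N2" and n: "\<not> split N1 whole" "\<not> split N2 whole"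
  shows "\<not> split (\<lambda>i. {a + b | a b. a \<in> N1 i \<and> b \<in> N2 i}) whole"
proof
  define N where "N = (\<lambda>i. {a + b | a b. a \<in> N1 i \<and> b \<in> N2 i})"
  assume "split (\<lambda>i. {a + b | a b. a \<in> N1 i \<and> b \<in> N2 i}) whole"
  then have "split N whole" by (simp only: N_def)
  from this[unfolded split_def] obtain \<phi> where \<phi>1: "lin \<phi>"
    and \<phi>2: "\<forall>\<alpha>\<in>arcs Q. \<forall>s\<in>whole (tail Q \<alpha>). z \<alpha> s - cob \<phi> \<alpha> s \<in> N (head Q \<alpha>)"
    by (elim exE conjE) (rule that)
  have "z \<alpha> s - cob \<phi> \<alpha> s \<in> N (head Q \<alpha>)" if "\<alpha> \<in> arcs Q" "s \<in> spc S (tail Q \<alpha>)" for \<alpha> s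
    using bspec[OF bspec[OF \<phi>2 that(1)], of s] that by (simp only: whole_def tail_in_verts if_True)
  note \<phi> = \<phi>1 this
  define w where "w \<alpha> s = z \<alpha> s - cob \<phi> \<alpha> s" for \<alpha> s
  have arr: "arr w" unfolding w_def using arr_diff[OF arr_z arr_cob[OF \<phi>(1)]] .
  have "\<exists>p. Vector_Spaces.linear (scl X) (scl X) p \<and> (\<forall>x. p x \<in> N1 i) \<and> (\<forall>x\<in>N i. x - p x \<in> N2 i)" if "i \<in> verts Q" for i
    unfolding N_def using X.projection_onto_summand[OF subrep_subspace(2)[OF N1 that] subrep_subspace(2)[OF N2 that]] .
  then obtain p where p: "\<And>i. i \<in> verts Q \<Longrightarrow> Vector_Spaces.linear (scl X) (scl X) (p i)"
    "\<And>i x. i \<in> verts Q \<Longrightarrow> p i x \<in> N1 i" "\<And>i x. i \<in> verts Q \<Longrightarrow> x \<in> N i \<Longrightarrow> x - p i x \<in> N2 i" by metis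
  define w1 where "w1 \<alpha> s = p (head Q \<alpha>) (w \<alpha> s)" for \<alpha> s
  have arr1: "arr w1"
    unfolding arr_def w1_def
  proof
    fix \<alpha> assume a: "\<alpha> \<in> arcs Q"
    have h: "head Q \<alpha> \<in> verts Q" using a by auto
    have "linear_btw (scl X) (scl X) (spc X (head Q \<alpha>)) (spc X (head Q \<alpha>)) (p (head Q \<alpha>))"
      by (rule linear_imp_btw[OF p(1)[OF h]]) (use p(2)[OF h] subrep_subspace(1)[OF N1 h] in auto)
    then show "linear_btw (scl S) (scl X) (spc S (tail Q \<alpha>)) (spc X (head Q \<alpha>)) (\<lambda>s. p (head Q \<alpha>) (w \<alpha> s))"
      using linear_btw_comp[OF arrD[OF arr a]] by blast
  qed
  obtain \<psi>1 where \<psi>1: "lin \<psi>1" "\<And>\<alpha> s. \<alpha> \<in> arcs Q \<Longrightarrow> s \<in> spc S (tail Q \<alpha>) \<Longrightarrow> w1 \<alpha> s = cob \<psi>1 \<alpha> s"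
    using coboundary_if_not_split[OF n(1) N1 subrep_whole arr1] p(2)[OF head_in_verts] unfolding w1_def by blast
  have w2: "w \<alpha> s - w1 \<alpha> s \<in> N2 (head Q \<alpha>)" if "\<alpha> \<in> arcs Q" "s \<in> whole (tail Q \<alpha>)" for \<alpha> s
  proof -
    have "s \<in> spc S (tail Q \<alpha>)" using that by (simp add: whole_def)
    then have "w \<alpha> s \<in> N (head Q \<alpha>)" unfolding w_def by (rule \<phi>(2)[OF that(1)])
    then show ?thesis unfolding w1_def by (rule p(3)[OF head_in_verts[OF that(1)]])
  qed
  obtain \<psi>2 where \<psi>2: "lin \<psi>2" "\<And>\<alpha> s. \<alpha> \<in> arcs Q \<Longrightarrow> s \<in> spc S (tail Q \<alpha>) \<Longrightarrow> w \<alpha> s - w1 \<alpha> s = cob \<psi>2 \<alpha> s"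
    using coboundary_if_not_split[OF n(2) N2 subrep_whole arr_diff[OF arr arr1] w2] by blast
  let ?\<chi> = "\<lambda>i s. \<phi> i s + (\<psi>1 i s + \<psi>2 i s)"
  have l: "lin (\<lambda>i s. \<psi>1 i s + \<psi>2 i s)" by (rule lin_add[OF \<psi>1(1) \<psi>2(1)])
  have "z \<alpha> s - cob ?\<chi> \<alpha> s \<in> zero_sub (head Q \<alpha>)" if a: "\<alpha> \<in> arcs Q" and s: "s \<in> whole (tail Q \<alpha>)" for \<alpha> s
  proof -
    have sS: "s \<in> spc S (tail Q \<alpha>)" using a s by (simp add: whole_def)
    show ?thesis
      using \<psi>1(2)[OF a sS] \<psi>2(2)[OF a sS] a
      by (simp add: cob_add[OF \<phi>(1) l a sS] cob_add[OF \<psi>1(1) \<psi>2(1) a sS] zero_sub_def w_def algebra_simps)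
  qed
  then have "split zero_sub whole" unfolding split_def using lin_add[OF \<phi>(1) l] by blast
  then show False using not_split_zero_whole by simp
qed

text \<open>
  Dual to \<open>not_split_sum\<close>: a cochain that vanishes on \<open>N1 \<inter> N2\<close> is the sum of one vanishing on
  \<open>N1\<close> and one vanishing on \<open>N2\<close>.
\<close>

lemma not_split_inter:
  assumes N1: "subrep Q S N1" and N2: "subrep Q S N2" and n: "\<not> split zero_sub N1" "\<not> split zero_sub N2"
  shows "\<not> split zero_sub (\<lambda>i. N1 i \<inter> N2 i)"
proof
  assume "split zero_sub (\<lambda>i. N1 i \<inter> N2 i)"
  then obtain \<phi> where \<phi>: "lin \<phi>"
      "\<forall>\<alpha>\<in>arcs Q. \<forall>s\<in>N1 (tail Q \<alpha>) \<inter> N2 (tail Q \<alpha>). z \<alpha> s - cob \<phi> \<alpha> s \<in> zero_sub (head Q \<alpha>)"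
    unfolding split_def by blast
  have pair: "vector_space_pair (scl S) (scl X)" ..
  define w where "w \<alpha> s = z \<alpha> s - cob \<phi> \<alpha> s" for \<alpha> s
  have arr: "arr w" unfolding w_def using arr_diff[OF arr_z arr_cob[OF \<phi>(1)]] .
  have w0: "w \<alpha> s = 0" if "\<alpha> \<in> arcs Q" "s \<in> N1 (tail Q \<alpha>)" "s \<in> N2 (tail Q \<alpha>)" for \<alpha> s
    using \<phi>(2) that by (auto simp: w_def zero_sub_def)
  have "\<exists>g. linear_btw (scl S) (scl X) (spc S (tail Q \<alpha>)) (spc X (head Q \<alpha>)) g \<and>
      (\<forall>s\<in>N1 (tail Q \<alpha>). g s = 0) \<and> (\<forall>s\<in>N2 (tail Q \<alpha>). g s = w \<alpha> s)" if a: "\<alpha> \<in> arcs Q" for \<alpha>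
  proof -
    have t: "tail Q \<alpha> \<in> verts Q" and h: "head Q \<alpha> \<in> verts Q" using a by auto
    have l: "linear_btw (scl S) (scl X) (N2 (tail Q \<alpha>)) UNIV (w \<alpha>)"
      by (rule linear_btw_mono[OF arrD[OF arr a]]) (use subrep_subspace(1)[OF N2 t] in auto)
    obtain g where g: "Vector_Spaces.linear (scl S) (scl X) g" "\<forall>s\<in>N1 (tail Q \<alpha>). g s = 0"
      "\<forall>s\<in>N2 (tail Q \<alpha>). g s = w \<alpha> s" "range g \<subseteq> X.span (w \<alpha> ` N2 (tail Q \<alpha>))"
      using vector_space_pair.linear_common_extension[OF pair, OF subrep_subspace(2)[OF N1 t] subrep_subspace(2)[OF N2 t] l w0[OF a]] by blast
    have "w \<alpha> ` N2 (tail Q \<alpha>) \<subseteq> spc X (head Q \<alpha>)"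
      using linear_btwD(1)[OF arrD[OF arr a]] subrep_subspace(1)[OF N2 t] by auto
    then have "X.span (w \<alpha> ` N2 (tail Q \<alpha>)) \<subseteq> spc X (head Q \<alpha>)" using XD(1)[OF h] by (rule X.span_minimal)
    then have "linear_btw (scl S) (scl X) (spc S (tail Q \<alpha>)) (spc X (head Q \<alpha>)) g"
      using g(4) by (intro linear_imp_btw[OF g(1)]) auto
    then show ?thesis using g by blast
  qed
  then obtain w1 where w1: "\<And>\<alpha>. \<alpha> \<in> arcs Q \<Longrightarrow> linear_btw (scl S) (scl X) (spc S (tail Q \<alpha>)) (spc X (head Q \<alpha>)) (w1 \<alpha>)"
    "\<And>\<alpha> s. \<alpha> \<in> arcs Q \<Longrightarrow> s \<in> N1 (tail Q \<alpha>) \<Longrightarrow> w1 \<alpha> s = 0"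
    "\<And>\<alpha> s. \<alpha> \<in> arcs Q \<Longrightarrow> s \<in> N2 (tail Q \<alpha>) \<Longrightarrow> w1 \<alpha> s = w \<alpha> s" by metis
  have arr1: "arr w1" using w1(1) by (simp add: arr_def)
  obtain \<psi>1 where \<psi>1: "lin \<psi>1" "\<And>\<alpha> s. \<alpha> \<in> arcs Q \<Longrightarrow> s \<in> spc S (tail Q \<alpha>) \<Longrightarrow> w1 \<alpha> s = cob \<psi>1 \<alpha> s"
    using coboundary_if_not_split[OF n(1) subrep_zero_sub N1 arr1] w1(2) by (auto simp: zero_sub_def)
  obtain \<psi>2 where \<psi>2: "lin \<psi>2" "\<And>\<alpha> s. \<alpha> \<in> arcs Q \<Longrightarrow> s \<in> spc S (tail Q \<alpha>) \<Longrightarrow> w \<alpha> s - w1 \<alpha> s = cob \<psi>2 \<alpha> s"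
    using coboundary_if_not_split[OF n(2) subrep_zero_sub N2 arr_diff[OF arr arr1]] w1(3) by (auto simp: zero_sub_def)
  let ?\<chi> = "\<lambda>i s. \<phi> i s + (\<psi>1 i s + \<psi>2 i s)"
  have l: "lin (\<lambda>i s. \<psi>1 i s + \<psi>2 i s)" by (rule lin_add[OF \<psi>1(1) \<psi>2(1)])
  have "z \<alpha> s - cob ?\<chi> \<alpha> s \<in> zero_sub (head Q \<alpha>)" if a: "\<alpha> \<in> arcs Q" and s: "s \<in> whole (tail Q \<alpha>)" for \<alpha> s
  proof -
    have sS: "s \<in> spc S (tail Q \<alpha>)" using a s by (simp add: whole_def)
    show ?thesis
      using \<psi>1(2)[OF a sS] \<psi>2(2)[OF a sS] a
      by (simp add: cob_add[OF \<phi>(1) l a sS] cob_add[OF \<psi>1(1) \<psi>2(1) a sS] zero_sub_def w_def algebra_simps)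
  qed
  then have "split zero_sub whole" unfolding split_def using lin_add[OF \<phi>(1) l] by blast
  then show False using not_split_zero_whole by simp
qed

text \<open>
  The image of \<open>z\<close> generates \<open>Ext\<^sup>1(S, X/N)\<close>, since cocycles lift along \<open>X \<rightarrow> X/N\<close>; so the
  dimension is one exactly if this image is nonzero.
\<close>

lemma ext_dim_quot_eq_1_iff:
  assumes N: "subrep Q X N"
  shows "ext_dim Q S (quot_rep Q X N) = 1 \<longleftrightarrow> \<not> split N whole"
proof -
  let ?Z = "quot_rep Q X N"
  obtain p where p: "is_quot Q X N ?Z p" using is_quot_quot_rep[OF wf X N] by blast
  then have Z: "fd_rep Q ?Z" and hom: "rep_hom Q X ?Z p"
    and pi: "\<And>i. i \<in> verts Q \<Longrightarrow> p i ` spc X i = spc ?Z i" "\<And>i. i \<in> verts Q \<Longrightarrow> {x \<in> spc X i. p i x = 0} = N i"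
    by (auto simp: is_quot_def)
  note ph = rep_homD[OF hom] and ZD = fd_repD[OF Z]
  interpret Z: vector_space "scl ?Z" by (rule ZD(1))
  have "rep_hom Q (X\<lparr>spc := N\<rparr>) X (\<lambda>_ x. x)"
    using subrep_subspace(1)[OF N] by (auto simp: rep_hom_def linear_btw_def)
  then have "short_exact Q (X\<lparr>spc := N\<rparr>) X ?Z (\<lambda>_ x. x) p" using hom pi by (simp add: short_exact_def)
  then have "\<exists>\<tau>. linear_btw (scl ?Z) (scl X) (spc ?Z i) (spc X i) \<tau> \<and> (\<forall>s\<in>spc ?Z i. p i (\<tau> s) = s)" if "i \<in> verts Q" for i
    using linear_section[OF X Z _ that] by blast
  then obtain \<tau> where \<tau>: "\<And>i. i \<in> verts Q \<Longrightarrow> linear_btw (scl ?Z) (scl X) (spc ?Z i) (spc X i) (\<tau> i)"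
    "\<And>i y. i \<in> verts Q \<Longrightarrow> y \<in> spc ?Z i \<Longrightarrow> p i (\<tau> i y) = y" by metis
  define z' where "z' \<alpha> s = (if \<alpha> \<in> arcs Q \<and> s \<in> spc S (tail Q \<alpha>) then p (head Q \<alpha>) (z \<alpha> s) else 0)" for \<alpha> s
  have plin: "p i (x - y) = p i x - p i y" "p i (x + y) = p i x + p i y" "p i (scl X c x) = scl ?Z c (p i x)"
    if "i \<in> verts Q" "x \<in> spc X i" "y \<in> spc X i" for i x y c
    using that linear_btw_diff[OF ph(1)[OF that(1)] X.module_axioms XD(1)[OF that(1)]] linear_btwD[OF ph(1)[OF that(1)]] by auto
  have "linear_btw (scl S) (scl ?Z) (spc S (tail Q \<alpha>)) (spc ?Z (head Q \<alpha>)) (z' \<alpha>)" if a: "\<alpha> \<in> arcs Q" for \<alpha>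
    using linear_btw_comp[OF arrD[OF arr_z a] ph(1)[OF head_in_verts[OF a]]] a
      S.subspace_add[OF SD(1)] S.subspace_scale[OF SD(1)]
    unfolding linear_btw_def by (auto simp: z'_def)
  then have z': "z' \<in> ext_cocycles Q S ?Z" by (auto simp: ext_cocycles_def z'_def)
  have pcob: "p (head Q \<alpha>) (cob \<phi> \<alpha> s) = ext_diff Q S ?Z (\<lambda>i s. p i (\<phi> i s)) \<alpha> s"
    if "lin \<phi>" "\<alpha> \<in> arcs Q" "s \<in> spc S (tail Q \<alpha>)" for \<phi> \<alpha> s
  proof -
    have t: "tail Q \<alpha> \<in> verts Q" and h: "head Q \<alpha> \<in> verts Q" using that by auto
    have "act S \<alpha> s \<in> spc S (head Q \<alpha>)" using linear_btwD(1)[OF SD(2)[OF that(2)] that(3)] .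
    then have m: "\<phi> (head Q \<alpha>) (act S \<alpha> s) \<in> spc X (head Q \<alpha>)" "\<phi> (tail Q \<alpha>) s \<in> spc X (tail Q \<alpha>)"
      using linear_btwD(1)[OF linD[OF that(1) h]] linear_btwD(1)[OF linD[OF that(1) t]] that by auto
    then have "act X \<alpha> (\<phi> (tail Q \<alpha>) s) \<in> spc X (head Q \<alpha>)" using linear_btwD(1)[OF XD(2)[OF that(2)]] by blast
    then show ?thesis using plin(1)[OF h m(1)] ph(2)[OF that(2) m(2)] that
      by (simp add: cob_def ext_diff_def)
  qed
  have lp: "linear_btw (scl S) (scl ?Z) (spc S i) (spc ?Z i) (\<lambda>s. p i (\<phi> i s))" if "lin \<phi>" "i \<in> verts Q" for \<phi> i
    using linear_btw_comp[OF linD[OF that] ph(1)[OF that(2)]] .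
  have zX: "z \<alpha> s \<in> spc X (head Q \<alpha>)" "cob \<phi> \<alpha> s \<in> spc X (head Q \<alpha>)" if "lin \<phi>" "\<alpha> \<in> arcs Q" "s \<in> spc S (tail Q \<alpha>)" for \<alpha> s \<phi>
    using linear_btwD(1)[OF arrD[OF arr_z that(2)] that(3)] linear_btwD(1)[OF arrD[OF arr_cob[OF that(1)] that(2)] that(3)] .
  have "ext_dim Q S ?Z = (if z' \<in> ext_coboundaries Q S ?Z then 0 else 1)"
  proof (rule ext_dim_of_generator[OF Q S Z z'])
    fix w assume w: "w \<in> ext_cocycles Q S ?Z"
    then have wl: "\<And>\<alpha>. \<alpha> \<in> arcs Q \<Longrightarrow> linear_btw (scl S) (scl ?Z) (spc S (tail Q \<alpha>)) (spc ?Z (head Q \<alpha>)) (w \<alpha>)"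
      by (simp add: ext_cocycles_def)
    have "arr (\<lambda>\<alpha> s. \<tau> (head Q \<alpha>) (w \<alpha> s))"
      unfolding arr_def using linear_btw_comp[OF wl \<tau>(1)[OF head_in_verts]] by blast
    then obtain c \<phi> where \<phi>: "lin \<phi>" "\<And>\<alpha> s. \<alpha> \<in> arcs Q \<Longrightarrow> s \<in> spc S (tail Q \<alpha>) \<Longrightarrow>
        \<tau> (head Q \<alpha>) (w \<alpha> s) = scl X c (z \<alpha> s) + cob \<phi> \<alpha> s"
      using arr_generated by blast
    have "w \<alpha> s = scl ?Z c (z' \<alpha> s) + ext_diff Q S ?Z (\<lambda>i s. p i (\<phi> i s)) \<alpha> s" for \<alpha> s
    proof (cases "\<alpha> \<in> arcs Q \<and> s \<in> spc S (tail Q \<alpha>)")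
      case True
      then have a: "\<alpha> \<in> arcs Q" and s: "s \<in> spc S (tail Q \<alpha>)" and h: "head Q \<alpha> \<in> verts Q" by auto
      note m = zX[OF \<phi>(1) a s]
      have "w \<alpha> s = p (head Q \<alpha>) (\<tau> (head Q \<alpha>) (w \<alpha> s))"
        using \<tau>(2)[OF h linear_btwD(1)[OF wl[OF a] s]] by simp
      also have "\<dots> = p (head Q \<alpha>) (scl X c (z \<alpha> s)) + p (head Q \<alpha>) (cob \<phi> \<alpha> s)"
        unfolding \<phi>(2)[OF a s] using plin(2)[OF h X.subspace_scale[OF XD(1)[OF h] m(1)] m(2)] .
      also have "\<dots> = scl ?Z c (z' \<alpha> s) + ext_diff Q S ?Z (\<lambda>i s. p i (\<phi> i s)) \<alpha> s"
        using plin(3)[OF h m(1) m(1)] pcob[OF \<phi>(1) a s] True by (simp add: z'_def)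
      finally show ?thesis .
    next
      case False
      then show ?thesis using w by (auto simp: ext_cocycles_def z'_def ext_diff_def)
    qed
    then have "w = ext_scale ?Z c z' + ext_diff Q S ?Z (\<lambda>i s. p i (\<phi> i s))" by (simp add: fun_eq_iff ext_scale_def)
    moreover have "ext_diff Q S ?Z (\<lambda>i s. p i (\<phi> i s)) \<in> ext_coboundaries Q S ?Z"
      using lp[OF \<phi>(1)] by (auto simp: ext_coboundaries_def)
    ultimately show "\<exists>c. \<exists>b\<in>ext_coboundaries Q S ?Z. w = ext_scale ?Z c z' + b" by blast
  qed
  moreover have "z' \<in> ext_coboundaries Q S ?Z \<longleftrightarrow> split N whole"
  proof
    assume "z' \<in> ext_coboundaries Q S ?Z"
    then obtain \<psi> where \<psi>: "z' = ext_diff Q S ?Z \<psi>" "\<And>i. i \<in> verts Q \<Longrightarrow> linear_btw (scl S) (scl ?Z) (spc S i) (spc ?Z i) (\<psi> i)"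
      by (auto simp: ext_coboundaries_def)
    let ?\<phi> = "\<lambda>i s. \<tau> i (\<psi> i s)"
    have l: "lin ?\<phi>" unfolding lin_def using linear_btw_comp[OF \<psi>(2) \<tau>(1)] by blast
    have "z \<alpha> s - cob ?\<phi> \<alpha> s \<in> N (head Q \<alpha>)" if a: "\<alpha> \<in> arcs Q" and s: "s \<in> whole (tail Q \<alpha>)" for \<alpha> s
    proof -
      have t: "tail Q \<alpha> \<in> verts Q" and h: "head Q \<alpha> \<in> verts Q" using a by auto
      have sS: "s \<in> spc S (tail Q \<alpha>)" using a s by (simp add: whole_def)
      note m = zX[OF l a sS]
      have "ext_diff Q S ?Z (\<lambda>i s. p i (?\<phi> i s)) \<alpha> s = ext_diff Q S ?Z \<psi> \<alpha> s"
        using \<tau>(2)[OF h linear_btwD(1)[OF \<psi>(2)[OF h] linear_btwD(1)[OF SD(2)[OF a] sS]]]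
          \<tau>(2)[OF t linear_btwD(1)[OF \<psi>(2)[OF t] sS]] by (simp add: ext_diff_def)
      then have "p (head Q \<alpha>) (z \<alpha> s - cob ?\<phi> \<alpha> s) = 0"
        using plin(1)[OF h m] pcob[OF l a sS] fun_cong[OF fun_cong[OF \<psi>(1)], of \<alpha> s] a sS by (simp add: z'_def)
      then show ?thesis using pi(2)[OF h] X.subspace_diff[OF XD(1)[OF h] m] by blast
    qed
    then show "split N whole" unfolding split_def using l by blast
  next
    assume "split N whole"
    then obtain \<phi> where \<phi>: "lin \<phi>" "\<forall>\<alpha>\<in>arcs Q. \<forall>s\<in>whole (tail Q \<alpha>). z \<alpha> s - cob \<phi> \<alpha> s \<in> N (head Q \<alpha>)"
      by (auto simp: split_def)
    have "z' \<alpha> s = ext_diff Q S ?Z (\<lambda>i s. p i (\<phi> i s)) \<alpha> s" for \<alpha> s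
    proof (cases "\<alpha> \<in> arcs Q \<and> s \<in> spc S (tail Q \<alpha>)")
      case True
      then have a: "\<alpha> \<in> arcs Q" and s: "s \<in> spc S (tail Q \<alpha>)" and h: "head Q \<alpha> \<in> verts Q" and w: "s \<in> whole (tail Q \<alpha>)"
        by (auto simp: whole_def)
      note m = zX[OF \<phi>(1) a s]
      have "z \<alpha> s - cob \<phi> \<alpha> s \<in> N (head Q \<alpha>)" using \<phi>(2) a w by blast
      then have "p (head Q \<alpha>) (z \<alpha> s - cob \<phi> \<alpha> s) = 0" using pi(2)[OF h] by blast
      then show ?thesis using plin(1)[OF h m] pcob[OF \<phi>(1) a s] True by (simp add: z'_def)
    next
      case False
      then show ?thesis by (auto simp: z'_def ext_diff_def)
    qed
    then have "z' = ext_diff Q S ?Z (\<lambda>i s. p i (\<phi> i s))" by blast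
    then show "z' \<in> ext_coboundaries Q S ?Z" using lp[OF \<phi>(1)] by (auto simp: ext_coboundaries_def)
  qed
  ultimately show ?thesis by auto
qed

text \<open>
  The restriction of \<open>z\<close> generates \<open>Ext\<^sup>1(N, X)\<close>, since cocycles extend from \<open>N\<close> to \<open>S\<close>.
\<close>

lemma ext_dim_sub_eq_1_iff:
  assumes N: "subrep Q S N"
  shows "ext_dim Q (S\<lparr>spc := N\<rparr>) X = 1 \<longleftrightarrow> \<not> split zero_sub N"
proof -
  let ?N = "S\<lparr>spc := N\<rparr>"
  have fN: "fd_rep Q ?N" by (rule fd_rep_subrep[OF S N])
  define z' where "z' \<alpha> s = (if \<alpha> \<in> arcs Q \<and> s \<in> N (tail Q \<alpha>) then z \<alpha> s else 0)" for \<alpha> s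
  note sub = subrep_subspace[OF N]
  have inS: "s \<in> spc S (tail Q \<alpha>)" if "\<alpha> \<in> arcs Q" "s \<in> N (tail Q \<alpha>)" for \<alpha> s
    using sub(1)[of "tail Q \<alpha>"] that by auto
  have "linear_btw (scl S) (scl X) (N (tail Q \<alpha>)) (spc X (head Q \<alpha>)) (z' \<alpha>)" if a: "\<alpha> \<in> arcs Q" for \<alpha>
    using arrD[OF arr_z a] inS[OF a] a S.subspace_add[OF sub(2)[OF tail_in_verts[OF a]]] S.subspace_scale[OF sub(2)[OF tail_in_verts[OF a]]]
    unfolding linear_btw_def by (auto simp: z'_def Pi_iff)
  then have z': "z' \<in> ext_cocycles Q ?N X" by (auto simp: ext_cocycles_def z'_def)
  have ext: "\<exists>f'. linear_btw (scl S) (scl X) (spc S i) (spc X j) f' \<and> (\<forall>s\<in>N i. f' s = f s)"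
    if "i \<in> verts Q" "j \<in> verts Q" "linear_btw (scl S) (scl X) (N i) (spc X j) f" for f i j
    using linear_btw_extend[OF S.vector_space_axioms X.vector_space_axioms sub(2)[OF that(1)] that(3) XD(1)[OF that(2)]]
    by (metis linear_imp_btw image_subsetI)
  have cobN: "ext_diff Q ?N X \<phi> \<alpha> s = cob \<phi> \<alpha> s" if "\<alpha> \<in> arcs Q" "s \<in> N (tail Q \<alpha>)" for \<phi> \<alpha> s
    using that by (simp add: ext_diff_def cob_def)
  have linN: "linear_btw (scl S) (scl X) (N i) (spc X i) (\<phi> i)" if "lin \<phi>" "i \<in> verts Q" for \<phi> i
    by (rule linear_btw_mono[OF linD[OF that]]) (use sub(1)[OF that(2)] linear_btwD(1)[OF linD[OF that]] in auto)
  have "ext_dim Q ?N X = (if z' \<in> ext_coboundaries Q ?N X then 0 else 1)"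
  proof (rule ext_dim_of_generator[OF Q fN X z'])
    fix w assume w: "w \<in> ext_cocycles Q ?N X"
    have "\<exists>f'. linear_btw (scl S) (scl X) (spc S (tail Q \<alpha>)) (spc X (head Q \<alpha>)) f' \<and> (\<forall>s\<in>N (tail Q \<alpha>). f' s = w \<alpha> s)" if "\<alpha> \<in> arcs Q" for \<alpha>
      using ext[of "tail Q \<alpha>" "head Q \<alpha>" "w \<alpha>"] w that by (simp add: ext_cocycles_def)
    then obtain w' where w': "\<And>\<alpha>. \<alpha> \<in> arcs Q \<Longrightarrow> linear_btw (scl S) (scl X) (spc S (tail Q \<alpha>)) (spc X (head Q \<alpha>)) (w' \<alpha>)"
      "\<And>\<alpha> s. \<alpha> \<in> arcs Q \<Longrightarrow> s \<in> N (tail Q \<alpha>) \<Longrightarrow> w' \<alpha> s = w \<alpha> s" by metis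
    have "arr w'" using w'(1) by (simp add: arr_def)
    then obtain c \<phi> where \<phi>: "lin \<phi>" "\<And>\<alpha> s. \<alpha> \<in> arcs Q \<Longrightarrow> s \<in> spc S (tail Q \<alpha>) \<Longrightarrow>
        w' \<alpha> s = scl X c (z \<alpha> s) + cob \<phi> \<alpha> s"
      using arr_generated by blast
    have "w \<alpha> s = scl X c (z' \<alpha> s) + ext_diff Q ?N X \<phi> \<alpha> s" for \<alpha> s
    proof (cases "\<alpha> \<in> arcs Q \<and> s \<in> N (tail Q \<alpha>)")
      case True
      then show ?thesis using \<phi>(2)[of \<alpha> s] w'(2)[of \<alpha> s] inS[of \<alpha> s] by (simp add: cobN z'_def)
    next
      case False
      then show ?thesis using w by (auto simp: ext_cocycles_def z'_def ext_diff_def)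
    qed
    then have "w = ext_scale X c z' + ext_diff Q ?N X \<phi>" by (simp add: fun_eq_iff ext_scale_def)
    moreover have "ext_diff Q ?N X \<phi> \<in> ext_coboundaries Q ?N X"
      using linN[OF \<phi>(1)] by (auto simp: ext_coboundaries_def)
    ultimately show "\<exists>c. \<exists>b\<in>ext_coboundaries Q ?N X. w = ext_scale X c z' + b" by blast
  qed
  moreover have "z' \<in> ext_coboundaries Q ?N X \<longleftrightarrow> split zero_sub N"
  proof
    assume "z' \<in> ext_coboundaries Q ?N X"
    then obtain \<psi> where \<psi>: "z' = ext_diff Q ?N X \<psi>" "\<And>i. i \<in> verts Q \<Longrightarrow> linear_btw (scl S) (scl X) (N i) (spc X i) (\<psi> i)"
      by (auto simp: ext_coboundaries_def)
    have "\<exists>f'. linear_btw (scl S) (scl X) (spc S i) (spc X i) f' \<and> (\<forall>s\<in>N i. f' s = \<psi> i s)" if "i \<in> verts Q" for i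
      using ext[OF that that \<psi>(2)[OF that]] .
    then obtain \<phi> where \<phi>: "\<And>i. i \<in> verts Q \<Longrightarrow> linear_btw (scl S) (scl X) (spc S i) (spc X i) (\<phi> i)"
      "\<And>i s. i \<in> verts Q \<Longrightarrow> s \<in> N i \<Longrightarrow> \<phi> i s = \<psi> i s" by metis
    have "z \<alpha> s - cob \<phi> \<alpha> s \<in> zero_sub (head Q \<alpha>)" if a: "\<alpha> \<in> arcs Q" and s: "s \<in> N (tail Q \<alpha>)" for \<alpha> s
    proof -
      have "act S \<alpha> s \<in> N (head Q \<alpha>)" using subrep_act[OF N a s] .
      then have "cob \<phi> \<alpha> s = cob \<psi> \<alpha> s" using a s \<phi>(2) by (simp add: cob_def)
      then show ?thesis using fun_cong[OF fun_cong[OF \<psi>(1)], of \<alpha> s] a s cobN[OF a s] by (simp add: z'_def zero_sub_def)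
    qed
    then show "split zero_sub N" unfolding split_def using \<phi>(1) by (auto simp: lin_def)
  next
    assume "split zero_sub N"
    then obtain \<phi> where \<phi>: "lin \<phi>" "\<forall>\<alpha>\<in>arcs Q. \<forall>s\<in>N (tail Q \<alpha>). z \<alpha> s - cob \<phi> \<alpha> s \<in> zero_sub (head Q \<alpha>)"
      by (auto simp: split_def)
    have "z' \<alpha> s = ext_diff Q ?N X \<phi> \<alpha> s" for \<alpha> s
      using \<phi>(2) by (auto simp: z'_def ext_diff_def cob_def zero_sub_def)
    then have "z' = ext_diff Q ?N X \<phi>" by blast
    then show "z' \<in> ext_coboundaries Q ?N X" using linN[OF \<phi>(1)] by (auto simp: ext_coboundaries_def)
  qed
  ultimately show ?thesis by auto
qed

lemma subrep_sum:
  assumes "subrep Q X N1" "subrep Q X N2"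
  shows "subrep Q X (\<lambda>i. {a + b | a b. a \<in> N1 i \<and> b \<in> N2 i})"
  unfolding subrep_def
proof (intro conjI ballI allI impI)
  fix i assume i: "i \<in> verts Q"
  note s1 = subrep_subspace[OF assms(1) i] and s2 = subrep_subspace[OF assms(2) i]
  show "{a + b | a b. a \<in> N1 i \<and> b \<in> N2 i} \<subseteq> spc X i"
    using s1(1) s2(1) X.subspace_add[OF XD(1)[OF i]] by blast
  show "X.subspace {a + b | a b. a \<in> N1 i \<and> b \<in> N2 i}" by (rule X.subspace_sums[OF s1(2) s2(2)])
next
  fix i assume "i \<notin> verts Q"
  then show "{a + b | a b. a \<in> N1 i \<and> b \<in> N2 i} = {}" using assms by (auto simp: subrep_def)
next
  fix \<alpha> assume a: "\<alpha> \<in> arcs Q"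
  show "act X \<alpha> ` {a + b | a b. a \<in> N1 (tail Q \<alpha>) \<and> b \<in> N2 (tail Q \<alpha>)} \<subseteq> {a + b | a b. a \<in> N1 (head Q \<alpha>) \<and> b \<in> N2 (head Q \<alpha>)}"
  proof
    fix y assume "y \<in> act X \<alpha> ` {a + b | a b. a \<in> N1 (tail Q \<alpha>) \<and> b \<in> N2 (tail Q \<alpha>)}"
    then obtain u v where uv: "u \<in> N1 (tail Q \<alpha>)" "v \<in> N2 (tail Q \<alpha>)" "y = act X \<alpha> (u + v)" by blast
    have "u \<in> spc X (tail Q \<alpha>)" "v \<in> spc X (tail Q \<alpha>)"
      using subrep_subspace(1)[OF assms(1) tail_in_verts[OF a]] subrep_subspace(1)[OF assms(2) tail_in_verts[OF a]] uv by auto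
    then have "y = act X \<alpha> u + act X \<alpha> v" using linear_btwD(2)[OF XD(2)[OF a]] uv(3) by simp
    moreover have "act X \<alpha> u \<in> N1 (head Q \<alpha>)" "act X \<alpha> v \<in> N2 (head Q \<alpha>)"
      using subrep_act[OF assms(1) a uv(1)] subrep_act[OF assms(2) a uv(2)] .
    ultimately show "y \<in> {a + b | a b. a \<in> N1 (head Q \<alpha>) \<and> b \<in> N2 (head Q \<alpha>)}" by blast
  qed
qed

lemma subrep_inter:
  assumes "subrep Q S N1" "subrep Q S N2"
  shows "subrep Q S (\<lambda>i. N1 i \<inter> N2 i)"
  unfolding subrep_def
proof (intro conjI ballI allI impI)
  fix i assume i: "i \<in> verts Q"
  note s1 = subrep_subspace[OF assms(1) i] and s2 = subrep_subspace[OF assms(2) i]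
  show "N1 i \<inter> N2 i \<subseteq> spc S i" using s1(1) by blast
  show "S.subspace (N1 i \<inter> N2 i)" by (rule S.subspace_inter[OF s1(2) s2(2)])
next
  fix i assume "i \<notin> verts Q"
  then show "N1 i \<inter> N2 i = {}" using assms(1) by (simp add: subrep_def)
next
  fix \<alpha> assume a: "\<alpha> \<in> arcs Q"
  show "act S \<alpha> ` (N1 (tail Q \<alpha>) \<inter> N2 (tail Q \<alpha>)) \<subseteq> N1 (head Q \<alpha>) \<inter> N2 (head Q \<alpha>)"
    using subrep_act[OF assms(1) a] subrep_act[OF assms(2) a] by blast
qed

text \<open>
  A non-split \<open>N\<close> of maximal total dimension contains every other one: its sum with another one
  is non-split again.
\<close>

lemma upper_sub:
  shows "subrep Q X (upper_sub Q X S)"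
    and "subrep Q X N \<Longrightarrow> \<not> split N whole \<longleftrightarrow> N \<le> upper_sub Q X S"
proof -
  let ?P = "\<lambda>N. subrep Q X N \<and> \<not> split N whole"
  let ?d = "\<lambda>N. \<Sum>i\<in>verts Q. X.dim (N i)"
  have le: "X.dim (N i) \<le> X.dim (M i)" "X.dim (N i) = X.dim (M i) \<Longrightarrow> N i = M i"
    if "subrep Q X N" "subrep Q X M" "N i \<subseteq> M i" "i \<in> verts Q" for N M i
  proof -
    have f: "fd_sub (scl X) (M i)"
      using fd_sub_subset[OF X.vector_space_axioms fd_rep_fd_sub[OF X that(4)]] subrep_subspace[OF that(2,4)] by blast
    show "X.dim (N i) \<le> X.dim (M i)" "X.dim (N i) = X.dim (M i) \<Longrightarrow> N i = M i"
      using subspace_eq_dim[OF X.vector_space_axioms f subrep_subspace(2)[OF that(1,4)] that(3)] by auto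
  qed
  have bound: "?d N \<le> (\<Sum>i\<in>verts Q. X.dim (spc X i))" if "?P N" for N
    using subspace_eq_dim(1)[OF X.vector_space_axioms fd_rep_fd_sub[OF X]] subrep_subspace[of Q X N] that
    by (intro sum_mono) auto
  have "?P zero_sub" using subrep_zero_sub not_split_zero_whole by simp
  then obtain U where U: "?P U" "\<And>N. ?P N \<Longrightarrow> ?d N \<le> ?d U"
    using ex_has_greatest_nat[of ?P zero_sub ?d "Suc (\<Sum>i\<in>verts Q. X.dim (spc X i))"] bound by (auto simp: less_Suc_eq_le)
  have max: "N \<le> U" if N: "?P N" for N
  proof (rule le_funI)
    fix i
    let ?M = "\<lambda>i. {a + b | a b. a \<in> U i \<and> b \<in> N i}"
    have M: "?P ?M" using subrep_sum not_split_sum U(1) N by blast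
    have UM: "U i \<subseteq> ?M i" "N i \<subseteq> ?M i" if "i \<in> verts Q" for i
      using X.subspace_0[OF subrep_subspace(2)[OF conjunct1[OF N] that]] X.subspace_0[OF subrep_subspace(2)[OF conjunct1[OF U(1)] that]] by force+
    show "N i \<subseteq> U i"
    proof (cases "i \<in> verts Q")
      case True
      have "X.dim (U i) = X.dim (?M i)" if "i \<in> verts Q" for i
      proof (rule ccontr)
        assume ne: "X.dim (U i) \<noteq> X.dim (?M i)"
        have l: "X.dim (U j) \<le> X.dim (?M j)" if "j \<in> verts Q" for j
          using le(1)[of U ?M j] U(1) M UM(1) that by blast
        then have "?d U < ?d ?M" using ne \<open>i \<in> verts Q\<close> finite_verts
          by (intro sum_strict_mono_ex1) (auto intro: le_neq_implies_less)
        then show False using U(2)[OF M] by simp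
      qed
      then have "U i = ?M i" using le(2)[of U ?M i] U(1) M UM(1) True by blast
      then show ?thesis using UM(2)[OF True] by blast
    next
      case False
      then show ?thesis using N by (auto simp: subrep_def)
    qed
  qed
  have "upper_sub Q X S = U"
    unfolding upper_sub_def
  proof (rule Greatest_equality)
    show "subrep Q X U \<and> ext_dim Q S (quot_rep Q X U) = 1" using U(1) ext_dim_quot_eq_1_iff by blast
    show "N \<le> U" if "subrep Q X N \<and> ext_dim Q S (quot_rep Q X N) = 1" for N
      using max that ext_dim_quot_eq_1_iff by blast
  qed
  then show "subrep Q X (upper_sub Q X S)" and "subrep Q X N \<Longrightarrow> \<not> split N whole \<longleftrightarrow> N \<le> upper_sub Q X S"
    using U(1) max split_mono[of N whole U whole] by (auto simp: le_fun_def)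
qed

text \<open>
  Here a non-split \<open>N\<close> of minimal total dimension is contained in every other one.
\<close>

lemma lower_sub:
  shows "subrep Q S (lower_sub Q X S)"
    and "subrep Q S N \<Longrightarrow> \<not> split zero_sub N \<longleftrightarrow> lower_sub Q X S \<le> N"
proof -
  let ?P = "\<lambda>N. subrep Q S N \<and> \<not> split zero_sub N"
  let ?d = "\<lambda>N. \<Sum>i\<in>verts Q. S.dim (N i)"
  have le: "S.dim (N i) \<le> S.dim (M i)" "S.dim (N i) = S.dim (M i) \<Longrightarrow> N i = M i"
    if "subrep Q S N" "subrep Q S M" "N i \<subseteq> M i" "i \<in> verts Q" for N M i
  proof -
    have f: "fd_sub (scl S) (M i)"
      using fd_sub_subset[OF S.vector_space_axioms fd_rep_fd_sub[OF S that(4)]] subrep_subspace[OF that(2,4)] by blast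
    show "S.dim (N i) \<le> S.dim (M i)" "S.dim (N i) = S.dim (M i) \<Longrightarrow> N i = M i"
      using subspace_eq_dim[OF S.vector_space_axioms f subrep_subspace(2)[OF that(1,4)] that(3)] by auto
  qed
  have "?P whole" using subrep_whole not_split_zero_whole by simp
  then obtain L where L: "?P L" "\<And>N. ?P N \<Longrightarrow> ?d L \<le> ?d N"
    using ex_has_least_nat[of ?P whole ?d] by auto
  have min: "L \<le> N" if N: "?P N" for N
  proof (rule le_funI)
    fix i
    let ?M = "\<lambda>i. L i \<inter> N i"
    have M: "?P ?M" using subrep_inter not_split_inter L(1) N by blast
    show "L i \<subseteq> N i"
    proof (cases "i \<in> verts Q")
      case True
      have "S.dim (?M i) = S.dim (L i)" if "i \<in> verts Q" for i
      proof (rule ccontr)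
        assume ne: "S.dim (?M i) \<noteq> S.dim (L i)"
        have l: "S.dim (?M j) \<le> S.dim (L j)" if "j \<in> verts Q" for j
          using le(1)[of ?M L j] L(1) M that by blast
        then have "?d ?M < ?d L" using ne \<open>i \<in> verts Q\<close> finite_verts
          by (intro sum_strict_mono_ex1) (auto intro: le_neq_implies_less)
        then show False using L(2)[OF M] by simp
      qed
      then have "?M i = L i" using le(2)[of ?M L i] L(1) M True by blast
      then show ?thesis by blast
    next
      case False
      then show ?thesis using L by (auto simp: subrep_def)
    qed
  qed
  have "lower_sub Q X S = L"
    unfolding lower_sub_def
  proof (rule Least_equality)
    show "subrep Q S L \<and> ext_dim Q (S\<lparr>spc := L\<rparr>) X = 1" using L(1) ext_dim_sub_eq_1_iff by blast
    show "L \<le> N" if "subrep Q S N \<and> ext_dim Q (S\<lparr>spc := N\<rparr>) X = 1" for N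
      using min that ext_dim_sub_eq_1_iff by blast
  qed
  then show "subrep Q S (lower_sub Q X S)" and "subrep Q S N \<Longrightarrow> \<not> split zero_sub N \<longleftrightarrow> lower_sub Q X S \<le> N"
    using L(1) min split_mono[of zero_sub N zero_sub L] by (auto simp: le_fun_def)
qed

lemma split_iff:
  assumes "subrep Q X N'" "subrep Q S N''"
  shows "split N' N'' \<longleftrightarrow> \<not> (N' \<le> upper_sub Q X S \<and> lower_sub Q X S \<le> N'')"
  using not_split_iff[OF assms] upper_sub(2)[OF assms(1)] lower_sub(2)[OF assms(2)] by blast

end

section \<open>Complements\<close>

definition compl :: "('k::field \<Rightarrow> 'v::ab_group_add \<Rightarrow> 'v) \<Rightarrow> 'v set \<Rightarrow> 'v set \<Rightarrow> 'v set \<Rightarrow> bool" where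
  "compl s N C V \<longleftrightarrow> module.subspace s N \<and> module.subspace s C \<and> N \<subseteq> V \<and> C \<subseteq> V \<and>
     N \<inter> C \<subseteq> {0} \<and> (\<forall>v\<in>V. \<exists>c\<in>C. v - c \<in> N)"

text \<open>
  The projection onto \<open>C\<close> along \<open>N\<close>, described by its characterising property so that it makes
  sense without naming the ambient space.
\<close>

definition cproj :: "'v::ab_group_add set \<Rightarrow> 'v set \<Rightarrow> 'v \<Rightarrow> 'v" where
  "cproj N C w = (THE c. c \<in> C \<and> w - c \<in> N)"

lemma complD:
  assumes "compl s N C V"
  shows "module.subspace s N" "module.subspace s C" "N \<subseteq> V" "C \<subseteq> V" "x \<in> N \<Longrightarrow> x \<in> C \<Longrightarrow> x = 0"
    "v \<in> V \<Longrightarrow> \<exists>c\<in>C. v - c \<in> N"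
  using assms by (auto simp: compl_def)

lemma cproj_eqI:
  assumes "vector_space s" "compl s N C V" "c \<in> C" "w - c \<in> N"
  shows "cproj N C w = c"
  unfolding cproj_def
proof (rule the_equality)
  interpret vector_space s by fact
  note c = complD[OF assms(2)]
  show "c \<in> C \<and> w - c \<in> N" using assms by simp
  fix c' assume c': "c' \<in> C \<and> w - c' \<in> N"
  have "(w - c) - (w - c') \<in> N" using subspace_diff[OF c(1) assms(4), of "w - c'"] c' by blast
  then have "c' - c \<in> N" by simp
  moreover have "c' - c \<in> C" using c' assms(3) c(2) by (intro subspace_diff) auto
  ultimately have "c' - c = 0" by (rule c(5))
  then show "c' = c" by simp
qed

lemma cproj_mem:
  assumes "vector_space s" "compl s N C V" "w \<in> V"
  shows "cproj N C w \<in> C" "w - cproj N C w \<in> N"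
  using complD(6)[OF assms(2,3)] cproj_eqI[OF assms(1,2)] by auto

lemma cproj_on:
  assumes "vector_space s" "compl s N C V"
  shows "w \<in> C \<Longrightarrow> cproj N C w = w" "w \<in> N \<Longrightarrow> cproj N C w = 0"
proof -
  interpret vector_space s by fact
  show "w \<in> C \<Longrightarrow> cproj N C w = w"
    using subspace_0[OF complD(1)[OF assms(2)]] by (intro cproj_eqI[OF assms]) auto
  show "w \<in> N \<Longrightarrow> cproj N C w = 0"
    using subspace_0[OF complD(2)[OF assms(2)]] by (intro cproj_eqI[OF assms]) auto
qed

lemma cproj_eq_0_iff:
  assumes "vector_space s" "compl s N C V" "w \<in> V"
  shows "cproj N C w = 0 \<longleftrightarrow> w \<in> N"
  using cproj_mem(2)[OF assms] cproj_on(2)[OF assms(1,2)] by auto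

lemma linear_btw_cproj:
  assumes "vector_space s" "compl s N C V" "module.subspace s V"
  shows "linear_btw s s V C (cproj N C)"
  unfolding linear_btw_def
proof (intro conjI ballI allI funcsetI)
  interpret vector_space s by fact
  note c = complD[OF assms(2)] and m = cproj_mem[OF assms(1,2)]
  fix x assume x: "x \<in> V"
  show "cproj N C x \<in> C" by (rule m(1)[OF x])
  have "s a x - s a (cproj N C x) \<in> N" for a
    using subspace_scale[OF c(1) m(2)[OF x], of a] by (simp add: scale_right_diff_distrib)
  then show "cproj N C (s a x) = s a (cproj N C x)" for a
    using subspace_scale[OF c(2) m(1)[OF x]] by (intro cproj_eqI[OF assms(1,2)]) auto
  fix y assume y: "y \<in> V"
  have "x + y - (cproj N C x + cproj N C y) \<in> N"
    using subspace_add[OF c(1) m(2)[OF x] m(2)[OF y]] by (simp add: algebra_simps)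
  then show "cproj N C (x + y) = cproj N C x + cproj N C y"
    using subspace_add[OF c(2) m(1)[OF x] m(1)[OF y]] by (intro cproj_eqI[OF assms(1,2)]) auto
qed

lemma compl_exists:
  assumes "vector_space s" "module.subspace s V" "module.subspace s N" "N \<subseteq> V"
  obtains C where "compl s N C V"
proof -
  interpret vector_space s by fact
  obtain r where r: "Vector_Spaces.linear s s r" "\<And>x. x \<in> V \<Longrightarrow> r x \<in> V" "\<And>x. x \<in> V \<Longrightarrow> x - r x \<in> N"
    "\<And>x. x \<in> N \<Longrightarrow> r x = 0" by (rule complement_projection[OF assms]) blast
  interpret r: Vector_Spaces.linear s s r by fact
  have rr: "r (r x) = r x" if "x \<in> V" for x
    using r(4)[OF r(3)[OF that]] by (simp add: r.diff)
  have "linear_btw s s V V r" by (rule linear_imp_btw[OF r(1)]) (use r in auto)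
  note rV = subspace_linear_btw(2)[OF module_axioms module_axioms assms(2) this]
  have "x = 0" if "x \<in> N" "x \<in> r ` V" for x
    using r(4)[OF that(1)] rr that(2) by auto
  moreover have "\<exists>c\<in>r ` V. v - c \<in> N" if "v \<in> V" for v using r(3)[OF that] that by blast
  moreover have "r ` V \<subseteq> V" using r(2) by blast
  ultimately have "compl s N (r ` V) V"
    unfolding compl_def using assms(3,4) rV by blast
  then show ?thesis by (rule that)
qed

lemma compl_dim:
  assumes "vector_space s" "compl s N C V" "fd_sub s V"
  shows "vector_space.dim s V = vector_space.dim s N + vector_space.dim s C"
proof -
  note V = fd_subD[OF assms(3)] and l = linear_btw_cproj[OF assms(1,2) fd_subD[OF assms(3)]]
  have "{v \<in> V. cproj N C v = 0} = N"
    using cproj_eq_0_iff[OF assms(1,2)] complD(3)[OF assms(2)] by auto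
  moreover have "cproj N C ` V = C"
    using cproj_mem(1)[OF assms(1,2)] cproj_on(1)[OF assms(1,2)] complD(4)[OF assms(2)] by force
  ultimately show ?thesis using dim_exact[OF assms(1,1,3) l] by simp
qed

text \<open>
  Subspaces with zero intersection and complementary dimensions: the projection along \<open>N\<close> onto
  some complement maps \<open>C\<close> isomorphically onto that complement.
\<close>

lemma compl_if_dim:
  assumes s: "vector_space s" and V: "fd_sub s V" and N: "module.subspace s N" "N \<subseteq> V"
    and C: "module.subspace s C" "C \<subseteq> V" and 0: "\<And>x. x \<in> N \<Longrightarrow> x \<in> C \<Longrightarrow> x = 0"
    and d: "vector_space.dim s V \<le> vector_space.dim s N + vector_space.dim s C"
  shows "compl s N C V"
proof -
  interpret vector_space s by fact
  obtain D where D: "compl s N D V" by (rule compl_exists[OF s fd_subD[OF V] N])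
  let ?p = "cproj N D"
  have l: "linear_btw s s V D ?p" by (rule linear_btw_cproj[OF s D fd_subD[OF V]])
  have lC: "linear_btw s s C D ?p" by (rule linear_btw_mono[OF l C(2)]) (use linear_btwD(1)[OF l] C in auto)
  have inj: "inj_on ?p C"
  proof (rule inj_onI)
    fix x y assume xy: "x \<in> C" "y \<in> C" "?p x = ?p y"
    then have "?p (x - y) = 0" using linear_btw_diff[OF lC module_axioms C(1)] by simp
    moreover have "x - y \<in> C" using xy C by (simp add: subspace_diff)
    ultimately have "x - y = 0" using 0 cproj_eq_0_iff[OF s D] C(2) by blast
    then show "x = y" by simp
  qed
  have fC: "fd_sub s C" and fD: "fd_sub s D"
    using fd_sub_subset[OF s V] C complD[OF D] by auto
  have "dim (?p ` C) = dim C" by (rule dim_image_inj[OF s s fC lC inj])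
  moreover have "dim (?p ` C) \<le> dim D"
    using subspace_eq_dim(1)[OF s fD subspace_linear_btw(2)[OF module_axioms module_axioms C(1) lC]] linear_btwD(1)[OF lC] by auto
  ultimately have "dim (?p ` C) = dim D" using compl_dim[OF s D V] d by simp
  then have im: "?p ` C = D"
    using subspace_eq_dim(2)[OF s fD subspace_linear_btw(2)[OF module_axioms module_axioms C(1) lC]] linear_btwD(1)[OF lC] by auto
  have "\<exists>c\<in>C. v - c \<in> N" if v: "v \<in> V" for v
  proof -
    obtain c where c: "c \<in> C" "?p c = ?p v" using im cproj_mem(1)[OF s D v] by force
    then have "?p (v - c) = 0" using linear_btw_diff[OF l module_axioms fd_subD[OF V] v, of c] C(2) by auto
    moreover have "v - c \<in> V" using subspace_diff[OF fd_subD[OF V] v] c C(2) by auto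
    ultimately show ?thesis using cproj_eq_0_iff[OF s D] c(1) by blast
  qed
  then show ?thesis unfolding compl_def using N C 0 by auto
qed

section \<open>Charts of Grassmannians\<close>

text \<open>
  The entries of the projections onto \<open>C\<close> along \<open>N\<close>. Among the subspaces with complement \<open>C\<close>
  these determine \<open>N\<close>, as the kernel of the projection; up to sign and constants they are the
  entries of the matrix whose graph is \<open>N\<close>.
\<close>

definition grass_coords :: "('i, 'a) pre_digraph \<Rightarrow> ('i, 'a, 'k::field, 'v::ab_group_add) qrep
    \<Rightarrow> ('i \<Rightarrow> 'v set) \<Rightarrow> (('i \<Rightarrow> 'v set) \<Rightarrow> 'k) set" where
  "grass_coords Q M C = {(\<lambda>N. l (cproj (N i) (C i) w)) | l i w.
     i \<in> verts Q \<and> w \<in> spc M i \<and> linear_btw (scl M) (*) (spc M i) UNIV l}"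

lemma grass_coordsI:
  "i \<in> verts Q \<Longrightarrow> w \<in> spc M i \<Longrightarrow> linear_btw (scl M) (*) (spc M i) UNIV l \<Longrightarrow>
    (\<lambda>N. l (cproj (N i) (C i) w)) \<in> grass_coords Q M C"
  unfolding grass_coords_def by blast

definition grass_chart :: "('i, 'a) pre_digraph \<Rightarrow> ('i, 'a, 'k::field, 'v::ab_group_add) qrep
    \<Rightarrow> ('i \<Rightarrow> 'v set) \<Rightarrow> ('i \<Rightarrow> 'v set) set" where
  "grass_chart Q M C = {N. \<forall>i\<in>verts Q. compl (scl M) (N i) (C i) (spc M i)}"

lemma poly_funs_comp_on:
  assumes "p \<in> poly_funs C" "\<And>\<gamma>. \<gamma> \<in> C \<Longrightarrow> \<exists>\<delta>\<in>poly_funs D. \<forall>x\<in>V. \<delta> x = \<gamma> (m x)"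
  shows "\<exists>p'\<in>poly_funs D. \<forall>x\<in>V. p' x = p (m x)"
  using assms(1)
proof induction
  case (const c)
  then show ?case by (intro bexI[of _ "\<lambda>_. c"]) (auto intro: poly_funs.const)
next
  case (coord \<gamma>)
  then show ?case using assms(2) by blast
next
  case (add p q)
  then obtain p' q' where "p' \<in> poly_funs D" "q' \<in> poly_funs D" "\<forall>x\<in>V. p' x = p (m x)" "\<forall>x\<in>V. q' x = q (m x)" by blast
  then show ?case by (intro bexI[of _ "\<lambda>x. p' x + q' x"]) (auto intro: poly_funs.add)
next
  case (mult p q)
  then obtain p' q' where "p' \<in> poly_funs D" "q' \<in> poly_funs D" "\<forall>x\<in>V. p' x = p (m x)" "\<forall>x\<in>V. q' x = q (m x)" by blast
  then show ?case by (intro bexI[of _ "\<lambda>x. p' x * q' x"]) (auto intro: poly_funs.mult)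
qed

lemma framesD:
  assumes "b \<in> frames Q M e" "i \<in> verts Q"
  shows "k < e i \<Longrightarrow> b (i, k) \<in> spc M i" "inj_on (\<lambda>k. b (i, k)) {..<e i}"
    "\<not> module.dependent (scl M) ((\<lambda>k. b (i, k)) ` {..<e i})"
  using assms unfolding frames_def by (force simp: PiE_iff)+

lemma frame_coords_of_frame:
  assumes "vector_space (scl M)" "b \<in> frames Q M e" "i \<in> verts Q"
  obtains \<kappa> where "coords (scl M) (frame_span Q M e b i) {..<e i} (\<lambda>k. b (i, k)) \<kappa>"
  using coords_of_independent[OF assms(1) _ framesD(2,3)[OF assms(2,3)]] assms(3)
  by (auto simp: frame_span_def)

text \<open>
  Take the matrix of the frame \<open>b\<close> modulo \<open>C\<close> in the basis \<open>b0\<close>, and let \<open>d\<close> be its determinant.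
  Where \<open>d\<close> does not vanish the span of \<open>b\<close> has complement \<open>C\<close>, and Cramer's rule expresses the
  projection along this span as a fraction with denominator \<open>d\<close>.
\<close>

lemma frame_span_compl_local:
  fixes M :: "('i, 'a, 'k::field, 'v::ab_group_add) qrep"
  assumes M: "fd_rep Q M" and i: "i \<in> verts Q" and b0: "b0 \<in> frames Q M e"
    and c0: "compl (scl M) (frame_span Q M e b0 i) (C i) (spc M i)"
  shows "\<exists>d\<in>poly_funs (frame_coords Q M e). d b0 \<noteq> 0 \<and>
     (\<forall>b\<in>frames Q M e. d b \<noteq> 0 \<longrightarrow> compl (scl M) (frame_span Q M e b i) (C i) (spc M i)) \<and>
     (\<forall>w\<in>spc M i. \<forall>l. linear_btw (scl M) (*) (spc M i) UNIV l \<longrightarrow>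
        (\<exists>p\<in>poly_funs (frame_coords Q M e). \<forall>b\<in>frames Q M e. d b \<noteq> 0 \<longrightarrow>
            l (cproj (frame_span Q M e b i) (C i) w) = p b / d b))"
proof -
  interpret vector_space "scl M" by (rule fd_repD(1)[OF M])
  note V = fd_repD(3)[OF M i]
  let ?N0 = "frame_span Q M e b0 i" and ?F = "poly_funs (frame_coords Q M e)"
  obtain \<kappa> where \<kappa>: "coords (scl M) ?N0 {..<e i} (\<lambda>k. b0 (i, k)) \<kappa>"
    by (rule frame_coords_of_frame[OF vector_space_axioms b0 i])
  note k = coordsD[OF \<kappa>] and cp = cproj_mem[OF vector_space_axioms c0] and c = complD[OF c0]
  note pl = linear_btw_cproj[OF vector_space_axioms c0 V]
  \<comment> \<open>\<open>\<mu> k\<close> is the \<open>k\<close>-th coordinate modulo \<open>C\<close> with respect to the frame \<open>b0\<close>.\<close>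
  define \<mu> where "\<mu> k w = \<kappa> k (w - cproj ?N0 (C i) w)" for k w
  have \<mu>: "linear_btw (scl M) (*) (spc M i) UNIV (\<mu> k)" if "k < e i" for k
  proof -
    have "linear_btw (scl M) (scl M) (spc M i) (spc M i) (\<lambda>w. w - cproj ?N0 (C i) w)"
      by (rule linear_btw_minus[OF _ linear_btw_mono[OF pl] module_axioms V])
        (use c(4) cp(1) in \<open>auto simp: linear_btw_def\<close>)
    then have "linear_btw (scl M) (scl M) (spc M i) ?N0 (\<lambda>w. w - cproj ?N0 (C i) w)"
      by (rule linear_btw_mono) (use cp(2) in auto)
    then show ?thesis unfolding \<mu>_def by (rule linear_btw_comp) (use k(3) that in simp)
  qed
  have \<mu>C: "w \<in> C i" if "w \<in> spc M i" "\<And>k. k < e i \<Longrightarrow> \<mu> k w = 0" for w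
  proof -
    have "w - cproj ?N0 (C i) w = 0"
      using cp(2)[OF that(1)] subspace_0[OF c(1)] that(2) linear_btw_0[OF k(3) module_axioms c(1)]
      by (intro coords_eqI[OF \<kappa>]) (auto simp: \<mu>_def)
    then show ?thesis using cp(1)[OF that(1)] by simp
  qed
  have \<mu>0: "\<mu> k w = 0" if "k < e i" "w \<in> C i" for k w
    using cproj_on(1)[OF vector_space_axioms c0 that(2)] linear_btw_0[OF k(3) module_axioms c(1)] that by (simp add: \<mu>_def)
  have \<mu>d: "\<mu> j (b0 (i, k)) = (if k = j then 1 else 0)" if "k < e i" "j < e i" for j k
    using that k(2,5) cproj_on(2)[OF vector_space_axioms c0] by (auto simp: \<mu>_def)
  have coord: "(\<lambda>b. l (b (i, k))) \<in> ?F" if "linear_btw (scl M) (*) (spc M i) UNIV l" "k < e i" for l k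
    using that i by (intro poly_funs.coord) (auto simp: frame_coords_def)
  define P where "P k j b = \<mu> j (b (i, k))" for k j and b :: "'i \<times> nat \<Rightarrow> 'v"
  have P: "P k j \<in> ?F" if "k < e i" "j < e i" for k j
    unfolding P_def using coord[OF \<mu>] that by simp
  obtain d a where d: "d \<in> ?F" and a: "\<And>k j. k < e i \<Longrightarrow> j < e i \<Longrightarrow> a k j \<in> ?F"
    and Pa: "\<And>k j b. k < e i \<Longrightarrow> j < e i \<Longrightarrow> (\<Sum>m<e i. P k m b * a m j b) = (if k = j then d b else 0)"
    and aP: "\<And>k j b. k < e i \<Longrightarrow> j < e i \<Longrightarrow> (\<Sum>m<e i. a k m b * P m j b) = (if k = j then d b else 0)"
    and d1: "\<And>b. (\<And>k j. k < e i \<Longrightarrow> j < e i \<Longrightarrow> P k j b = (if k = j then 1 else 0)) \<Longrightarrow> d b = 1"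
    using poly_adjugate[of "e i" P, OF P] by blast
  have "d b0 \<noteq> 0" using d1[of b0] \<mu>d by (simp add: P_def)
  \<comment> \<open>Cramer's rule for the combination of \<open>b\<close> that agrees with \<open>w\<close> modulo \<open>C\<close>; the rest \<open>u\<close> is the projection.\<close>
  define \<alpha> where "\<alpha> w k b = (\<Sum>m<e i. \<mu> m w * a m k b) / d b" for w k and b :: "'i \<times> nat \<Rightarrow> 'v"
  define u where "u w b = w - (\<Sum>k<e i. scl M (\<alpha> w k b) (b (i, k)))" for w and b :: "'i \<times> nat \<Rightarrow> 'v"
  have cu: "compl (scl M) (frame_span Q M e b i) (C i) (spc M i) \<and>
      (\<forall>w\<in>spc M i. cproj (frame_span Q M e b i) (C i) w = u w b)"
    if b: "b \<in> frames Q M e" and db: "d b \<noteq> 0" for b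
  proof -
    let ?N = "frame_span Q M e b i"
    have Neq: "?N = span ((\<lambda>k. b (i, k)) ` {..<e i})" using i by (simp add: frame_span_def)
    then have sN: "subspace ?N" by simp
    have bN: "b (i, k) \<in> ?N" if "k < e i" for k unfolding Neq using that by (intro span_base) auto
    have NV: "?N \<subseteq> spc M i" unfolding Neq using framesD(1)[OF b i] V by (intro span_minimal) auto
    obtain \<kappa>' where "coords (scl M) ?N {..<e i} (\<lambda>k. b (i, k)) \<kappa>'"
      by (rule frame_coords_of_frame[OF vector_space_axioms b i])
    note k' = coordsD[OF this]
    have 0: "x = 0" if x: "x \<in> ?N" "x \<in> C i" for x
    proof -
      have "\<kappa>' m x = 0" if m: "m < e i" for m
      proof -
        have z: "(\<Sum>k<e i. \<kappa>' k x * P k j b) = 0" if "j < e i" for j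
        proof -
          have "\<mu> j x = \<mu> j (\<Sum>k<e i. scl M (\<kappa>' k x) (b (i, k)))" using k'(4)[OF x(1)] by simp
          also have "\<dots> = (\<Sum>k<e i. \<kappa>' k x * \<mu> j (b (i, k)))"
            using framesD(1)[OF b i] by (intro linear_btw_lincomb[OF \<mu>[OF that] module_axioms V]) auto
          finally show ?thesis using \<mu>0[OF that x(2)] by (simp add: P_def)
        qed
        have "(\<Sum>j<e i. (\<Sum>k<e i. \<kappa>' k x * P k j b) * a j m b) = (\<Sum>k<e i. \<kappa>' k x * (\<Sum>j<e i. P k j b * a j m b))"
          unfolding sum_distrib_left sum_distrib_right by (subst sum.swap) (simp add: mult.assoc)
        also have "\<dots> = (\<Sum>k<e i. \<kappa>' k x * (if k = m then d b else 0))" using Pa[OF _ m] by (intro sum.cong) auto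
        also have "\<dots> = (\<Sum>k<e i. if k = m then \<kappa>' k x * d b else 0)" by (intro sum.cong) auto
        also have "\<dots> = \<kappa>' m x * d b" using m by simp
        finally show ?thesis using z db by simp
      qed
      then show ?thesis using k'(4)[OF x(1)] by simp
    qed
    have u: "u w b \<in> C i" "w - u w b \<in> ?N" if w: "w \<in> spc M i" for w
    proof -
      have "(\<Sum>k<e i. scl M (\<alpha> w k b) (b (i, k))) \<in> ?N"
        using sN bN by (intro subspace_sum subspace_scale) auto
      then show "w - u w b \<in> ?N" by (simp add: u_def)
      from subspace_diff[OF V w subsetD[OF NV this]] have "w - (w - u w b) \<in> spc M i" .
      then have uV: "u w b \<in> spc M i" by simp
      have "\<mu> j (u w b) = 0" if j: "j < e i" for j
      proof -
        have "\<mu> j (u w b) = \<mu> j w - \<mu> j (\<Sum>k<e i. scl M (\<alpha> w k b) (b (i, k)))"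
          unfolding u_def using \<open>(\<Sum>k<e i. scl M (\<alpha> w k b) (b (i, k))) \<in> ?N\<close> NV
          by (intro linear_btw_diff[OF \<mu>[OF j] module_axioms V w]) auto
        also have "\<mu> j (\<Sum>k<e i. scl M (\<alpha> w k b) (b (i, k))) = (\<Sum>k<e i. \<alpha> w k b * P k j b)"
          unfolding P_def using framesD(1)[OF b i] by (intro linear_btw_lincomb[OF \<mu>[OF j] module_axioms V]) auto
        also have "\<dots> = (\<Sum>k<e i. \<Sum>m<e i. \<mu> m w * (a m k b * P k j b)) / d b"
          unfolding \<alpha>_def by (simp add: sum_divide_distrib sum_distrib_right mult.assoc)
        also have "(\<Sum>k<e i. \<Sum>m<e i. \<mu> m w * (a m k b * P k j b)) = (\<Sum>m<e i. \<mu> m w * (\<Sum>k<e i. a m k b * P k j b))"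
          unfolding sum_distrib_left by (rule sum.swap)
        also have "\<dots> = (\<Sum>m<e i. \<mu> m w * (if m = j then d b else 0))" using aP[OF _ j] by (intro sum.cong) auto
        also have "\<dots> = (\<Sum>m<e i. if m = j then \<mu> m w * d b else 0)" by (intro sum.cong) auto
        also have "\<dots> = \<mu> j w * d b" using j by simp
        finally show ?thesis using db by simp
      qed
      then show "u w b \<in> C i" using \<mu>C[OF uV] by blast
    qed
    have cc: "compl (scl M) ?N (C i) (spc M i)"
      unfolding compl_def using sN c(2,4) NV 0 u by blast
    then show ?thesis using cproj_eqI[OF vector_space_axioms cc u] by blast
  qed
  have "\<exists>p\<in>?F. \<forall>b\<in>frames Q M e. d b \<noteq> 0 \<longrightarrow> l (cproj (frame_span Q M e b i) (C i) w) = p b / d b"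
    if w: "w \<in> spc M i" and l: "linear_btw (scl M) (*) (spc M i) UNIV l" for w l
  proof (intro bexI[of _ "\<lambda>b. l w * d b - (\<Sum>k<e i. (\<Sum>m<e i. \<mu> m w * a m k b) * l (b (i, k)))"] ballI impI)
    show "(\<lambda>b. l w * d b - (\<Sum>k<e i. (\<Sum>m<e i. \<mu> m w * a m k b) * l (b (i, k)))) \<in> ?F"
      using d a coord[OF l] by (intro poly_funs_minus poly_funs_cmult poly_funs_sum poly_funs.mult) auto
    fix b assume b: "b \<in> frames Q M e" and db: "d b \<noteq> 0"
    have "(\<Sum>k<e i. scl M (\<alpha> w k b) (b (i, k))) \<in> spc M i"
      using framesD(1)[OF b i] V by (intro subspace_sum subspace_scale) auto
    then have "l (u w b) = l w - l (\<Sum>k<e i. scl M (\<alpha> w k b) (b (i, k)))"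
      unfolding u_def by (intro linear_btw_diff[OF l module_axioms V w])
    also have "l (\<Sum>k<e i. scl M (\<alpha> w k b) (b (i, k))) = (\<Sum>k<e i. \<alpha> w k b * l (b (i, k)))"
      using framesD(1)[OF b i] by (intro linear_btw_lincomb[OF l module_axioms V]) auto
    also have "\<dots> = (\<Sum>k<e i. (\<Sum>m<e i. \<mu> m w * a m k b) * l (b (i, k))) / d b"
      unfolding \<alpha>_def by (simp add: sum_divide_distrib[symmetric])
    finally show "l (cproj (frame_span Q M e b i) (C i) w) =
        (l w * d b - (\<Sum>k<e i. (\<Sum>m<e i. \<mu> m w * a m k b) * l (b (i, k)))) / d b"
      using cu[OF b db] w db by (simp add: diff_divide_distrib)
  qed
  then have B: "\<forall>w\<in>spc M i. \<forall>l. linear_btw (scl M) (*) (spc M i) UNIV l \<longrightarrow>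
        (\<exists>p\<in>?F. \<forall>b\<in>frames Q M e. d b \<noteq> 0 \<longrightarrow> l (cproj (frame_span Q M e b i) (C i) w) = p b / d b)"
    by blast
  have A: "\<forall>b\<in>frames Q M e. d b \<noteq> 0 \<longrightarrow> compl (scl M) (frame_span Q M e b i) (C i) (spc M i)"
    using cu by blast
  show ?thesis by (intro bexI[OF _ d] conjI \<open>d b0 \<noteq> 0\<close> A B)
qed

text \<open>
  Open sets and regular functions of the Grassmannian are those of the frames. They come down
  along a section: sending \<open>N\<close> to the frame \<open>b0 - cproj N C b0\<close> for a fixed frame \<open>b0\<close>, under
  which coordinates of frames become polynomials in the entries of the projections.
\<close>

lemma chart_grass_spc:
  fixes M :: "('i, 'a, 'k::field, 'v::ab_group_add) qrep"
  assumes Q: "fin_digraph Q" and M: "fd_rep Q M"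
  shows "chart (grass_spc Q M e) (grass_chart Q M C \<inter> frame_span Q M e ` frames Q M e) (grass_coords Q M C)"
proof -
  interpret fin_digraph Q by fact
  interpret vector_space "scl M" by (rule fd_repD(1)[OF M])
  let ?A = "zar_space (frames Q M e) (frame_coords Q M e)" and ?q = "frame_span Q M e"
  let ?V = "grass_chart Q M C \<inter> frame_span Q M e ` frames Q M e" and ?F = "poly_funs (frame_coords Q M e)"
    and ?G = "poly_funs (grass_coords Q M C)"
  define P where "P U = {b \<in> frames Q M e. ?q b \<in> U}" for U
  have o: "openin (zar (grass_spc Q M e)) U \<longleftrightarrow> U \<subseteq> ?q ` frames Q M e \<and> openin (zar ?A) (P U)" for U
    unfolding grass_spc_def openin_quot_spc topspace_zar_space P_def ..
  have r: "\<phi> \<in> reg (grass_spc Q M e) U \<longleftrightarrow> (\<lambda>b. \<phi> (?q b)) \<in> reg ?A (P U)" for \<phi> U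
    by (simp add: grass_spc_def quot_spc_def topspace_zar_space P_def comp_def)
  have V: "compl (scl M) (N i) (C i) (spc M i)" if "N \<in> ?V" "i \<in> verts Q" for N i
    using that by (auto simp: grass_chart_def)
  have loc: "\<exists>d\<in>?F. d b0 \<noteq> 0 \<and>
     (\<forall>b\<in>frames Q M e. d b \<noteq> 0 \<longrightarrow> compl (scl M) (?q b i) (C i) (spc M i)) \<and>
     (\<forall>w\<in>spc M i. \<forall>l. linear_btw (scl M) (*) (spc M i) UNIV l \<longrightarrow>
        (\<exists>p\<in>?F. \<forall>b\<in>frames Q M e. d b \<noteq> 0 \<longrightarrow> l (cproj (?q b i) (C i) w) = p b / d b))"
    if "b0 \<in> P ?V" "i \<in> verts Q" for b0 i
    by (rule frame_span_compl_local[OF M that(2)]) (use that(1) V[OF _ that(2)] in \<open>auto simp: P_def\<close>)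
  \<comment> \<open>A section on the chart that passes through a prescribed frame \<open>b0\<close>.\<close>
  have sec: "\<exists>s. (\<forall>N\<in>?V. s N \<in> frames Q M e \<and> ?q (s N) = N) \<and> s (?q b0) = b0 \<and>
      (\<forall>\<gamma>\<in>frame_coords Q M e. \<exists>\<delta>\<in>?G. \<forall>N\<in>?V. \<delta> N = \<gamma> (s N))" if b0: "b0 \<in> P ?V" for b0
  proof -
    have b0f: "b0 \<in> frames Q M e" and b0V: "?q b0 \<in> ?V" using b0 by (auto simp: P_def)
    define s where "s N = (\<lambda>(i, k)\<in>(SIGMA i:verts Q. {..<e i}). b0 (i, k) - cproj (N i) (C i) (b0 (i, k)))" for N
    have s: "s N (i, k) = b0 (i, k) - cproj (N i) (C i) (b0 (i, k))" if "i \<in> verts Q" "k < e i" for N i k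
      using that by (simp add: s_def)
    have N0: "b0 (i, k) \<in> ?q b0 i" if "i \<in> verts Q" "k < e i" for i k
      using that by (auto simp: frame_span_def intro: span_base)
    have sf: "s N \<in> frames Q M e \<and> ?q (s N) = N" if N: "N \<in> ?V" for N
    proof -
      have *: "inj_on (\<lambda>k. s N (i, k)) {..<e i} \<and> independent ((\<lambda>k. s N (i, k)) ` {..<e i}) \<and>
          span ((\<lambda>k. s N (i, k)) ` {..<e i}) = N i" if i: "i \<in> verts Q" for i
      proof -
        note Vi = fd_repD(3)[OF M i]
        note c0 = V[OF b0V i] and c = V[OF N i]
        note m = cproj_mem[OF vector_space_axioms c]
        have bV: "b0 (i, k) \<in> spc M i" if "k < e i" for k using framesD(1)[OF b0f i that] .
        have sN: "s N (i, k) \<in> N i" if "k < e i" for k using m(2)[OF bV[OF that]] that i by (simp add: s)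
        obtain \<kappa> where \<kappa>: "coords (scl M) (?q b0 i) {..<e i} (\<lambda>k. b0 (i, k)) \<kappa>"
          by (rule frame_coords_of_frame[OF vector_space_axioms b0f i])
        note k = coordsD[OF \<kappa>]
        define \<mu> where "\<mu> k x = \<kappa> k (x - cproj (?q b0 i) (C i) x)" for k x
        have "coords (scl M) (N i) {..<e i} (\<lambda>k. s N (i, k)) \<mu>"
          unfolding coords_def
        proof (intro conjI ballI)
          fix j assume j: "j \<in> {..<e i}"
          show "s N (i, j) \<in> N i" using sN j by simp
          note pl = linear_btw_cproj[OF vector_space_axioms c0 Vi]
          have "linear_btw (scl M) (scl M) (spc M i) (spc M i) (\<lambda>w. w - cproj (?q b0 i) (C i) w)"
            by (rule linear_btw_minus[OF _ linear_btw_mono[OF pl] module_axioms Vi])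
              (use complD(4)[OF c0] cproj_mem(1)[OF vector_space_axioms c0] in \<open>auto simp: linear_btw_def\<close>)
          then have "linear_btw (scl M) (scl M) (N i) (?q b0 i) (\<lambda>w. w - cproj (?q b0 i) (C i) w)"
            by (rule linear_btw_mono[OF _ complD(3)[OF c]])
              (use complD(3)[OF c] cproj_mem(2)[OF vector_space_axioms c0] in auto)
          then show lin: "linear_btw (scl M) (*) (N i) UNIV (\<mu> j)"
            unfolding \<mu>_def using k(3)[OF j] by (rule linear_btw_comp)
          fix l assume l: "l \<in> {..<e i}"
          have "cproj (?q b0 i) (C i) (s N (i, l)) = - cproj (N i) (C i) (b0 (i, l))"
          proof (rule cproj_eqI[OF vector_space_axioms c0])
            show "- cproj (N i) (C i) (b0 (i, l)) \<in> C i"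
              using m(1)[OF bV] l subspace_neg[OF complD(2)[OF c]] by simp
            show "s N (i, l) - - cproj (N i) (C i) (b0 (i, l)) \<in> ?q b0 i"
              using N0[OF i] l by (simp add: s i)
          qed
          then have "\<mu> j (s N (i, l)) = \<kappa> j (b0 (i, l))" using l by (simp add: \<mu>_def s i)
          then show "\<mu> j (s N (i, l)) = (if j = l then 1 else 0)" using k(5)[OF j l] by simp
        next
          fix x assume x: "x \<in> N i"
          then have xV: "x \<in> spc M i" using complD(3)[OF c] by auto
          let ?n = "x - cproj (?q b0 i) (C i) x"
          let ?y = "\<Sum>k<e i. scl M (\<mu> k x) (s N (i, k))"
          have n: "?n \<in> ?q b0 i" using cproj_mem(2)[OF vector_space_axioms c0 xV] .
          have yN: "?y \<in> N i" using sN complD(1)[OF c] by (intro subspace_sum subspace_scale) auto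
          have "?y = (\<Sum>k<e i. scl M (\<kappa> k ?n) (b0 (i, k))) - (\<Sum>k<e i. scl M (\<mu> k x) (cproj (N i) (C i) (b0 (i, k))))"
            by (simp add: s i scale_right_diff_distrib sum_subtractf \<mu>_def)
          also have "(\<Sum>k<e i. scl M (\<kappa> k ?n) (b0 (i, k))) = ?n" using k(4)[OF n] .
          finally have "x - ?y = cproj (?q b0 i) (C i) x + (\<Sum>k<e i. scl M (\<mu> k x) (cproj (N i) (C i) (b0 (i, k))))"
            by simp
          moreover have "\<dots> \<in> C i"
            using cproj_mem(1)[OF vector_space_axioms c0 xV] m(1) bV complD(2)[OF c]
            by (intro subspace_add subspace_sum subspace_scale) auto
          ultimately have "x - ?y \<in> C i" by simp
          moreover have "x - ?y \<in> N i" using subspace_diff[OF complD(1)[OF c] x yN] .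
          ultimately have "x - ?y = 0" using complD(5)[OF c] by blast
          then show "x = ?y" by simp
        qed simp
        from coords_span[OF vector_space_axioms complD(1)[OF c] this] show ?thesis by blast
      qed
      have NV: "N i \<subseteq> spc M i" if "i \<in> verts Q" for i using complD(3)[OF V[OF N that]] .
      have sV: "s N (i, k) \<in> spc M i" if "i \<in> verts Q" "k < e i" for i k
        using *[OF that(1)] NV[OF that(1)] that(2) span_base[of "s N (i, k)" "(\<lambda>k. s N (i, k)) ` {..<e i}"] by auto
      have "s N \<in> (\<Pi>\<^sub>E (i, k)\<in>(SIGMA i:verts Q. {..<e i}). spc M i)"
      proof (rule PiE_I)
        fix x assume "x \<in> (SIGMA i:verts Q. {..<e i})"
        then show "s N x \<in> (case x of (i, k) \<Rightarrow> spc M i)" using sV by auto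
      qed (simp add: s_def)
      then have 1: "s N \<in> frames Q M e" unfolding frames_def using * by auto
      obtain b where "N = ?q b" using N by blast
      then have "N i = {}" if "i \<notin> verts Q" for i using that by (simp add: frame_span_def)
      then have "?q (s N) = N" using * by (auto simp: frame_span_def fun_eq_iff)
      then show ?thesis using 1 by blast
    qed
    have s2: "s (?q b0) = b0"
    proof
      fix x :: "'i \<times> nat"
      obtain i k where x: "x = (i, k)" by force
      show "s (?q b0) x = b0 x"
      proof (cases "i \<in> verts Q \<and> k < e i")
        case True
        then show ?thesis using s[of i k] cproj_on(2)[OF vector_space_axioms V[OF b0V]] N0 x by simp
      next
        case False
        have "b0 \<in> extensional (SIGMA i:verts Q. {..<e i})" using b0f by (auto simp: frames_def PiE_def)
        then show ?thesis using False x by (auto simp: s_def extensional_def)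
      qed
    qed
    have s3: "\<exists>\<delta>\<in>?G. \<forall>N\<in>?V. \<delta> N = \<gamma> (s N)" if \<gamma>: "\<gamma> \<in> frame_coords Q M e" for \<gamma>
    proof -
      obtain l i k where l: "\<gamma> = (\<lambda>b. l (b (i, k)))" "i \<in> verts Q" "k < e i" "linear_btw (scl M) (*) (spc M i) UNIV l"
        using \<gamma> unfolding frame_coords_def by blast
      have bV: "b0 (i, k) \<in> spc M i" using framesD(1)[OF b0f l(2,3)] .
      have "(\<lambda>N. l (b0 (i, k)) - l (cproj (N i) (C i) (b0 (i, k)))) \<in> ?G"
        using grass_coordsI[OF l(2) bV l(4)] by (intro poly_funs_minus poly_funs.const poly_funs.coord)
      moreover have "l (b0 (i, k)) - l (cproj (N i) (C i) (b0 (i, k))) = \<gamma> (s N)" if N: "N \<in> ?V" for N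
      proof -
        have "cproj (N i) (C i) (b0 (i, k)) \<in> spc M i"
          using cproj_mem(1)[OF vector_space_axioms V[OF N l(2)] bV] complD(4)[OF V[OF N l(2)]] by blast
        then show ?thesis
          using linear_btw_diff[OF l(4) module_axioms fd_repD(3)[OF M l(2)] bV] by (simp add: l(1) s l(2,3))
      qed
      ultimately show ?thesis by (intro bexI[of _ "\<lambda>N. l (b0 (i, k)) - l (cproj (N i) (C i) (b0 (i, k)))"]) auto
    qed
    show ?thesis
      by (intro exI[of _ s] conjI ballI s2 s3 conjunct1[OF sf] conjunct2[OF sf])
  qed
  show ?thesis
    unfolding chart_def
  proof (intro conjI allI impI ballI subsetI)
    show "openin (zar (grass_spc Q M e)) ?V"
      unfolding o
    proof
      show "openin (zar ?A) (P ?V)"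
        unfolding openin_zar_space
      proof (intro conjI ballI)
        show "P ?V \<subseteq> frames Q M e" by (auto simp: P_def)
        fix b0 assume b0: "b0 \<in> P ?V"
        then have "\<exists>d\<in>?F. d b0 \<noteq> 0 \<and> (\<forall>b\<in>frames Q M e. d b \<noteq> 0 \<longrightarrow> compl (scl M) (?q b i) (C i) (spc M i))"
          if "i \<in> verts Q" for i using loc[OF b0 that] by blast
        then obtain d where d: "\<And>i. i \<in> verts Q \<Longrightarrow> d i \<in> ?F" "\<And>i. i \<in> verts Q \<Longrightarrow> d i b0 \<noteq> 0"
          "\<And>i b. i \<in> verts Q \<Longrightarrow> b \<in> frames Q M e \<Longrightarrow> d i b \<noteq> 0 \<Longrightarrow> compl (scl M) (?q b i) (C i) (spc M i)" by metis
        show "\<exists>p\<in>?F. p b0 \<noteq> 0 \<and> {b \<in> frames Q M e. p b \<noteq> 0} \<subseteq> P ?V"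
        proof (intro bexI[of _ "\<lambda>b. \<Prod>i\<in>verts Q. d i b"] conjI)
          show "(\<Prod>i\<in>verts Q. d i b0) \<noteq> 0" using d(2) by simp
          show "{b \<in> frames Q M e. (\<Prod>i\<in>verts Q. d i b) \<noteq> 0} \<subseteq> P ?V"
            using d(3) finite_verts by (auto simp: P_def grass_chart_def)
          show "(\<lambda>b. \<Prod>i\<in>verts Q. d i b) \<in> ?F" using d(1) by (intro poly_funs_prod)
        qed
      qed
    qed blast
  next
    fix \<gamma> assume "\<gamma> \<in> grass_coords Q M C"
    then obtain l i w where l: "\<gamma> = (\<lambda>N. l (cproj (N i) (C i) w))" "i \<in> verts Q" "w \<in> spc M i"
       "linear_btw (scl M) (*) (spc M i) UNIV l" unfolding grass_coords_def by blast
    show "\<gamma> \<in> reg (grass_spc Q M e) ?V"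
      unfolding r reg_zar_space
    proof
      fix b0 assume b0: "b0 \<in> P ?V"
      obtain d where d: "d \<in> ?F" "d b0 \<noteq> 0" "\<forall>w\<in>spc M i. \<forall>l. linear_btw (scl M) (*) (spc M i) UNIV l \<longrightarrow>
        (\<exists>p\<in>?F. \<forall>b\<in>frames Q M e. d b \<noteq> 0 \<longrightarrow> l (cproj (?q b i) (C i) w) = p b / d b)"
        using loc[OF b0 l(2)] by blast
      obtain p where "p \<in> ?F" "\<forall>b\<in>frames Q M e. d b \<noteq> 0 \<longrightarrow> l (cproj (?q b i) (C i) w) = p b / d b"
        using d(3) l(3,4) by blast
      then show "frac_at (frame_coords Q M e) (P ?V) b0 (\<lambda>b. \<gamma> (?q b))"
        unfolding frac_at_def l(1) using d(1,2) by (intro bexI[of _ p] bexI[of _ d]) (auto simp: P_def)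
    qed
  next
    fix W N0 assume W: "W \<subseteq> ?V" "openin (zar (grass_spc Q M e)) W" and N0: "N0 \<in> W"
    obtain b0 where b0: "b0 \<in> frames Q M e" "?q b0 = N0" using W N0 by blast
    then have b0W: "b0 \<in> P W" and b0V: "b0 \<in> P ?V" using W N0 by (auto simp: P_def)
    have PW: "openin (zar ?A) (P W)" using W(2) unfolding o by blast
    from sec[OF b0V] obtain s where s': "\<forall>N\<in>?V. s N \<in> frames Q M e \<and> ?q (s N) = N" "s (?q b0) = b0"
      "\<forall>\<gamma>\<in>frame_coords Q M e. \<exists>\<delta>\<in>?G. \<forall>N\<in>?V. \<delta> N = \<gamma> (s N)"
      by (elim exE conjE) (rule that)
    note s = bspec[OF s'(1)] s'(2)[unfolded b0(2)] bspec[OF s'(3)]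
    have pull: "\<exists>p'\<in>?G. \<forall>N\<in>?V. p' N = p (s N)" if "p \<in> ?F" for p
      by (rule poly_funs_comp_on[OF that s(3)])
    have N0V: "N0 \<in> ?V" using W N0 by blast
    obtain p where p: "p \<in> ?F" "p b0 \<noteq> 0" "{b \<in> frames Q M e. p b \<noteq> 0} \<subseteq> P W"
      using PW b0W unfolding openin_zar_space by blast
    obtain p' where p': "p' \<in> ?G" "\<forall>N\<in>?V. p' N = p (s N)" using pull[OF p(1)] by blast
    have "p' N0 \<noteq> 0" using p'(2) N0V p(2) s(2) by simp
    moreover have "N \<in> W" if N: "N \<in> ?V" "p' N \<noteq> 0" for N
    proof -
      have "s N \<in> P W" using p(3) p'(2) N s(1)[OF N(1)] by auto
      then show ?thesis using s(1)[OF N(1)] by (simp add: P_def)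
    qed
    ultimately show "\<exists>p\<in>?G. p N0 \<noteq> 0 \<and> {y \<in> ?V. p y \<noteq> 0} \<subseteq> W" using p'(1) by blast
    fix \<phi> assume \<phi>: "\<phi> \<in> reg (grass_spc Q M e) W"
    then have "frac_at (frame_coords Q M e) (P W) b0 (\<lambda>b. \<phi> (?q b))"
      using b0W unfolding r reg_zar_space by blast
    then obtain f g where fg: "f \<in> ?F" "g \<in> ?F" "g b0 \<noteq> 0" "\<And>b. b \<in> P W \<Longrightarrow> g b \<noteq> 0 \<Longrightarrow> \<phi> (?q b) = f b / g b"
      unfolding frac_at_def by blast
    obtain f' where f': "f' \<in> ?G" "\<forall>N\<in>?V. f' N = f (s N)" using pull[OF fg(1)] by blast
    obtain g' where g': "g' \<in> ?G" "\<forall>N\<in>?V. g' N = g (s N)" using pull[OF fg(2)] by blast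
    have "\<phi> N = f' N / g' N" if N: "N \<in> W" "g' N \<noteq> 0" for N
    proof -
      have NV: "N \<in> ?V" using W N by blast
      have "s N \<in> P W" using s(1)[OF NV] N by (simp add: P_def)
      then show ?thesis using fg(4)[of "s N"] s(1)[OF NV] f'(2) g'(2) NV N by simp
    qed
    then show "frac_at (grass_coords Q M C) W N0 \<phi>"
      unfolding frac_at_def using f'(1) g' N0V s(2) fg(3) by (intro bexI[of _ f'] bexI[of _ g']) auto
  qed
qed

lemma geometric_grass_spc: "geometric (grass_spc Q M e)"
  unfolding grass_spc_def by (intro geometric_quot_spc geometric_zar_space)

lemma geometric_Gr_spc: "geometric (Gr_spc Q M e)"
  unfolding Gr_spc_def by (intro geometric_subspc geometric_grass_spc)

lemma Gr_subset_frame_span: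
  assumes "fd_rep Q M"
  shows "Gr Q M e \<subseteq> frame_span Q M e ` frames Q M e"
  using topspace_Gr_spc[OF assms, of e]
  by (auto simp: Gr_spc_def zar_subspc grass_spc_def topspace_quot_spc topspace_zar_space)

lemma chart_Gr_spc:
  assumes Q: "fin_digraph Q" and M: "fd_rep Q M"
  shows "chart (Gr_spc Q M e) (grass_chart Q M C \<inter> Gr Q M e) (grass_coords Q M C)"
proof -
  have "chart (Gr_spc Q M e) (grass_chart Q M C \<inter> frame_span Q M e ` frames Q M e \<inter> Gr Q M e) (grass_coords Q M C)"
    unfolding Gr_spc_def by (rule chart_subspc[OF geometric_grass_spc chart_grass_spc[OF Q M]])
  moreover have "grass_chart Q M C \<inter> frame_span Q M e ` frames Q M e \<inter> Gr Q M e = grass_chart Q M C \<inter> Gr Q M e"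
    using Gr_subset_frame_span[OF M] by blast
  ultimately show ?thesis by simp
qed

section \<open>The stratum over a chart\<close>

text \<open>
  The section \<open>\<sigma>\<close> is linear but not a homomorphism of representations; \<open>z\<close> measures the failure,
  and \<open>\<sigma>\<close> identifies \<open>Y\<close> with \<open>X \<oplus> S\<close> as a family of spaces.
\<close>

locale ext_bundle = one_generated_ext Q X S z
  for Q :: "('i, 'a) pre_digraph"
    and X :: "('i, 'a, 'k::field, 'x::ab_group_add) qrep"
    and S :: "('i, 'a, 'k, 's::ab_group_add) qrep"
    and z :: "'a \<Rightarrow> 's \<Rightarrow> 'x" +
  fixes Y :: "('i, 'a, 'k, 'y::ab_group_add) qrep"
    and \<iota> :: "'i \<Rightarrow> 'x \<Rightarrow> 'y" and \<pi> :: "'i \<Rightarrow> 'y \<Rightarrow> 's" and \<sigma> :: "'i \<Rightarrow> 's \<Rightarrow> 'y"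
  assumes Y: "fd_rep Q Y" and exact: "short_exact Q X Y S \<iota> \<pi>"
    and \<sigma>: "\<And>i. i \<in> verts Q \<Longrightarrow> linear_btw (scl S) (scl Y) (spc S i) (spc Y i) (\<sigma> i)"
    and \<pi>\<sigma>: "\<And>i s. i \<in> verts Q \<Longrightarrow> s \<in> spc S i \<Longrightarrow> \<pi> i (\<sigma> i s) = s"
    and \<iota>z: "\<And>\<alpha> s. \<alpha> \<in> arcs Q \<Longrightarrow> s \<in> spc S (tail Q \<alpha>) \<Longrightarrow>
          \<iota> (head Q \<alpha>) (z \<alpha> s) = act Y \<alpha> (\<sigma> (tail Q \<alpha>) s) - \<sigma> (head Q \<alpha>) (act S \<alpha> s)"
begin

sublocale Y: vector_space "scl Y" by (rule fd_repD(1)[OF Y])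

lemmas YD = fd_repD(3,4)[OF Y] and E = short_exactD[OF exact]

text \<open>
  The component in \<open>X\<close> for the decomposition of \<open>Y\<close> given by \<open>\<iota>\<close> and \<open>\<sigma>\<close>; the component in \<open>S\<close>
  is \<open>\<pi>\<close>.
\<close>

definition \<rho> :: "'i \<Rightarrow> 'y \<Rightarrow> 'x" where
  "\<rho> i y = inv_into (spc X i) (\<iota> i) (y - \<sigma> i (\<pi> i y))"

lemma \<iota>_mem: "i \<in> verts Q \<Longrightarrow> x \<in> spc X i \<Longrightarrow> \<iota> i x \<in> spc Y i \<and> \<pi> i (\<iota> i x) = 0"
  using E(6) by blast

lemma zero_maps:
  assumes "i \<in> verts Q"
  shows "\<iota> i 0 = 0" "\<sigma> i 0 = 0" "\<pi> i 0 = 0"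
  using linear_btw_0[OF E(1) X.module_axioms XD(1)] linear_btw_0[OF \<sigma> S.module_axioms SD(1)]
    linear_btw_0[OF E(2) Y.module_axioms YD(1)] assms by auto

lemma \<rho>:
  assumes i: "i \<in> verts Q" and y: "y \<in> spc Y i"
  shows "\<rho> i y \<in> spc X i" "\<iota> i (\<rho> i y) + \<sigma> i (\<pi> i y) = y"
proof -
  have s: "\<sigma> i (\<pi> i y) \<in> spc Y i" "\<pi> i y \<in> spc S i"
    using linear_btwD(1)[OF \<sigma>[OF i]] linear_btwD(1)[OF E(2)[OF i] y] by auto
  have "\<pi> i (y - \<sigma> i (\<pi> i y)) = 0"
    using linear_btw_diff[OF E(2)[OF i] Y.module_axioms YD(1)[OF i] y s(1)] \<pi>\<sigma>[OF i s(2)] by simp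
  then have m: "y - \<sigma> i (\<pi> i y) \<in> \<iota> i ` spc X i"
    unfolding E(6)[OF i] using Y.subspace_diff[OF YD(1)[OF i] y s(1)] by blast
  show "\<rho> i y \<in> spc X i" unfolding \<rho>_def by (rule inv_into_into[OF m])
  show "\<iota> i (\<rho> i y) + \<sigma> i (\<pi> i y) = y" unfolding \<rho>_def f_inv_into_f[OF m] by simp
qed

lemma coordinates:
  assumes i: "i \<in> verts Q" and x: "x \<in> spc X i" and s: "s \<in> spc S i"
  shows "\<iota> i x + \<sigma> i s \<in> spc Y i" "\<pi> i (\<iota> i x + \<sigma> i s) = s" "\<rho> i (\<iota> i x + \<sigma> i s) = x"
proof -
  note m = \<iota>_mem[OF i x] and m' = linear_btwD(1)[OF \<sigma>[OF i] s]
  show y: "\<iota> i x + \<sigma> i s \<in> spc Y i" using Y.subspace_add[OF YD(1)[OF i]] m m' by blast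
  show p: "\<pi> i (\<iota> i x + \<sigma> i s) = s" using linear_btwD(2)[OF E(2)[OF i]] m m' \<pi>\<sigma>[OF i s] by simp
  have "\<iota> i (\<rho> i (\<iota> i x + \<sigma> i s)) = \<iota> i x" using \<rho>(2)[OF i y] p by simp
  then show "\<rho> i (\<iota> i x + \<sigma> i s) = x" using inj_onD[OF E(5)[OF i] _ \<rho>(1)[OF i y] x] by blast
qed

lemma coordinates_\<iota>: "i \<in> verts Q \<Longrightarrow> x \<in> spc X i \<Longrightarrow> \<rho> i (\<iota> i x) = x"
  using coordinates(3)[of i x 0] S.subspace_0[OF SD(1)] zero_maps by simp

lemma coordinates_\<sigma>: "i \<in> verts Q \<Longrightarrow> s \<in> spc S i \<Longrightarrow> \<rho> i (\<sigma> i s) = 0 \<and> \<sigma> i s \<in> spc Y i"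
  using coordinates(3,1)[of i 0 s] X.subspace_0[OF XD(1)] zero_maps by simp

lemma \<pi>_mem: "i \<in> verts Q \<Longrightarrow> y \<in> spc Y i \<Longrightarrow> \<pi> i y \<in> spc S i"
  using linear_btwD(1)[OF E(2)] .

lemma \<rho>_linear:
  assumes i: "i \<in> verts Q"
  shows "linear_btw (scl Y) (scl X) (spc Y i) (spc X i) (\<rho> i)"
  unfolding linear_btw_def
proof (intro conjI ballI allI funcsetI)
  fix y assume y: "y \<in> spc Y i"
  note m = \<rho>(1)[OF i y] \<pi>_mem[OF i y]
  show "\<rho> i y \<in> spc X i" by (rule m)
  show "\<rho> i (scl Y c y) = scl X c (\<rho> i y)" for c
  proof -
    have "scl Y c y = scl Y c (\<iota> i (\<rho> i y) + \<sigma> i (\<pi> i y))" using \<rho>(2)[OF i y] by simp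
    also have "\<dots> = \<iota> i (scl X c (\<rho> i y)) + \<sigma> i (scl S c (\<pi> i y))"
      using linear_btwD(3)[OF E(1)[OF i] m(1)] linear_btwD(3)[OF \<sigma>[OF i] m(2)] by (simp add: Y.scale_right_distrib)
    finally show ?thesis
      using coordinates(3)[OF i X.subspace_scale[OF XD(1)[OF i] m(1)] S.subspace_scale[OF SD(1)[OF i] m(2)]] by simp
  qed
  fix y' assume y': "y' \<in> spc Y i"
  note m' = \<rho>(1)[OF i y'] \<pi>_mem[OF i y']
  have "y + y' = (\<iota> i (\<rho> i y) + \<sigma> i (\<pi> i y)) + (\<iota> i (\<rho> i y') + \<sigma> i (\<pi> i y'))" using \<rho>(2)[OF i y] \<rho>(2)[OF i y'] by simp
  also have "\<dots> = \<iota> i (\<rho> i y + \<rho> i y') + \<sigma> i (\<pi> i y + \<pi> i y')"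
    using linear_btwD(2)[OF E(1)[OF i] m(1) m'(1)] linear_btwD(2)[OF \<sigma>[OF i] m(2) m'(2)] by (simp add: algebra_simps)
  finally show "\<rho> i (y + y') = \<rho> i y + \<rho> i y'"
    using coordinates(3)[OF i X.subspace_add[OF XD(1)[OF i] m(1) m'(1)] S.subspace_add[OF SD(1)[OF i] m(2) m'(2)]] by simp
qed

text \<open>
  In the decomposition \<open>Y = X \<oplus> S\<close> the action is that of the direct sum, twisted by \<open>z\<close>.
\<close>

lemma act_coordinates:
  assumes a: "\<alpha> \<in> arcs Q" and y: "y \<in> spc Y (tail Q \<alpha>)"
  shows "\<rho> (head Q \<alpha>) (act Y \<alpha> y) = act X \<alpha> (\<rho> (tail Q \<alpha>) y) + z \<alpha> (\<pi> (tail Q \<alpha>) y)"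
    "\<pi> (head Q \<alpha>) (act Y \<alpha> y) = act S \<alpha> (\<pi> (tail Q \<alpha>) y)"
proof -
  have h: "head Q \<alpha> \<in> verts Q" and t: "tail Q \<alpha> \<in> verts Q" using a by auto
  note m = \<rho>(1)[OF t y] \<pi>_mem[OF t y]
  note \<iota>m = conjunct1[OF \<iota>_mem[OF t m(1)]] and \<sigma>m = linear_btwD(1)[OF \<sigma>[OF t] m(2)]
  have Xm: "act X \<alpha> (\<rho> (tail Q \<alpha>) y) \<in> spc X (head Q \<alpha>)" using linear_btwD(1)[OF XD(2)[OF a] m(1)] .
  have zm: "z \<alpha> (\<pi> (tail Q \<alpha>) y) \<in> spc X (head Q \<alpha>)" using linear_btwD(1)[OF arrD[OF arr_z a] m(2)] .
  have Sm: "act S \<alpha> (\<pi> (tail Q \<alpha>) y) \<in> spc S (head Q \<alpha>)" using linear_btwD(1)[OF SD(2)[OF a] m(2)] .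
  have "act Y \<alpha> y = act Y \<alpha> (\<iota> (tail Q \<alpha>) (\<rho> (tail Q \<alpha>) y)) + act Y \<alpha> (\<sigma> (tail Q \<alpha>) (\<pi> (tail Q \<alpha>) y))"
    using linear_btwD(2)[OF YD(2)[OF a] \<iota>m \<sigma>m] \<rho>(2)[OF t y] by simp
  also have "act Y \<alpha> (\<sigma> (tail Q \<alpha>) (\<pi> (tail Q \<alpha>) y)) =
      \<iota> (head Q \<alpha>) (z \<alpha> (\<pi> (tail Q \<alpha>) y)) + \<sigma> (head Q \<alpha>) (act S \<alpha> (\<pi> (tail Q \<alpha>) y))"
    using \<iota>z[OF a m(2)] by simp
  also have "act Y \<alpha> (\<iota> (tail Q \<alpha>) (\<rho> (tail Q \<alpha>) y)) = \<iota> (head Q \<alpha>) (act X \<alpha> (\<rho> (tail Q \<alpha>) y))"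
    using E(3)[OF a m(1)] by simp
  finally have e: "act Y \<alpha> y = \<iota> (head Q \<alpha>) (act X \<alpha> (\<rho> (tail Q \<alpha>) y) + z \<alpha> (\<pi> (tail Q \<alpha>) y)) +
      \<sigma> (head Q \<alpha>) (act S \<alpha> (\<pi> (tail Q \<alpha>) y))"
    using linear_btwD(2)[OF E(1)[OF h] Xm zm] by (simp add: add.assoc)
  show "\<rho> (head Q \<alpha>) (act Y \<alpha> y) = act X \<alpha> (\<rho> (tail Q \<alpha>) y) + z \<alpha> (\<pi> (tail Q \<alpha>) y)"
    "\<pi> (head Q \<alpha>) (act Y \<alpha> y) = act S \<alpha> (\<pi> (tail Q \<alpha>) y)"
    unfolding e using coordinates(2,3)[OF h X.subspace_add[OF XD(1)[OF h] Xm zm] Sm] by auto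
qed

lemma Psi_subrep:
  assumes N: "subrep Q Y N"
  shows "subrep Q X (fst (Psi X \<iota> \<pi> N))" "subrep Q S (snd (Psi X \<iota> \<pi> N))"
proof -
  note sub = subrep_subspace[OF N]
  have e: "N i = {}" if "i \<notin> verts Q" for i using N that by (simp add: subrep_def)
  show "subrep Q X (fst (Psi X \<iota> \<pi> N))"
    unfolding subrep_def Psi_def fst_conv
  proof (intro conjI ballI allI impI)
    fix i assume i: "i \<in> verts Q"
    show "X.subspace {x \<in> spc X i. \<iota> i x \<in> N i}"
      unfolding X.subspace_def
      using X.subspace_0[OF XD(1)[OF i]] X.subspace_add[OF XD(1)[OF i]] X.subspace_scale[OF XD(1)[OF i]]
        Y.subspace_0[OF sub(2)[OF i]] Y.subspace_add[OF sub(2)[OF i]] Y.subspace_scale[OF sub(2)[OF i]]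
        zero_maps(1)[OF i] linear_btwD(2,3)[OF E(1)[OF i]] by simp
  next
    fix \<alpha> assume a: "\<alpha> \<in> arcs Q"
    show "act X \<alpha> ` {x \<in> spc X (tail Q \<alpha>). \<iota> (tail Q \<alpha>) x \<in> N (tail Q \<alpha>)} \<subseteq>
        {x \<in> spc X (head Q \<alpha>). \<iota> (head Q \<alpha>) x \<in> N (head Q \<alpha>)}"
      using E(3)[OF a] linear_btwD(1)[OF XD(2)[OF a]] subrep_act[OF N a] by auto
  qed (use e in auto)
  show "subrep Q S (snd (Psi X \<iota> \<pi> N))"
    unfolding subrep_def Psi_def snd_conv
  proof (intro conjI ballI allI impI)
    fix i assume i: "i \<in> verts Q"
    show "\<pi> i ` N i \<subseteq> spc S i" using \<pi>_mem[OF i] sub(1)[OF i] by blast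
    have "linear_btw (scl Y) (scl S) (N i) (spc S i) (\<pi> i)"
      by (rule linear_btw_mono[OF E(2)[OF i] sub(1)[OF i]]) (use \<pi>_mem[OF i] sub(1)[OF i] in blast)
    from subspace_linear_btw(2)[OF Y.module_axioms S.module_axioms sub(2)[OF i] this]
    show "S.subspace (\<pi> i ` N i)" .
  next
    fix \<alpha> assume a: "\<alpha> \<in> arcs Q"
    show "act S \<alpha> ` \<pi> (tail Q \<alpha>) ` N (tail Q \<alpha>) \<subseteq> \<pi> (head Q \<alpha>) ` N (head Q \<alpha>)"
    proof
      fix s assume "s \<in> act S \<alpha> ` \<pi> (tail Q \<alpha>) ` N (tail Q \<alpha>)"
      then obtain y where y: "y \<in> N (tail Q \<alpha>)" "s = act S \<alpha> (\<pi> (tail Q \<alpha>) y)" by blast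
      have "y \<in> spc Y (tail Q \<alpha>)" using sub(1)[OF tail_in_verts[OF a]] y(1) by blast
      then have "s = \<pi> (head Q \<alpha>) (act Y \<alpha> y)" using E(4)[OF a] y(2) by simp
      then show "s \<in> \<pi> (head Q \<alpha>) ` N (head Q \<alpha>)" using subrep_act[OF N a y(1)] by blast
    qed
  qed (use e in auto)
qed

lemma stratumD:
  assumes "N \<in> stratum Q X Y S \<iota> \<pi> f g"
  shows "subrep Q Y N" "fst (Psi X \<iota> \<pi> N) \<in> Gr Q X f" "snd (Psi X \<iota> \<pi> N) \<in> Gr Q S g"
  using assms Psi_subrep[of N] by (auto simp: stratum_def Gr_def)

end

text \<open>
  A base point \<open>(N0', N0'')\<close> and complements of its members. Everything below happens over the
  pairs \<open>x\<close> with \<open>chart_pt x\<close>, those that have the same complements.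
\<close>

locale ext_chart = ext_bundle Q X S z Y \<iota> \<pi> \<sigma>
  for Q :: "('i, 'a) pre_digraph"
    and X :: "('i, 'a, 'k::field, 'x::ab_group_add) qrep"
    and S :: "('i, 'a, 'k, 's::ab_group_add) qrep"
    and z :: "'a \<Rightarrow> 's \<Rightarrow> 'x"
    and Y :: "('i, 'a, 'k, 'y::ab_group_add) qrep"
    and \<iota> :: "'i \<Rightarrow> 'x \<Rightarrow> 'y" and \<pi> :: "'i \<Rightarrow> 'y \<Rightarrow> 's" and \<sigma> :: "'i \<Rightarrow> 's \<Rightarrow> 'y" +
  fixes N0' C' :: "'i \<Rightarrow> 'x set" and N0'' C'' :: "'i \<Rightarrow> 's set"
  assumes N0': "subrep Q X N0'" and N0'': "subrep Q S N0''"
    and c0': "N0' \<in> grass_chart Q X C'" and c0'': "N0'' \<in> grass_chart Q S C''"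
begin

text \<open>
  The complement \<open>C' \<oplus> C''\<close> in \<open>Y\<close>.
\<close>

definition D :: "'i \<Rightarrow> 'y set" where
  "D i = {y \<in> spc Y i. \<rho> i y \<in> C' i \<and> \<pi> i y \<in> C'' i}"

text \<open>
  Projection to \<open>N0''\<close> along \<open>C''\<close>. It identifies the second member of any pair in the chart
  with \<open>N0''\<close>, with inverse \<open>w \<mapsto> w - cproj (snd x i) (C'' i) w\<close> (\<open>shift_base\<close>,
  \<open>shift_base_inverse\<close>).
\<close>

definition \<beta> :: "'i \<Rightarrow> 's \<Rightarrow> 's" where
  "\<beta> i s = s - cproj (N0'' i) (C'' i) s"

text \<open>
  \<open>psi\<close> and \<open>NN\<close> are mutually inverse descriptions of the subrepresentations of \<open>Y\<close> over \<open>x\<close>.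
  Over \<open>x\<close> such a subrepresentation is the graph of a map from the second member of \<open>x\<close> to \<open>X\<close>
  modulo the first member, that is, of a map \<open>N0'' \<rightarrow> C'\<close>. The map in \<open>psi\<close> is the negative of
  the one with this graph, which makes it a projection along \<open>N\<close> and therefore a coordinate of
  \<open>N\<close>.
\<close>

definition psi :: "('i \<Rightarrow> 'y set) \<Rightarrow> 'i \<Rightarrow> 's \<Rightarrow> 'x" where
  "psi N i w = (if i \<in> verts Q \<and> w \<in> N0'' i then \<rho> i (cproj (N i) (D i) (\<sigma> i w)) else 0)"

definition NN :: "('i \<Rightarrow> 'x set) \<times> ('i \<Rightarrow> 's set) \<Rightarrow> ('i \<Rightarrow> 's \<Rightarrow> 'x) \<Rightarrow> 'i \<Rightarrow> 'y set" where
  "NN x \<psi> i = (if i \<in> verts Q then {y \<in> spc Y i. cproj (snd x i) (C'' i) (\<pi> i y) = 0 \<and>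
     cproj (fst x i) (C' i) (\<rho> i y) + \<psi> i (\<beta> i (\<pi> i y)) = 0} else {})"

text \<open>
  \<open>F\<close> holds the unknowns \<open>\<psi>\<close>, and \<open>F1\<close> the equations. For a pair \<open>x\<close> in the chart, \<open>NN x \<psi>\<close> is
  stable under the action if and only if \<open>L x \<psi> = Rh x\<close>; here \<open>L x\<close> is the differential of the
  complex computing \<open>Ext\<^sup>1(N'', X/N')\<close>, up to sign, and \<open>Rh x\<close> the image of \<open>z\<close> in it, after
  transport to spaces that do not depend on \<open>x\<close>.
\<close>

definition F :: "('i \<Rightarrow> 's \<Rightarrow> 'x) set" where
  "F = hom_fam (verts Q) (scl S) (scl X) N0'' C'"

definition F1 :: "('a \<Rightarrow> 's \<Rightarrow> 'x) set" where
  "F1 = hom_fam (arcs Q) (scl S) (scl X) (\<lambda>\<alpha>. N0'' (tail Q \<alpha>)) (\<lambda>\<alpha>. C' (head Q \<alpha>))"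

definition L :: "('i \<Rightarrow> 'x set) \<times> ('i \<Rightarrow> 's set) \<Rightarrow> ('i \<Rightarrow> 's \<Rightarrow> 'x) \<Rightarrow> 'a \<Rightarrow> 's \<Rightarrow> 'x" where
  "L x \<psi> \<alpha> w = (if \<alpha> \<in> arcs Q \<and> w \<in> N0'' (tail Q \<alpha>) then
     cproj (fst x (head Q \<alpha>)) (C' (head Q \<alpha>)) (act X \<alpha> (\<psi> (tail Q \<alpha>) w)) -
     \<psi> (head Q \<alpha>) (\<beta> (head Q \<alpha>) (act S \<alpha> (w - cproj (snd x (tail Q \<alpha>)) (C'' (tail Q \<alpha>)) w))) else 0)"

definition Rh :: "('i \<Rightarrow> 'x set) \<times> ('i \<Rightarrow> 's set) \<Rightarrow> 'a \<Rightarrow> 's \<Rightarrow> 'x" where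
  "Rh x \<alpha> w = (if \<alpha> \<in> arcs Q \<and> w \<in> N0'' (tail Q \<alpha>) then
     cproj (fst x (head Q \<alpha>)) (C' (head Q \<alpha>)) (z \<alpha> (w - cproj (snd x (tail Q \<alpha>)) (C'' (tail Q \<alpha>)) w)) else 0)"

definition chart_pt :: "('i \<Rightarrow> 'x set) \<times> ('i \<Rightarrow> 's set) \<Rightarrow> bool" where
  "chart_pt x \<longleftrightarrow> subrep Q X (fst x) \<and> subrep Q S (snd x) \<and>
     fst x \<in> grass_chart Q X C' \<and> snd x \<in> grass_chart Q S C''"

lemma chart_ptD:
  assumes "chart_pt x"
  shows "subrep Q X (fst x)" "subrep Q S (snd x)"
    "i \<in> verts Q \<Longrightarrow> compl (scl X) (fst x i) (C' i) (spc X i)"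
    "i \<in> verts Q \<Longrightarrow> compl (scl S) (snd x i) (C'' i) (spc S i)"
  using assms by (auto simp: chart_pt_def grass_chart_def)

lemma base_pt: "chart_pt (N0', N0'')"
  using N0' N0'' c0' c0'' by (simp add: chart_pt_def)

lemmas base = chart_ptD[OF base_pt, unfolded fst_conv snd_conv]

lemma C_sub:
  assumes "i \<in> verts Q"
  shows "X.subspace (C' i)" "C' i \<subseteq> spc X i" "S.subspace (C'' i)" "C'' i \<subseteq> spc S i"
  using complD(2,4)[OF base(3)[OF assms]] complD(2,4)[OF base(4)[OF assms]] by auto

lemma q'_linear: "chart_pt x \<Longrightarrow> i \<in> verts Q \<Longrightarrow>
    linear_btw (scl X) (scl X) (spc X i) (C' i) (cproj (fst x i) (C' i))"
  using linear_btw_cproj[OF X.vector_space_axioms chart_ptD(3) XD(1)] .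

lemma q''_linear: "chart_pt x \<Longrightarrow> i \<in> verts Q \<Longrightarrow>
    linear_btw (scl S) (scl S) (spc S i) (C'' i) (cproj (snd x i) (C'' i))"
  using linear_btw_cproj[OF S.vector_space_axioms chart_ptD(4) SD(1)] .

lemma minus_q''_linear:
  assumes "chart_pt x" "i \<in> verts Q"
  shows "linear_btw (scl S) (scl S) (spc S i) (snd x i) (\<lambda>s. s - cproj (snd x i) (C'' i) s)"
proof -
  have "linear_btw (scl S) (scl S) (spc S i) (spc S i) (\<lambda>s. s - cproj (snd x i) (C'' i) s)"
  proof (rule linear_btw_minus[OF _ _ S.module_axioms SD(1)[OF assms(2)]])
    show "linear_btw (scl S) (scl S) (spc S i) (spc S i) (\<lambda>s. s)" by (simp add: linear_btw_def)
    show "linear_btw (scl S) (scl S) (spc S i) (spc S i) (cproj (snd x i) (C'' i))"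
      by (rule linear_btw_mono[OF q''_linear[OF assms] subset_refl])
        (use linear_btwD(1)[OF q''_linear[OF assms]] C_sub(4)[OF assms(2)] in blast)
  qed
  then show ?thesis
    by (rule linear_btw_mono[OF _ subset_refl])
      (use cproj_mem(2)[OF S.vector_space_axioms chart_ptD(4)[OF assms]] in blast)
qed

lemma \<beta>_linear: "i \<in> verts Q \<Longrightarrow> linear_btw (scl S) (scl S) (spc S i) (N0'' i) (\<beta> i)"
  unfolding \<beta>_def using minus_q''_linear[OF base_pt] by simp

lemma \<beta>_base: "i \<in> verts Q \<Longrightarrow> w \<in> N0'' i \<Longrightarrow> \<beta> i w = w"
  using cproj_on(2)[OF S.vector_space_axioms base(4)] by (simp add: \<beta>_def)

lemma \<beta>_C: "i \<in> verts Q \<Longrightarrow> w \<in> C'' i \<Longrightarrow> \<beta> i w = 0"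
  using cproj_on(1)[OF S.vector_space_axioms base(4)] by (simp add: \<beta>_def)

lemma F_D:
  assumes "\<psi> \<in> F"
  shows "i \<in> verts Q \<Longrightarrow> linear_btw (scl S) (scl X) (N0'' i) (C' i) (\<psi> i)" "i \<notin> verts Q \<or> w \<notin> N0'' i \<Longrightarrow> \<psi> i w = 0"
  using assms by (auto simp: F_def hom_fam_def)

lemma F\<beta>_linear: "\<psi> \<in> F \<Longrightarrow> i \<in> verts Q \<Longrightarrow> linear_btw (scl S) (scl X) (spc S i) (C' i) (\<lambda>s. \<psi> i (\<beta> i s))"
  using linear_btw_comp[OF \<beta>_linear F_D(1)] .

lemma base_sub: "i \<in> verts Q \<Longrightarrow> w \<in> N0'' i \<Longrightarrow> w \<in> spc S i"
  using subrep_subspace(1)[OF N0''] by blast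

lemma shift_base:
  assumes x: "chart_pt x" and i: "i \<in> verts Q" and w: "w \<in> N0'' i"
  shows "w - cproj (snd x i) (C'' i) w \<in> snd x i" "\<beta> i (w - cproj (snd x i) (C'' i) w) = w"
proof -
  have wS: "w \<in> spc S i" by (rule base_sub[OF i w])
  have m: "cproj (snd x i) (C'' i) w \<in> C'' i" "w - cproj (snd x i) (C'' i) w \<in> snd x i"
    using cproj_mem[OF S.vector_space_axioms chart_ptD(4)[OF x i] wS] .
  then show "w - cproj (snd x i) (C'' i) w \<in> snd x i" by blast
  have "\<beta> i (w - cproj (snd x i) (C'' i) w) = \<beta> i w - \<beta> i (cproj (snd x i) (C'' i) w)"
    using m(1) C_sub(4)[OF i] by (intro linear_btw_diff[OF \<beta>_linear[OF i] S.module_axioms SD(1)[OF i] wS]) blast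
  then show "\<beta> i (w - cproj (snd x i) (C'' i) w) = w" using \<beta>_base[OF i w] \<beta>_C[OF i m(1)] by simp
qed

lemma shift_base_inverse:
  assumes x: "chart_pt x" and i: "i \<in> verts Q" and s: "s \<in> snd x i"
  shows "\<beta> i s \<in> N0'' i" "\<beta> i s - cproj (snd x i) (C'' i) (\<beta> i s) = s"
proof -
  have sS: "s \<in> spc S i" using subrep_subspace(1)[OF chart_ptD(2)[OF x] i] s by blast
  show b: "\<beta> i s \<in> N0'' i" using linear_btwD(1)[OF \<beta>_linear[OF i] sS] .
  have c: "cproj (N0'' i) (C'' i) s \<in> C'' i" using cproj_mem(1)[OF S.vector_space_axioms base(4)[OF i] sS] .
  have "cproj (snd x i) (C'' i) (\<beta> i s) = - cproj (N0'' i) (C'' i) s"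
    by (rule cproj_eqI[OF S.vector_space_axioms chart_ptD(4)[OF x i]])
      (use s S.subspace_neg[OF C_sub(3)[OF i] c] in \<open>simp_all add: \<beta>_def\<close>)
  then show "\<beta> i s - cproj (snd x i) (C'' i) (\<beta> i s) = s" by (simp add: \<beta>_def)
qed

lemma subspace_D:
  assumes "i \<in> verts Q"
  shows "Y.subspace (D i)"
  unfolding Y.subspace_def D_def
  using Y.subspace_0[OF YD(1)] Y.subspace_add[OF YD(1)] Y.subspace_scale[OF YD(1)]
    X.subspace_0[OF C_sub(1)] X.subspace_add[OF C_sub(1)] X.subspace_scale[OF C_sub(1)]
    S.subspace_0[OF C_sub(3)] S.subspace_add[OF C_sub(3)] S.subspace_scale[OF C_sub(3)]
    linear_btw_0[OF \<rho>_linear Y.module_axioms YD(1)] zero_maps(3) linear_btwD(2,3)[OF \<rho>_linear] linear_btwD(2,3)[OF E(2)] assms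
  by simp

text \<open>
  Along an exact sequence, complements of the two ends make up a complement in the middle.
\<close>

lemma compl_D:
  assumes N: "subrep Q Y N" and i: "i \<in> verts Q"
    and c': "compl (scl X) {x \<in> spc X i. \<iota> i x \<in> N i} (C' i) (spc X i)"
    and c'': "compl (scl S) (\<pi> i ` N i) (C'' i) (spc S i)"
  shows "compl (scl Y) (N i) (D i) (spc Y i)"
proof -
  note sub = subrep_subspace[OF N i]
  have 0: "y = 0" if y: "y \<in> N i" "y \<in> D i" for y
  proof -
    have yY: "y \<in> spc Y i" and d: "\<rho> i y \<in> C' i" "\<pi> i y \<in> C'' i" using y(2) by (auto simp: D_def)
    have "\<pi> i y = 0" using complD(5)[OF c'' _ d(2)] y(1) by blast
    then have e: "\<iota> i (\<rho> i y) = y" using \<rho>(2)[OF i yY] zero_maps(2)[OF i] by simp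
    then have "\<rho> i y = 0" using complD(5)[OF c' _ d(1)] \<rho>(1)[OF i yY] y(1) by simp
    then show "y = 0" using e zero_maps(1)[OF i] by simp
  qed
  have ex: "\<exists>d\<in>D i. y - d \<in> N i" if y: "y \<in> spc Y i" for y
  proof -
    obtain c where c: "c \<in> C'' i" "\<pi> i y - c \<in> \<pi> i ` N i" using complD(6)[OF c'' \<pi>_mem[OF i y]] by blast
    then obtain n where n: "n \<in> N i" "\<pi> i n = \<pi> i y - c" by force
    have nY: "n \<in> spc Y i" using n sub by blast
    have cS: "c \<in> spc S i" using c C_sub(4)[OF i] by blast
    note xm = \<rho>(1)[OF i y] \<rho>(1)[OF i nY]
    have "\<rho> i y - \<rho> i n \<in> spc X i" using X.subspace_diff[OF XD(1)[OF i] xm] .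
    then obtain c1 where c1: "c1 \<in> C' i" "\<rho> i y - \<rho> i n - c1 \<in> {x \<in> spc X i. \<iota> i x \<in> N i}" using complD(6)[OF c'] by blast
    have c1X: "c1 \<in> spc X i" using c1 C_sub(2)[OF i] by blast
    let ?d = "\<iota> i c1 + \<sigma> i c"
    have "?d \<in> D i" using coordinates[OF i c1X cS] c1(1) c(1) by (simp add: D_def)
    moreover have "y - ?d = n + \<iota> i (\<rho> i y - \<rho> i n - c1)"
    proof -
      have sm: "\<pi> i y - c = \<pi> i n" using n by simp
      have "\<iota> i (\<rho> i y - \<rho> i n - c1) = \<iota> i (\<rho> i y) - \<iota> i (\<rho> i n) - \<iota> i c1"
        using linear_btw_diff[OF E(1)[OF i] X.module_axioms XD(1)[OF i]] xm c1X X.subspace_diff[OF XD(1)[OF i] xm] by simp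
      moreover have "\<sigma> i (\<pi> i n) = \<sigma> i (\<pi> i y) - \<sigma> i c"
        using linear_btw_diff[OF \<sigma>[OF i] S.module_axioms SD(1)[OF i] \<pi>_mem[OF i y] cS] sm by simp
      moreover have "u - (c1' + sc) = m + v" if "A + B = u" "An + Bn = m" "Bn = B - sc" "v = A - An - c1'" for u m A B An Bn sc v c1' :: 'y
        unfolding that(1,2)[symmetric] that(3,4) by simp
      ultimately show ?thesis using \<rho>(2)[OF i y] \<rho>(2)[OF i nY] by blast
    qed
    then have "y - ?d \<in> N i" using Y.subspace_add[OF sub(2) n(1)] c1(2) by simp
    ultimately show ?thesis by blast
  qed
  show ?thesis
    unfolding compl_def using sub subspace_D[OF i] 0 ex by (auto simp: D_def)
qed

text \<open>
  The complement \<open>D\<close> of \<open>N\<close> alone gives only that the preimage of \<open>N\<close> in \<open>X\<close> meets \<open>C'\<close> in zero;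
  with the dimension fixed, as it is on the stratum, the preimage is a complement of \<open>C'\<close>, and
  then the image of \<open>N\<close> one of \<open>C''\<close>.
\<close>

lemma compl_D_converse:
  assumes N: "subrep Q Y N" and i: "i \<in> verts Q" and c: "compl (scl Y) (N i) (D i) (spc Y i)"
    and d: "X.dim {x \<in> spc X i. \<iota> i x \<in> N i} = X.dim (N0' i)"
  shows "compl (scl X) {x \<in> spc X i. \<iota> i x \<in> N i} (C' i) (spc X i)"
    "compl (scl S) (\<pi> i ` N i) (C'' i) (spc S i)"
proof -
  note sub = subrep_subspace[OF N i]
  note P = subrep_subspace[OF Psi_subrep(1)[OF N] i, unfolded Psi_def fst_conv]
    and P' = subrep_subspace[OF Psi_subrep(2)[OF N] i, unfolded Psi_def snd_conv]
  show c': "compl (scl X) {x \<in> spc X i. \<iota> i x \<in> N i} (C' i) (spc X i)"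
  proof (rule compl_if_dim[OF X.vector_space_axioms fd_rep_fd_sub[OF X i] P(2,1) C_sub(1,2)[OF i]])
    show "X.dim (spc X i) \<le> X.dim {x \<in> spc X i. \<iota> i x \<in> N i} + X.dim (C' i)"
      using compl_dim[OF X.vector_space_axioms base(3)[OF i] fd_rep_fd_sub[OF X i]] d by simp
    fix x assume x: "x \<in> {x \<in> spc X i. \<iota> i x \<in> N i}" "x \<in> C' i"
    then have xX: "x \<in> spc X i" by blast
    have "\<iota> i x \<in> D i"
      using x \<iota>_mem[OF i xX] coordinates_\<iota>[OF i xX] S.subspace_0[OF C_sub(3)[OF i]] by (simp add: D_def)
    then have "\<iota> i x = 0" using complD(5)[OF c] x by blast
    then show "x = 0" using coordinates_\<iota>[OF i xX] coordinates_\<iota>[OF i X.subspace_0[OF XD(1)[OF i]]] zero_maps(1)[OF i] by simp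
  qed
  have 0: "s = 0" if s: "s \<in> \<pi> i ` N i" "s \<in> C'' i" for s
  proof -
    obtain y where y: "y \<in> N i" "s = \<pi> i y" using s(1) by blast
    have yY: "y \<in> spc Y i" using y sub by blast
    obtain c1 where c1: "c1 \<in> C' i" "\<rho> i y - c1 \<in> {x \<in> spc X i. \<iota> i x \<in> N i}" using complD(6)[OF c' \<rho>(1)[OF i yY]] by blast
    have c1X: "c1 \<in> spc X i" using c1 C_sub(2)[OF i] by blast
    have sS: "s \<in> spc S i" using \<pi>_mem[OF i yY] y by simp
    have "y - \<iota> i (\<rho> i y - c1) = \<iota> i c1 + \<sigma> i s"
    proof -
      have "u - v = c + B" if "A + B = u" "v = A - c" for u v A B c :: 'y
        unfolding that(1)[symmetric] that(2) by simp
      from this[OF \<rho>(2)[OF i yY] linear_btw_diff[OF E(1)[OF i] X.module_axioms XD(1)[OF i] \<rho>(1)[OF i yY] c1X]]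
      show ?thesis using y(2) by simp
    qed
    moreover have "y - \<iota> i (\<rho> i y - c1) \<in> N i" using Y.subspace_diff[OF sub(2) y(1)] c1(2) by blast
    moreover have "\<iota> i c1 + \<sigma> i s \<in> D i" using coordinates[OF i c1X sS] c1(1) s(2) by (simp add: D_def)
    ultimately have "\<iota> i c1 + \<sigma> i s = 0" using complD(5)[OF c] by simp
    then show "s = 0" using coordinates(2)[OF i c1X sS] zero_maps(3)[OF i] by simp
  qed
  have "\<exists>c\<in>C'' i. s - c \<in> \<pi> i ` N i" if s: "s \<in> spc S i" for s
  proof -
    obtain d where d: "d \<in> D i" "\<sigma> i s - d \<in> N i"
      using complD(6)[OF c conjunct2[OF coordinates_\<sigma>[OF i s]]] by blast
    have "\<pi> i (\<sigma> i s - d) = s - \<pi> i d"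
      using linear_btw_diff[OF E(2)[OF i] Y.module_axioms YD(1)[OF i] conjunct2[OF coordinates_\<sigma>[OF i s]]] d(1) \<pi>\<sigma>[OF i s]
      by (simp add: D_def)
    then show ?thesis using d by (intro bexI[of _ "\<pi> i d"]) (auto simp: D_def intro: image_eqI[rotated])
  qed
  then show "compl (scl S) (\<pi> i ` N i) (C'' i) (spc S i)"
    unfolding compl_def using P' C_sub[OF i] 0 by auto
qed

lemma cproj_D:
  assumes i: "i \<in> verts Q" and c: "compl (scl Y) (N i) (D i) (spc Y i)"
  shows "x \<in> spc X i \<Longrightarrow> compl (scl X) {x \<in> spc X i. \<iota> i x \<in> N i} (C' i) (spc X i) \<Longrightarrow>
      cproj (N i) (D i) (\<iota> i x) = \<iota> i (cproj {x \<in> spc X i. \<iota> i x \<in> N i} (C' i) x)"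
    "y \<in> spc Y i \<Longrightarrow> compl (scl S) (\<pi> i ` N i) (C'' i) (spc S i) \<Longrightarrow>
      cproj (\<pi> i ` N i) (C'' i) (\<pi> i y) = \<pi> i (cproj (N i) (D i) y)"
proof -
  assume x: "x \<in> spc X i" and c': "compl (scl X) {x \<in> spc X i. \<iota> i x \<in> N i} (C' i) (spc X i)"
  let ?c = "cproj {x \<in> spc X i. \<iota> i x \<in> N i} (C' i) x"
  have m: "?c \<in> C' i" "x - ?c \<in> {x \<in> spc X i. \<iota> i x \<in> N i}" using cproj_mem[OF X.vector_space_axioms c' x] .
  have cX: "?c \<in> spc X i" using m(1) C_sub(2)[OF i] by blast
  show "cproj (N i) (D i) (\<iota> i x) = \<iota> i ?c"
  proof (rule cproj_eqI[OF Y.vector_space_axioms c])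
    show "\<iota> i ?c \<in> D i"
      using m(1) \<iota>_mem[OF i cX] coordinates_\<iota>[OF i cX] S.subspace_0[OF C_sub(3)[OF i]] by (simp add: D_def)
    show "\<iota> i x - \<iota> i ?c \<in> N i" using m(2) linear_btw_diff[OF E(1)[OF i] X.module_axioms XD(1)[OF i] x cX] by simp
  qed
next
  assume y: "y \<in> spc Y i" and c'': "compl (scl S) (\<pi> i ` N i) (C'' i) (spc S i)"
  let ?d = "cproj (N i) (D i) y"
  have m: "?d \<in> D i" "y - ?d \<in> N i" using cproj_mem[OF Y.vector_space_axioms c y] .
  have dY: "?d \<in> spc Y i" using m(1) by (simp add: D_def)
  show "cproj (\<pi> i ` N i) (C'' i) (\<pi> i y) = \<pi> i ?d"
  proof (rule cproj_eqI[OF S.vector_space_axioms c''])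
    show "\<pi> i ?d \<in> C'' i" using m(1) by (simp add: D_def)
    have "\<pi> i y - \<pi> i ?d = \<pi> i (y - ?d)"
      using linear_btw_diff[OF E(2)[OF i] Y.module_axioms YD(1)[OF i] y dY] by simp
    then show "\<pi> i y - \<pi> i ?d \<in> \<pi> i ` N i" using m(2) by simp
  qed
qed

lemma Psi_chart:
  assumes "chart_pt (Psi X \<iota> \<pi> N)" "subrep Q Y N" "i \<in> verts Q"
  shows "compl (scl X) {x \<in> spc X i. \<iota> i x \<in> N i} (C' i) (spc X i)"
    "compl (scl S) (\<pi> i ` N i) (C'' i) (spc S i)" "compl (scl Y) (N i) (D i) (spc Y i)"
  using chart_ptD(3,4)[OF assms(1,3)] compl_D[OF assms(2,3)] by (auto simp: Psi_def)

text \<open>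
  Split \<open>y\<close> into its components in \<open>X\<close>, in \<open>N0''\<close> and in \<open>C''\<close>; the last one lies in \<open>D\<close> and
  contributes nothing to the \<open>X\<close>-component.
\<close>

lemma \<rho>_cproj_D:
  assumes N: "subrep Q Y N" and x: "chart_pt (Psi X \<iota> \<pi> N)" and i: "i \<in> verts Q" and y: "y \<in> spc Y i"
  shows "\<rho> i (cproj (N i) (D i) y) =
     cproj (fst (Psi X \<iota> \<pi> N) i) (C' i) (\<rho> i y) + psi N i (\<beta> i (\<pi> i y))"
proof -
  note c = Psi_chart[OF x N i]
  note l = linear_btw_cproj[OF Y.vector_space_axioms c(3) YD(1)[OF i]]
  have DY: "D i \<subseteq> spc Y i" by (auto simp: D_def)
  have lr: "linear_btw (scl Y) (scl X) (spc Y i) (spc X i) (\<lambda>y. \<rho> i (cproj (N i) (D i) y))"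
    by (rule linear_btw_comp[OF l linear_btw_mono[OF \<rho>_linear[OF i] DY]]) (use \<rho>(1)[OF i] DY in blast)
  define s where "s = \<pi> i y"
  have s: "s \<in> spc S i" unfolding s_def by (rule \<pi>_mem[OF i y])
  let ?c = "cproj (N0'' i) (C'' i) s"
  have cC: "?c \<in> C'' i" and b: "\<beta> i s \<in> N0'' i"
    using cproj_mem[OF S.vector_space_axioms base(4)[OF i] s] by (auto simp: \<beta>_def)
  have cS: "?c \<in> spc S i" using cC C_sub(4)[OF i] by blast
  have bS: "\<beta> i s \<in> spc S i" by (rule base_sub[OF i b])
  have xm: "\<rho> i y \<in> spc X i" by (rule \<rho>(1)[OF i y])
  have "\<sigma> i s = \<sigma> i (\<beta> i s) + \<sigma> i ?c" using linear_btwD(2)[OF \<sigma>[OF i] bS cS] by (simp add: \<beta>_def)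
  then have "y = \<iota> i (\<rho> i y) + (\<sigma> i (\<beta> i s) + \<sigma> i ?c)" using \<rho>(2)[OF i y] by (simp add: s_def)
  then have "\<rho> i (cproj (N i) (D i) y) = \<rho> i (cproj (N i) (D i) (\<iota> i (\<rho> i y) + (\<sigma> i (\<beta> i s) + \<sigma> i ?c)))" by simp
  also have "\<dots> = \<rho> i (cproj (N i) (D i) (\<iota> i (\<rho> i y))) + (\<rho> i (cproj (N i) (D i) (\<sigma> i (\<beta> i s))) + \<rho> i (cproj (N i) (D i) (\<sigma> i ?c)))"
    using linear_btwD(2)[OF lr] \<iota>_mem[OF i xm] coordinates_\<sigma>[OF i bS] coordinates_\<sigma>[OF i cS] Y.subspace_add[OF YD(1)[OF i]] by simp
  also have "\<rho> i (cproj (N i) (D i) (\<iota> i (\<rho> i y))) = cproj (fst (Psi X \<iota> \<pi> N) i) (C' i) (\<rho> i y)"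
  proof -
    have "cproj {x \<in> spc X i. \<iota> i x \<in> N i} (C' i) (\<rho> i y) \<in> spc X i"
      using cproj_mem(1)[OF X.vector_space_axioms c(1) xm] C_sub(2)[OF i] by blast
    then show ?thesis using cproj_D(1)[where N = N, OF i c(3) xm c(1)] coordinates_\<iota>[OF i] by (simp add: Psi_def)
  qed
  also have "\<rho> i (cproj (N i) (D i) (\<sigma> i (\<beta> i s))) = psi N i (\<beta> i s)" using b i by (simp add: psi_def)
  also have "\<rho> i (cproj (N i) (D i) (\<sigma> i ?c)) = 0"
  proof -
    have "\<sigma> i ?c \<in> D i"
      using coordinates_\<sigma>[OF i cS] \<pi>\<sigma>[OF i cS] cC X.subspace_0[OF C_sub(1)[OF i]] by (simp add: D_def)
    then show ?thesis using cproj_on(1)[OF Y.vector_space_axioms c(3)] coordinates_\<sigma>[OF i cS] by simp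
  qed
  finally show ?thesis by (simp add: s_def)
qed

lemma NN_psi:
  assumes N: "subrep Q Y N" and x: "chart_pt (Psi X \<iota> \<pi> N)"
  shows "NN (Psi X \<iota> \<pi> N) (psi N) = N"
proof
  fix i
  show "NN (Psi X \<iota> \<pi> N) (psi N) i = N i"
  proof (cases "i \<in> verts Q")
    case i: True
    note c = Psi_chart[OF x N i] and sub = subrep_subspace[OF N i]
    have "y \<in> N i \<longleftrightarrow> cproj (snd (Psi X \<iota> \<pi> N) i) (C'' i) (\<pi> i y) = 0 \<and>
        cproj (fst (Psi X \<iota> \<pi> N) i) (C' i) (\<rho> i y) + psi N i (\<beta> i (\<pi> i y)) = 0" if y: "y \<in> spc Y i" for y
    proof -
      let ?d = "cproj (N i) (D i) y"
      have dY: "?d \<in> spc Y i" using cproj_mem(1)[OF Y.vector_space_axioms c(3) y] by (simp add: D_def)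
      have "y \<in> N i \<longleftrightarrow> ?d = 0" using cproj_eq_0_iff[OF Y.vector_space_axioms c(3) y] by simp
      also have "\<dots> \<longleftrightarrow> \<pi> i ?d = 0 \<and> \<rho> i ?d = 0"
        using \<rho>(2)[OF i dY] zero_maps[OF i] linear_btw_0[OF \<rho>_linear[OF i] Y.module_axioms YD(1)[OF i]] by auto
      finally show ?thesis using cproj_D(2)[where N = N, OF i c(3) y c(2)] \<rho>_cproj_D[OF N x i y] by (simp add: Psi_def)
    qed
    then show ?thesis using sub i by (auto simp: NN_def)
  next
    case False
    then show ?thesis using N by (simp add: NN_def subrep_def)
  qed
qed

lemma psi_F:
  assumes N: "subrep Q Y N" and x: "chart_pt (Psi X \<iota> \<pi> N)"
  shows "psi N \<in> F"
  unfolding F_def hom_fam_def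
proof (intro CollectI conjI ballI allI impI)
  fix i assume i: "i \<in> verts Q"
  note c = Psi_chart[OF x N i]
  note l = linear_btw_cproj[OF Y.vector_space_axioms c(3) YD(1)[OF i]]
  have lD: "linear_btw (scl Y) (scl X) (D i) (C' i) (\<rho> i)"
    by (rule linear_btw_mono[OF \<rho>_linear[OF i]]) (auto simp: D_def)
  have "linear_btw (scl S) (scl X) (spc S i) (C' i) (\<lambda>w. \<rho> i (cproj (N i) (D i) (\<sigma> i w)))"
    using linear_btw_comp[OF \<sigma>[OF i] linear_btw_comp[OF l lD]] .
  then have "linear_btw (scl S) (scl X) (N0'' i) (C' i) (\<lambda>w. \<rho> i (cproj (N i) (D i) (\<sigma> i w)))"
    by (rule linear_btw_mono) (use subrep_subspace(1)[OF N0'' i] linear_btwD(1)[OF \<open>linear_btw _ _ (spc S i) _ _\<close>] in blast)+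
  then show "linear_btw (scl S) (scl X) (N0'' i) (C' i) (psi N i)"
    using i S.subspace_add[OF subrep_subspace(2)[OF N0'' i]] S.subspace_scale[OF subrep_subspace(2)[OF N0'' i]]
    unfolding linear_btw_def by (simp add: psi_def Pi_iff)
qed (auto simp: psi_def)

text \<open>
  Apply the action to the vector of \<open>N\<close> over a given vector of \<open>N0''\<close>; that the result lies in
  \<open>N\<close> again is the equation.
\<close>

lemma psi_equation:
  assumes N: "subrep Q Y N" and x: "chart_pt (Psi X \<iota> \<pi> N)"
  shows "L (Psi X \<iota> \<pi> N) (psi N) = Rh (Psi X \<iota> \<pi> N)"
proof (intro ext)
  fix \<alpha> w
  let ?x = "Psi X \<iota> \<pi> N"
  show "L ?x (psi N) \<alpha> w = Rh ?x \<alpha> w"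
  proof (cases "\<alpha> \<in> arcs Q \<and> w \<in> N0'' (tail Q \<alpha>)")
    case True
    then have a: "\<alpha> \<in> arcs Q" and w: "w \<in> N0'' (tail Q \<alpha>)" and h: "head Q \<alpha> \<in> verts Q" and t: "tail Q \<alpha> \<in> verts Q" by auto
    define s where "s = w - cproj (snd ?x (tail Q \<alpha>)) (C'' (tail Q \<alpha>)) w"
    have s: "s \<in> snd ?x (tail Q \<alpha>)" "\<beta> (tail Q \<alpha>) s = w" unfolding s_def using shift_base[OF x t w] by auto
    have sS: "s \<in> spc S (tail Q \<alpha>)" using subrep_subspace(1)[OF chart_ptD(2)[OF x] t] s(1) by blast
    note pF = F_D(1)[OF psi_F[OF N x]]
    have pw: "psi N (tail Q \<alpha>) w \<in> C' (tail Q \<alpha>)" using linear_btwD(1)[OF pF[OF t] w] .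
    have pX: "psi N (tail Q \<alpha>) w \<in> spc X (tail Q \<alpha>)" using pw C_sub(2)[OF t] by blast
    have mX: "- psi N (tail Q \<alpha>) w \<in> spc X (tail Q \<alpha>)" using X.subspace_neg[OF XD(1)[OF t] pX] .
    \<comment> \<open>The vector of \<open>N\<close> whose component in \<open>S\<close> corresponds to \<open>w\<close> and whose component in \<open>X\<close> lies in \<open>C'\<close>.\<close>
    define y where "y = \<iota> (tail Q \<alpha>) (- psi N (tail Q \<alpha>) w) + \<sigma> (tail Q \<alpha>) s"
    note yc = coordinates[OF t mX sS, folded y_def]
    have q: "cproj (fst ?x (tail Q \<alpha>)) (C' (tail Q \<alpha>)) (- psi N (tail Q \<alpha>) w) = - psi N (tail Q \<alpha>) w"
      using cproj_on(1)[OF X.vector_space_axioms chart_ptD(3)[OF x t]] X.subspace_neg[OF C_sub(1)[OF t] pw] by blast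
    have "y \<in> NN ?x (psi N) (tail Q \<alpha>)"
      using yc t q s cproj_on(2)[OF S.vector_space_axioms chart_ptD(4)[OF x t] s(1)] by (simp add: NN_def)
    then have yN: "y \<in> N (tail Q \<alpha>)" using NN_psi[OF N x] by simp
    have "act Y \<alpha> y \<in> NN ?x (psi N) (head Q \<alpha>)" using subrep_act[OF N a yN] NN_psi[OF N x] by simp
    then have e: "cproj (fst ?x (head Q \<alpha>)) (C' (head Q \<alpha>)) (act X \<alpha> (- psi N (tail Q \<alpha>) w) + z \<alpha> s) +
        psi N (head Q \<alpha>) (\<beta> (head Q \<alpha>) (act S \<alpha> s)) = 0"
      using act_coordinates[OF a yc(1)] yc h by (simp add: NN_def)
    have zm: "z \<alpha> s \<in> spc X (head Q \<alpha>)" using linear_btwD(1)[OF arrD[OF arr_z a] sS] .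
    have am: "act X \<alpha> (psi N (tail Q \<alpha>) w) \<in> spc X (head Q \<alpha>)" using linear_btwD(1)[OF XD(2)[OF a] pX] .
    have "act X \<alpha> (- psi N (tail Q \<alpha>) w) = - act X \<alpha> (psi N (tail Q \<alpha>) w)"
      using linear_btw_diff[OF XD(2)[OF a] X.module_axioms XD(1)[OF t] X.subspace_0[OF XD(1)[OF t]] pX]
        linear_btw_0[OF XD(2)[OF a] X.module_axioms XD(1)[OF t]] by simp
    then have "act X \<alpha> (- psi N (tail Q \<alpha>) w) + z \<alpha> s = z \<alpha> s - act X \<alpha> (psi N (tail Q \<alpha>) w)" by simp
    then have "cproj (fst ?x (head Q \<alpha>)) (C' (head Q \<alpha>)) (z \<alpha> s) -
        cproj (fst ?x (head Q \<alpha>)) (C' (head Q \<alpha>)) (act X \<alpha> (psi N (tail Q \<alpha>) w)) +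
        psi N (head Q \<alpha>) (\<beta> (head Q \<alpha>) (act S \<alpha> s)) = 0"
      using e linear_btw_diff[OF q'_linear[OF x h] X.module_axioms XD(1)[OF h] zm am] by simp
    then have "cproj (fst ?x (head Q \<alpha>)) (C' (head Q \<alpha>)) (act X \<alpha> (psi N (tail Q \<alpha>) w)) -
        psi N (head Q \<alpha>) (\<beta> (head Q \<alpha>) (act S \<alpha> s)) = cproj (fst ?x (head Q \<alpha>)) (C' (head Q \<alpha>)) (z \<alpha> s)"
      by (simp add: algebra_simps)
    then show ?thesis using True by (simp add: L_def Rh_def s_def)
  qed (auto simp: L_def Rh_def)
qed

context
  fixes x \<psi> assumes x: "chart_pt x" and \<psi>: "\<psi> \<in> F" and eq: "L x \<psi> = Rh x"
begin

lemma NN_mem_iff: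
  "i \<in> verts Q \<Longrightarrow> y \<in> NN x \<psi> i \<longleftrightarrow> y \<in> spc Y i \<and> \<pi> i y \<in> snd x i \<and>
     cproj (fst x i) (C' i) (\<rho> i y) = - \<psi> i (\<beta> i (\<pi> i y))"
  using cproj_eq_0_iff[OF S.vector_space_axioms chart_ptD(4)[OF x] \<pi>_mem]
  by (auto simp: NN_def eq_neg_iff_add_eq_0)

lemma NN_subspace:
  assumes i: "i \<in> verts Q"
  shows "Y.subspace (NN x \<psi> i)"
proof -
  note l1 = linear_btw_comp[OF E(2)[OF i] q''_linear[OF x i]]
  have l2: "linear_btw (scl Y) (scl X) (spc Y i) (spc X i) (\<lambda>y. cproj (fst x i) (C' i) (\<rho> i y) + \<psi> i (\<beta> i (\<pi> i y)))"
  proof (rule linear_btw_plus[OF _ _ X.module_axioms XD(1)[OF i]])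
    have "linear_btw (scl X) (scl X) (spc X i) (spc X i) (cproj (fst x i) (C' i))"
      by (rule linear_btw_mono[OF q'_linear[OF x i] subset_refl])
        (use linear_btwD(1)[OF q'_linear[OF x i]] C_sub(2)[OF i] in blast)
    then show "linear_btw (scl Y) (scl X) (spc Y i) (spc X i) (\<lambda>y. cproj (fst x i) (C' i) (\<rho> i y))"
      using linear_btw_comp[OF \<rho>_linear[OF i]] by blast
    have "linear_btw (scl S) (scl X) (spc S i) (spc X i) (\<lambda>s. \<psi> i (\<beta> i s))"
      by (rule linear_btw_mono[OF F\<beta>_linear[OF \<psi> i] subset_refl])
        (use linear_btwD(1)[OF F\<beta>_linear[OF \<psi> i]] C_sub(2)[OF i] in blast)
    then show "linear_btw (scl Y) (scl X) (spc Y i) (spc X i) (\<lambda>y. \<psi> i (\<beta> i (\<pi> i y)))"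
      using linear_btw_comp[OF E(2)[OF i]] by blast
  qed
  have "Y.subspace ({y \<in> spc Y i. cproj (snd x i) (C'' i) (\<pi> i y) = 0} \<inter>
      {y \<in> spc Y i. cproj (fst x i) (C' i) (\<rho> i y) + \<psi> i (\<beta> i (\<pi> i y)) = 0})"
    using subspace_linear_btw(1)[OF Y.module_axioms S.module_axioms YD(1)[OF i] l1]
      subspace_linear_btw(1)[OF Y.module_axioms X.module_axioms YD(1)[OF i] l2] by (rule Y.subspace_inter)
  moreover have "NN x \<psi> i = {y \<in> spc Y i. cproj (snd x i) (C'' i) (\<pi> i y) = 0} \<inter>
      {y \<in> spc Y i. cproj (fst x i) (C' i) (\<rho> i y) + \<psi> i (\<beta> i (\<pi> i y)) = 0}" using i by (auto simp: NN_def)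
  ultimately show ?thesis by simp
qed

lemma NN_subrep: "subrep Q Y (NN x \<psi>)"
  unfolding subrep_def
proof (intro conjI ballI allI impI)
  show "NN x \<psi> i \<subseteq> spc Y i" if "i \<in> verts Q" for i using that by (auto simp: NN_def)
  show "Y.subspace (NN x \<psi> i)" if "i \<in> verts Q" for i by (rule NN_subspace[OF that])
  show "NN x \<psi> i = {}" if "i \<notin> verts Q" for i using that by (simp add: NN_def)
  fix \<alpha> assume a: "\<alpha> \<in> arcs Q"
  have h: "head Q \<alpha> \<in> verts Q" and t: "tail Q \<alpha> \<in> verts Q" using a by auto
  show "act Y \<alpha> ` NN x \<psi> (tail Q \<alpha>) \<subseteq> NN x \<psi> (head Q \<alpha>)"
  proof
    fix u assume "u \<in> act Y \<alpha> ` NN x \<psi> (tail Q \<alpha>)"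
    then obtain y where y: "y \<in> NN x \<psi> (tail Q \<alpha>)" "u = act Y \<alpha> y" by blast
    define s where "s = \<pi> (tail Q \<alpha>) y"
    have yY: "y \<in> spc Y (tail Q \<alpha>)" and s: "s \<in> snd x (tail Q \<alpha>)"
      and r: "cproj (fst x (tail Q \<alpha>)) (C' (tail Q \<alpha>)) (\<rho> (tail Q \<alpha>) y) = - \<psi> (tail Q \<alpha>) (\<beta> (tail Q \<alpha>) s)"
      using y(1) unfolding NN_mem_iff[OF t] s_def by auto
    define w where "w = \<beta> (tail Q \<alpha>) s"
    have w: "w \<in> N0'' (tail Q \<alpha>)" "w - cproj (snd x (tail Q \<alpha>)) (C'' (tail Q \<alpha>)) w = s"
      unfolding w_def using shift_base_inverse[OF x t s] by auto
    have sS: "s \<in> spc S (tail Q \<alpha>)" using subrep_subspace(1)[OF chart_ptD(2)[OF x] t] s by blast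
    have pw: "\<psi> (tail Q \<alpha>) w \<in> spc X (tail Q \<alpha>)"
      using linear_btwD(1)[OF F_D(1)[OF \<psi> t] w(1)] C_sub(2)[OF t] by blast
    let ?q = "cproj (fst x (head Q \<alpha>)) (C' (head Q \<alpha>))"
    note ql = q'_linear[OF x h]
    have Lw: "?q (act X \<alpha> (\<psi> (tail Q \<alpha>) w)) - \<psi> (head Q \<alpha>) (\<beta> (head Q \<alpha>) (act S \<alpha> s)) = ?q (z \<alpha> s)"
      using fun_cong[OF fun_cong[OF eq], of \<alpha> w] a w by (simp add: L_def Rh_def)
    have xm: "\<rho> (tail Q \<alpha>) y \<in> spc X (tail Q \<alpha>)" by (rule \<rho>(1)[OF t yY])
    have n: "\<rho> (tail Q \<alpha>) y + \<psi> (tail Q \<alpha>) w \<in> fst x (tail Q \<alpha>)"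
      using cproj_mem(2)[OF X.vector_space_axioms chart_ptD(3)[OF x t] xm] r by (simp add: w_def)
    have "act X \<alpha> (\<rho> (tail Q \<alpha>) y + \<psi> (tail Q \<alpha>) w) \<in> fst x (head Q \<alpha>)" using subrep_act[OF chart_ptD(1)[OF x] a n] .
    then have "?q (act X \<alpha> (\<rho> (tail Q \<alpha>) y + \<psi> (tail Q \<alpha>) w)) = 0"
      using cproj_on(2)[OF X.vector_space_axioms chart_ptD(3)[OF x h]] by blast
    moreover have am: "act X \<alpha> (\<rho> (tail Q \<alpha>) y) \<in> spc X (head Q \<alpha>)" "act X \<alpha> (\<psi> (tail Q \<alpha>) w) \<in> spc X (head Q \<alpha>)"
      using linear_btwD(1)[OF XD(2)[OF a]] xm pw by auto
    ultimately have q1: "?q (act X \<alpha> (\<rho> (tail Q \<alpha>) y)) = - ?q (act X \<alpha> (\<psi> (tail Q \<alpha>) w))"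
      using linear_btwD(2)[OF XD(2)[OF a] xm pw] linear_btwD(2)[OF ql am] by (simp add: eq_neg_iff_add_eq_0)
    have zm: "z \<alpha> s \<in> spc X (head Q \<alpha>)" using linear_btwD(1)[OF arrD[OF arr_z a] sS] .
    have "?q (act X \<alpha> (\<rho> (tail Q \<alpha>) y) + z \<alpha> s) = - \<psi> (head Q \<alpha>) (\<beta> (head Q \<alpha>) (act S \<alpha> s))"
    proof -
      have "u + v = - p" if "u = - b" "b - p = v" for u v b p :: 'x
        unfolding that(1) that(2)[symmetric] by simp
      from this[OF q1 Lw] show ?thesis using linear_btwD(2)[OF ql am(1) zm] by simp
    qed
    moreover have "act S \<alpha> s \<in> snd x (head Q \<alpha>)" using subrep_act[OF chart_ptD(2)[OF x] a s] .
    moreover have "act Y \<alpha> y \<in> spc Y (head Q \<alpha>)" using linear_btwD(1)[OF YD(2)[OF a] yY] .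
    ultimately show "u \<in> NN x \<psi> (head Q \<alpha>)"
      unfolding y(2) NN_mem_iff[OF h] using act_coordinates[OF a yY] by (simp add: s_def)
  qed
qed

lemma Psi_NN: "Psi X \<iota> \<pi> (NN x \<psi>) = x"
proof -
  have 1: "{v \<in> spc X i. \<iota> i v \<in> NN x \<psi> i} = fst x i" for i
  proof (cases "i \<in> verts Q")
    case i: True
    have "\<iota> i v \<in> NN x \<psi> i \<longleftrightarrow> v \<in> fst x i" if v: "v \<in> spc X i" for v
    proof -
      have 0: "0 \<in> snd x i" using S.subspace_0[OF subrep_subspace(2)[OF chart_ptD(2)[OF x] i]] .
      have "\<psi> i (\<beta> i 0) = 0" using linear_btw_0[OF F\<beta>_linear[OF \<psi> i] S.module_axioms SD(1)[OF i]] .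
      then show ?thesis unfolding NN_mem_iff[OF i]
        using \<iota>_mem[OF i v] coordinates_\<iota>[OF i v] 0 cproj_eq_0_iff[OF X.vector_space_axioms chart_ptD(3)[OF x i] v] by simp
    qed
    then show ?thesis using subrep_subspace(1)[OF chart_ptD(1)[OF x] i] by blast
  next
    case False
    then show ?thesis using chart_ptD(1)[OF x] by (simp add: NN_def subrep_def)
  qed
  have 2: "\<pi> i ` NN x \<psi> i = snd x i" for i
  proof (cases "i \<in> verts Q")
    case i: True
    show ?thesis
    proof
      show "\<pi> i ` NN x \<psi> i \<subseteq> snd x i" using NN_mem_iff[OF i] by blast
      show "snd x i \<subseteq> \<pi> i ` NN x \<psi> i"
      proof
        fix s assume s: "s \<in> snd x i"
        have sS: "s \<in> spc S i" using subrep_subspace(1)[OF chart_ptD(2)[OF x] i] s by blast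
        define v where "v = - \<psi> i (\<beta> i s)"
        have vC: "v \<in> C' i" using X.subspace_neg[OF C_sub(1)[OF i] linear_btwD(1)[OF F\<beta>_linear[OF \<psi> i] sS]] by (simp add: v_def)
        then have vX: "v \<in> spc X i" using C_sub(2)[OF i] by blast
        have "\<iota> i v + \<sigma> i s \<in> NN x \<psi> i"
          unfolding NN_mem_iff[OF i] using coordinates[OF i vX sS] s
            cproj_on(1)[OF X.vector_space_axioms chart_ptD(3)[OF x i] vC] by (simp add: v_def)
        then show "s \<in> \<pi> i ` NN x \<psi> i" using coordinates(2)[OF i vX sS] by (metis imageI)
      qed
    qed
  next
    case False
    then show ?thesis using chart_ptD(2)[OF x] by (simp add: NN_def subrep_def)
  qed
  show ?thesis unfolding Psi_def 1 2 by simp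
qed

text \<open>
  The dimension of a member of the fibre comes from the exact sequence with kernel \<open>fst x i\<close> and
  image \<open>snd x i\<close>.
\<close>

lemma NN_stratum:
  assumes "fst x \<in> Gr Q X f" "snd x \<in> Gr Q S g"
  shows "NN x \<psi> \<in> stratum Q X Y S \<iota> \<pi> f g"
proof -
  have "Y.dim (NN x \<psi> i) = f i + g i" if i: "i \<in> verts Q" for i
  proof -
    note sub = subrep_subspace[OF NN_subrep i]
    have fN: "fd_sub (scl Y) (NN x \<psi> i)"
      by (rule fd_sub_subset[OF Y.vector_space_axioms fd_rep_fd_sub[OF Y i] sub(2,1)])
    have l: "linear_btw (scl Y) (scl S) (NN x \<psi> i) (spc S i) (\<pi> i)"
      by (rule linear_btw_mono[OF E(2)[OF i] sub(1)]) (use \<pi>_mem[OF i] sub(1) in blast)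
    have im: "\<pi> i ` NN x \<psi> i = snd x i" and pre: "{v \<in> spc X i. \<iota> i v \<in> NN x \<psi> i} = fst x i"
      using fun_cong[OF arg_cong[OF Psi_NN, of snd], of i] fun_cong[OF arg_cong[OF Psi_NN, of fst], of i] by (simp_all add: Psi_def)
    have "{y \<in> NN x \<psi> i. \<pi> i y = 0} = \<iota> i ` {v \<in> spc X i. \<iota> i v \<in> NN x \<psi> i}"
    proof (intro equalityI subsetI)
      fix y assume "y \<in> {y \<in> NN x \<psi> i. \<pi> i y = 0}"
      then have "y \<in> \<iota> i ` spc X i" "y \<in> NN x \<psi> i" unfolding E(6)[OF i] using sub(1) by auto
      then show "y \<in> \<iota> i ` {v \<in> spc X i. \<iota> i v \<in> NN x \<psi> i}" by auto
    qed (use \<iota>_mem[OF i] in auto)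
    then have k: "{y \<in> NN x \<psi> i. \<pi> i y = 0} = \<iota> i ` fst x i" using pre by simp
    note fs = subrep_subspace[OF chart_ptD(1)[OF x] i]
    have lf: "linear_btw (scl X) (scl Y) (fst x i) (spc Y i) (\<iota> i)"
      by (rule linear_btw_mono[OF E(1)[OF i] fs(1)]) (use \<iota>_mem[OF i] fs(1) in blast)
    have "Y.dim (\<iota> i ` fst x i) = X.dim (fst x i)"
      using dim_image_inj[OF X.vector_space_axioms Y.vector_space_axioms fd_sub_subset[OF X.vector_space_axioms fd_rep_fd_sub[OF X i] fs(2,1)] lf inj_on_subset[OF E(5)[OF i] fs(1)]] .
    then show ?thesis
      using dim_exact[OF Y.vector_space_axioms S.vector_space_axioms fN l] assms i
      by (simp add: k im Gr_def dimvec_def)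
  qed
  then show ?thesis
    using NN_subrep assms by (simp add: stratum_def Gr_def Psi_NN dimvec_def)
qed

lemma psi_NN: "psi (NN x \<psi>) = \<psi>"
proof (intro ext)
  fix i w
  have xN: "chart_pt (Psi X \<iota> \<pi> (NN x \<psi>))" using x Psi_NN by simp
  show "psi (NN x \<psi>) i w = \<psi> i w"
  proof (cases "i \<in> verts Q \<and> w \<in> N0'' i")
    case True
    then have i: "i \<in> verts Q" and w: "w \<in> N0'' i" by auto
    define s where "s = w - cproj (snd x i) (C'' i) w"
    have s: "s \<in> snd x i" "\<beta> i s = w" unfolding s_def using shift_base[OF x i w] by auto
    have sS: "s \<in> spc S i" using subrep_subspace(1)[OF chart_ptD(2)[OF x] i] s(1) by blast
    have pC: "\<psi> i w \<in> C' i" using linear_btwD(1)[OF F_D(1)[OF \<psi> i] w] .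
    have vC: "- \<psi> i w \<in> C' i" using X.subspace_neg[OF C_sub(1)[OF i] pC] .
    have vX: "- \<psi> i w \<in> spc X i" using vC C_sub(2)[OF i] by blast
    define y where "y = \<iota> i (- \<psi> i w) + \<sigma> i s"
    note yc = coordinates[OF i vX sS, folded y_def]
    have q: "cproj (fst x i) (C' i) (- \<psi> i w) = - \<psi> i w"
      by (rule cproj_on(1)[OF X.vector_space_axioms chart_ptD(3)[OF x i] vC])
    have yN: "y \<in> NN x \<psi> i" unfolding NN_mem_iff[OF i] using yc s q by simp
    have "cproj (fst (Psi X \<iota> \<pi> (NN x \<psi>)) i) (C' i) (\<rho> i y) + psi (NN x \<psi>) i (\<beta> i (\<pi> i y)) = \<rho> i (cproj (NN x \<psi> i) (D i) y)"
      using \<rho>_cproj_D[OF NN_subrep xN i yc(1)] by simp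
    also have "cproj (NN x \<psi> i) (D i) y = 0"
      by (rule cproj_on(2)[OF Y.vector_space_axioms Psi_chart(3)[OF xN NN_subrep i] yN])
    also have "\<rho> i 0 = 0" by (rule linear_btw_0[OF \<rho>_linear[OF i] Y.module_axioms YD(1)[OF i]])
    finally show ?thesis using yc s(2) q by (simp add: Psi_NN)
  next
    case False
    then show ?thesis using F_D(2)[OF \<psi>] by (auto simp: psi_def)
  qed
qed

lemma cproj_NN:
  assumes i: "i \<in> verts Q" and y: "y \<in> spc Y i"
  shows "cproj (NN x \<psi> i) (D i) y = \<iota> i (cproj (fst x i) (C' i) (\<rho> i y) + \<psi> i (\<beta> i (\<pi> i y))) +
     \<sigma> i (cproj (snd x i) (C'' i) (\<pi> i y))"
proof -
  have xN: "chart_pt (Psi X \<iota> \<pi> (NN x \<psi>))" using x Psi_NN by simp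
  note c = Psi_chart[OF xN NN_subrep i]
  let ?d = "cproj (NN x \<psi> i) (D i) y"
  have dY: "?d \<in> spc Y i" using cproj_mem(1)[OF Y.vector_space_axioms c(3) y] by (simp add: D_def)
  have "\<pi> i ` NN x \<psi> i = snd x i" using fun_cong[OF arg_cong[OF Psi_NN, of snd], of i] by (simp add: Psi_def)
  then have "\<pi> i ?d = cproj (snd x i) (C'' i) (\<pi> i y)" using cproj_D(2)[where N = "NN x \<psi>", OF i c(3) y c(2)] by simp
  moreover have "\<rho> i ?d = cproj (fst x i) (C' i) (\<rho> i y) + \<psi> i (\<beta> i (\<pi> i y))"
    using \<rho>_cproj_D[OF NN_subrep xN i y] by (simp add: Psi_NN psi_NN)
  ultimately show ?thesis using \<rho>(2)[OF i dY] by simp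
qed

end

lemma L_in_F1:
  assumes x: "chart_pt x" and \<psi>: "\<psi> \<in> F"
  shows "L x \<psi> \<in> F1"
  unfolding F1_def hom_fam_def
proof (intro CollectI conjI ballI allI impI)
  fix \<alpha> assume a: "\<alpha> \<in> arcs Q"
  have h: "head Q \<alpha> \<in> verts Q" and t: "tail Q \<alpha> \<in> verts Q" using a by auto
  note sub = subrep_subspace[OF N0'' t]
  have lt: "linear_btw (scl S) (scl X) (N0'' (tail Q \<alpha>)) (spc X (tail Q \<alpha>)) (\<psi> (tail Q \<alpha>))"
    by (rule linear_btw_mono[OF F_D(1)[OF \<psi> t] subset_refl])
      (use linear_btwD(1)[OF F_D(1)[OF \<psi> t]] C_sub(2)[OF t] in blast)
  have l1: "linear_btw (scl S) (scl X) (N0'' (tail Q \<alpha>)) (C' (head Q \<alpha>))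
      (\<lambda>w. cproj (fst x (head Q \<alpha>)) (C' (head Q \<alpha>)) (act X \<alpha> (\<psi> (tail Q \<alpha>) w)))"
    using linear_btw_comp[OF lt linear_btw_comp[OF XD(2)[OF a] q'_linear[OF x h]]] .
  have ls: "linear_btw (scl S) (scl S) (N0'' (tail Q \<alpha>)) (spc S (tail Q \<alpha>)) (\<lambda>w. w - cproj (snd x (tail Q \<alpha>)) (C'' (tail Q \<alpha>)) w)"
    by (rule linear_btw_mono[OF minus_q''_linear[OF x t] sub(1)])
      (use linear_btwD(1)[OF minus_q''_linear[OF x t]] sub(1) subrep_subspace(1)[OF chart_ptD(2)[OF x] t] in blast)
  have l2: "linear_btw (scl S) (scl X) (N0'' (tail Q \<alpha>)) (C' (head Q \<alpha>))
      (\<lambda>w. \<psi> (head Q \<alpha>) (\<beta> (head Q \<alpha>) (act S \<alpha> (w - cproj (snd x (tail Q \<alpha>)) (C'' (tail Q \<alpha>)) w))))"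
    using linear_btw_comp[OF ls linear_btw_comp[OF SD(2)[OF a] F\<beta>_linear[OF \<psi> h]]] .
  have "linear_btw (scl S) (scl X) (N0'' (tail Q \<alpha>)) (C' (head Q \<alpha>))
     (\<lambda>w. cproj (fst x (head Q \<alpha>)) (C' (head Q \<alpha>)) (act X \<alpha> (\<psi> (tail Q \<alpha>) w)) -
       \<psi> (head Q \<alpha>) (\<beta> (head Q \<alpha>) (act S \<alpha> (w - cproj (snd x (tail Q \<alpha>)) (C'' (tail Q \<alpha>)) w))))"
    by (rule linear_btw_minus[OF l1 l2 X.module_axioms C_sub(1)[OF h]])
  then show "linear_btw (scl S) (scl X) (N0'' (tail Q \<alpha>)) (C' (head Q \<alpha>)) (L x \<psi> \<alpha>)"
    using a S.subspace_add[OF sub(2)] S.subspace_scale[OF sub(2)] unfolding linear_btw_def by (simp add: L_def Pi_iff)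
qed (auto simp: L_def)

lemma Rh_in_F1:
  assumes x: "chart_pt x"
  shows "Rh x \<in> F1"
  unfolding F1_def hom_fam_def
proof (intro CollectI conjI ballI allI impI)
  fix \<alpha> assume a: "\<alpha> \<in> arcs Q"
  have h: "head Q \<alpha> \<in> verts Q" and t: "tail Q \<alpha> \<in> verts Q" using a by auto
  note sub = subrep_subspace[OF N0'' t]
  have ls: "linear_btw (scl S) (scl S) (N0'' (tail Q \<alpha>)) (spc S (tail Q \<alpha>)) (\<lambda>w. w - cproj (snd x (tail Q \<alpha>)) (C'' (tail Q \<alpha>)) w)"
    by (rule linear_btw_mono[OF minus_q''_linear[OF x t] sub(1)])
      (use linear_btwD(1)[OF minus_q''_linear[OF x t]] sub(1) subrep_subspace(1)[OF chart_ptD(2)[OF x] t] in blast)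
  have "linear_btw (scl S) (scl X) (N0'' (tail Q \<alpha>)) (C' (head Q \<alpha>))
      (\<lambda>w. cproj (fst x (head Q \<alpha>)) (C' (head Q \<alpha>)) (z \<alpha> (w - cproj (snd x (tail Q \<alpha>)) (C'' (tail Q \<alpha>)) w)))"
    using linear_btw_comp[OF ls linear_btw_comp[OF arrD[OF arr_z a] q'_linear[OF x h]]] .
  then show "linear_btw (scl S) (scl X) (N0'' (tail Q \<alpha>)) (C' (head Q \<alpha>)) (Rh x \<alpha>)"
    using a S.subspace_add[OF sub(2)] S.subspace_scale[OF sub(2)] unfolding linear_btw_def by (simp add: Rh_def Pi_iff)
qed (auto simp: Rh_def)

lemma L_linear:
  assumes x: "chart_pt x"
  shows "linear_btw (fam_scale (scl X)) (fam_scale (scl X)) F F1 (L x)"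
  unfolding linear_btw_def
proof (intro conjI ballI allI funcsetI)
  show "L x \<psi> \<in> F1" if "\<psi> \<in> F" for \<psi> by (rule L_in_F1[OF x that])
  have m: "\<psi> (tail Q \<alpha>) w \<in> spc X (tail Q \<alpha>)" "act X \<alpha> (\<psi> (tail Q \<alpha>) w) \<in> spc X (head Q \<alpha>)"
    if "\<psi> \<in> F" "\<alpha> \<in> arcs Q" "w \<in> N0'' (tail Q \<alpha>)" for \<psi> \<alpha> w
  proof -
    show "\<psi> (tail Q \<alpha>) w \<in> spc X (tail Q \<alpha>)"
      using linear_btwD(1)[OF F_D(1)[OF that(1) tail_in_verts[OF that(2)]] that(3)] C_sub(2)[OF tail_in_verts[OF that(2)]] by blast
    then show "act X \<alpha> (\<psi> (tail Q \<alpha>) w) \<in> spc X (head Q \<alpha>)" using linear_btwD(1)[OF XD(2)[OF that(2)]] by blast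
  qed
  fix \<psi> assume \<psi>: "\<psi> \<in> F"
  show "L x (fam_scale (scl X) c \<psi>) = fam_scale (scl X) c (L x \<psi>)" for c
  proof (intro ext)
    fix \<alpha> w
    show "L x (fam_scale (scl X) c \<psi>) \<alpha> w = fam_scale (scl X) c (L x \<psi>) \<alpha> w"
    proof (cases "\<alpha> \<in> arcs Q \<and> w \<in> N0'' (tail Q \<alpha>)")
      case True
      then show ?thesis
        using m[OF \<psi>, of \<alpha> w] linear_btwD(3)[OF XD(2)] linear_btwD(3)[OF q'_linear[OF x head_in_verts]]
        by (simp add: L_def fam_scale_def X.scale_right_diff_distrib)
    next
      case False
      then show ?thesis by (auto simp: L_def fam_scale_def)
    qed
  qed
  fix \<phi> assume \<phi>: "\<phi> \<in> F"
  show "L x (\<psi> + \<phi>) = L x \<psi> + L x \<phi>"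
  proof (intro ext)
    fix \<alpha> w
    show "L x (\<psi> + \<phi>) \<alpha> w = (L x \<psi> + L x \<phi>) \<alpha> w"
    proof (cases "\<alpha> \<in> arcs Q \<and> w \<in> N0'' (tail Q \<alpha>)")
      case True
      then show ?thesis
        using m[OF \<psi>, of \<alpha> w] m[OF \<phi>, of \<alpha> w] linear_btwD(2)[OF XD(2)] linear_btwD(2)[OF q'_linear[OF x head_in_verts]]
        by (simp add: L_def)
    next
      case False
      then show ?thesis by (auto simp: L_def)
    qed
  qed
qed

text \<open>
  Extend an element of \<open>F1\<close> to a cochain from \<open>S\<close> to \<open>X\<close>. Since the base point splits, a
  coboundary reduces the cochain to one that is zero from \<open>N0''\<close> to \<open>X/N0'\<close>, and this coboundary
  provides the preimage.
\<close>

lemma L_base_surj: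
  assumes sp: "split N0' N0''" and w: "w \<in> F1"
  shows "\<exists>\<psi>\<in>F. L (N0', N0'') \<psi> = w"
proof -
  have wl: "linear_btw (scl S) (scl X) (N0'' (tail Q \<alpha>)) (C' (head Q \<alpha>)) (w \<alpha>)" if "\<alpha> \<in> arcs Q" for \<alpha>
    using w that by (simp add: F1_def hom_fam_def)
  have w0: "w \<alpha> s = 0" if "\<alpha> \<notin> arcs Q \<or> s \<notin> N0'' (tail Q \<alpha>)" for \<alpha> s
    using w that by (auto simp: F1_def hom_fam_def)
  define v where "v \<alpha> s = w \<alpha> (\<beta> (tail Q \<alpha>) s)" for \<alpha> s
  have "linear_btw (scl S) (scl X) (spc S (tail Q \<alpha>)) (spc X (head Q \<alpha>)) (v \<alpha>)" if a: "\<alpha> \<in> arcs Q" for \<alpha>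
  proof -
    have "linear_btw (scl S) (scl X) (spc S (tail Q \<alpha>)) (C' (head Q \<alpha>)) (v \<alpha>)"
      unfolding v_def using linear_btw_comp[OF \<beta>_linear[OF tail_in_verts[OF a]] wl[OF a]] .
    then show ?thesis
      by (rule linear_btw_mono[OF _ subset_refl])
        (use linear_btwD(1)[OF \<open>linear_btw _ _ _ (C' _) _\<close>] C_sub(2)[OF head_in_verts[OF a]] in blast)
  qed
  then have "arr v" by (simp add: arr_def)
  then obtain \<phi> where \<phi>: "lin \<phi>" "\<And>\<alpha> s. \<alpha> \<in> arcs Q \<Longrightarrow> s \<in> N0'' (tail Q \<alpha>) \<Longrightarrow> v \<alpha> s - cob \<phi> \<alpha> s \<in> N0' (head Q \<alpha>)"
    using split_reduces_all[OF sp N0' N0''] by blast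
  \<comment> \<open>The sign comes from \<open>cob\<close>, in which the action on \<open>X\<close> occurs with the opposite sign to \<open>L\<close>.\<close>
  define \<psi> where "\<psi> i s = (if i \<in> verts Q \<and> s \<in> N0'' i then - cproj (N0' i) (C' i) (\<phi> i s) else 0)" for i s
  have ql: "linear_btw (scl X) (scl X) (spc X i) (C' i) (cproj (N0' i) (C' i))" if "i \<in> verts Q" for i
    using q'_linear[OF base_pt that] by simp
  have "\<psi> \<in> F"
    unfolding F_def hom_fam_def
  proof (intro CollectI conjI ballI allI impI)
    fix i assume i: "i \<in> verts Q"
    note sub = subrep_subspace[OF N0'' i]
    have "linear_btw (scl S) (scl X) (spc S i) (C' i) (\<lambda>s. cproj (N0' i) (C' i) (\<phi> i s))"
      using linear_btw_comp[OF linD[OF \<phi>(1) i] ql[OF i]] .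
    then show "linear_btw (scl S) (scl X) (N0'' i) (C' i) (\<psi> i)"
      using i sub(1) S.subspace_add[OF sub(2)] S.subspace_scale[OF sub(2)] X.subspace_neg[OF C_sub(1)[OF i]]
      unfolding linear_btw_def by (simp add: \<psi>_def Pi_iff subset_iff)
  qed (auto simp: \<psi>_def)
  moreover have "L (N0', N0'') \<psi> \<alpha> s = w \<alpha> s" for \<alpha> s
  proof (cases "\<alpha> \<in> arcs Q \<and> s \<in> N0'' (tail Q \<alpha>)")
    case True
    then have a: "\<alpha> \<in> arcs Q" and s: "s \<in> N0'' (tail Q \<alpha>)" and h: "head Q \<alpha> \<in> verts Q" and t: "tail Q \<alpha> \<in> verts Q" by auto
    let ?q = "cproj (N0' (head Q \<alpha>)) (C' (head Q \<alpha>))" and ?qt = "cproj (N0' (tail Q \<alpha>)) (C' (tail Q \<alpha>))"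
    have sS: "s \<in> spc S (tail Q \<alpha>)" by (rule base_sub[OF t s])
    have As: "act S \<alpha> s \<in> N0'' (head Q \<alpha>)" by (rule subrep_act[OF N0'' a s])
    have AsS: "act S \<alpha> s \<in> spc S (head Q \<alpha>)" by (rule base_sub[OF h As])
    have \<phi>m: "\<phi> (tail Q \<alpha>) s \<in> spc X (tail Q \<alpha>)" "\<phi> (head Q \<alpha>) (act S \<alpha> s) \<in> spc X (head Q \<alpha>)"
      using linear_btwD(1)[OF linD[OF \<phi>(1) t] sS] linear_btwD(1)[OF linD[OF \<phi>(1) h] AsS] .
    have Am: "act X \<alpha> (\<phi> (tail Q \<alpha>) s) \<in> spc X (head Q \<alpha>)" using linear_btwD(1)[OF XD(2)[OF a] \<phi>m(1)] .
    have qm: "?qt (\<phi> (tail Q \<alpha>) s) \<in> C' (tail Q \<alpha>)" "\<phi> (tail Q \<alpha>) s - ?qt (\<phi> (tail Q \<alpha>) s) \<in> N0' (tail Q \<alpha>)"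
      using cproj_mem[OF X.vector_space_axioms base(3)[OF t] \<phi>m(1)] .
    have qX: "?qt (\<phi> (tail Q \<alpha>) s) \<in> spc X (tail Q \<alpha>)" using qm(1) C_sub(2)[OF t] by blast
    have Aq: "act X \<alpha> (?qt (\<phi> (tail Q \<alpha>) s)) \<in> spc X (head Q \<alpha>)" using linear_btwD(1)[OF XD(2)[OF a] qX] .
    have "act X \<alpha> (\<phi> (tail Q \<alpha>) s - ?qt (\<phi> (tail Q \<alpha>) s)) \<in> N0' (head Q \<alpha>)" by (rule subrep_act[OF N0' a qm(2)])
    then have "?q (act X \<alpha> (\<phi> (tail Q \<alpha>) s - ?qt (\<phi> (tail Q \<alpha>) s))) = 0"
      by (rule cproj_on(2)[OF X.vector_space_axioms base(3)[OF h]])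
    then have q1: "?q (act X \<alpha> (?qt (\<phi> (tail Q \<alpha>) s))) = ?q (act X \<alpha> (\<phi> (tail Q \<alpha>) s))"
      using linear_btw_diff[OF XD(2)[OF a] X.module_axioms XD(1)[OF t] \<phi>m(1) qX]
        linear_btw_diff[OF ql[OF h] X.module_axioms XD(1)[OF h] Am Aq] by simp
    have "act X \<alpha> (- ?qt (\<phi> (tail Q \<alpha>) s)) = - act X \<alpha> (?qt (\<phi> (tail Q \<alpha>) s))"
      using linear_btw_diff[OF XD(2)[OF a] X.module_axioms XD(1)[OF t] X.subspace_0[OF XD(1)[OF t]] qX]
        linear_btw_0[OF XD(2)[OF a] X.module_axioms XD(1)[OF t]] by simp
    moreover have "?q (- act X \<alpha> (?qt (\<phi> (tail Q \<alpha>) s))) = - ?q (act X \<alpha> (?qt (\<phi> (tail Q \<alpha>) s)))"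
      using linear_btw_diff[OF ql[OF h] X.module_axioms XD(1)[OF h] X.subspace_0[OF XD(1)[OF h]] Aq]
        linear_btw_0[OF ql[OF h] X.module_axioms XD(1)[OF h]] by simp
    ultimately have q2: "?q (act X \<alpha> (\<psi> (tail Q \<alpha>) s)) = - ?q (act X \<alpha> (\<phi> (tail Q \<alpha>) s))"
      using s t q1 by (simp add: \<psi>_def)
    have q0: "cproj (N0'' (tail Q \<alpha>)) (C'' (tail Q \<alpha>)) s = 0" by (rule cproj_on(2)[OF S.vector_space_axioms base(4)[OF t] s])
    have "L (N0', N0'') \<psi> \<alpha> s = ?q (\<phi> (head Q \<alpha>) (act S \<alpha> s)) - ?q (act X \<alpha> (\<phi> (tail Q \<alpha>) s))"
      using True q0 q2 \<beta>_base[OF h As] As h by (simp add: L_def \<psi>_def)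
    also have "\<dots> = ?q (cob \<phi> \<alpha> s)"
      unfolding cob_def using linear_btw_diff[OF ql[OF h] X.module_axioms XD(1)[OF h] \<phi>m(2) Am] by simp
    also have "\<dots> = w \<alpha> s"
    proof -
      have v: "v \<alpha> s = w \<alpha> s" using \<beta>_base[OF t s] by (simp add: v_def)
      have wC: "w \<alpha> s \<in> C' (head Q \<alpha>)" using linear_btwD(1)[OF wl[OF a] s] .
      have wX: "w \<alpha> s \<in> spc X (head Q \<alpha>)" using wC C_sub(2)[OF h] by blast
      have cX: "cob \<phi> \<alpha> s \<in> spc X (head Q \<alpha>)" unfolding cob_def by (rule X.subspace_diff[OF XD(1)[OF h] \<phi>m(2) Am])
      have "?q (w \<alpha> s - cob \<phi> \<alpha> s) = 0"
        using \<phi>(2)[OF a s] v by (intro cproj_on(2)[OF X.vector_space_axioms base(3)[OF h]]) simp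
      then show ?thesis
        using linear_btw_diff[OF ql[OF h] X.module_axioms XD(1)[OF h] wX cX]
          cproj_on(1)[OF X.vector_space_axioms base(3)[OF h] wC] by simp
    qed
    finally show ?thesis .
  next
    case False
    then show ?thesis using w0 by (auto simp: L_def)
  qed
  then have "L (N0', N0'') \<psi> = w" by blast
  ultimately show ?thesis by blast
qed

lemma split_if_solvable:
  assumes \<psi>: "\<psi> \<in> F" and eq: "L (N0', N0'') \<psi> = Rh (N0', N0'')"
  shows "split N0' N0''"
proof -
  define \<phi> where "\<phi> i s = - \<psi> i (\<beta> i s)" for i s
  have "lin \<phi>"
    unfolding lin_def
  proof
    fix i assume i: "i \<in> verts Q"
    show "linear_btw (scl S) (scl X) (spc S i) (spc X i) (\<phi> i)"
      using F\<beta>_linear[OF \<psi> i] C_sub(2)[OF i] X.subspace_neg[OF XD(1)[OF i]]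
      unfolding linear_btw_def by (auto simp: \<phi>_def Pi_iff)
  qed
  moreover have "z \<alpha> s - cob \<phi> \<alpha> s \<in> N0' (head Q \<alpha>)" if a: "\<alpha> \<in> arcs Q" and s: "s \<in> N0'' (tail Q \<alpha>)" for \<alpha> s
  proof -
    have h: "head Q \<alpha> \<in> verts Q" and t: "tail Q \<alpha> \<in> verts Q" using a by auto
    let ?q = "cproj (N0' (head Q \<alpha>)) (C' (head Q \<alpha>))"
    have ql: "linear_btw (scl X) (scl X) (spc X (head Q \<alpha>)) (C' (head Q \<alpha>)) ?q" using q'_linear[OF base_pt h] by simp
    have sS: "s \<in> spc S (tail Q \<alpha>)" by (rule base_sub[OF t s])
    have As: "act S \<alpha> s \<in> N0'' (head Q \<alpha>)" by (rule subrep_act[OF N0'' a s])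
    have p: "\<psi> (tail Q \<alpha>) s \<in> spc X (tail Q \<alpha>)" using linear_btwD(1)[OF F_D(1)[OF \<psi> t] s] C_sub(2)[OF t] by blast
    have pC: "\<psi> (head Q \<alpha>) (act S \<alpha> s) \<in> C' (head Q \<alpha>)" using linear_btwD(1)[OF F_D(1)[OF \<psi> h] As] .
    have pX: "\<psi> (head Q \<alpha>) (act S \<alpha> s) \<in> spc X (head Q \<alpha>)" using pC C_sub(2)[OF h] by blast
    have Ap: "act X \<alpha> (\<psi> (tail Q \<alpha>) s) \<in> spc X (head Q \<alpha>)" using linear_btwD(1)[OF XD(2)[OF a] p] .
    have zm: "z \<alpha> s \<in> spc X (head Q \<alpha>)" using linear_btwD(1)[OF arrD[OF arr_z a] sS] .
    have q0: "cproj (N0'' (tail Q \<alpha>)) (C'' (tail Q \<alpha>)) s = 0" by (rule cproj_on(2)[OF S.vector_space_axioms base(4)[OF t] s])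
    have e: "?q (act X \<alpha> (\<psi> (tail Q \<alpha>) s)) - \<psi> (head Q \<alpha>) (act S \<alpha> s) = ?q (z \<alpha> s)"
      using fun_cong[OF fun_cong[OF eq], of \<alpha> s] a s q0 \<beta>_base[OF h As] by (simp add: L_def Rh_def)
    have "act X \<alpha> (- \<psi> (tail Q \<alpha>) s) = - act X \<alpha> (\<psi> (tail Q \<alpha>) s)"
      using linear_btw_diff[OF XD(2)[OF a] X.module_axioms XD(1)[OF t] X.subspace_0[OF XD(1)[OF t]] p]
        linear_btw_0[OF XD(2)[OF a] X.module_axioms XD(1)[OF t]] by simp
    then have c: "z \<alpha> s - cob \<phi> \<alpha> s = z \<alpha> s + \<psi> (head Q \<alpha>) (act S \<alpha> s) - act X \<alpha> (\<psi> (tail Q \<alpha>) s)"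
      using \<beta>_base[OF h As] \<beta>_base[OF t s] by (simp add: cob_def \<phi>_def algebra_simps)
    have m: "z \<alpha> s + \<psi> (head Q \<alpha>) (act S \<alpha> s) \<in> spc X (head Q \<alpha>)" by (rule X.subspace_add[OF XD(1)[OF h] zm pX])
    have "?q (z \<alpha> s - cob \<phi> \<alpha> s) = ?q (z \<alpha> s) + ?q (\<psi> (head Q \<alpha>) (act S \<alpha> s)) - ?q (act X \<alpha> (\<psi> (tail Q \<alpha>) s))"
      unfolding c using linear_btw_diff[OF ql X.module_axioms XD(1)[OF h] m Ap] linear_btwD(2)[OF ql zm pX] by simp
    also have "?q (\<psi> (head Q \<alpha>) (act S \<alpha> s)) = \<psi> (head Q \<alpha>) (act S \<alpha> s)"
      by (rule cproj_on(1)[OF X.vector_space_axioms base(3)[OF h] pC])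
    finally have "?q (z \<alpha> s - cob \<phi> \<alpha> s) = 0" using e by (simp add: algebra_simps)
    moreover have "z \<alpha> s - cob \<phi> \<alpha> s \<in> spc X (head Q \<alpha>)"
      unfolding c by (rule X.subspace_diff[OF XD(1)[OF h] m Ap])
    ultimately show ?thesis using cproj_eq_0_iff[OF X.vector_space_axioms base(3)[OF h]] by blast
  qed
  ultimately show ?thesis unfolding split_def by blast
qed

end

context ext_bundle
begin

lemma ext_chart_exists:
  assumes sub: "subrep Q X N'" "subrep Q S N''"
  shows "\<exists>C' C''. ext_chart Q X S z Y \<iota> \<pi> \<sigma> N' C' N'' C''"
proof -
  have "\<exists>C. compl (scl X) (N' i) C (spc X i)" if "i \<in> verts Q" for i
    using compl_exists[OF X.vector_space_axioms XD(1)[OF that] subrep_subspace(2,1)[OF sub(1) that]] by metis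
  moreover have "\<exists>C. compl (scl S) (N'' i) C (spc S i)" if "i \<in> verts Q" for i
    using compl_exists[OF S.vector_space_axioms SD(1)[OF that] subrep_subspace(2,1)[OF sub(2) that]] by metis
  ultimately obtain C' C'' where "\<And>i. i \<in> verts Q \<Longrightarrow> compl (scl X) (N' i) (C' i) (spc X i)"
    "\<And>i. i \<in> verts Q \<Longrightarrow> compl (scl S) (N'' i) (C'' i) (spc S i)" by metis
  then have "ext_chart Q X S z Y \<iota> \<pi> \<sigma> N' C' N'' C''"
    using sub by unfold_locales (auto simp: grass_chart_def)
  then show ?thesis by blast
qed

text \<open>
  A point of the image may be taken as the base point of a chart, where a subrepresentation over
  it is a solution of the linear system; solvability at the base point amounts to \<open>split\<close>.
\<close>

lemma image_Psi:
  "Psi X \<iota> \<pi> ` stratum Q X Y S \<iota> \<pi> f g = {x \<in> Gr Q X f \<times> Gr Q S g. split (fst x) (snd x)}"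
proof (intro equalityI subsetI)
    fix x assume "x \<in> Psi X \<iota> \<pi> ` stratum Q X Y S \<iota> \<pi> f g"
    then obtain N where N: "N \<in> stratum Q X Y S \<iota> \<pi> f g" "x = Psi X \<iota> \<pi> N" by blast
    note sN = stratumD[OF N(1)]
    obtain C' C'' where "ext_chart Q X S z Y \<iota> \<pi> \<sigma> (fst x) C' (snd x) C''"
      using ext_chart_exists[OF Psi_subrep[OF sN(1)]] N(2) by blast
    then interpret c: ext_chart Q X S z Y \<iota> \<pi> \<sigma> "fst x" C' "snd x" C'' .
    have x: "c.chart_pt (Psi X \<iota> \<pi> N)" using c.base_pt N(2) by simp
    have "split (fst x) (snd x)"
      using c.split_if_solvable[OF c.psi_F[OF sN(1) x]] c.psi_equation[OF sN(1) x] N(2) by simp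
    then show "x \<in> {x \<in> Gr Q X f \<times> Gr Q S g. split (fst x) (snd x)}"
      using sN N(2) by (simp add: mem_Times_iff)
  next
    fix x assume "x \<in> {x \<in> Gr Q X f \<times> Gr Q S g. split (fst x) (snd x)}"
    then have x: "fst x \<in> Gr Q X f" "snd x \<in> Gr Q S g" "split (fst x) (snd x)" by (auto simp: mem_Times_iff)
    then obtain C' C'' where "ext_chart Q X S z Y \<iota> \<pi> \<sigma> (fst x) C' (snd x) C''"
      using ext_chart_exists[of "fst x" "snd x"] by (auto simp: Gr_def)
    then interpret c: ext_chart Q X S z Y \<iota> \<pi> \<sigma> "fst x" C' "snd x" C'' .
    have xp: "c.chart_pt x" using c.base_pt by simp
    obtain \<psi> where \<psi>: "\<psi> \<in> c.F" "c.L x \<psi> = c.Rh x"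
      using c.L_base_surj[OF x(3) c.Rh_in_F1[OF xp]] by auto
    have "c.NN x \<psi> \<in> stratum Q X Y S \<iota> \<pi> f g" by (rule c.NN_stratum[OF xp \<psi> x(1,2)])
    moreover have "Psi X \<iota> \<pi> (c.NN x \<psi>) = x" by (rule c.Psi_NN[OF xp \<psi>])
    ultimately show "x \<in> Psi X \<iota> \<pi> ` stratum Q X Y S \<iota> \<pi> f g" by (metis imageI)
  qed

end

section \<open>Regularity of the linear system\<close>

lemma functional_extend:
  fixes l :: "'v::ab_group_add \<Rightarrow> 'k::field"
  assumes "vector_space s" "module.subspace s C" "linear_btw s (*) C UNIV l"
  obtains l' where "linear_btw s (*) V UNIV l'" "\<And>c. c \<in> C \<Longrightarrow> l' c = l c"
proof -
  interpret k: vector_space "(*) :: 'k \<Rightarrow> 'k \<Rightarrow> 'k" by (rule vector_space_times)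
  obtain F where F: "Vector_Spaces.linear s (*) F" "\<And>c. c \<in> C \<Longrightarrow> F c = l c"
    by (rule linear_btw_extend[OF assms(1) vector_space_times assms(2,3) k.subspace_UNIV]) (rule that)
  have "linear_btw s (*) V UNIV F" by (rule linear_imp_btw[OF F(1)]) auto
  then show ?thesis using F(2) by (rule that)
qed

text \<open>
  A linear functional on families of maps is a combination of functionals of single values.
\<close>

lemma hom_fam_functional_poly:
  fixes J :: "'j set"
  assumes s: "vector_space s" and t: "vector_space t" and J: "finite J"
    and V: "\<And>j. j \<in> J \<Longrightarrow> fd_sub s (V j)" and W: "\<And>j. j \<in> J \<Longrightarrow> fd_sub t (W j)"
    and \<mu>: "linear_btw (fam_scale t) (*) (hom_fam J s t V W) UNIV \<mu>"
    and \<Omega>: "\<And>x. x \<in> T \<Longrightarrow> \<Omega> x \<in> hom_fam J s t V W"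
    and ev: "\<And>j v l. j \<in> J \<Longrightarrow> v \<in> V j \<Longrightarrow> linear_btw t (*) (W j) UNIV l \<Longrightarrow>
        \<exists>p\<in>poly_funs C. \<forall>x\<in>T. p x = l (\<Omega> x j v)"
  shows "\<exists>p\<in>poly_funs C. \<forall>x\<in>T. p x = \<mu> (\<Omega> x)"
proof -
  interpret f: vector_space "fam_scale t :: 'a \<Rightarrow> ('j \<Rightarrow> 'b \<Rightarrow> 'c) \<Rightarrow> _" by (rule vector_space_fam_scale[OF t])
  have sub: "f.subspace (hom_fam J s t V W)" by (rule subspace_hom_fam[OF s t]) (use V W fd_subD in blast)+
  have "\<exists>I E \<kappa>. coords (fam_scale t) (hom_fam J s t V W) (I :: ('j \<times> nat \<times> nat) set) E \<kappa> \<and>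
     card I = (\<Sum>j\<in>J. vector_space.dim s (V j) * vector_space.dim t (W j)) \<and>
     (\<forall>i\<in>I. \<exists>j\<in>J. \<exists>v\<in>V j. \<exists>l. linear_btw t (*) (W j) UNIV l \<and> (\<forall>\<psi>. \<kappa> i \<psi> = l (\<psi> j v)))"
    by (rule coords_hom_fam[OF s t J V W])
  then obtain I :: "('j \<times> nat \<times> nat) set" and E \<kappa>
    where c: "coords (fam_scale t) (hom_fam J s t V W) I E \<kappa>"
      and e: "\<forall>i\<in>I. \<exists>j\<in>J. \<exists>v\<in>V j. \<exists>l. linear_btw t (*) (W j) UNIV l \<and> (\<forall>\<psi>. \<kappa> i \<psi> = l (\<psi> j v))"
    by (elim exE conjE) (rule that)
  have "\<exists>p\<in>poly_funs C. \<forall>x\<in>T. p x = \<kappa> i (\<Omega> x)" if i: "i \<in> I" for i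
  proof -
    from bspec[OF e i] obtain j v l where j: "j \<in> J" "v \<in> V j" "linear_btw t (*) (W j) UNIV l" "\<forall>\<psi>. \<kappa> i \<psi> = l (\<psi> j v)"
      by (elim bexE exE conjE) (rule that)
    show ?thesis using ev[OF j(1-3)] j(4) by simp
  qed
  then obtain p where p: "\<And>i. i \<in> I \<Longrightarrow> p i \<in> poly_funs C" "\<And>i x. i \<in> I \<Longrightarrow> x \<in> T \<Longrightarrow> p i x = \<kappa> i (\<Omega> x)" by metis
  have "(\<Sum>i\<in>I. p i x * \<mu> (E i)) = \<mu> (\<Omega> x)" if x: "x \<in> T" for x
    using linear_btw_expand[OF c f.module_axioms sub \<mu> \<Omega>[OF x]] p(2) x by simp
  moreover have "(\<lambda>x. \<Sum>i\<in>I. p i x * \<mu> (E i)) \<in> poly_funs C"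
    using p(1) by (intro poly_funs_sum poly_funs.mult poly_funs.const)
  ultimately show ?thesis by (intro bexI[of _ "\<lambda>x. \<Sum>i\<in>I. p i x * \<mu> (E i)"]) auto
qed

lemma geometric_poly_reg:
  assumes "geometric A" "openin (zar A) U" "p \<in> poly_funs (reg A U)"
  shows "p \<in> reg A U"
  using poly_funs_reg[OF assms(1,2) _ assms(3), of "\<lambda>x. x"] by simp

lemma chart_poly_reg:
  assumes "geometric A" "chart A U C" "p \<in> poly_funs C" "\<And>x. x \<in> U \<Longrightarrow> \<phi> x = p x"
  shows "\<phi> \<in> reg A U"
proof -
  note c = chartD(1,2)[OF assms(2)]
  have "p \<in> poly_funs (reg A U)" by (rule poly_funs_mono[OF assms(3)]) (use c(2) in blast)
  then show ?thesis
    by (rule geometricD(1)[OF assms(1) c(1) geometric_poly_reg[OF assms(1) c(1)]]) (rule assms(4))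
qed

lemma topspace_prod_spc_geometric:
  assumes "geometric A" "geometric B"
  shows "topspace (zar (prod_spc A B)) = topspace (zar A) \<times> topspace (zar B)"
  using geometricD(4)[OF assms(1) openin_topspace] geometricD(4)[OF assms(2) openin_topspace]
  by (rule topspace_prod_spc)

context ext_bundle
begin

abbreviation St :: "('i \<Rightarrow> nat) \<Rightarrow> ('i \<Rightarrow> nat) \<Rightarrow> ('i \<Rightarrow> 'y set) set" where
  "St f g \<equiv> stratum Q X Y S \<iota> \<pi> f g"

abbreviation Tot :: "('i \<Rightarrow> nat) \<Rightarrow> ('i \<Rightarrow> nat) \<Rightarrow> ('i \<Rightarrow> 'y set, 'k) fn_space" where
  "Tot f g \<equiv> subspc (Gr_spc Q Y (\<lambda>i. f i + g i)) (St f g)"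

abbreviation Base :: "('i \<Rightarrow> nat) \<Rightarrow> ('i \<Rightarrow> nat) \<Rightarrow> (('i \<Rightarrow> 'x set) \<times> ('i \<Rightarrow> 's set), 'k) fn_space" where
  "Base f g \<equiv> subspc (prod_spc (Gr_spc Q X f) (Gr_spc Q S g)) (Psi X \<iota> \<pi> ` St f g)"

lemma geometric_Tot: "geometric (Tot f g)"
  by (rule geometric_subspc[OF geometric_Gr_spc])

lemma geometric_Base: "geometric (Base f g)"
  by (rule geometric_subspc[OF geometric_prod_spc[OF geometric_Gr_spc geometric_Gr_spc]])

lemma topspace_Tot: "topspace (zar (Tot f g)) = St f g"
  by (auto simp: zar_subspc topspace_Gr_spc[OF Y] stratum_def)

lemma topspace_Base: "topspace (zar (Base f g)) = Psi X \<iota> \<pi> ` St f g"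
  using image_Psi[of f g]
  by (auto simp: zar_subspc topspace_prod_spc_geometric geometric_Gr_spc topspace_Gr_spc[OF X] topspace_Gr_spc[OF S])

end

context ext_chart
begin

definition base_chart :: "('i \<Rightarrow> nat) \<Rightarrow> ('i \<Rightarrow> nat) \<Rightarrow> (('i \<Rightarrow> 'x set) \<times> ('i \<Rightarrow> 's set)) set" where
  "base_chart f g = {x \<in> Psi X \<iota> \<pi> ` St f g. chart_pt x}"

definition base_coords :: "(('i \<Rightarrow> 'x set) \<times> ('i \<Rightarrow> 's set) \<Rightarrow> 'k) set" where
  "base_coords = (\<lambda>\<gamma> w. \<gamma> (fst w)) ` grass_coords Q X C' \<union> (\<lambda>\<gamma> w. \<gamma> (snd w)) ` grass_coords Q S C''"

lemma chart_Base: "chart (Base f g) (base_chart f g) base_coords"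
proof -
  let ?V = "(grass_chart Q X C' \<inter> Gr Q X f) \<times> (grass_chart Q S C'' \<inter> Gr Q S g)"
  have "chart (Base f g) (?V \<inter> Psi X \<iota> \<pi> ` St f g) base_coords"
    unfolding base_coords_def
    by (intro chart_subspc geometric_prod_spc chart_prod geometric_Gr_spc chart_Gr_spc Q X S)
  moreover have "?V \<inter> Psi X \<iota> \<pi> ` St f g = base_chart f g"
    unfolding base_chart_def image_Psi by (auto simp: chart_pt_def Gr_def)
  ultimately show ?thesis by simp
qed

definition tot_chart :: "('i \<Rightarrow> nat) \<Rightarrow> ('i \<Rightarrow> nat) \<Rightarrow> ('i \<Rightarrow> 'y set) set" where
  "tot_chart f g = {N \<in> St f g. chart_pt (Psi X \<iota> \<pi> N)}"

text \<open>
  The chart of the Grassmannian of \<open>Y\<close> given by \<open>D\<close>, cut down to the stratum, lies exactly over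
  the chart of pairs given by \<open>C'\<close> and \<open>C''\<close>; the dimension condition of the stratum enters
  through \<open>compl_D_converse\<close>.
\<close>

lemma chart_Tot:
  assumes f: "N0' \<in> Gr Q X f"
  shows "chart (Tot f g) (tot_chart f g) (grass_coords Q Y D)"
proof -
  have "chart (Tot f g) (grass_chart Q Y D \<inter> Gr Q Y (\<lambda>i. f i + g i) \<inter> St f g) (grass_coords Q Y D)"
    by (intro chart_subspc geometric_Gr_spc chart_Gr_spc Q Y)
  moreover have "grass_chart Q Y D \<inter> Gr Q Y (\<lambda>i. f i + g i) \<inter> St f g = tot_chart f g"
  proof (intro equalityI subsetI)
    fix N assume N: "N \<in> grass_chart Q Y D \<inter> Gr Q Y (\<lambda>i. f i + g i) \<inter> St f g"
    then have sN: "N \<in> St f g" by blast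
    note sD = stratumD[OF sN]
    have "compl (scl X) (fst (Psi X \<iota> \<pi> N) i) (C' i) (spc X i) \<and> compl (scl S) (snd (Psi X \<iota> \<pi> N) i) (C'' i) (spc S i)"
      if i: "i \<in> verts Q" for i
    proof -
      have c: "compl (scl Y) (N i) (D i) (spc Y i)" using N i by (auto simp: grass_chart_def)
      have "X.dim {x \<in> spc X i. \<iota> i x \<in> N i} = X.dim (N0' i)"
        using sD(2) f i by (simp add: Gr_def dimvec_def Psi_def)
      from compl_D_converse[OF sD(1) i c this] show ?thesis by (simp add: Psi_def)
    qed
    then show "N \<in> tot_chart f g"
      using sN sD by (simp add: tot_chart_def chart_pt_def grass_chart_def Gr_def)
  next
    fix N assume "N \<in> tot_chart f g"
    then have N: "N \<in> St f g" "chart_pt (Psi X \<iota> \<pi> N)" by (auto simp: tot_chart_def)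
    then have "N \<in> grass_chart Q Y D" using Psi_chart(3)[OF N(2) stratumD(1)[OF N(1)]] by (simp add: grass_chart_def)
    then show "N \<in> grass_chart Q Y D \<inter> Gr Q Y (\<lambda>i. f i + g i) \<inter> St f g" using N by (simp add: stratum_def)
  qed
  ultimately show ?thesis by simp
qed

text \<open>
  Projections along the members of \<open>\<Psi> N\<close> are the components of the projection along \<open>N\<close>, by
  \<open>cproj_D\<close>.
\<close>

lemma base_coords_Psi:
  assumes "\<gamma> \<in> base_coords"
  shows "\<exists>\<delta>\<in>grass_coords Q Y D. \<forall>N\<in>tot_chart f g. \<gamma> (Psi X \<iota> \<pi> N) = \<delta> N"
  using assms unfolding base_coords_def
proof
  assume "\<gamma> \<in> (\<lambda>\<gamma> w. \<gamma> (fst w)) ` grass_coords Q X C'"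
  then obtain l i w where l: "\<gamma> = (\<lambda>x. l (cproj (fst x i) (C' i) w))" "i \<in> verts Q" "w \<in> spc X i"
    "linear_btw (scl X) (*) (spc X i) UNIV l" unfolding grass_coords_def by blast
  let ?\<delta> = "\<lambda>N. l (\<rho> i (cproj (N i) (D i) (\<iota> i w)))"
  have \<delta>: "?\<delta> \<in> grass_coords Q Y D"
    using grass_coordsI[OF l(2) conjunct1[OF \<iota>_mem[OF l(2,3)]] linear_btw_comp[OF \<rho>_linear[OF l(2)] l(4)]] .
  have "\<gamma> (Psi X \<iota> \<pi> N) = ?\<delta> N" if "N \<in> tot_chart f g" for N
  proof -
    have N: "N \<in> St f g" "chart_pt (Psi X \<iota> \<pi> N)" using that by (auto simp: tot_chart_def)
    note c = Psi_chart[OF N(2) stratumD(1)[OF N(1)] l(2)]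
    have "cproj {x \<in> spc X i. \<iota> i x \<in> N i} (C' i) w \<in> spc X i"
      using cproj_mem(1)[OF X.vector_space_axioms c(1) l(3)] C_sub(2)[OF l(2)] by blast
    then show ?thesis
      using cproj_D(1)[where N = N, OF l(2) c(3) l(3) c(1)] coordinates_\<iota>[OF l(2)] by (simp add: l(1) Psi_def)
  qed
  then show ?thesis by (intro bexI[OF _ \<delta>]) blast
next
  assume "\<gamma> \<in> (\<lambda>\<gamma> w. \<gamma> (snd w)) ` grass_coords Q S C''"
  then obtain l i w where l: "\<gamma> = (\<lambda>x. l (cproj (snd x i) (C'' i) w))" "i \<in> verts Q" "w \<in> spc S i"
    "linear_btw (scl S) (*) (spc S i) UNIV l" unfolding grass_coords_def by blast
  let ?\<delta> = "\<lambda>N. l (\<pi> i (cproj (N i) (D i) (\<sigma> i w)))"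
  note \<sigma>w = conjunct2[OF coordinates_\<sigma>[OF l(2,3)]]
  have \<delta>: "?\<delta> \<in> grass_coords Q Y D"
    using grass_coordsI[OF l(2) \<sigma>w linear_btw_comp[OF E(2)[OF l(2)] l(4)]] .
  have "\<gamma> (Psi X \<iota> \<pi> N) = ?\<delta> N" if "N \<in> tot_chart f g" for N
  proof -
    have N: "N \<in> St f g" "chart_pt (Psi X \<iota> \<pi> N)" using that by (auto simp: tot_chart_def)
    note c = Psi_chart[OF N(2) stratumD(1)[OF N(1)] l(2)]
    show ?thesis
      using cproj_D(2)[where N = N, OF l(2) c(3) \<sigma>w c(2)] \<pi>\<sigma>[OF l(2,3)] by (simp add: l(1) Psi_def)
  qed
  then show ?thesis by (intro bexI[OF _ \<delta>]) blast
qed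

lemma base_coordI':
  "i \<in> verts Q \<Longrightarrow> w \<in> spc X i \<Longrightarrow> linear_btw (scl X) (*) (spc X i) UNIV l \<Longrightarrow>
    (\<lambda>x. l (cproj (fst x i) (C' i) w)) \<in> poly_funs base_coords"
  unfolding base_coords_def by (intro poly_funs.coord UnI1 image_eqI[OF _ grass_coordsI]) auto

lemma base_coordI'':
  "i \<in> verts Q \<Longrightarrow> w \<in> spc S i \<Longrightarrow> linear_btw (scl S) (*) (spc S i) UNIV l \<Longrightarrow>
    (\<lambda>x. l (cproj (snd x i) (C'' i) w)) \<in> poly_funs base_coords"
  unfolding base_coords_def by (intro poly_funs.coord UnI2 image_eqI[OF _ grass_coordsI]) auto

lemma fd_N0'': "i \<in> verts Q \<Longrightarrow> fd_sub (scl S) (N0'' i)"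
  using fd_sub_subset[OF S.vector_space_axioms fd_rep_fd_sub[OF S]] subrep_subspace[OF N0''] by blast

lemma fd_C': "i \<in> verts Q \<Longrightarrow> fd_sub (scl X) (C' i)"
  using fd_sub_subset[OF X.vector_space_axioms fd_rep_fd_sub[OF X]] C_sub(1,2) by blast

lemma F1_functional_poly:
  assumes "linear_btw (fam_scale (scl X)) (*) F1 UNIV \<mu>" "\<And>x. x \<in> T \<Longrightarrow> \<Omega> x \<in> F1"
    and "\<And>\<alpha> w l. \<alpha> \<in> arcs Q \<Longrightarrow> w \<in> N0'' (tail Q \<alpha>) \<Longrightarrow> linear_btw (scl X) (*) (spc X (head Q \<alpha>)) UNIV l \<Longrightarrow>
        \<exists>p\<in>poly_funs C. \<forall>x\<in>T. p x = l (\<Omega> x \<alpha> w)"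
  shows "\<exists>p\<in>poly_funs C. \<forall>x\<in>T. p x = \<mu> (\<Omega> x)"
proof (rule hom_fam_functional_poly[OF S.vector_space_axioms X.vector_space_axioms finite_arcs _ _ assms(1,2)[unfolded F1_def]])
  fix \<alpha> v l assume a: "\<alpha> \<in> arcs Q" and v: "v \<in> N0'' (tail Q \<alpha>)" and l: "linear_btw (scl X) (*) (C' (head Q \<alpha>)) UNIV l"
  obtain l' where l': "linear_btw (scl X) (*) (spc X (head Q \<alpha>)) UNIV l'" "\<And>c. c \<in> C' (head Q \<alpha>) \<Longrightarrow> l' c = l c"
    using functional_extend[OF X.vector_space_axioms C_sub(1)[OF head_in_verts[OF a]] l] by blast
  have "\<Omega> x \<alpha> v \<in> C' (head Q \<alpha>)" if "x \<in> T" for x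
    using assms(2)[OF that] a v linear_btwD(1)[of "scl S" "scl X" "N0'' (tail Q \<alpha>)" "C' (head Q \<alpha>)" "\<Omega> x \<alpha>"]
    by (simp add: F1_def hom_fam_def)
  then show "\<exists>p\<in>poly_funs C. \<forall>x\<in>T. p x = l (\<Omega> x \<alpha> v)"
    using assms(3)[OF a v l'(1)] l'(2) by simp
qed (use fd_N0'' fd_C' in auto)

text \<open>
  For a fixed \<open>\<psi>\<close>, one term of \<open>L x \<psi>\<close> involves only the projection along \<open>fst x\<close>, the other
  only the one along \<open>snd x\<close>.
\<close>

lemma L_poly:
  assumes \<mu>: "linear_btw (fam_scale (scl X)) (*) F1 UNIV \<mu>" and \<psi>: "\<psi> \<in> F"
  shows "\<exists>p\<in>poly_funs base_coords. \<forall>x\<in>Collect chart_pt. p x = \<mu> (L x \<psi>)"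
proof (rule F1_functional_poly[OF \<mu>])
  show "L x \<psi> \<in> F1" if "x \<in> Collect chart_pt" for x using L_in_F1[OF _ \<psi>] that by simp
  fix \<alpha> w l assume a: "\<alpha> \<in> arcs Q" and w: "w \<in> N0'' (tail Q \<alpha>)" and l: "linear_btw (scl X) (*) (spc X (head Q \<alpha>)) UNIV l"
  have h: "head Q \<alpha> \<in> verts Q" and t: "tail Q \<alpha> \<in> verts Q" using a by auto
  have wS: "w \<in> spc S (tail Q \<alpha>)" by (rule base_sub[OF t w])
  have pw: "\<psi> (tail Q \<alpha>) w \<in> spc X (tail Q \<alpha>)" using linear_btwD(1)[OF F_D(1)[OF \<psi> t] w] C_sub(2)[OF t] by blast
  have Ap: "act X \<alpha> (\<psi> (tail Q \<alpha>) w) \<in> spc X (head Q \<alpha>)" using linear_btwD(1)[OF XD(2)[OF a] pw] .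
  define m where "m s = l (\<psi> (head Q \<alpha>) (\<beta> (head Q \<alpha>) (act S \<alpha> s)))" for s
  have lC: "linear_btw (scl X) (*) (C' (head Q \<alpha>)) UNIV l" by (rule linear_btw_mono[OF l C_sub(2)[OF h]]) auto
  have m: "linear_btw (scl S) (*) (spc S (tail Q \<alpha>)) UNIV m"
    unfolding m_def using linear_btw_comp[OF SD(2)[OF a] linear_btw_comp[OF F\<beta>_linear[OF \<psi> h] lC]] .
  let ?p = "\<lambda>x. l (cproj (fst x (head Q \<alpha>)) (C' (head Q \<alpha>)) (act X \<alpha> (\<psi> (tail Q \<alpha>) w))) -
      (m w - m (cproj (snd x (tail Q \<alpha>)) (C'' (tail Q \<alpha>)) w))"
  have p: "?p \<in> poly_funs base_coords"
    by (intro poly_funs_minus poly_funs.const base_coordI'[OF h Ap l] base_coordI''[OF t wS m])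
  have "?p x = l (L x \<psi> \<alpha> w)" if x: "chart_pt x" for x
  proof -
    let ?w = "cproj (snd x (tail Q \<alpha>)) (C'' (tail Q \<alpha>)) w"
    have cS: "?w \<in> spc S (tail Q \<alpha>)" using linear_btwD(1)[OF q''_linear[OF x t] wS] C_sub(4)[OF t] by blast
    have dS: "act S \<alpha> (w - ?w) \<in> spc S (head Q \<alpha>)"
      using linear_btwD(1)[OF SD(2)[OF a] S.subspace_diff[OF SD(1)[OF t] wS cS]] .
    have 1: "cproj (fst x (head Q \<alpha>)) (C' (head Q \<alpha>)) (act X \<alpha> (\<psi> (tail Q \<alpha>) w)) \<in> C' (head Q \<alpha>)"
      using linear_btwD(1)[OF q'_linear[OF x h] Ap] .
    have 2: "\<psi> (head Q \<alpha>) (\<beta> (head Q \<alpha>) (act S \<alpha> (w - ?w))) \<in> C' (head Q \<alpha>)"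
      using linear_btwD(1)[OF F\<beta>_linear[OF \<psi> h] dS] .
    have "m w - m ?w = m (w - ?w)" using linear_btw_diff[OF m S.module_axioms SD(1)[OF t] wS cS] by simp
    then show ?thesis
      using linear_btw_diff[OF lC X.module_axioms C_sub(1)[OF h] 1 2] a w by (simp add: L_def m_def)
  qed
  then show "\<exists>p\<in>poly_funs base_coords. \<forall>x\<in>Collect chart_pt. p x = l (L x \<psi> \<alpha> w)"
    by (intro bexI[OF _ p]) blast
qed

text \<open>
  Here the two projections are composed; expanding the inner one in a basis of the space of \<open>S\<close>
  gives products of coordinates of both kinds.
\<close>

lemma Rh_poly:
  assumes \<mu>: "linear_btw (fam_scale (scl X)) (*) F1 UNIV \<mu>"
  shows "\<exists>p\<in>poly_funs base_coords. \<forall>x\<in>Collect chart_pt. p x = \<mu> (Rh x)"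
proof (rule F1_functional_poly[OF \<mu>])
  show "Rh x \<in> F1" if "x \<in> Collect chart_pt" for x using Rh_in_F1 that by simp
  fix \<alpha> w l assume a: "\<alpha> \<in> arcs Q" and w: "w \<in> N0'' (tail Q \<alpha>)" and l: "linear_btw (scl X) (*) (spc X (head Q \<alpha>)) UNIV l"
  have h: "head Q \<alpha> \<in> verts Q" and t: "tail Q \<alpha> \<in> verts Q" using a by auto
  have wS: "w \<in> spc S (tail Q \<alpha>)" by (rule base_sub[OF t w])
  obtain e \<kappa> where c: "coords (scl S) (spc S (tail Q \<alpha>)) {..<S.dim (spc S (tail Q \<alpha>))} e \<kappa>"
    using coords_exist[OF S.vector_space_axioms fd_rep_fd_sub[OF S t]] by blast
  note zl = arrD[OF arr_z a]
  let ?I = "{..<S.dim (spc S (tail Q \<alpha>))}"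
  let ?q = "\<lambda>x. cproj (fst x (head Q \<alpha>)) (C' (head Q \<alpha>))" and ?c = "\<lambda>x. cproj (snd x (tail Q \<alpha>)) (C'' (tail Q \<alpha>)) w"
  let ?p = "\<lambda>x. l (?q x (z \<alpha> w)) - (\<Sum>i\<in>?I. \<kappa> i (?c x) * l (?q x (z \<alpha> (e i))))"
  have zX: "z \<alpha> s \<in> spc X (head Q \<alpha>)" if "s \<in> spc S (tail Q \<alpha>)" for s using linear_btwD(1)[OF zl that] .
  have p: "?p \<in> poly_funs base_coords"
    by (intro poly_funs_minus poly_funs_sum poly_funs.mult base_coordI'[OF h zX[OF wS] l]
        base_coordI'[OF h zX[OF coordsD(2)[OF c]] l] base_coordI''[OF t wS coordsD(3)[OF c]])
  have "?p x = l (Rh x \<alpha> w)" if x: "chart_pt x" for x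
  proof -
    have cS: "?c x \<in> spc S (tail Q \<alpha>)" using linear_btwD(1)[OF q''_linear[OF x t] wS] C_sub(4)[OF t] by blast
    have lC: "linear_btw (scl X) (*) (C' (head Q \<alpha>)) UNIV l" by (rule linear_btw_mono[OF l C_sub(2)[OF h]]) auto
    have lz: "linear_btw (scl S) (*) (spc S (tail Q \<alpha>)) UNIV (\<lambda>s. l (?q x (z \<alpha> s)))"
      using linear_btw_comp[OF zl linear_btw_comp[OF q'_linear[OF x h] lC]] .
    have "l (?q x (z \<alpha> (w - ?c x))) = l (?q x (z \<alpha> w)) - l (?q x (z \<alpha> (?c x)))"
      by (rule linear_btw_diff[OF lz S.module_axioms SD(1)[OF t] wS cS])
    also have "l (?q x (z \<alpha> (?c x))) = (\<Sum>i\<in>?I. \<kappa> i (?c x) * l (?q x (z \<alpha> (e i))))"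
      by (rule linear_btw_expand[OF c S.module_axioms SD(1)[OF t] lz cS])
    finally show ?thesis using a w by (simp add: Rh_def)
  qed
  then show "\<exists>p\<in>poly_funs base_coords. \<forall>x\<in>Collect chart_pt. p x = l (Rh x \<alpha> w)"
    by (intro bexI[OF _ p]) blast
qed

lemma psi_poly:
  assumes \<mu>: "linear_btw (fam_scale (scl X)) (*) F UNIV \<mu>"
  shows "\<exists>p\<in>poly_funs (grass_coords Q Y D). \<forall>N\<in>tot_chart f g. p N = \<mu> (psi N)"
proof (rule hom_fam_functional_poly[OF S.vector_space_axioms X.vector_space_axioms finite_verts _ _ \<mu>[unfolded F_def]])
  show "psi N \<in> hom_fam (verts Q) (scl S) (scl X) N0'' C'" if "N \<in> tot_chart f g" for N
    unfolding F_def[symmetric] using that by (intro psi_F stratumD(1)[of N f g]) (simp_all add: tot_chart_def)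
  fix i v l assume i: "i \<in> verts Q" and v: "v \<in> N0'' i" and l: "linear_btw (scl X) (*) (C' i) UNIV l"
  obtain l' where l': "linear_btw (scl X) (*) (spc X i) UNIV l'" "\<And>c. c \<in> C' i \<Longrightarrow> l' c = l c"
    using functional_extend[OF X.vector_space_axioms C_sub(1)[OF i] l] by blast
  note \<sigma>v = conjunct2[OF coordinates_\<sigma>[OF i base_sub[OF i v]]]
  let ?\<delta> = "\<lambda>N. l' (\<rho> i (cproj (N i) (D i) (\<sigma> i v)))"
  have "?\<delta> \<in> poly_funs (grass_coords Q Y D)"
    by (intro poly_funs.coord grass_coordsI[OF i \<sigma>v linear_btw_comp[OF \<rho>_linear[OF i] l'(1)]])
  moreover have "?\<delta> N = l (psi N i v)" if "N \<in> tot_chart f g" for N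
  proof -
    have N: "N \<in> St f g" "chart_pt (Psi X \<iota> \<pi> N)" using that by (auto simp: tot_chart_def)
    have "psi N i v \<in> C' i" using linear_btwD(1)[OF F_D(1)[OF psi_F[OF stratumD(1)[OF N(1)] N(2)] i] v] .
    then show ?thesis using l'(2) i v by (simp add: psi_def)
  qed
  ultimately show "\<exists>p\<in>poly_funs (grass_coords Q Y D). \<forall>N\<in>tot_chart f g. p N = l (psi N i v)"
    by (intro bexI[of _ ?\<delta>] ballI)
qed (use fd_N0'' fd_C' in auto)

lemma subspace_F: "module.subspace (fam_scale (scl X)) F"
  unfolding F_def by (rule subspace_hom_fam[OF S.vector_space_axioms X.vector_space_axioms])
    (use fd_subD[OF fd_N0''] fd_subD[OF fd_C'] in blast)+

lemma subspace_F1: "module.subspace (fam_scale (scl X)) F1"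
  unfolding F1_def by (rule subspace_hom_fam[OF S.vector_space_axioms X.vector_space_axioms])
    (use fd_subD[OF fd_N0''] fd_subD[OF fd_C'] in auto)

lemma vs_fam: "vector_space (fam_scale (scl X) :: 'k \<Rightarrow> ('j \<Rightarrow> 's \<Rightarrow> 'x) \<Rightarrow> _)"
  by (rule vector_space_fam_scale[OF X.vector_space_axioms])

lemma F_dim:
  shows "fd_sub (fam_scale (scl X)) F"
    "vector_space.dim (fam_scale (scl X)) F = (\<Sum>i\<in>verts Q. S.dim (N0'' i) * X.dim (C' i))"
proof -
  have "\<exists>I E \<kappa>. coords (fam_scale (scl X)) F (I :: ('i \<times> nat \<times> nat) set) E \<kappa> \<and>
     card I = (\<Sum>i\<in>verts Q. S.dim (N0'' i) * X.dim (C' i)) \<and>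
     (\<forall>k\<in>I. \<exists>i\<in>verts Q. \<exists>v\<in>N0'' i. \<exists>l. linear_btw (scl X) (*) (C' i) UNIV l \<and> (\<forall>\<psi>. \<kappa> k \<psi> = l (\<psi> i v)))"
    unfolding F_def by (rule coords_hom_fam[OF S.vector_space_axioms X.vector_space_axioms finite_verts fd_N0'' fd_C'])
  then obtain I :: "('i \<times> nat \<times> nat) set" and E \<kappa> where c: "coords (fam_scale (scl X)) F I E \<kappa>"
    "card I = (\<Sum>i\<in>verts Q. S.dim (N0'' i) * X.dim (C' i))"
    by (elim exE conjE) (rule that)
  show "fd_sub (fam_scale (scl X)) F"
    "vector_space.dim (fam_scale (scl X)) F = (\<Sum>i\<in>verts Q. S.dim (N0'' i) * X.dim (C' i))"
    using coords_dim[OF vs_fam subspace_F c(1)] c(2) by auto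
qed

lemma F1_dim:
  shows "fd_sub (fam_scale (scl X)) F1"
    "vector_space.dim (fam_scale (scl X)) F1 = (\<Sum>\<alpha>\<in>arcs Q. S.dim (N0'' (tail Q \<alpha>)) * X.dim (C' (head Q \<alpha>)))"
proof -
  have fd: "fd_sub (scl S) (N0'' (tail Q \<alpha>))" "fd_sub (scl X) (C' (head Q \<alpha>))" if "\<alpha> \<in> arcs Q" for \<alpha>
    using fd_N0''[OF tail_in_verts[OF that]] fd_C'[OF head_in_verts[OF that]] .
  have "\<exists>I E \<kappa>. coords (fam_scale (scl X)) F1 (I :: ('a \<times> nat \<times> nat) set) E \<kappa> \<and>
     card I = (\<Sum>\<alpha>\<in>arcs Q. S.dim (N0'' (tail Q \<alpha>)) * X.dim (C' (head Q \<alpha>))) \<and>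
     (\<forall>k\<in>I. \<exists>\<alpha>\<in>arcs Q. \<exists>v\<in>N0'' (tail Q \<alpha>). \<exists>l. linear_btw (scl X) (*) (C' (head Q \<alpha>)) UNIV l \<and> (\<forall>\<psi>. \<kappa> k \<psi> = l (\<psi> \<alpha> v)))"
    unfolding F1_def by (rule coords_hom_fam[OF S.vector_space_axioms X.vector_space_axioms finite_arcs fd])
  then obtain I :: "('a \<times> nat \<times> nat) set" and E \<kappa> where c: "coords (fam_scale (scl X)) F1 I E \<kappa>"
    "card I = (\<Sum>\<alpha>\<in>arcs Q. S.dim (N0'' (tail Q \<alpha>)) * X.dim (C' (head Q \<alpha>)))"
    by (elim exE conjE) (rule that)
  show "fd_sub (fam_scale (scl X)) F1"
    "vector_space.dim (fam_scale (scl X)) F1 = (\<Sum>\<alpha>\<in>arcs Q. S.dim (N0'' (tail Q \<alpha>)) * X.dim (C' (head Q \<alpha>)))"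
    using coords_dim[OF vs_fam subspace_F1 c(1)] c(2) by auto
qed

text \<open>
  A basis of the kernel of \<open>L\<close> at the base point, followed by preimages of a basis of \<open>F1\<close>. In
  these coordinates the last \<open>r\<close> columns of the matrix of \<open>L\<close> form the identity matrix at the
  base point.
\<close>

lemma adapted_coordinates:
  assumes sp: "split N0' N0''"
  obtains n r :: nat and H \<kappa> G \<mu> where "coords (fam_scale (scl X)) F {..<n + r} H \<kappa>"
    "coords (fam_scale (scl X)) F1 {..<r} G \<mu>"
    "\<And>j. j < r \<Longrightarrow> L (N0', N0'') (H (n + j)) = G j"
    "n + r = (\<Sum>i\<in>verts Q. S.dim (N0'' i) * X.dim (C' i))"
    "r = (\<Sum>\<alpha>\<in>arcs Q. S.dim (N0'' (tail Q \<alpha>)) * X.dim (C' (head Q \<alpha>)))"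
proof -
  interpret f: vector_space "fam_scale (scl X) :: 'k \<Rightarrow> ('i \<Rightarrow> 's \<Rightarrow> 'x) \<Rightarrow> _" by (rule vs_fam)
  interpret f1: vector_space "fam_scale (scl X) :: 'k \<Rightarrow> ('a \<Rightarrow> 's \<Rightarrow> 'x) \<Rightarrow> _" by (rule vs_fam)
  let ?L = "L (N0', N0'')"
  note l = L_linear[OF base_pt]
  have im: "?L ` F = F1" using L_base_surj[OF sp] linear_btwD(1)[OF l] by blast
  have "fd_sub (fam_scale (scl X)) {\<psi> \<in> F. ?L \<psi> = 0}"
    by (rule fd_sub_subset[OF vs_fam F_dim(1) subspace_linear_btw(1)[OF f.module_axioms f1.module_axioms subspace_F l]]) auto
  define n where "n = f.dim {\<psi> \<in> F. ?L \<psi> = 0}"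
  define r where "r = f1.dim F1"
  obtain E \<epsilon> where K: "coords (fam_scale (scl X)) {\<psi> \<in> F. ?L \<psi> = 0} {..<n} E \<epsilon>"
    using coords_exist[OF vs_fam \<open>fd_sub _ {\<psi> \<in> F. ?L \<psi> = 0}\<close>] unfolding n_def by blast
  obtain G \<mu> where G: "coords (fam_scale (scl X)) F1 {..<r} G \<mu>"
    using coords_exist[OF vs_fam F1_dim(1)] unfolding r_def by blast
  have "\<exists>h. h \<in> F \<and> ?L h = G j" if "j < r" for j
    using L_base_surj[OF sp coordsD(2)[OF G]] that by blast
  then obtain h where h: "\<And>j. j < r \<Longrightarrow> h j \<in> F \<and> ?L (h j) = G j" by metis
  have G': "coords (fam_scale (scl X)) (?L ` F) {..<r} G \<mu>" using G im by simp
  note c = coords_exact[OF vs_fam vs_fam subspace_F l K G' h]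
  show thesis
  proof (rule that[OF c G])
    show "?L (if n + j < n then E (n + j) else h (n + j - n)) = G j" if "j < r" for j
      using h[OF that] by simp
    show "n + r = (\<Sum>i\<in>verts Q. S.dim (N0'' i) * X.dim (C' i))"
      using coords_dim(1)[OF vs_fam subspace_F c] F_dim(2) by simp
    show "r = (\<Sum>\<alpha>\<in>arcs Q. S.dim (N0'' (tail Q \<alpha>)) * X.dim (C' (head Q \<alpha>)))"
      using F1_dim(2) by (simp add: r_def)
  qed
qed

end

context ext_bundle
begin

text \<open>
  Near a point of the image, use the chart based at that point.
\<close>

lemma Psi_morphism: "morphism (Tot f g) (Base f g) (Psi X \<iota> \<pi>)"
proof (rule morphism_chartI[OF geometric_Tot geometric_Base])
  show "Psi X \<iota> \<pi> N \<in> topspace (zar (Base f g))" if "N \<in> topspace (zar (Tot f g))" for N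
    using that unfolding topspace_Tot topspace_Base by (rule imageI)
  fix b assume "b \<in> topspace (zar (Base f g))"
  then have bP: "b \<in> Psi X \<iota> \<pi> ` St f g" unfolding topspace_Base .
  then obtain N where N: "N \<in> St f g" "b = Psi X \<iota> \<pi> N" by (elim imageE) (rule that)
  note sN = stratumD[OF N(1), folded N(2)]
  have sub: "subrep Q X (fst b)" "subrep Q S (snd b)" using Psi_subrep[OF sN(1), folded N(2)] .
  obtain C' C'' where "ext_chart Q X S z Y \<iota> \<pi> \<sigma> (fst b) C' (snd b) C''"
    using ext_chart_exists[OF sub] by (elim exE) (rule that)
  then interpret c: ext_chart Q X S z Y \<iota> \<pi> \<sigma> "fst b" C' "snd b" C'' .
  have e: "{N \<in> topspace (zar (Tot f g)). Psi X \<iota> \<pi> N \<in> c.base_chart f g} = c.tot_chart f g"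
    unfolding topspace_Tot c.base_chart_def c.tot_chart_def by blast
  note ch = c.chart_Tot[OF sN(2)]
  have reg: "(\<lambda>N. \<gamma> (Psi X \<iota> \<pi> N)) \<in> reg (Tot f g) (c.tot_chart f g)" if \<gamma>: "\<gamma> \<in> c.base_coords" for \<gamma>
  proof -
    from c.base_coords_Psi[OF \<gamma>, where f = f and g = g] obtain \<delta> where \<delta>: "\<delta> \<in> grass_coords Q Y c.D"
      "\<forall>N\<in>c.tot_chart f g. \<gamma> (Psi X \<iota> \<pi> N) = \<delta> N" by (elim bexE) (rule that)
    show ?thesis
      by (rule chart_poly_reg[OF geometric_Tot ch poly_funs.coord[OF \<delta>(1)] bspec[OF \<delta>(2)]])
  qed
  show "\<exists>V C. chart (Base f g) V C \<and> b \<in> V \<and>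
       openin (zar (Tot f g)) {N \<in> topspace (zar (Tot f g)). Psi X \<iota> \<pi> N \<in> V} \<and>
       (\<forall>\<gamma>\<in>C. (\<lambda>N. \<gamma> (Psi X \<iota> \<pi> N)) \<in> reg (Tot f g) {N \<in> topspace (zar (Tot f g)). Psi X \<iota> \<pi> N \<in> V})"
  proof (intro exI conjI)
    show "chart (Base f g) (c.base_chart f g) c.base_coords" by (rule c.chart_Base)
    show "b \<in> c.base_chart f g" using bP c.base_pt by (simp add: c.base_chart_def)
    show "openin (zar (Tot f g)) {N \<in> topspace (zar (Tot f g)). Psi X \<iota> \<pi> N \<in> c.base_chart f g}"
      unfolding e by (rule chartD(1)[OF ch])
    show "\<forall>\<gamma>\<in>c.base_coords. (\<lambda>N. \<gamma> (Psi X \<iota> \<pi> N)) \<in> reg (Tot f g)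
        {N \<in> topspace (zar (Tot f g)). Psi X \<iota> \<pi> N \<in> c.base_chart f g}"
      unfolding e using reg by (rule ballI)
  qed
qed

end

section \<open>Solving a linear system whose coefficients depend on parameters\<close>

text \<open>
  Cramer's rule with \<open>n\<close> free unknowns \<open>u\<close>: the matrix has the block \<open>K\<close> in front of a square
  block with determinant \<open>d\<close> and adjugate \<open>a\<close>, and \<open>b\<close> is the right-hand side.
\<close>

definition solution_coeff :: "nat \<Rightarrow> nat \<Rightarrow> (nat \<Rightarrow> nat \<Rightarrow> 'k::field) \<Rightarrow> 'k \<Rightarrow> (nat \<Rightarrow> nat \<Rightarrow> 'k) \<Rightarrow> (nat \<Rightarrow> 'k)
    \<Rightarrow> (nat \<Rightarrow> 'k) \<Rightarrow> nat \<Rightarrow> 'k" where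
  "solution_coeff n r a d K b u k =
     (if k < n then u k else (\<Sum>j<r. a (k - n) j * (b j - (\<Sum>i<n. u i * K j i))) * inverse d)"

lemma linear_system_solution:
  fixes L :: "'v::ab_group_add \<Rightarrow> 'w::ab_group_add" and n r :: nat and A :: "nat \<Rightarrow> nat \<Rightarrow> 'k::field"
  assumes s: "vector_space s" and t: "vector_space t" and V: "module.subspace s V"
    and L: "linear_btw s t V W L" and H: "coords s V {..<n + r} H \<kappa>" and G: "coords t W {..<r} G \<mu>"
    and w: "w \<in> W"
    and A: "\<And>j l. j < r \<Longrightarrow> l < r \<Longrightarrow> A j l = \<mu> j (L (H (n + l)))"
    and K: "\<And>j k. j < r \<Longrightarrow> k < n \<Longrightarrow> K j k = \<mu> j (L (H k))"
    and b: "\<And>j. j < r \<Longrightarrow> b j = \<mu> j w"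
    and Aa: "\<And>i j. i < r \<Longrightarrow> j < r \<Longrightarrow> (\<Sum>k<r. A i k * a k j) = (if i = j then d else 0)"
    and aA: "\<And>i j. i < r \<Longrightarrow> j < r \<Longrightarrow> (\<Sum>k<r. a i k * A k j) = (if i = j then d else 0)"
    and d: "d \<noteq> 0"
  defines "sol \<equiv> \<lambda>u. \<Sum>k<n + r. s (solution_coeff n r a d K b u k) (H k)"
  shows "sol u \<in> V" "L (sol u) = w" "\<And>k. k < n \<Longrightarrow> \<kappa> k (sol u) = u k"
    "\<psi> \<in> V \<Longrightarrow> L \<psi> = w \<Longrightarrow> (\<And>k. k < n \<Longrightarrow> u k = \<kappa> k \<psi>) \<Longrightarrow> sol u = \<psi>"
proof -
  interpret vector_space s by fact
  note h = coordsD[OF H]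
  let ?c = "solution_coeff n r a d K b u" and ?y = "\<lambda>j. b j - (\<Sum>i<n. u i * K j i)"
  show m: "sol u \<in> V" unfolding sol_def by (intro subspace_sum[OF V] subspace_scale[OF V] h(2)) auto
  show \<kappa>: "\<kappa> k (sol u) = u k" if "k < n" for k
    unfolding sol_def using coords_comb[OF H module_axioms V, of k ?c] that by (simp add: solution_coeff_def)
  have \<mu>L: "\<mu> j (L (\<Sum>k<n + r. s (c k) (H k))) = (\<Sum>k<n. c k * K j k) + (\<Sum>l<r. A j l * c (n + l))" if j: "j < r" for j c
  proof -
    have l: "linear_btw s (*) V UNIV (\<lambda>v. \<mu> j (L v))" by (rule linear_btw_comp[OF L coordsD(3)[OF G]]) (use j in simp)
    have "\<mu> j (L (\<Sum>k<n + r. s (c k) (H k))) = (\<Sum>k<n + r. c k * \<mu> j (L (H k)))"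
      by (rule linear_btw_lincomb[OF l module_axioms V]) (use h(2) in simp)
    then show ?thesis using A[OF j] K[OF j] by (simp add: sum_lessThan_add_split mult.commute)
  qed
  show "L (sol u) = w"
  proof (rule coords_eqI[OF G linear_btwD(1)[OF L m] w])
    fix j assume "j \<in> {..<r}"
    then have j: "j < r" by simp
    have "(\<Sum>l<r. A j l * ?c (n + l)) = (\<Sum>l<r. \<Sum>i<r. (A j l * a l i) * (?y i * inverse d))"
      by (simp add: solution_coeff_def sum_distrib_left sum_distrib_right algebra_simps)
    also have "\<dots> = (\<Sum>i<r. (\<Sum>l<r. A j l * a l i) * (?y i * inverse d))"
      unfolding sum_distrib_right by (rule sum.swap)
    also have "\<dots> = (\<Sum>i<r. if i = j then ?y j else 0)"
      using Aa[OF j] d by (intro sum.cong) auto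
    also have "\<dots> = ?y j" using j by simp
    finally show "\<mu> j (L (sol u)) = \<mu> j w"
      unfolding sol_def \<mu>L[OF j] using b[OF j] by (simp add: solution_coeff_def)
  qed
  show "sol u = \<psi>" if \<psi>: "\<psi> \<in> V" "L \<psi> = w" and u: "\<And>k. k < n \<Longrightarrow> u k = \<kappa> k \<psi>"
  proof (rule coords_eqI[OF H m \<psi>(1)])
    fix k assume k: "k \<in> {..<n + r}"
    have e: "\<psi> = (\<Sum>k<n + r. s (\<kappa> k \<psi>) (H k))" using h(4)[OF \<psi>(1)] by simp
    show "\<kappa> k (sol u) = \<kappa> k \<psi>"
    proof (cases "k < n")
      case True
      then show ?thesis using \<kappa> u by simp
    next
      case False
      define m where "m = k - n"
      have m: "k = n + m" "m < r" using False k by (auto simp: m_def)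
      have y: "?y j = (\<Sum>l<r. A j l * \<kappa> (n + l) \<psi>)" if j: "j < r" for j
        using \<mu>L[OF j, of "\<lambda>k. \<kappa> k \<psi>"] e \<psi>(2) b[OF j] u by simp
      have "(\<Sum>j<r. a m j * ?y j) = (\<Sum>j<r. \<Sum>l<r. (a m j * A j l) * \<kappa> (n + l) \<psi>)"
        using y by (simp add: sum_distrib_left mult.assoc)
      also have "\<dots> = (\<Sum>l<r. (\<Sum>j<r. a m j * A j l) * \<kappa> (n + l) \<psi>)"
        unfolding sum_distrib_right by (rule sum.swap)
      also have "\<dots> = (\<Sum>l<r. if l = m then d * \<kappa> (n + m) \<psi> else 0)"
        using aA[OF m(2)] by (intro sum.cong) auto
      also have "\<dots> = d * \<kappa> k \<psi>" using m by simp
      finally have "?c k = \<kappa> k \<psi>" using d m by (simp add: solution_coeff_def)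
      then show ?thesis
        unfolding sol_def using coords_comb[OF H module_axioms V, of k ?c] k by simp
    qed
  qed
qed

section \<open>A trivialisation near a point of the base\<close>

text \<open>
  The matrix of the linear system over the chart in adapted coordinates: \<open>K\<close> is its part for the
  free unknowns, \<open>A\<close> the square part, \<open>d\<close> and \<open>a\<close> are the determinant and the adjugate of \<open>A\<close>,
  and \<open>b\<close> is the right-hand side. All are polynomials in the coordinates of the base.
\<close>

locale ext_trivialisation = ext_chart Q X S z Y \<iota> \<pi> \<sigma> N0' C' N0'' C''
  for Q :: "('i, 'a) pre_digraph"
    and X :: "('i, 'a, 'k::field, 'x::ab_group_add) qrep"
    and S :: "('i, 'a, 'k, 's::ab_group_add) qrep"
    and z :: "'a \<Rightarrow> 's \<Rightarrow> 'x"
    and Y :: "('i, 'a, 'k, 'y::ab_group_add) qrep"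
    and \<iota> :: "'i \<Rightarrow> 'x \<Rightarrow> 'y" and \<pi> :: "'i \<Rightarrow> 'y \<Rightarrow> 's" and \<sigma> :: "'i \<Rightarrow> 's \<Rightarrow> 'y"
    and N0' C' :: "'i \<Rightarrow> 'x set" and N0'' C'' :: "'i \<Rightarrow> 's set" +
  fixes f g :: "'i \<Rightarrow> nat" and n r :: nat
    and H :: "nat \<Rightarrow> 'i \<Rightarrow> 's \<Rightarrow> 'x" and \<kappa> :: "nat \<Rightarrow> ('i \<Rightarrow> 's \<Rightarrow> 'x) \<Rightarrow> 'k"
    and G :: "nat \<Rightarrow> 'a \<Rightarrow> 's \<Rightarrow> 'x" and \<mu> :: "nat \<Rightarrow> ('a \<Rightarrow> 's \<Rightarrow> 'x) \<Rightarrow> 'k"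
    and A K :: "nat \<Rightarrow> nat \<Rightarrow> ('i \<Rightarrow> 'x set) \<times> ('i \<Rightarrow> 's set) \<Rightarrow> 'k"
    and b :: "nat \<Rightarrow> ('i \<Rightarrow> 'x set) \<times> ('i \<Rightarrow> 's set) \<Rightarrow> 'k"
    and d :: "('i \<Rightarrow> 'x set) \<times> ('i \<Rightarrow> 's set) \<Rightarrow> 'k"
    and a :: "nat \<Rightarrow> nat \<Rightarrow> ('i \<Rightarrow> 'x set) \<times> ('i \<Rightarrow> 's set) \<Rightarrow> 'k"
  assumes N0'_Gr: "N0' \<in> Gr Q X f"
    and H: "coords (fam_scale (scl X)) F {..<n + r} H \<kappa>"
    and G: "coords (fam_scale (scl X)) F1 {..<r} G \<mu>"
    and A_poly: "\<And>j l. j < r \<Longrightarrow> l < r \<Longrightarrow> A j l \<in> poly_funs base_coords"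
    and A_eq: "\<And>x j l. chart_pt x \<Longrightarrow> j < r \<Longrightarrow> l < r \<Longrightarrow> A j l x = \<mu> j (L x (H (n + l)))"
    and K_poly: "\<And>j k. j < r \<Longrightarrow> k < n \<Longrightarrow> K j k \<in> poly_funs base_coords"
    and K_eq: "\<And>x j k. chart_pt x \<Longrightarrow> j < r \<Longrightarrow> k < n \<Longrightarrow> K j k x = \<mu> j (L x (H k))"
    and b_poly: "\<And>j. j < r \<Longrightarrow> b j \<in> poly_funs base_coords"
    and b_eq: "\<And>x j. chart_pt x \<Longrightarrow> j < r \<Longrightarrow> b j x = \<mu> j (Rh x)"
    and d_poly: "d \<in> poly_funs base_coords"
    and a_poly: "\<And>i j. i < r \<Longrightarrow> j < r \<Longrightarrow> a i j \<in> poly_funs base_coords"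
    and Aa: "\<And>x i j. i < r \<Longrightarrow> j < r \<Longrightarrow> (\<Sum>k<r. A i k x * a k j x) = (if i = j then d x else 0)"
    and aA: "\<And>x i j. i < r \<Longrightarrow> j < r \<Longrightarrow> (\<Sum>k<r. a i k x * A k j x) = (if i = j then d x else 0)"
begin

definition U :: "(('i \<Rightarrow> 'x set) \<times> ('i \<Rightarrow> 's set)) set" where
  "U = {x \<in> base_chart f g. d x \<noteq> 0}"

definition TU :: "('i \<Rightarrow> 'y set) set" where
  "TU = {N \<in> topspace (zar (Tot f g)). Psi X \<iota> \<pi> N \<in> U}"

definition coeff :: "('i \<Rightarrow> 'x set) \<times> ('i \<Rightarrow> 's set) \<Rightarrow> (nat \<Rightarrow> 'k) \<Rightarrow> nat \<Rightarrow> 'k" where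
  "coeff x = solution_coeff n r (\<lambda>i j. a i j x) (d x) (\<lambda>i j. K i j x) (\<lambda>j. b j x)"

definition sol :: "('i \<Rightarrow> 'x set) \<times> ('i \<Rightarrow> 's set) \<Rightarrow> (nat \<Rightarrow> 'k) \<Rightarrow> 'i \<Rightarrow> 's \<Rightarrow> 'x" where
  "sol x u = (\<Sum>k<n + r. fam_scale (scl X) (coeff x u k) (H k))"

text \<open>
  The trivialisation records the free unknowns of the solution that describes \<open>N\<close>; the inverse
  completes them to a solution.
\<close>

definition triv :: "('i \<Rightarrow> 'y set) \<Rightarrow> (('i \<Rightarrow> 'x set) \<times> ('i \<Rightarrow> 's set)) \<times> (nat \<Rightarrow> 'k)" where
  "triv N = (Psi X \<iota> \<pi> N, \<lambda>k\<in>{..<n}. \<kappa> k (psi N))"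

definition triv_inv :: "(('i \<Rightarrow> 'x set) \<times> ('i \<Rightarrow> 's set)) \<times> (nat \<Rightarrow> 'k) \<Rightarrow> 'i \<Rightarrow> 'y set" where
  "triv_inv w = NN (fst w) (sol (fst w) (snd w))"

abbreviation P :: "(nat \<Rightarrow> 'k) set" where "P \<equiv> {..<n} \<rightarrow>\<^sub>E UNIV"

abbreviation pcoords :: "((('i \<Rightarrow> 'x set) \<times> ('i \<Rightarrow> 's set)) \<times> (nat \<Rightarrow> 'k) \<Rightarrow> 'k) set" where
  "pcoords \<equiv> (\<lambda>\<gamma> w. \<gamma> (fst w)) ` base_coords \<union> (\<lambda>\<gamma> w. \<gamma> (snd w)) ` {(\<lambda>x. x k) | k. k < n}"

abbreviation PU :: "((('i \<Rightarrow> 'x set) \<times> ('i \<Rightarrow> 's set)) \<times> (nat \<Rightarrow> 'k), 'k) fn_space" where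
  "PU \<equiv> prod_spc (subspc (Base f g) U) (affine_spc n)"

lemma U_chart: "x \<in> U \<Longrightarrow> chart_pt x" "x \<in> U \<Longrightarrow> d x \<noteq> 0" "x \<in> U \<Longrightarrow> fst x \<in> Gr Q X f \<and> snd x \<in> Gr Q S g"
  by (auto simp: U_def base_chart_def image_Psi)

lemma sol:
  assumes x: "x \<in> U"
  shows "sol x u \<in> F" "L x (sol x u) = Rh x" "\<And>k. k < n \<Longrightarrow> \<kappa> k (sol x u) = u k"
    "\<And>\<psi>. \<psi> \<in> F \<Longrightarrow> L x \<psi> = Rh x \<Longrightarrow> (\<And>k. k < n \<Longrightarrow> u k = \<kappa> k \<psi>) \<Longrightarrow> sol x u = \<psi>"
proof -
  note p = U_chart(1)[OF x]
  note s = linear_system_solution[OF vs_fam vs_fam subspace_F L_linear[OF p] H G Rh_in_F1[OF p],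
      where A = "\<lambda>j l. A j l x" and K = "\<lambda>j k. K j k x" and b = "\<lambda>j. b j x"
      and a = "\<lambda>i j. a i j x" and d = "d x"]
  note s = s[OF A_eq[OF p] K_eq[OF p] b_eq[OF p] Aa aA U_chart(2)[OF x], folded coeff_def, folded sol_def]
  show "sol x u \<in> F" "L x (sol x u) = Rh x" "\<And>k. k < n \<Longrightarrow> \<kappa> k (sol x u) = u k"
    by (rule s; assumption)+
  show "sol x u = \<psi>" if "\<psi> \<in> F" "L x \<psi> = Rh x" "\<And>k. k < n \<Longrightarrow> u k = \<kappa> k \<psi>" for \<psi>
    by (rule s(4)) (use that in auto)
qed

lemma openin_U: "openin (zar (Base f g)) U"
  unfolding U_def
  by (rule geometricD(7)[OF geometric_Base chartD(1)[OF chart_Base]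
        chart_poly_reg[OF geometric_Base chart_Base d_poly refl]])

lemma topspace_U: "topspace (zar (subspc (Base f g) U)) = U"
  using openin_subset[OF openin_U] by (auto simp: zar_subspc)

lemma chart_U: "chart (subspc (Base f g) U) U base_coords"
proof -
  have "chart (subspc (Base f g) U) (base_chart f g \<inter> U) base_coords"
    by (rule chart_subspc[OF geometric_Base chart_Base])
  moreover have "base_chart f g \<inter> U = U" by (auto simp: U_def)
  ultimately show ?thesis by simp
qed

lemma topspace_TU: "topspace (zar (subspc (Tot f g) TU)) = TU"
  by (auto simp: zar_subspc TU_def)

lemma chart_TU: "chart (subspc (Tot f g) TU) TU (grass_coords Q Y D)"
proof -
  have "chart (subspc (Tot f g) TU) (tot_chart f g \<inter> TU) (grass_coords Q Y D)"
    by (rule chart_subspc[OF geometric_Tot chart_Tot[OF N0'_Gr]])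
  moreover have "tot_chart f g \<inter> TU = TU"
    unfolding TU_def topspace_Tot by (auto simp: tot_chart_def U_def base_chart_def)
  ultimately show ?thesis by simp
qed

lemma geometric_affine: "geometric (affine_spc n :: (nat \<Rightarrow> 'k, 'k) fn_space)"
  unfolding affine_spc_def by (rule geometric_zar_space)

lemma geometric_PU: "geometric PU"
  by (rule geometric_prod_spc[OF geometric_subspc[OF geometric_Base] geometric_affine])

lemma topspace_PU: "topspace (zar PU) = U \<times> P"
  by (simp add: topspace_prod_spc_geometric[OF geometric_subspc[OF geometric_Base] geometric_affine] topspace_U)
    (simp add: affine_spc_def topspace_zar_space)

lemma chart_PU: "chart PU (U \<times> P) pcoords"
  by (rule chart_prod[OF geometric_subspc[OF geometric_Base] geometric_affine chart_U])
    (simp add: affine_spc_def chart_zar_space)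

lemma TU_D:
  assumes "N \<in> TU"
  shows "N \<in> St f g" "Psi X \<iota> \<pi> N \<in> U" "subrep Q Y N" "chart_pt (Psi X \<iota> \<pi> N)" "N \<in> tot_chart f g"
  using assms stratumD(1)[of N f g] unfolding TU_def topspace_Tot
  by (auto simp: tot_chart_def U_def base_chart_def)

lemma triv_inverse:
  assumes "N \<in> TU"
  shows "triv N \<in> U \<times> P" "triv_inv (triv N) = N"
proof -
  note N = TU_D[OF assms]
  show "triv N \<in> U \<times> P" using N(2) by (simp add: triv_def)
  have "sol (Psi X \<iota> \<pi> N) (\<lambda>k\<in>{..<n}. \<kappa> k (psi N)) = psi N"
    by (rule sol(4)[OF N(2) psi_F[OF N(3,4)] psi_equation[OF N(3,4)]]) simp
  then show "triv_inv (triv N) = N" by (simp add: triv_inv_def triv_def NN_psi[OF N(3,4)])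
qed

lemma triv_inv_inverse:
  assumes "w \<in> U \<times> P"
  shows "triv_inv w \<in> TU" "triv (triv_inv w) = w"
proof -
  have x: "fst w \<in> U" and u: "snd w \<in> P"
    using assms[unfolded mem_Times_iff] by (rule conjunct1, rule conjunct2)
  note c = U_chart[OF x] and s = sol[OF x, where u = "snd w"]
  have p: "Psi X \<iota> \<pi> (triv_inv w) = fst w" unfolding triv_inv_def by (rule Psi_NN[OF c(1) s(1,2)])
  have "triv_inv w \<in> St f g"
    unfolding triv_inv_def using c(3) by (intro NN_stratum[OF c(1) s(1,2)]) auto
  then show "triv_inv w \<in> TU" unfolding TU_def topspace_Tot using p x by simp
  have "psi (triv_inv w) = sol (fst w) (snd w)" unfolding triv_inv_def by (rule psi_NN[OF c(1) s(1,2)])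
  moreover have "(\<lambda>k\<in>{..<n}. \<kappa> k (sol (fst w) (snd w))) = snd w"
    using u s(3) by (intro ext) (auto simp: PiE_def extensional_def)
  ultimately show "triv (triv_inv w) = w" by (simp add: triv_def p)
qed

lemma triv_regular:
  assumes "\<delta> \<in> pcoords"
  shows "(\<lambda>N. \<delta> (triv N)) \<in> reg (subspc (Tot f g) TU) TU"
proof -
  note geo = geometric_subspc[OF geometric_Tot, where T = TU]
  from assms show ?thesis
  proof
    assume "\<delta> \<in> (\<lambda>\<gamma> w. \<gamma> (fst w)) ` base_coords"
    then obtain \<gamma> where \<gamma>: "\<gamma> \<in> base_coords" "\<delta> = (\<lambda>w. \<gamma> (fst w))" by (elim imageE) (rule that)
    from base_coords_Psi[OF \<gamma>(1), where f = f and g = g] obtain \<delta>' where \<delta>': "\<delta>' \<in> grass_coords Q Y D"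
      "\<forall>N\<in>tot_chart f g. \<gamma> (Psi X \<iota> \<pi> N) = \<delta>' N" by (elim bexE) (rule that)
    show ?thesis
      by (rule chart_poly_reg[OF geo chart_TU poly_funs.coord[OF \<delta>'(1)]])
        (use \<delta>'(2) TU_D(5) \<gamma>(2) in \<open>simp add: triv_def\<close>)
  next
    assume "\<delta> \<in> (\<lambda>\<gamma> w. \<gamma> (snd w)) ` {(\<lambda>x. x k) | k. k < n}"
    then obtain k where k: "k < n" "\<delta> = (\<lambda>w. snd w k)" by auto
    have "k \<in> {..<n + r}" using k by simp
    from psi_poly[OF coordsD(3)[OF H this], where f = f and g = g] obtain p where
      p: "p \<in> poly_funs (grass_coords Q Y D)" "\<forall>N\<in>tot_chart f g. p N = \<kappa> k (psi N)" by (elim bexE) (rule that)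
    show ?thesis
      by (rule chart_poly_reg[OF geo chart_TU p(1)]) (use p(2) TU_D(5) k in \<open>simp add: triv_def\<close>)
  qed
qed

lemma pcoords_base: "p \<in> poly_funs base_coords \<Longrightarrow> (\<lambda>w. p (fst w)) \<in> poly_funs pcoords"
  by (rule poly_funs_comp[of p base_coords]) (auto intro: poly_funs.coord)

lemma pcoords_fibre: "k < n \<Longrightarrow> (\<lambda>w. snd w k) \<in> poly_funs pcoords"
  by (rule poly_funs.coord, rule UnI2, rule image_eqI[of _ _ "\<lambda>x. x k"]) auto

lemma pcoords_regular: "p \<in> poly_funs pcoords \<Longrightarrow> p \<in> reg PU (U \<times> P)"
  by (rule chart_poly_reg[OF geometric_PU chart_PU _ refl])

text \<open>
  On \<open>U\<close> the denominator \<open>d\<close> does not vanish.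
\<close>

lemma coeff_regular:
  assumes k: "k < n + r"
  shows "(\<lambda>w. coeff (fst w) (snd w) k) \<in> reg PU (U \<times> P)"
proof (cases "k < n")
  case True
  then show ?thesis using pcoords_regular[OF pcoords_fibre[OF True]] by (simp add: coeff_def solution_coeff_def)
next
  case False
  note o = chartD(1)[OF chart_PU]
  have m: "k - n < r" using False k by simp
  have num: "(\<lambda>w. \<Sum>j<r. a (k - n) j (fst w) * (b j (fst w) - (\<Sum>i<n. snd w i * K j i (fst w)))) \<in> poly_funs pcoords"
    by (intro poly_funs_sum poly_funs.mult poly_funs_minus pcoords_base pcoords_fibre a_poly b_poly K_poly m) auto
  have e: "{w \<in> U \<times> P. d (fst w) \<noteq> 0} = U \<times> P" using U_chart(2) by auto
  have "(\<lambda>w. inverse (d (fst w))) \<in> reg PU (U \<times> P)"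
    using geometricD(8)[OF geometric_PU o pcoords_regular[OF pcoords_base[OF d_poly]]] unfolding e .
  from geometricD(6)[OF geometric_PU o pcoords_regular[OF num] this]
  show ?thesis using False by (simp add: coeff_def solution_coeff_def)
qed

text \<open>
  By \<open>cproj_NN\<close> the projection along \<open>NN x \<psi>\<close> is a sum of the projections along the members of
  \<open>x\<close> and a term linear in \<open>\<psi>\<close>, whose coefficients in the basis \<open>H\<close> are regular.
\<close>

lemma triv_inv_regular:
  assumes "\<gamma> \<in> grass_coords Q Y D"
  shows "(\<lambda>w. \<gamma> (triv_inv w)) \<in> reg PU (U \<times> P)"
proof -
  obtain l i y where l: "\<gamma> = (\<lambda>N. l (cproj (N i) (D i) y))" "i \<in> verts Q" "y \<in> spc Y i"
    "linear_btw (scl Y) (*) (spc Y i) UNIV l" using assms unfolding grass_coords_def by blast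
  note i = l(2) and o = chartD(1)[OF chart_PU]
  note li = linear_btw_comp[OF E(1)[OF i] l(4)] and ls = linear_btw_comp[OF \<sigma>[OF i] l(4)]
  note \<rho>y = \<rho>(1)[OF i l(3)] and \<pi>y = \<pi>_mem[OF i l(3)]
  let ?R = "reg PU (U \<times> P)"
  let ?p = "\<lambda>w. l (\<iota> i (cproj (fst (fst w) i) (C' i) (\<rho> i y)))" and ?s = "\<lambda>w. l (\<sigma> i (cproj (snd (fst w) i) (C'' i) (\<pi> i y)))"
  let ?e = "\<lambda>k. l (\<iota> i (H k i (\<beta> i (\<pi> i y))))"
  have p: "?p \<in> ?R" and s: "?s \<in> ?R"
    by (rule pcoords_regular[OF pcoords_base[OF base_coordI'[OF i \<rho>y li]]])
      (rule pcoords_regular[OF pcoords_base[OF base_coordI''[OF i \<pi>y ls]]])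
  have "(\<lambda>w. ?p w + (\<Sum>k<n + r. coeff (fst w) (snd w) k * ?e k) + ?s w) \<in> poly_funs ?R"
    by (intro poly_funs.add poly_funs_sum poly_funs.mult poly_funs.const
        poly_funs.coord[OF p] poly_funs.coord[OF s] poly_funs.coord[OF coeff_regular]) simp
  note q = geometric_poly_reg[OF geometric_PU o this]
  show ?thesis
  proof (rule geometricD(1)[OF geometric_PU o q])
    fix w assume "w \<in> U \<times> P"
    then have x: "fst w \<in> U" unfolding mem_Times_iff by (rule conjunct1)
    note c = U_chart(1)[OF x] and s = sol[OF x, where u = "snd w"]
    have m1: "cproj (fst (fst w) i) (C' i) (\<rho> i y) \<in> spc X i"
      using linear_btwD(1)[OF q'_linear[OF c i] \<rho>y] C_sub(2)[OF i] by blast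
    have m2: "cproj (snd (fst w) i) (C'' i) (\<pi> i y) \<in> spc S i"
      using linear_btwD(1)[OF q''_linear[OF c i] \<pi>y] C_sub(4)[OF i] by blast
    have Hm: "H k i (\<beta> i (\<pi> i y)) \<in> spc X i" if "k < n + r" for k
      using linear_btwD(1)[OF F\<beta>_linear[OF coordsD(2)[OF H] i] \<pi>y] C_sub(2)[OF i] that by auto
    have e: "sol (fst w) (snd w) i (\<beta> i (\<pi> i y)) = (\<Sum>k<n + r. scl X (coeff (fst w) (snd w) k) (H k i (\<beta> i (\<pi> i y))))"
      by (simp add: sol_def sum_fam_apply fam_scale_def)
    have m3: "sol (fst w) (snd w) i (\<beta> i (\<pi> i y)) \<in> spc X i"
      using linear_btwD(1)[OF F\<beta>_linear[OF s(1) i] \<pi>y] C_sub(2)[OF i] by blast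
    have "l (\<iota> i (sol (fst w) (snd w) i (\<beta> i (\<pi> i y)))) = (\<Sum>k<n + r. coeff (fst w) (snd w) k * ?e k)"
      unfolding e by (rule linear_btw_lincomb[OF li X.module_axioms XD(1)[OF i]]) (use Hm in simp)
    moreover have "\<gamma> (triv_inv w) = l (\<iota> i (cproj (fst (fst w) i) (C' i) (\<rho> i y) + sol (fst w) (snd w) i (\<beta> i (\<pi> i y))) +
        \<sigma> i (cproj (snd (fst w) i) (C'' i) (\<pi> i y)))"
      by (simp add: l(1) triv_inv_def cproj_NN[OF c s(1,2) i l(3)])
    moreover have "\<dots> = l (\<iota> i (cproj (fst (fst w) i) (C' i) (\<rho> i y) + sol (fst w) (snd w) i (\<beta> i (\<pi> i y)))) + ?s w"
      by (rule linear_btwD(2)[OF l(4) linear_btwD(1)[OF E(1)[OF i] X.subspace_add[OF XD(1)[OF i] m1 m3]]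
            linear_btwD(1)[OF \<sigma>[OF i] m2]])
    moreover have "l (\<iota> i (cproj (fst (fst w) i) (C' i) (\<rho> i y) + sol (fst w) (snd w) i (\<beta> i (\<pi> i y)))) =
        ?p w + l (\<iota> i (sol (fst w) (snd w) i (\<beta> i (\<pi> i y))))"
      by (rule linear_btwD(2)[OF li m1 m3])
    ultimately show "\<gamma> (triv_inv w) = ?p w + (\<Sum>k<n + r. coeff (fst w) (snd w) k * ?e k) + ?s w" by simp
  qed
qed

lemma triv_isomorphism: "isomorphism (subspc (Tot f g) TU) PU triv"
proof (rule isomorphism_chartI[where m' = triv_inv])
  show "geometric (subspc (Tot f g) TU)" by (rule geometric_subspc[OF geometric_Tot])
  show "geometric PU" by (rule geometric_PU)
  show "chart (subspc (Tot f g) TU) (topspace (zar (subspc (Tot f g) TU))) (grass_coords Q Y D)"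
    unfolding topspace_TU by (rule chart_TU)
  show "chart PU (topspace (zar PU)) pcoords" unfolding topspace_PU by (rule chart_PU)
  show "triv N \<in> topspace (zar PU) \<and> triv_inv (triv N) = N" if "N \<in> topspace (zar (subspc (Tot f g) TU))" for N
    using triv_inverse[OF that[unfolded topspace_TU]] unfolding topspace_PU by (rule conjI)
  show "triv_inv w \<in> topspace (zar (subspc (Tot f g) TU)) \<and> triv (triv_inv w) = w" if "w \<in> topspace (zar PU)" for w
    using triv_inv_inverse[OF that[unfolded topspace_PU]] unfolding topspace_TU by (rule conjI)
  show "(\<lambda>N. \<delta> (triv N)) \<in> reg (subspc (Tot f g) TU) (topspace (zar (subspc (Tot f g) TU)))" if "\<delta> \<in> pcoords" for \<delta>
    unfolding topspace_TU by (rule triv_regular[OF that])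
  show "(\<lambda>w. \<gamma> (triv_inv w)) \<in> reg PU (topspace (zar PU))" if "\<gamma> \<in> grass_coords Q Y D" for \<gamma>
    unfolding topspace_PU by (rule triv_inv_regular[OF that])
qed

end

text \<open>
  The base point lies in the open set where Cramer's rule applies, because the square part of
  the matrix is the identity there. The rank is \<open>dim F - dim F1\<close>, which is the value of the
  Euler form because \<open>dim N0''\<^sub>i = g i\<close> and \<open>dim C'\<^sub>i = dim X\<^sub>i - f i\<close>.
\<close>

lemma (in ext_chart) local_trivialisation:
  assumes f: "N0' \<in> Gr Q X f" and g: "N0'' \<in> Gr Q S g" and sp: "split N0' N0''"
  shows "\<exists>U n t. openin (zar (Base f g)) U \<and> (N0', N0'') \<in> U \<and>
     int n = euler_form Q (\<lambda>i. int (g i)) (\<lambda>i. int (dimvec X (spc X) i) - int (f i)) \<and>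
     isomorphism (subspc (Tot f g) {N \<in> topspace (zar (Tot f g)). Psi X \<iota> \<pi> N \<in> U})
       (prod_spc (subspc (Base f g) U) (affine_spc n)) t \<and>
     (\<forall>N\<in>topspace (zar (Tot f g)). Psi X \<iota> \<pi> N \<in> U \<longrightarrow> fst (t N) = Psi X \<iota> \<pi> N)"
proof -
  obtain n r :: nat and H \<kappa> G \<mu> where H: "coords (fam_scale (scl X)) F {..<n + r} H \<kappa>"
    and G: "coords (fam_scale (scl X)) F1 {..<r} G \<mu>"
    and LH: "\<And>j. j < r \<Longrightarrow> L (N0', N0'') (H (n + j)) = G j"
    and n: "n + r = (\<Sum>i\<in>verts Q. S.dim (N0'' i) * X.dim (C' i))"
    and r: "r = (\<Sum>\<alpha>\<in>arcs Q. S.dim (N0'' (tail Q \<alpha>)) * X.dim (C' (head Q \<alpha>)))"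
    by (rule adapted_coordinates[OF sp]) (rule that)
  have \<mu>: "linear_btw (fam_scale (scl X)) (*) F1 UNIV (\<mu> j)" if "j < r" for j
    using coordsD(3)[OF G] that by simp
  have HF: "H k \<in> F" if "k < n + r" for k using coordsD(2)[OF H] that by simp
  \<comment> \<open>The full matrix of \<open>L\<close>, of which the columns from \<open>n\<close> on form the square part.\<close>
  define M where "M j k = (SOME p. p \<in> poly_funs base_coords \<and> (\<forall>x\<in>Collect chart_pt. p x = \<mu> j (L x (H k))))" for j k
  have M: "M j k \<in> poly_funs base_coords \<and> (\<forall>x\<in>Collect chart_pt. M j k x = \<mu> j (L x (H k)))"
    if "j < r" "k < n + r" for j k
    unfolding M_def by (rule someI_ex[OF L_poly[OF \<mu>[OF that(1)] HF[OF that(2)], unfolded Bex_def]])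
  have M_poly: "M j k \<in> poly_funs base_coords" if "j < r" "k < n + r" for j k
    using M[OF that] by (rule conjunct1)
  have M_eq: "M j k x = \<mu> j (L x (H k))" if "chart_pt x" "j < r" "k < n + r" for x j k
    by (rule bspec[OF conjunct2[OF M[OF that(2,3)]]]) (use that(1) in simp)
  define b where "b j = (SOME p. p \<in> poly_funs base_coords \<and> (\<forall>x\<in>Collect chart_pt. p x = \<mu> j (Rh x)))" for j
  have b: "b j \<in> poly_funs base_coords \<and> (\<forall>x\<in>Collect chart_pt. b j x = \<mu> j (Rh x))" if "j < r" for j
    unfolding b_def by (rule someI_ex[OF Rh_poly[OF \<mu>[OF that], unfolded Bex_def]])
  have b_poly: "b j \<in> poly_funs base_coords" if "j < r" for j
    using b[OF that] by (rule conjunct1)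
  have b_eq: "b j x = \<mu> j (Rh x)" if "chart_pt x" "j < r" for x j
    by (rule bspec[OF conjunct2[OF b[OF that(2)]]]) (use that(1) in simp)
  have A_poly: "\<And>j l. j < r \<Longrightarrow> l < r \<Longrightarrow> M j (n + l) \<in> poly_funs base_coords" by (simp add: M_poly)
  show ?thesis
  proof (rule poly_adjugate[of r "\<lambda>j l. M j (n + l)" base_coords])
    show "M i (n + j) \<in> poly_funs base_coords" if "i < r" "j < r" for i j by (rule A_poly[OF that])
  next
    fix d a assume d: "d \<in> poly_funs base_coords"
      and a: "\<And>i j. i < r \<Longrightarrow> j < r \<Longrightarrow> a i j \<in> poly_funs base_coords"
      and Aa: "\<And>i j x. i < r \<Longrightarrow> j < r \<Longrightarrow> (\<Sum>k<r. M i (n + k) x * a k j x) = (if i = j then d x else 0)"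
      and aA: "\<And>i j x. i < r \<Longrightarrow> j < r \<Longrightarrow> (\<Sum>k<r. a i k x * M k (n + j) x) = (if i = j then d x else 0)"
      and d1: "\<And>x. (\<And>i j. i < r \<Longrightarrow> j < r \<Longrightarrow> M i (n + j) x = (if i = j then 1 else 0)) \<Longrightarrow> d x = 1"
    interpret t: ext_trivialisation Q X S z Y \<iota> \<pi> \<sigma> N0' C' N0'' C'' f g n r H \<kappa> G \<mu>
        "\<lambda>j l. M j (n + l)" M b d a
      by unfold_locales (simp_all add: f H G M_poly M_eq b_poly b_eq d a Aa aA)
    have "d (N0', N0'') = 1"
    proof (rule d1)
      fix i j assume ij: "i < r" "j < r"
      then have "M i (n + j) (N0', N0'') = \<mu> i (G j)" using M_eq[OF base_pt] LH by simp
      then show "M i (n + j) (N0', N0'') = (if i = j then 1 else 0)" using coordsD(5)[OF G] ij by simp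
    qed
    moreover have "(N0', N0'') \<in> base_chart f g"
      unfolding base_chart_def image_Psi using f g sp base_pt by simp
    ultimately have mem: "(N0', N0'') \<in> t.U" by (simp add: t.U_def)
    have S0: "S.dim (N0'' i) = g i" if "i \<in> verts Q" for i using g that by (simp add: Gr_def dimvec_def)
    have X0: "int (X.dim (C' i)) = int (dimvec X (spc X) i) - int (f i)" if i: "i \<in> verts Q" for i
      using compl_dim[OF X.vector_space_axioms base(3)[OF i] fd_rep_fd_sub[OF X i]] f i by (simp add: Gr_def dimvec_def)
    have "int (n + r) = (\<Sum>i\<in>verts Q. int (g i) * (int (dimvec X (spc X) i) - int (f i)))"
      unfolding n of_nat_sum of_nat_mult by (rule sum.cong[OF refl]) (simp add: S0 X0)
    moreover have "int r = (\<Sum>\<alpha>\<in>arcs Q. int (g (tail Q \<alpha>)) * (int (dimvec X (spc X) (head Q \<alpha>)) - int (f (head Q \<alpha>))))"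
      unfolding r of_nat_sum of_nat_mult by (rule sum.cong[OF refl]) (simp add: S0 X0)
    ultimately have rank: "int n = euler_form Q (\<lambda>i. int (g i)) (\<lambda>i. int (dimvec X (spc X) i) - int (f i))"
      by (simp add: euler_form_def)
    show ?thesis
      by (intro exI conjI, rule t.openin_U, rule mem, rule rank,
          rule t.triv_isomorphism[unfolded t.TU_def]) (simp add: t.triv_def)
  qed
qed

lemma (in ext_bundle) Psi_affine_bundle:
  "affine_bundle (Tot f g) (Base f g) (Psi X \<iota> \<pi>)
     (euler_form Q (\<lambda>i. int (g i)) (\<lambda>i. int (dimvec X (spc X) i) - int (f i)))"
  unfolding affine_bundle_def
proof (intro conjI ballI)
  show "morphism (Tot f g) (Base f g) (Psi X \<iota> \<pi>)" by (rule Psi_morphism)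
  fix b assume "b \<in> topspace (zar (Base f g))"
  then have "b \<in> Psi X \<iota> \<pi> ` St f g" unfolding topspace_Base .
  then have b: "fst b \<in> Gr Q X f" "snd b \<in> Gr Q S g" "split (fst b) (snd b)"
    unfolding image_Psi by (simp_all add: mem_Times_iff)
  then have sub: "subrep Q X (fst b)" "subrep Q S (snd b)" by (simp_all add: Gr_def)
  obtain C' C'' where "ext_chart Q X S z Y \<iota> \<pi> \<sigma> (fst b) C' (snd b) C''"
    using ext_chart_exists[OF sub] by (elim exE) (rule that)
  from ext_chart.local_trivialisation[OF this b]
  show "\<exists>U n t. openin (zar (Base f g)) U \<and> b \<in> U \<and>
      int n = euler_form Q (\<lambda>i. int (g i)) (\<lambda>i. int (dimvec X (spc X) i) - int (f i)) \<and>
      isomorphism (subspc (Tot f g) {N \<in> topspace (zar (Tot f g)). Psi X \<iota> \<pi> N \<in> U})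
        (prod_spc (subspc (Base f g) U) (affine_spc n)) t \<and>
      (\<forall>N\<in>topspace (zar (Tot f g)). Psi X \<iota> \<pi> N \<in> U \<longrightarrow> fst (t N) = Psi X \<iota> \<pi> N)"
    unfolding prod.collapse .
qed

section \<open>The image and the bundle\<close>

lemma (in ext_bundle) image_Psi_eq_diff:
  "Psi X \<iota> \<pi> ` stratum Q X Y S \<iota> \<pi> f g =
     Gr Q X f \<times> Gr Q S g -
       Gr Q (X\<lparr>spc := upper_sub Q X S\<rparr>) f \<times> {N \<in> Gr Q S g. lower_sub Q X S \<le> N}"
proof -
  have u: "upper_sub Q X S i \<subseteq> spc X i" if "i \<in> verts Q" for i
    using subrep_subspace(1)[OF upper_sub(1) that] .
  have upper: "N \<in> Gr Q (X\<lparr>spc := upper_sub Q X S\<rparr>) f \<longleftrightarrow> N \<in> Gr Q X f \<and> N \<le> upper_sub Q X S" for N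
  proof
    assume N: "N \<in> Gr Q (X\<lparr>spc := upper_sub Q X S\<rparr>) f"
    have le: "N i \<subseteq> upper_sub Q X S i" for i
      using N by (cases "i \<in> verts Q") (simp_all add: Gr_def subrep_def)
    have "N i \<subseteq> spc X i" if "i \<in> verts Q" for i using le[of i] u[OF that] by (rule order_trans)
    then have "N \<in> Gr Q X f" using N by (simp add: Gr_def subrep_def dimvec_def)
    then show "N \<in> Gr Q X f \<and> N \<le> upper_sub Q X S" using le by (simp add: le_fun_def)
  next
    assume "N \<in> Gr Q X f \<and> N \<le> upper_sub Q X S"
    then show "N \<in> Gr Q (X\<lparr>spc := upper_sub Q X S\<rparr>) f"
      by (simp add: Gr_def subrep_def dimvec_def le_fun_def)
  qed
  have sp: "split N' N'' \<longleftrightarrow> \<not> (N' \<le> upper_sub Q X S \<and> lower_sub Q X S \<le> N'')"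
    if "N' \<in> Gr Q X f" "N'' \<in> Gr Q S g" for N' N''
    using that by (intro split_iff) (simp_all add: Gr_def)
  show ?thesis
  proof (rule Set.set_eqI)
    fix x
    show "x \<in> Psi X \<iota> \<pi> ` stratum Q X Y S \<iota> \<pi> f g \<longleftrightarrow> x \<in> Gr Q X f \<times> Gr Q S g -
       Gr Q (X\<lparr>spc := upper_sub Q X S\<rparr>) f \<times> {N \<in> Gr Q S g. lower_sub Q X S \<le> N}"
      unfolding image_Psi mem_Times_iff Diff_iff mem_Collect_eq upper
      using sp[of "fst x" "snd x"] by blast
  qed
qed

lemma ext1_member_cocycle:
  assumes wf: "wf_digraph Q" and S: "fd_rep Q S" and X: "fd_rep Q X" and \<xi>: "\<xi> \<in> ext1 Q S X" "z \<in> \<xi>"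
  shows "z \<in> ext_cocycles Q S X"
proof -
  interpret wf_digraph Q by fact
  obtain z0 where z0: "z0 \<in> \<xi>" "z0 \<in> ext_cocycles Q S X" by (rule ext1_cocycle_in[OF wf S X \<xi>(1)])
  have "z - z0 \<in> ext_coboundaries Q S X" using ext1_mem_iff[OF wf S X \<xi>(1) z0(1)] \<xi>(2) by blast
  then obtain \<phi> where \<phi>: "z - z0 = ext_diff Q S X \<phi>"
    "\<forall>i\<in>verts Q. linear_btw (scl S) (scl X) (spc S i) (spc X i) (\<phi> i)"
    unfolding ext_coboundaries_def by (elim imageE CollectE) (rule that)
  have d: "z - z0 \<in> ext_cocycles Q S X"
    unfolding \<phi>(1) by (rule ext_diff_mem_cocycles[OF wf S X bspec[OF \<phi>(2)]])
  have "module.subspace (ext_scale X) (ext_cocycles Q S X)"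
    unfolding ext_cocycles_eq_hom_fam ext_scale_eq_fam_scale
    by (rule subspace_hom_fam[OF fd_repD(1)[OF S] fd_repD(1)[OF X] fd_repD(3)[OF S tail_in_verts] fd_repD(3)[OF X head_in_verts]])
  from module.subspace_add[OF _ this z0(2) d] show ?thesis
    using vector_space_fam_scale[OF fd_repD(1)[OF X]]
    by (simp add: ext_scale_eq_fam_scale module_iff_vector_space)
qed

lemma one_generated_ext_of_generating:
  fixes X :: "('i, 'a, 'k::field, 'x::ab_group_add) qrep" and S :: "('i, 'a, 'k, 's::ab_group_add) qrep"
  assumes Q: "fin_digraph Q" and X: "fd_rep Q X" and S: "fd_rep Q S"
    and nz: "\<xi> \<noteq> ext_coboundaries Q S X" and gen: "generating Q S X \<xi>" and z: "z \<in> \<xi>"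
  shows "one_generated_ext Q X S z"
proof -
  interpret fin_digraph Q by fact
  have wf: "wf_digraph Q" by unfold_locales
  have \<xi>: "\<xi> \<in> ext1 Q S X" using gen by (simp add: generating_def)
  note mem = ext1_mem_iff[OF wf S X \<xi> z]
  note d = ext_coboundaries_diff[OF wf S X] and 0 = ext_coboundaries_0[OF wf S X]
  have m: "Modules.module (ext_scale X :: 'k \<Rightarrow> ('a \<Rightarrow> 's \<Rightarrow> 'x) \<Rightarrow> _)"
    using vector_space_fam_scale[OF fd_repD(1)[OF X]]
    by (simp add: ext_scale_eq_fam_scale module_iff_vector_space)
  note sub = subspace_ext_coboundaries[OF wf S X]
  note sa = module.subspace_add[OF m sub] and ss = module.subspace_scale[OF m sub]
  have zc: "z \<in> ext_cocycles Q S X" by (rule ext1_member_cocycle[OF wf S X \<xi> z])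
  have z_nz: "z \<notin> ext_coboundaries Q S X"
  proof
    assume zb: "z \<in> ext_coboundaries Q S X"
    have "w \<in> \<xi> \<longleftrightarrow> w \<in> ext_coboundaries Q S X" for w
      unfolding mem using sa[OF _ zb, of "w - z"] d[OF _ zb, of w] by auto
    then show False using nz by blast
  qed
  have "\<exists>c. \<exists>b\<in>ext_coboundaries Q S X. w = ext_scale X c z + b" if w: "w \<in> ext_cocycles Q S X" for w
  proof -
  \<comment> \<open>Every class is a multiple of \<open>\<xi>\<close>; comparing representatives changes it by a coboundary only.\<close>
  let ?\<eta> = "{w + b | b. b \<in> ext_coboundaries Q S X}"
  have "?\<eta> \<in> ext1 Q S X" using w by (auto simp: ext1_def)
  then obtain c where c: "?\<eta> = ext1_scale Q S X c \<xi>" using gen by (auto simp: generating_def)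
  have "w + 0 \<in> ?\<eta>" using 0 by blast
  then have "w \<in> ext1_scale Q S X c \<xi>" unfolding c by simp
  then obtain z' b where z': "z' \<in> \<xi>" "b \<in> ext_coboundaries Q S X" "w = ext_scale X c z' + b"
    unfolding ext1_scale_def by blast
  have "ext_scale X c (z' - z) \<in> ext_coboundaries Q S X" using mem z'(1) by (intro ss) blast
  then have "ext_scale X c (z' - z) + b \<in> ext_coboundaries Q S X" by (rule sa) (rule z'(2))
  moreover have "w = ext_scale X c z + (ext_scale X c (z' - z) + b)"
    unfolding z'(3) using module.scale_right_diff_distrib[OF m, of c z' z] by simp
  ultimately show ?thesis by blast
  qed
  with Q X S zc z_nz show ?thesis by (rule one_generated_ext.intro)
qed

theorem theorem32:
  fixes Q :: "('i, 'a) pre_digraph"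
    and X :: "('i, 'a, 'k::alg_closed_field, 'x::ab_group_add) qrep"
    and S :: "('i, 'a, 'k, 's::ab_group_add) qrep"
    and Y :: "('i, 'a, 'k, 'y::ab_group_add) qrep"
    and \<iota> :: "'i \<Rightarrow> 'x \<Rightarrow> 'y" and \<pi> :: "'i \<Rightarrow> 'y \<Rightarrow> 's"
    and \<xi> :: "('a \<Rightarrow> 's \<Rightarrow> 'x) set"
  assumes "fin_digraph Q" and "acyclic (arcs_ends Q)"
    and "fd_rep Q X" and "fd_rep Q S" and "fd_rep Q Y"
    and "\<xi> \<in> ext1 Q S X" and "\<xi> \<noteq> ext_coboundaries Q S X" and "generating Q S X \<xi>"
    and "represents Q X Y S \<iota> \<pi> \<xi>"
  shows "\<forall>f g :: 'i \<Rightarrow> nat.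
    Psi X \<iota> \<pi> ` stratum Q X Y S \<iota> \<pi> f g =
      Gr Q X f \<times> Gr Q S g -
        Gr Q (X\<lparr>spc := upper_sub Q X S\<rparr>) f \<times> {N \<in> Gr Q S g. lower_sub Q X S \<le> N} \<and>
    affine_bundle
      (subspc (Gr_spc Q Y (\<lambda>i. f i + g i)) (stratum Q X Y S \<iota> \<pi> f g))
      (subspc (prod_spc (Gr_spc Q X f) (Gr_spc Q S g)) (Psi X \<iota> \<pi> ` stratum Q X Y S \<iota> \<pi> f g))
      (Psi X \<iota> \<pi>)
      (euler_form Q (\<lambda>i. int (g i)) (\<lambda>i. int (dimvec X (spc X) i) - int (f i)))"
proof (intro allI conjI)
  fix f g :: "'i \<Rightarrow> nat"
  obtain \<sigma> z where r: "z \<in> \<xi>"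
    "\<And>i. i \<in> verts Q \<Longrightarrow> linear_btw (scl S) (scl Y) (spc S i) (spc Y i) (\<sigma> i)"
    "\<And>i s. i \<in> verts Q \<Longrightarrow> s \<in> spc S i \<Longrightarrow> \<pi> i (\<sigma> i s) = s"
    "\<And>\<alpha> s. \<alpha> \<in> arcs Q \<Longrightarrow> s \<in> spc S (tail Q \<alpha>) \<Longrightarrow>
       \<iota> (head Q \<alpha>) (z \<alpha> s) = act Y \<alpha> (\<sigma> (tail Q \<alpha>) s) - \<sigma> (head Q \<alpha>) (act S \<alpha> s)"
    by (rule representsE[OF assms(9)]) (rule that)
  interpret one_generated_ext Q X S z
    by (rule one_generated_ext_of_generating[OF assms(1,3,4,7,8) r(1)])
  have "short_exact Q X Y S \<iota> \<pi>" using assms(9) by (simp add: represents_def)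
  then interpret ext_bundle Q X S z Y \<iota> \<pi> \<sigma>
    using assms(5) r(2-4) by unfold_locales
  show "Psi X \<iota> \<pi> ` stratum Q X Y S \<iota> \<pi> f g =
      Gr Q X f \<times> Gr Q S g -
        Gr Q (X\<lparr>spc := upper_sub Q X S\<rparr>) f \<times> {N \<in> Gr Q S g. lower_sub Q X S \<le> N}"
    by (rule image_Psi_eq_diff)
  show "affine_bundle (Tot f g) (Base f g) (Psi X \<iota> \<pi>)
      (euler_form Q (\<lambda>i. int (g i)) (\<lambda>i. int (dimvec X (spc X) i) - int (f i)))"
    by (rule Psi_affine_bundle)
qed

end
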